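(* Let $\alpha\in(\frac12,1]$, $p\in\mathcal{P}([0,1])$ and $q\in\mathcal{P}^{\log}(\mathbb{R}^3)$ with $2<q^-\le q^+<+\infty$, $q^+=q_\infty$, $p^->2$, and $$\frac{2\alpha}{p^-}+\frac{3\vartheta_1}{2}<\alpha-\frac12,\qquad\text{where}\quad \vartheta_1:=\left(\frac2{q^-}-\frac1{q_\infty}\right)\left(\frac{2+q_\infty(1-\frac2{q^-})}{1+q_\infty(1-\frac2{q^-})}-\frac1{q_\infty-1}\right).$$ If $f\in L^1\big(0,1;L^{q(\cdot)}(\mathbb{R}^3)\big)$ is a divergence-free exterior force and $u_0\in L^{q(\cdot)}(\mathbb{R}^3)$ is a divergence-free initial datum, then there exist a time $T\in(0,1]$ and a unique mild solution of the fractional Navier–Stokes equations with data $u_0,f$ in the space $L^{p(\cdot)}\big(0,T;L^{q(\cdot)}(\mathbb{R}^3)\big)$.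
   Context: Variable Lebesgue spaces. For $\Omega=\mathbb{R}^3$ or an interval, $\mathcal{P}(\Omega)$ is the set of measurable $p:\Omega\to[1,\infty]$; $p^-,p^+$ are the essential infimum and supremum; $\frac1\infty:=0$. With $\omega_p(s)=s^p$ for $p<\infty$, $\omega_\infty(s)=0$ for $s\le1$ and $\omega_\infty(s)=\infty$ for $s>1$, put $\varrho_{p(\cdot)}(f)=\int_\Omega\omega_{p(x)}(|f(x)|)dx$; $L^{p(\cdot)}(\Omega)$ is the space of measurable $f$ with $\varrho_{p(\cdot)}(\lambda f)<\infty$ for some $\lambda>0$, with norm $\inf\{\lambda>0:\varrho_{p(\cdot)}(f/\lambda)\le1\}$ (similarly for vector fields). $L^{p(\cdot)}(0,T;X)$ has norm $\big\|\,\|u(t,\cdot)\|_X\big\|_{L^{p(\cdot)}((0,T))}$. $\mathcal{P}^{\log}(\mathbb{R}^3)$ is the set of $q\in\mathcal{P}(\mathbb{R}^3)$ such that $g=1/q$ satisfies, for some $c>0$, $g_\infty\in\mathbb{R}$ and all $x,y$, $|g(x)-g(y)|\le\frac{c}{\log(e+1/|x-y|)}$ and $|g(x)-g_\infty|\le\frac{c}{\log(e+|x|)}$; $q_\infty$ is defined by $\frac1{q_\infty}=\lim_{|x|\to\infty}\frac1{q(x)}$. Fractional Navier–Stokes equations on $\mathbb{R}^3$: $\partial_tu=-(-\Delta)^\alpha u-(u\cdot\nabla)u+\nabla P+f$, $\operatorname{div}u=0$, $u(0,\cdot)=u_0$, $\operatorname{div}u_0=0$, with unknown velocity $u$ and pressure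 $P$; $(-\Delta)^\alpha$ has symbol $|\xi|^{2\alpha}$. A mild solution on $(0,T)$ is a solution $u$ of $$u(t,x)=g_{\alpha,t}*u_0(x)+\int_0^tg_{\alpha,t-s}*f(s,x)\,ds-\int_0^tK_{\alpha,t-s}*(u\otimes u)(s,x)\,ds,$$ where $g_{\alpha,t}$ is the convolution kernel of $e^{-t(-\Delta)^\alpha}$ (symbol $e^{-t|\xi|^{2\alpha}}$) and $K_{\alpha,t}$ is the kernel of $e^{-t(-\Delta)^\alpha}\mathbb{P}\operatorname{div}$, $\mathbb{P}$ the Leray projector; i.e. the $j$-th component of $K_{\alpha,t}*(u\otimes u)$ is $\sum_{h,k=1}^3K^{j;h,k}_{\alpha,t}*(u_hu_k)$, where $K^{j;h,k}_{\alpha,t}$ has symbol $i\xi_k\big(\delta_{jh}-\frac{\xi_j\xi_h}{|\xi|^2}\big)e^{-t|\xi|^{2\alpha}}$. *)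

theory Defs
  imports "HOL-Probability.Probability"
begin

section \<open>Variable exponents\<close>

text \<open>Exponents take values in \<^typ>\<open>ereal\<close>, where \<^term>\<open>1 / \<infinity> = (0 :: ereal)\<close>.\<close>

definition exponents :: "'a::euclidean_space set \<Rightarrow> ('a \<Rightarrow> ereal) set" where
  "exponents \<Omega> = {p \<in> borel_measurable (lebesgue_on \<Omega>). \<forall>x\<in>\<Omega>. 1 \<le> p x}"

definition exp_sup :: "'a::euclidean_space set \<Rightarrow> ('a \<Rightarrow> ereal) \<Rightarrow> ereal" where
  "exp_sup \<Omega> p = esssup (lebesgue_on \<Omega>) p"

definition exp_inf :: "'a::euclidean_space set \<Rightarrow> ('a \<Rightarrow> ereal) \<Rightarrow> ereal" where
  "exp_inf \<Omega> p = - esssup (lebesgue_on \<Omega>) (\<lambda>x. - p x)"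

definition recip :: "ereal \<Rightarrow> real" where
  "recip r = real_of_ereal (1 / r)"

text \<open>At \<^term>\<open>x = y\<close> the convention \<^term>\<open>1 / 0 = (0 :: real)\<close> makes the first bound
  read \<open>0 \<le> c\<close>, so the diagonal imposes no condition, as intended.\<close>

definition log_exponents :: "('a::euclidean_space \<Rightarrow> ereal) set" where
  "log_exponents = {q \<in> exponents UNIV. \<exists>c>0. \<exists>l::real. \<forall>x y.
     \<bar>recip (q x) - recip (q y)\<bar> \<le> c / ln (exp 1 + 1 / norm (x - y)) \<and>
     \<bar>recip (q x) - l\<bar> \<le> c / ln (exp 1 + norm x)}"

definition exp_at_infinity :: "('a::euclidean_space \<Rightarrow> ereal) \<Rightarrow> ereal" where
  "exp_at_infinity q = 1 / ereal (Lim at_infinity (\<lambda>x. recip (q x)))"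


definition theta1 :: "(real^3 \<Rightarrow> ereal) \<Rightarrow> real" where
  "theta1 q = (let q_minus = real_of_ereal (exp_inf UNIV q); q_inf = real_of_ereal (exp_at_infinity q) in
     (2 / q_minus - 1 / q_inf) *
     ((2 + q_inf * (1 - 2 / q_minus)) / (1 + q_inf * (1 - 2 / q_minus)) - 1 / (q_inf - 1)))"


section \<open>Variable Lebesgue spaces\<close>

text \<open>Elements of the spaces below are functions, not classes; equality in the spaces is
  equality almost everywhere.\<close>

definition omega :: "ereal \<Rightarrow> real \<Rightarrow> ennreal" where
  "omega p s = (if p = \<infinity> then (if s \<le> 1 then 0 else \<infinity>) else ennreal (s powr real_of_ereal p))"

definition modular ::
  "'a::euclidean_space set \<Rightarrow> ('a \<Rightarrow> ereal) \<Rightarrow> ('a \<Rightarrow> 'b::real_normed_vector) \<Rightarrow> ennreal" where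
  "modular \<Omega> p f = (\<integral>\<^sup>+x. omega (p x) (norm (f x)) \<partial>lebesgue_on \<Omega>)"

definition var_Lebesgue ::
  "'a::euclidean_space set \<Rightarrow> ('a \<Rightarrow> ereal) \<Rightarrow> ('a \<Rightarrow> 'b::real_normed_vector) set" where
  "var_Lebesgue \<Omega> p = {f \<in> borel_measurable (lebesgue_on \<Omega>).
     \<exists>r>0. modular \<Omega> p (\<lambda>x. r *\<^sub>R f x) < \<infinity>}"

definition var_norm ::
  "'a::euclidean_space set \<Rightarrow> ('a \<Rightarrow> ereal) \<Rightarrow> ('a \<Rightarrow> 'b::real_normed_vector) \<Rightarrow> real" where
  "var_norm \<Omega> p f = Inf {r. r > 0 \<and> modular \<Omega> p (\<lambda>x. f x /\<^sub>R r) \<le> 1}"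

text \<open>The space \<open>L\<^bsup>p(\<cdot>)\<^esup>(0,T; L\<^bsup>q(\<cdot>)\<^esup>)\<close>. Its elements are represented by jointly Lebesgue
  measurable functions of time and space. The value of \<^const>\<open>var_norm\<close> is meaningful only on
  \<^const>\<open>var_Lebesgue\<close>, hence the separate requirement on almost every time slice.\<close>

definition mixed_Lebesgue :: "real \<Rightarrow> (real \<Rightarrow> ereal) \<Rightarrow> ('a::euclidean_space \<Rightarrow> ereal) \<Rightarrow>
    (real \<Rightarrow> 'a \<Rightarrow> 'b::real_normed_vector) set" where
  "mixed_Lebesgue T p q = {u.
     (\<lambda>(t, x). u t x) \<in> borel_measurable (lebesgue_on ({0<..<T} \<times> UNIV)) \<and>
     (AE t in lebesgue_on {0<..<T}. u t \<in> var_Lebesgue UNIV q) \<and>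
     (\<lambda>t. var_norm UNIV q (u t)) \<in> var_Lebesgue {0<..<T} p}"


section \<open>Divergence-free fields\<close>

primrec C_k :: "nat \<Rightarrow> (real^3 \<Rightarrow> real) \<Rightarrow> bool" where
  "C_k 0 \<phi> \<longleftrightarrow> continuous_on UNIV \<phi>"
| "C_k (Suc k) \<phi> \<longleftrightarrow> (\<exists>g :: real^3 \<Rightarrow> real^3.
     (\<forall>x. (\<phi> has_derivative (\<lambda>h. g x \<bullet> h)) (at x)) \<and> (\<forall>i. C_k k (\<lambda>x. g x $ i)))"

definition test_functions :: "(real^3 \<Rightarrow> real) set" where
  "test_functions = {\<phi>. (\<forall>k. C_k k \<phi>) \<and> compact (closure {x. \<phi> x \<noteq> 0})}"

text \<open>The divergence is taken in the sense of distributions;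
  \<^term>\<open>frechet_derivative \<phi> (at x) (w x)\<close> is \<open>\<nabla>\<phi>(x) \<cdot> w(x)\<close>.\<close>

definition divergence_free :: "(real^3 \<Rightarrow> real^3) \<Rightarrow> bool" where
  "divergence_free w \<longleftrightarrow> (\<forall>\<phi>\<in>test_functions.
     (LINT x|lebesgue. frechet_derivative \<phi> (at x) (w x)) = 0)"


section \<open>Mild solutions\<close>

text \<open>The kernel with (integrable) symbol \<open>m\<close> is the inverse Fourier transform of \<open>m\<close>. It is
  real for the symbols below, since these satisfy \<open>m(-\<xi>) = cnj (m(\<xi>))\<close>; so taking the real part
  discards nothing.\<close>

definition kernel :: "(real^3 \<Rightarrow> complex) \<Rightarrow> real^3 \<Rightarrow> real" where
  "kernel m x = Re ((LINT \<xi>|lebesgue. cis (x \<bullet> \<xi>) * m \<xi>) / (2 * pi) ^ 3)"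

definition heat_kernel :: "real \<Rightarrow> real \<Rightarrow> real^3 \<Rightarrow> real" where
  "heat_kernel \<alpha> t = kernel (\<lambda>\<xi>. of_real (exp (- t * norm \<xi> powr (2 * \<alpha>))))"

definition oseen_kernel :: "real \<Rightarrow> real \<Rightarrow> 3 \<Rightarrow> 3 \<Rightarrow> 3 \<Rightarrow> real^3 \<Rightarrow> real" where
  "oseen_kernel \<alpha> t j h k = kernel (\<lambda>\<xi>. \<i> * of_real
     (\<xi> $ k * ((if j = h then 1 else 0) - \<xi> $ j * \<xi> $ h / (norm \<xi>)\<^sup>2)
       * exp (- t * norm \<xi> powr (2 * \<alpha>))))"

definition conv :: "(real^3 \<Rightarrow> real) \<Rightarrow> (real^3 \<Rightarrow> 'b) \<Rightarrow> real^3 \<Rightarrow> 'b::{banach,second_countable_topology}"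
  where "conv k w x = (LINT y|lebesgue. k (x - y) *\<^sub>R w y)"

definition conv_exists ::
  "(real^3 \<Rightarrow> real) \<Rightarrow> (real^3 \<Rightarrow> 'b::{banach,second_countable_topology}) \<Rightarrow> real^3 \<Rightarrow> bool"
  where "conv_exists k w x \<longleftrightarrow> integrable lebesgue (\<lambda>y. k (x - y) *\<^sub>R w y)"

definition oseen_conv :: "real \<Rightarrow> real \<Rightarrow> (real^3 \<Rightarrow> real^3) \<Rightarrow> real^3 \<Rightarrow> real^3" where
  "oseen_conv \<alpha> t w x =
     (\<chi> j. \<Sum>h\<in>UNIV. \<Sum>k\<in>UNIV. conv (oseen_kernel \<alpha> t j h k) (\<lambda>y. w y $ h * w y $ k) x)"

definition oseen_conv_exists :: "real \<Rightarrow> real \<Rightarrow> (real^3 \<Rightarrow> real^3) \<Rightarrow> real^3 \<Rightarrow> bool" where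
  "oseen_conv_exists \<alpha> t w x \<longleftrightarrow>
     (\<forall>j h k. conv_exists (oseen_kernel \<alpha> t j h k) (\<lambda>y. w y $ h * w y $ k) x)"

text \<open>Bochner integrals are total in HOL (zero for non-integrable functions). A solution of the
  integral equation must make its terms meaningful, so this is demanded explicitly.\<close>

definition mild_terms_exist :: "real \<Rightarrow> (real^3 \<Rightarrow> real^3) \<Rightarrow> (real \<Rightarrow> real^3 \<Rightarrow> real^3) \<Rightarrow>
    (real \<Rightarrow> real^3 \<Rightarrow> real^3) \<Rightarrow> real \<Rightarrow> real^3 \<Rightarrow> bool" where
  "mild_terms_exist \<alpha> u\<^sub>0 f u t x \<longleftrightarrow>
     conv_exists (heat_kernel \<alpha> t) u\<^sub>0 x \<and>
     (AE s in lebesgue_on {0<..<t}. conv_exists (heat_kernel \<alpha> (t - s)) (f s) x) \<and>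
     integrable (lebesgue_on {0<..<t}) (\<lambda>s. conv (heat_kernel \<alpha> (t - s)) (f s) x) \<and>
     (AE s in lebesgue_on {0<..<t}. oseen_conv_exists \<alpha> (t - s) (u s) x) \<and>
     integrable (lebesgue_on {0<..<t}) (\<lambda>s. oseen_conv \<alpha> (t - s) (u s) x)"

definition mild_solution :: "real \<Rightarrow> real \<Rightarrow> (real^3 \<Rightarrow> real^3) \<Rightarrow> (real \<Rightarrow> real^3 \<Rightarrow> real^3) \<Rightarrow>
    (real \<Rightarrow> real^3 \<Rightarrow> real^3) \<Rightarrow> bool" where
  "mild_solution \<alpha> T u\<^sub>0 f u \<longleftrightarrow>
     (AE (t, x) in lebesgue_on ({0<..<T} \<times> UNIV).
        mild_terms_exist \<alpha> u\<^sub>0 f u t x \<and>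
        u t x = conv (heat_kernel \<alpha> t) u\<^sub>0 x
          + (LINT s|lebesgue_on {0<..<t}. conv (heat_kernel \<alpha> (t - s)) (f s) x)
          - (LINT s|lebesgue_on {0<..<t}. oseen_conv \<alpha> (t - s) (u s) x))"

end

theory Submission
  imports Defs
begin

text \<open>Write \<open>a = 1 / q\<^sup>-\<close> and \<open>b = 1 / q\<^sub>\<infinity> = 1 / q\<^sup>+\<close>. The hypothesis on \<open>\<vartheta>\<^sub>1\<close> is used only through
  \<open>\<vartheta>\<^sub>1 \<ge> 2 a - b\<close>.

  The function \<open>exp (- \<lambda>\<^sup>\<alpha>)\<close> is the Laplace transform of a law on the half line (a limit of scaled
  sums of Pareto variables), so the heat kernel is a mixture of Gaussians, and the Oseen kernel is
  dominated by mixtures of Gaussians. A Gaussian is in turn a mixture of uniform distributions on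
  balls, and the log-Hoelder conditions bound averages over balls in \<open>L\<^bsup>q(\<cdot>)\<^esup>\<close>. This controls the
  linear part of the equation.

  For the quadratic part, split \<open>u(s) \<in> L\<^bsup>q(\<cdot>)\<^esup>\<close> into its large values, in \<open>L\<^bsup>1/a\<^esup>\<close>, and its small
  values, in \<open>L\<^bsup>1/b\<^esup>\<close>. By Young's inequality the Oseen kernel maps the products into \<open>L\<^bsup>1/b\<^esup>\<close> with norm
  \<open>O((t - s)\<^bsup>-\<gamma>\<^esup>)\<close>, \<open>\<gamma> = (1 + 3 (2 a - b)) / (2 \<alpha>)\<close>, and \<open>L\<^bsup>1/b\<^esup>\<close> embeds into \<open>L\<^bsup>q(\<cdot>)\<^esup>\<close> because \<open>q \<le> 1/b\<close>
  and \<open>1/q\<close> decays to \<open>b\<close>. The hypothesis on the exponents says exactly that \<open>\<gamma> < 1 - 2 / P\<close> for some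
  \<open>P\<close> below the time exponent, so the singularity is integrable against \<open>n\<^sup>2\<close> for \<open>n \<in> L\<^bsup>P\<^esup>(0,T)\<close>.

  The solution is bounded in \<open>L\<^bsup>q(\<cdot>)\<^esup>\<close> uniformly in time. It is the pointwise limit of iterates whose
  increments are dominated by the increments of a monotone scheme with absolute values everywhere.
  A difference of two solutions lies in \<open>L\<^bsup>1/b\<^esup>\<close> uniformly in time, although the solutions need not;
  a weight \<open>e\<^bsup>ls\<^esup>\<close> then gives uniqueness.\<close>

subsection \<open>Luxemburg norms\<close>

text \<open>The obstacle is that \<open>L^q(.)\<close> is not invariant under translations, so a
  convolution is not controlled there by the integral of its kernel, and Young's inequality is
  available only for constant exponents. The quadratic term is therefore kept in constant-exponent
  spaces. This closes because \<open>L^(1/b)\<close> is at once the space of the small values and a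
  subspace of \<open>L^q(.)\<close>: whichever pieces of \<open>u(s)\<close> are multiplied, the
  result returns to one and the same translation-invariant space.

  The exponent \<gamma> interpolates two facts on the Oseen kernel at time t, the sup bound
  \<open>O(t^(-2/\<alpha>))\<close> and the \<open>L^1\<close> bound
  \<open>O(t^(-1/(2\<alpha>)))\<close>, in the worst case of two large factors, both in
  \<open>L^(1/a)\<close>.

  Estimates are made for integrals with values in [0,\<infinity>], where Tonelli and monotone limits
  need no integrability, and norms enter only through the relation \<open>Lux_le\<close>. Membership
  in the spaces is stated for the completed measure and up to null sets, so data and competing
  solutions are exchanged for Borel representatives before they are estimated.\<close>

abbreviation borel_measurable2 :: "('a::topological_space \<Rightarrow> 'b::topological_space \<Rightarrow> 'c::topological_space) \<Rightarrow> bool" where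
  "borel_measurable2 F \<equiv> (\<lambda>(s, y). F s y) \<in> borel_measurable (borel \<Otimes>\<^sub>M borel)"

text \<open>Both 0 and \<open>\<top>\<close> are fixed by every exponent, including 0. With these
  values the laws for products, sums of exponents and iterated powers hold without side
  conditions.\<close>

definition epow :: "ennreal \<Rightarrow> real \<Rightarrow> ennreal" where
  "epow x a = (if x = \<top> then \<top> else ennreal (enn2real x powr a))"

lemma epow_ennreal [simp]: "0 \<le> r \<Longrightarrow> epow (ennreal r) a = ennreal (r powr a)"
  by (simp add: epow_def)

lemma epow_top [simp]: "epow \<top> a = \<top>"
  by (simp add: epow_def)

lemma epow_0 [simp]: "epow 0 a = 0"
  by (simp add: epow_def)

lemma epow_one [simp]: "epow 1 a = 1"
  by (simp add: epow_def)

lemma epow_by_1 [simp]: "epow x 1 = x"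
  by (cases x) auto

lemma epow_by_2: "epow x 2 = x * x"
  by (cases x) (auto simp: ennreal_mult[symmetric] power2_eq_square)

lemma epow_eq_0_iff [simp]: "epow x a = 0 \<longleftrightarrow> x = 0"
  by (cases x) auto

lemma epow_eq_top_iff [simp]: "epow x a = \<top> \<longleftrightarrow> x = \<top>"
  by (cases x) auto

lemma epow_mono: "x \<le> y \<Longrightarrow> 0 \<le> a \<Longrightarrow> epow x a \<le> epow y a"
  by (cases x; cases y) (auto intro!: ennreal_leI powr_mono2 simp: top_unique)

lemma epow_mult: "epow (x * y) a = epow x a * epow y a"
  by (cases x; cases y)
    (auto simp: ennreal_mult[symmetric] powr_mult ennreal_mult_top ennreal_top_mult)

lemma epow_epow: "epow (epow x a) b = epow x (a * b)"
  by (cases x) (auto simp: powr_powr)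

lemma epow_add: "epow x (a + b) = epow x a * epow x b"
  by (cases x) (auto simp: powr_add ennreal_mult ennreal_top_mult ennreal_mult_top)

lemma epow_inverse: "a > 0 \<Longrightarrow> epow (epow x a) (1 / a) = x" "a > 0 \<Longrightarrow> epow (epow x (1 / a)) a = x"
  by (simp_all add: epow_epow)

lemma epow_le_1: "x \<le> 1 \<Longrightarrow> 0 \<le> a \<Longrightarrow> epow x a \<le> 1"
  using epow_mono[of x 1 a] by simp

lemma epow_exponent_mono: "1 \<le> x \<Longrightarrow> a \<le> b \<Longrightarrow> epow x a \<le> epow x b"
  by (cases x) (auto intro!: ennreal_leI powr_mono)

lemma epow_exponent_mono': "x \<le> 1 \<Longrightarrow> a \<le> b \<Longrightarrow> epow x b \<le> epow x a"
  by (cases x) (auto intro!: ennreal_leI powr_mono')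

text \<open>For \<open>a > 0\<close> the power is an order isomorphism whose inverse is the power
  \<open>1 / a\<close>, hence it commutes with suprema.\<close>

lemma epow_SUP:
  assumes "a > 0"
  shows "epow (SUP n. F n) a = (SUP n. epow (F n) a)"
proof (rule antisym)
  have "F n \<le> epow (SUP n. epow (F n) a) (1 / a)" for n
  proof -
    have "F n = epow (epow (F n) a) (1 / a)" using assms by (simp add: epow_inverse)
    also have "\<dots> \<le> epow (SUP n. epow (F n) a) (1 / a)"
      by (intro epow_mono SUP_upper) (use assms in auto)
    finally show ?thesis .
  qed
  then have "(SUP n. F n) \<le> epow (SUP n. epow (F n) a) (1 / a)" by (intro SUP_least)
  then have "epow (SUP n. F n) a \<le> epow (epow (SUP n. epow (F n) a) (1 / a)) a"
    by (intro epow_mono) (use assms in auto)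
  then show "epow (SUP n. F n) a \<le> (SUP n. epow (F n) a)" using assms by (simp add: epow_inverse)
  show "(SUP n. epow (F n) a) \<le> epow (SUP n. F n) a"
    by (intro SUP_least epow_mono SUP_upper) (use assms in auto)
qed

lemma measurable_epow [measurable (raw)]:
  assumes [measurable]: "f \<in> borel_measurable M" "g \<in> borel_measurable M"
  shows "(\<lambda>x. epow (f x) (g x)) \<in> borel_measurable M"
  unfolding epow_def by measurable

lemma epow_weighted_AM_GM:
  assumes "0 < a" "0 < b" "a + b = 1"
  shows "epow x a * epow y b \<le> ennreal a * x + ennreal b * y"
proof (cases "x = \<top> \<or> y = \<top>")
  case True
  then show ?thesis using assms by (auto simp: ennreal_mult_top)
next
  case False
  then obtain r s where rs: "x = ennreal r" "y = ennreal s" "r \<ge> 0" "s \<ge> 0"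
    by (cases x; cases y) auto
  show ?thesis
  proof (cases "r = 0 \<or> s = 0")
    case False
    then have "r powr a * s powr b \<le> a * r + b * s"
      using assms rs by (intro Youngs_inequality_0) auto
    then show ?thesis using rs assms
      by (simp add: ennreal_mult[symmetric] ennreal_plus[symmetric] ennreal_leI del: ennreal_plus)
  qed (use rs in auto)
qed

text \<open>After division by the two integrals the claim is the weighted AM-GM inequality at each
  point; the integrals 0 and \<infinity> are treated apart. Placing the powers on the integrands
  suits the later uses, where an integrand is first factored into powers.\<close>

lemma nn_integral_Holder:
  assumes [measurable]: "f \<in> borel_measurable M" "g \<in> borel_measurable M"
    and ab: "0 < a" "0 < b" "a + b = 1"
  shows "(\<integral>\<^sup>+x. epow (f x) a * epow (g x) b \<partial>M)
      \<le> epow (\<integral>\<^sup>+x. f x \<partial>M) a * epow (\<integral>\<^sup>+x. g x \<partial>M) b"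
proof -
  define A where "A = (\<integral>\<^sup>+x. f x \<partial>M)"
  define B where "B = (\<integral>\<^sup>+x. g x \<partial>M)"
  consider "A = 0" | "B = 0" | "A \<noteq> 0" "B \<noteq> 0" "A = \<top> \<or> B = \<top>"
    | "A \<noteq> 0" "B \<noteq> 0" "A \<noteq> \<top>" "B \<noteq> \<top>" by blast
  then show ?thesis
  proof cases
    case 1
    then have "AE x in M. f x = 0" by (auto simp: A_def nn_integral_0_iff_AE)
    then have "AE x in M. epow (f x) a * epow (g x) b = 0" by eventually_elim simp
    then have "(\<integral>\<^sup>+x. epow (f x) a * epow (g x) b \<partial>M) = 0" by (subst nn_integral_0_iff_AE) auto
    then show ?thesis by simp
  next
    case 2
    then have "AE x in M. g x = 0" by (auto simp: B_def nn_integral_0_iff_AE)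
    then have "AE x in M. epow (f x) a * epow (g x) b = 0" by eventually_elim simp
    then have "(\<integral>\<^sup>+x. epow (f x) a * epow (g x) b \<partial>M) = 0" by (subst nn_integral_0_iff_AE) auto
    then show ?thesis by simp
  next
    case 3
    then have "epow A a * epow B b = \<top>" by (auto simp: ennreal_mult_top ennreal_top_mult)
    then show ?thesis by (simp add: A_def B_def)
  next
    case 4
    then obtain r s where rs: "A = ennreal r" "B = ennreal s" "r > 0" "s > 0"
      by (cases A; cases B) (auto simp: less_le)
    have eq: "epow (f x) a * epow (g x) b = epow A a * epow B b *
        (epow (ennreal (1 / r) * f x) a * epow (ennreal (1 / s) * g x) b)" for x
    proof -
      have 1: "epow A a * epow (ennreal (1 / r)) a = 1"
        using rs by (simp add: ennreal_mult[symmetric] powr_mult[symmetric])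
      have 2: "epow B b * epow (ennreal (1 / s)) b = 1"
        using rs by (simp add: ennreal_mult[symmetric] powr_mult[symmetric])
      have "epow A a * epow B b * (epow (ennreal (1 / r) * f x) a * epow (ennreal (1 / s) * g x) b)
        = (epow A a * epow (ennreal (1 / r)) a) * (epow B b * epow (ennreal (1 / s)) b) *
          (epow (f x) a * epow (g x) b)" unfolding epow_mult by (simp only: ac_simps)
      then show ?thesis unfolding 1 2 by simp
    qed
    have "(\<integral>\<^sup>+x. epow (f x) a * epow (g x) b \<partial>M) = epow A a * epow B b *
        (\<integral>\<^sup>+x. epow (ennreal (1 / r) * f x) a * epow (ennreal (1 / s) * g x) b \<partial>M)"
      unfolding eq by (rule nn_integral_cmult) measurable
    also have "\<dots> \<le> epow A a * epow B b *
        (\<integral>\<^sup>+x. ennreal a * (ennreal (1 / r) * f x) + ennreal b * (ennreal (1 / s) * g x) \<partial>M)"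
      by (intro mult_left_mono nn_integral_mono epow_weighted_AM_GM ab) auto
    also have "(\<integral>\<^sup>+x. ennreal a * (ennreal (1 / r) * f x) + ennreal b * (ennreal (1 / s) * g x) \<partial>M)
        = ennreal a * (ennreal (1 / r) * A) + ennreal b * (ennreal (1 / s) * B)"
      by (simp add: nn_integral_add nn_integral_cmult A_def B_def)
    also have "\<dots> = 1"
      using rs ab by (simp add: ennreal_mult[symmetric] ennreal_plus[symmetric] del: ennreal_plus)
    finally show ?thesis by (simp add: A_def B_def)
  qed
qed

text \<open>Hoelder's inequality for the factorization
  \<open>h c = (h^a c)^(1/a) * c^(1 - 1/a)\<close>, in which the second factor integrates to at most
  1. A weight of mass below 1 is admissible because only this upper bound enters.\<close>

lemma nn_integral_Jensen:
  assumes [measurable]: "h \<in> borel_measurable M" "c \<in> borel_measurable M"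
    and c: "(\<integral>\<^sup>+i. c i \<partial>M) \<le> 1" and a: "1 < a"
  shows "epow (\<integral>\<^sup>+i. h i * c i \<partial>M) a \<le> (\<integral>\<^sup>+i. epow (h i) a * c i \<partial>M)"
proof -
  have eq: "h i * c i = epow (epow (h i) a * c i) (1 / a) * epow (c i) (1 - 1 / a)" for i
  proof -
    have "epow (c i) (1 / a) * epow (c i) (1 - 1 / a) = c i"
      using epow_add[of "c i" "1 / a" "1 - 1 / a"] by simp
    then show ?thesis using a by (simp add: epow_mult epow_inverse mult.assoc)
  qed
  have "(\<integral>\<^sup>+i. h i * c i \<partial>M)
      \<le> epow (\<integral>\<^sup>+i. epow (h i) a * c i \<partial>M) (1 / a) * epow (\<integral>\<^sup>+i. c i \<partial>M) (1 - 1 / a)"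
    unfolding eq[abs_def] by (rule nn_integral_Holder) (use a in auto)
  also have "\<dots> \<le> epow (\<integral>\<^sup>+i. epow (h i) a * c i \<partial>M) (1 / a) * 1"
    by (intro mult_left_mono epow_le_1 c) (use a in auto)
  finally have "epow (\<integral>\<^sup>+i. h i * c i \<partial>M) a \<le> epow (epow (\<integral>\<^sup>+i. epow (h i) a * c i \<partial>M) (1 / a)) a"
    by (intro epow_mono) (use a in auto)
  then show ?thesis using a by (simp add: epow_inverse)
qed

text \<open>\<open>Lux_le q w c\<close> says that the Luxemburg norm of \<open>w\<close> in \<open>L\<^bsup>q(\<cdot>)\<^esup>\<close> is at most \<open>c\<close>.\<close>

definition Lux_le :: "('a::euclidean_space \<Rightarrow> real) \<Rightarrow> ('a \<Rightarrow> ennreal) \<Rightarrow> real \<Rightarrow> bool" where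
  "Lux_le q w c \<longleftrightarrow> 0 < c \<and> w \<in> borel_measurable borel \<and>
     (\<integral>\<^sup>+x. epow (ennreal (1 / c) * w x) (q x) \<partial>lborel) \<le> 1"

lemma Lux_leD:
  assumes "Lux_le q w c"
  shows "0 < c" "w \<in> borel_measurable borel"
    "(\<integral>\<^sup>+x. epow (ennreal (1 / c) * w x) (q x) \<partial>lborel) \<le> 1"
  using assms by (auto simp: Lux_le_def)

lemma Lux_le_mono:
  assumes "Lux_le q w c" "AE x in lborel. v x \<le> w x" "v \<in> borel_measurable borel" "c \<le> d"
    "\<And>x. 0 \<le> q x"
  shows "Lux_le q v d"
proof -
  have c: "0 < c" using assms(1) by (rule Lux_leD)
  have "(\<integral>\<^sup>+x. epow (ennreal (1 / d) * v x) (q x) \<partial>lborel)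
      \<le> (\<integral>\<^sup>+x. epow (ennreal (1 / c) * w x) (q x) \<partial>lborel)"
  proof (rule nn_integral_mono_AE)
    from assms(2) show "AE x in lborel. epow (ennreal (1 / d) * v x) (q x)
        \<le> epow (ennreal (1 / c) * w x) (q x)"
      by eventually_elim (intro epow_mono mult_mono ennreal_leI; use assms c in \<open>auto simp: frac_le\<close>)
  qed
  also have "\<dots> \<le> 1" using assms(1) by (rule Lux_leD)
  finally show ?thesis using assms c by (auto simp: Lux_le_def)
qed

lemma Lux_le_scale:
  assumes "Lux_le q w c" "0 < r"
  shows "Lux_le q (\<lambda>x. ennreal r * w x) (r * c)"
proof -
  have c: "0 < c" and [measurable]: "w \<in> borel_measurable borel" using assms(1) by (auto dest: Lux_leD)
  have "ennreal (1 / (r * c)) * (ennreal r * w x) = ennreal (1 / c) * w x" for x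
    using c assms(2) by (simp add: mult.assoc[symmetric] ennreal_mult[symmetric])
  then show ?thesis using assms c Lux_leD(3)[OF assms(1)] by (auto simp: Lux_le_def)
qed

lemma Lux_le_unscale:
  "Lux_le q w c \<longleftrightarrow> 0 < c \<and> Lux_le q (\<lambda>x. ennreal (1 / c) * w x) 1"
proof
  assume *: "Lux_le q w c"
  then show "0 < c \<and> Lux_le q (\<lambda>x. ennreal (1 / c) * w x) 1"
    using Lux_le_scale[OF *, of "1 / c"] Lux_leD(1)[OF *] by auto
next
  assume *: "0 < c \<and> Lux_le q (\<lambda>x. ennreal (1 / c) * w x) 1"
  have "ennreal c * (ennreal (1 / c) * w x) = w x" for x
    using * by (simp add: mult.assoc[symmetric] ennreal_mult[symmetric])
  then show "Lux_le q w c" using * Lux_le_scale[of q "\<lambda>x. ennreal (1 / c) * w x" 1 c] by auto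
qed

lemma Lux_le_1_iff:
  "Lux_le q w 1 \<longleftrightarrow> w \<in> borel_measurable borel \<and> (\<integral>\<^sup>+x. epow (w x) (q x) \<partial>lborel) \<le> 1"
  by (simp add: Lux_le_def)

text \<open>Since \<open>q \<ge> 1\<close> and \<open>C \<ge> 1\<close>, dividing the function by
  \<open>C\<close> divides the modular by at least \<open>C\<close>.\<close>

lemma Lux_le_of_modular:
  assumes [measurable]: "w \<in> borel_measurable borel"
    and q: "q \<in> borel_measurable borel" "\<And>x. 1 \<le> q x"
    and C: "(\<integral>\<^sup>+x. epow (w x) (q x) \<partial>lborel) \<le> ennreal C" "1 \<le> C"
  shows "Lux_le q w C"
proof -
  note q(1)[measurable]
  have *: "epow (ennreal (1 / C)) (q x) \<le> ennreal (1 / C)" for x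
    using epow_exponent_mono'[of "ennreal (1 / C)" 1 "q x"] C q(2) by simp
  have "(\<integral>\<^sup>+x. epow (ennreal (1 / C) * w x) (q x) \<partial>lborel)
      \<le> (\<integral>\<^sup>+x. ennreal (1 / C) * epow (w x) (q x) \<partial>lborel)"
    unfolding epow_mult by (intro nn_integral_mono mult_right_mono *) auto
  also have "\<dots> = ennreal (1 / C) * (\<integral>\<^sup>+x. epow (w x) (q x) \<partial>lborel)"
    by (rule nn_integral_cmult) measurable
  also have "\<dots> \<le> ennreal (1 / C) * ennreal C" by (intro mult_left_mono C) auto
  also have "\<dots> = 1" using C by (simp add: ennreal_mult[symmetric])
  finally show ?thesis using C by (auto simp: Lux_le_def)
qed

text \<open>Minkowski's inequality, by Jensen's inequality with the weights \<open>c / Z\<close>.\<close>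

lemma Lux_le_nn_integral:
  assumes \<mu>: "sigma_finite_measure \<mu>"
    and q: "q \<in> borel_measurable borel" "\<And>x. 1 < q x"
    and h[measurable]: "(\<lambda>(i, x). h i x) \<in> borel_measurable (\<mu> \<Otimes>\<^sub>M lborel)"
    and c[measurable]: "c \<in> borel_measurable \<mu>"
    and hc: "AE i in \<mu>. Lux_le q (h i) (c i)"
    and Z: "(\<integral>\<^sup>+i. ennreal (c i) \<partial>\<mu>) \<le> ennreal Z" "0 < Z"
  shows "Lux_le q (\<lambda>x. \<integral>\<^sup>+i. h i x \<partial>\<mu>) Z"
proof -
  note q(1)[measurable]
  interpret \<mu>: sigma_finite_measure \<mu> by (rule \<mu>)
  interpret pair_sigma_finite \<mu> lborel ..
  have hm[measurable]: "(\<lambda>i. h i x) \<in> borel_measurable \<mu>" for x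
    by measurable
  define e where "e i = ennreal (c i / Z)" for i
  have [measurable]: "e \<in> borel_measurable \<mu>" unfolding e_def by measurable
  have e1: "(\<integral>\<^sup>+i. e i \<partial>\<mu>) \<le> 1"
  proof -
    have "e i = ennreal (1 / Z) * ennreal (c i)" for i
      using Z by (simp add: e_def ennreal_mult'[symmetric])
    then have "(\<integral>\<^sup>+i. e i \<partial>\<mu>) = ennreal (1 / Z) * (\<integral>\<^sup>+i. ennreal (c i) \<partial>\<mu>)"
      by (simp add: nn_integral_cmult)
    also have "\<dots> \<le> ennreal (1 / Z) * ennreal Z" by (intro mult_left_mono Z) auto
    also have "\<dots> = 1" using Z by (simp add: ennreal_mult[symmetric])
    finally show ?thesis .
  qed
  \<comment> \<open>At a fixed \<open>x\<close> the exponent \<open>q x\<close> is a constant, so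
    Jensen's inequality in \<open>i\<close> is unaffected by the variation of
    \<open>q\<close>.\<close>
  have pt: "epow (ennreal (1 / Z) * (\<integral>\<^sup>+i. h i x \<partial>\<mu>)) (q x)
      \<le> (\<integral>\<^sup>+i. epow (ennreal (1 / c i) * h i x) (q x) * e i \<partial>\<mu>)" for x
  proof -
    have "ennreal (1 / Z) * (\<integral>\<^sup>+i. h i x \<partial>\<mu>) = (\<integral>\<^sup>+i. ennreal (1 / Z) * h i x \<partial>\<mu>)"
      by (rule nn_integral_cmult[symmetric]) measurable
    also have "\<dots> = (\<integral>\<^sup>+i. (ennreal (1 / c i) * h i x) * e i \<partial>\<mu>)"
    proof (rule nn_integral_cong_AE)
      from hc show "AE i in \<mu>. ennreal (1 / Z) * h i x = (ennreal (1 / c i) * h i x) * e i"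
      proof eventually_elim
        case (elim i)
        then have "0 < c i" by (rule Lux_leD)
        then have "ennreal (1 / c i) * e i = ennreal (1 / Z)"
          using Z by (simp add: e_def ennreal_mult[symmetric])
        then show ?case by (metis mult.commute mult.left_commute)
      qed
    qed
    finally show ?thesis by (simp only:) (rule nn_integral_Jensen; use e1 q in \<open>auto simp: e_def\<close>)
  qed
  have "(\<integral>\<^sup>+x. epow (ennreal (1 / Z) * (\<integral>\<^sup>+i. h i x \<partial>\<mu>)) (q x) \<partial>lborel)
      \<le> (\<integral>\<^sup>+x. (\<integral>\<^sup>+i. epow (ennreal (1 / c i) * h i x) (q x) * e i \<partial>\<mu>) \<partial>lborel)"
    by (intro nn_integral_mono pt)
  also have "\<dots> = (\<integral>\<^sup>+i. (\<integral>\<^sup>+x. epow (ennreal (1 / c i) * h i x) (q x) * e i \<partial>lborel) \<partial>\<mu>)"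
    by (rule Fubini') (simp add: e_def)
  also have "\<dots> \<le> (\<integral>\<^sup>+i. e i \<partial>\<mu>)"
  proof (rule nn_integral_mono_AE)
    from hc show "AE i in \<mu>. (\<integral>\<^sup>+x. epow (ennreal (1 / c i) * h i x) (q x) * e i \<partial>lborel) \<le> e i"
    proof eventually_elim
      case (elim i)
      have [measurable]: "h i \<in> borel_measurable borel" using elim by (rule Lux_leD)
      have "(\<integral>\<^sup>+x. epow (ennreal (1 / c i) * h i x) (q x) * e i \<partial>lborel)
        = (\<integral>\<^sup>+x. epow (ennreal (1 / c i) * h i x) (q x) \<partial>lborel) * e i"
        by (rule nn_integral_multc) measurable
      also have "\<dots> \<le> 1 * e i" by (intro mult_right_mono Lux_leD(3) elim) auto
      finally show ?case by simp
    qed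
  qed
  also have "\<dots> \<le> 1" by (rule e1)
  finally show ?thesis using Z by (auto simp: Lux_le_def)
qed

text \<open>Minkowski's inequality for the counting measure on a two-point set.\<close>

lemma Lux_le_add:
  assumes "q \<in> borel_measurable borel" "\<And>x. 1 < q x" "Lux_le q v c" "Lux_le q w d"
  shows "Lux_le q (\<lambda>x. v x + w x) (c + d)"
proof -
  define h where "h i = (if i then v else w)" for i
  define e where "e i = (if i then c else d)" for i
  have [measurable]: "v \<in> borel_measurable borel" "w \<in> borel_measurable borel"
    and cd: "0 < c" "0 < d" using assms by (auto dest: Lux_leD)
  have "Lux_le q (\<lambda>x. \<integral>\<^sup>+i. h i x \<partial>count_space UNIV) (c + d)"
  proof (rule Lux_le_nn_integral[where c = e])
    show "sigma_finite_measure (count_space (UNIV :: bool set))"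
      by (rule sigma_finite_measure_count_space_finite) auto
    show "(\<lambda>(i, x). h i x) \<in> borel_measurable (count_space UNIV \<Otimes>\<^sub>M lborel)"
      by (rule measurable_pair_measure_countable1) (auto simp: h_def)
  qed (use assms cd in \<open>auto simp: h_def e_def nn_integral_count_space_finite UNIV_bool add.commute ennreal_plus[symmetric] simp del: ennreal_plus\<close>)
  then show ?thesis
    by (simp add: h_def nn_integral_count_space_finite UNIV_bool add.commute)
qed

text \<open>Monotone convergence inside the modular. This Fatou property passes uniform bounds on
  the iterates of the majorant to their limit.\<close>

lemma Lux_le_SUP:
  assumes "q \<in> borel_measurable borel" "\<And>x. 0 < q x" "incseq W" "\<And>n. Lux_le q (W n) c"
  shows "Lux_le q (\<lambda>x. SUP n. W n x) c"
proof -
  note assms(1)[measurable]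
  have [measurable]: "W n \<in> borel_measurable borel" for n using assms(4) by (rule Lux_leD)
  have "(\<integral>\<^sup>+x. epow (ennreal (1 / c) * (SUP n. W n x)) (q x) \<partial>lborel)
    = (\<integral>\<^sup>+x. (SUP n. epow (ennreal (1 / c) * W n x) (q x)) \<partial>lborel)"
    by (simp add: SUP_mult_left_ennreal epow_SUP assms(2))
  also have "\<dots> = (SUP n. \<integral>\<^sup>+x. epow (ennreal (1 / c) * W n x) (q x) \<partial>lborel)"
    by (rule nn_integral_monotone_convergence_SUP)
      (use assms(2,3) in \<open>auto simp: incseq_def le_fun_def less_imp_le intro!: epow_mono mult_left_mono\<close>)
  also have "\<dots> \<le> 1" by (intro SUP_least Lux_leD(3) assms)
  finally show ?thesis using Lux_leD(1)[OF assms(4)] by (simp add: Lux_le_def)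
qed

lemma Lux_le_AE_finite:
  assumes "q \<in> borel_measurable borel" "Lux_le q w c"
  shows "AE x in lborel. w x < \<infinity>"
proof -
  note assms(1)[measurable]
  have [measurable]: "w \<in> borel_measurable borel" and c: "0 < c" using assms by (auto dest: Lux_leD)
  have "AE x in lborel. epow (ennreal (1 / c) * w x) (q x) \<noteq> \<infinity>"
    by (rule nn_integral_PInf_AE) (use Lux_leD(3)[OF assms(2)] in \<open>auto simp: top_unique\<close>)
  then show ?thesis
    by eventually_elim (use c in \<open>auto simp: ennreal_mult_eq_top_iff less_top[symmetric]\<close>)
qed

text \<open>Where \<open>w / c > 1\<close> a smaller exponent gives a smaller power, and where
  \<open>w / c \<le> 1\<close> a larger exponent does. With the norm bound itself as threshold, both
  parts keep the bound \<open>c\<close>.\<close>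

lemma Lux_le_split:
  assumes "Lux_le q w c" "\<And>x. ql \<le> q x" "\<And>x. q x \<le> qu" "0 \<le> ql"
  shows "Lux_le (\<lambda>_. ql) (\<lambda>x. if ennreal c < w x then w x else 0) c"
    and "Lux_le (\<lambda>_. qu) (\<lambda>x. if ennreal c < w x then 0 else w x) c"
proof -
  have [measurable]: "w \<in> borel_measurable borel" and c: "0 < c" using assms by (auto dest: Lux_leD)
  have c1: "ennreal (1 / c) * ennreal c = 1" using c by (simp add: ennreal_mult[symmetric])
  have "epow (ennreal (1 / c) * (if ennreal c < w x then w x else 0)) ql
      \<le> epow (ennreal (1 / c) * w x) (q x)" for x
  proof (cases "ennreal c < w x")
    case True
    then have "1 \<le> ennreal (1 / c) * w x" using mult_left_mono[of "ennreal c" "w x" "ennreal (1 / c)"]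
      by (simp add: c1)
    then show ?thesis using True assms by (auto intro: epow_exponent_mono)
  qed auto
  then show "Lux_le (\<lambda>_. ql) (\<lambda>x. if ennreal c < w x then w x else 0) c"
    using c order.trans[OF nn_integral_mono Lux_leD(3)[OF assms(1)]] by (auto simp: Lux_le_def)
  have "epow (ennreal (1 / c) * (if ennreal c < w x then 0 else w x)) qu
      \<le> epow (ennreal (1 / c) * w x) (q x)" for x
  proof (cases "ennreal c < w x")
    case False
    then have "ennreal (1 / c) * w x \<le> 1" using mult_left_mono[of "w x" "ennreal c" "ennreal (1 / c)"]
      by (simp add: c1 not_less)
    then show ?thesis using False assms by (auto intro: epow_exponent_mono')
  qed auto
  then show "Lux_le (\<lambda>_. qu) (\<lambda>x. if ennreal c < w x then 0 else w x) c"
    using c order.trans[OF nn_integral_mono Lux_leD(3)[OF assms(1)]] by (auto simp: Lux_le_def)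
qed

text \<open>Reduces operator bounds to functions of norm at most 1, where the modular can be used
  directly, by rescaling with \<open>1 / d\<close>.\<close>

lemma Lux_le_homogeneous:
  assumes A: "\<And>w. Lux_le p w 1 \<Longrightarrow> Lux_le q (A w) C"
    and hom: "\<And>w r. 0 < r \<Longrightarrow> w \<in> borel_measurable borel \<Longrightarrow>
      A (\<lambda>x. ennreal r * w x) = (\<lambda>x. ennreal r * A w x)"
    and w: "Lux_le p w d"
  shows "Lux_le q (A w) (C * d)"
proof -
  from w have d: "0 < d" and w': "Lux_le p (\<lambda>x. ennreal (1 / d) * w x) 1"
    by (auto simp: Lux_le_unscale[of _ w d])
  have [measurable]: "w \<in> borel_measurable borel" using w by (rule Lux_leD)
  have "A w = A (\<lambda>x. ennreal d * (ennreal (1 / d) * w x))"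
    using d by (simp add: mult.assoc[symmetric] ennreal_mult[symmetric])
  also have "\<dots> = (\<lambda>x. ennreal d * A (\<lambda>x. ennreal (1 / d) * w x) x)"
    by (rule hom) (use d in auto)
  finally show ?thesis using Lux_le_scale[OF A[OF w'] d] by (simp add: mult.commute)
qed

subsection \<open>Variable exponents satisfying the log-Hoelder conditions\<close>

text \<open>The bounds on \<open>q\<close> are required at every point; for an exponent given by
  essential bounds this follows from the continuity of \<open>1 / q\<close>. That \<open>b\<close>
  is both the lower bound of \<open>1 / q\<close> and its limit at infinity expresses
  \<open>q\<^sup>+ = q\<^sub>\<infinity>\<close>.\<close>

locale log_Hoelder_exponent =
  fixes q :: "real^3 \<Rightarrow> real" and a b c :: real
  assumes q_measurable [measurable]: "q \<in> borel_measurable borel"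
    and ab: "0 < b" "b \<le> a" "a < 1 / 2" "0 < c"
    and q_ge: "\<And>x. 1 / a \<le> q x" and q_le: "\<And>x. q x \<le> 1 / b"
    and q_local: "\<And>x y. \<bar>1 / q x - 1 / q y\<bar> \<le> c / ln (exp 1 + 1 / norm (x - y))"
    and q_decay: "\<And>x. \<bar>1 / q x - b\<bar> \<le> c / ln (exp 1 + norm x)"
begin

lemma a_pos: "0 < a" using ab by simp

lemma inverse_gt_2: "2 < 1 / a" "2 < 1 / b"
  using ab by (auto simp: field_simps)

lemma q_gt_2: "2 < q x" using q_ge[of x] inverse_gt_2 by linarith

lemma q_gt_1: "1 < q x" and q_pos: "0 < q x" and q_nonneg: "0 \<le> q x"
  using q_gt_2[of x] by auto

lemma inverse_q_bounds: "b \<le> 1 / q x" "1 / q x \<le> a"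
  using divide_left_mono[OF q_le[of x], of 1] divide_left_mono[OF q_ge[of x], of 1] q_pos[of x] a_pos ab
  by auto

end

lemma ln_exp1_plus_ge_1: "0 \<le> r \<Longrightarrow> 1 \<le> ln (exp 1 + r :: real)"
  using ln_ge_iff[of "exp 1 + r" 1] by (simp add: add_pos_nonneg)

lemma nn_integral_inverse_1_plus_square_finite:
  "(\<integral>\<^sup>+(x::real). ennreal (inverse (1 + x\<^sup>2)) \<partial>lborel) < \<infinity>"
proof -
  have "integrable lborel (\<lambda>x::real. inverse (1 + x\<^sup>2))"
    using integrable_inverse_1_plus_square by (simp add: set_integrable_def einterval_def)
  then show ?thesis
    by (auto simp: integrable_iff_bounded)
qed

text \<open>Each factor \<open>1 + (x \<bullet> b)\<^sup>2\<close> is at most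
  \<open>(exp 1 + norm x)\<^sup>2\<close>. The exponent 6 thus permits comparison with a product of
  three Cauchy densities, which is integrated coordinate by coordinate.\<close>

lemma nn_integral_decay_finite:
  "(\<integral>\<^sup>+(x::real^3). ennreal ((exp 1 + norm x) powr -6) \<partial>lborel) < \<infinity>"
proof -
  have "(exp 1 + norm x) powr -6 \<le> (\<Prod>b\<in>Basis. inverse (1 + (x \<bullet> b)\<^sup>2))" for x :: "real^3"
  proof -
    let ?e = "exp 1 + norm x"
    have e: "1 \<le> ?e" using exp_ge_add_one_self[of 1] norm_ge_zero[of x] by linarith
    have 1: "1 + (x \<bullet> b)\<^sup>2 \<le> ?e\<^sup>2" if "b \<in> Basis" for b
    proof -
      have "\<bar>x \<bullet> b\<bar> \<le> norm x" using that by (rule Basis_le_norm)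
      then have "(x \<bullet> b)\<^sup>2 \<le> (norm x)\<^sup>2" by (metis abs_ge_zero power2_abs power_mono)
      moreover have "1 \<le> (exp 1 :: real)\<^sup>2" by simp
      moreover have "0 \<le> 2 * exp 1 * norm x" by simp
      ultimately show ?thesis unfolding power2_sum by linarith
    qed
    have "(\<Prod>b\<in>Basis. 1 + (x \<bullet> b)\<^sup>2) \<le> (\<Prod>b\<in>(Basis::(real^3) set). ?e\<^sup>2)"
      by (intro prod_mono) (use 1 in auto)
    also have "\<dots> = ?e ^ 6" by (simp add: power_mult[symmetric])
    finally have "(\<Prod>b\<in>Basis. 1 + (x \<bullet> b)\<^sup>2) \<le> ?e ^ 6" .
    moreover have "0 < (\<Prod>b\<in>Basis. 1 + (x \<bullet> b)\<^sup>2)" by (intro prod_pos) (auto intro: add_pos_nonneg)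
    ultimately have "inverse (?e ^ 6) \<le> inverse (\<Prod>b\<in>Basis. 1 + (x \<bullet> b)\<^sup>2)"
      by (rule le_imp_inverse_le)
    moreover have "?e powr -6 = inverse (?e ^ 6)"
      using e by (simp add: powr_minus)
    ultimately show ?thesis by (simp add: prod_inversef[unfolded comp_def])
  qed
  then have "(\<integral>\<^sup>+(x::real^3). ennreal ((exp 1 + norm x) powr -6) \<partial>lborel)
    \<le> (\<integral>\<^sup>+(x::real^3). (\<Prod>b\<in>Basis. ennreal (inverse (1 + (x \<bullet> b)\<^sup>2))) \<partial>lborel)"
    by (intro nn_integral_mono) (simp add: prod_ennreal ennreal_leI)
  also have "\<dots> = (\<Prod>b\<in>(Basis::(real^3) set). (\<integral>\<^sup>+(x::real). ennreal (inverse (1 + x\<^sup>2)) \<partial>lborel))"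
    by (rule nn_integral_lborel_prod) auto
  also have "\<dots> < \<infinity>"
    using nn_integral_inverse_1_plus_square_finite by (simp add: power_less_top_ennreal)
  finally show ?thesis .
qed

text \<open>With \<open>R = r powr (1 / b)\<close> and \<open>k = q x * b \<le> 1\<close> the left
  side is \<open>R powr k\<close>, to be compared with \<open>R\<close> and with the integrable
  function \<open>h\<close>. The decay condition gives
  \<open>(1 - k) * ln (exp 1 + norm x) \<le> c / b\<close>, so \<open>h powr (k - 1)\<close> is
  bounded. If \<open>R \<ge> h\<close>, then \<open>R powr (k - 1) \<le> h powr (k - 1)\<close> and
  the power is absorbed by \<open>R\<close>; if \<open>R < h\<close>, it is absorbed by
  \<open>h\<close>.\<close>

lemma (in log_Hoelder_exponent) epow_decay_bound:
  "epow w (q x) \<le> ennreal (exp (6 * c / b)) *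
     (epow w (1 / b) + ennreal ((exp 1 + norm x) powr -6))"
proof (cases w)
  case (real r)
  define e where "e = exp 1 + norm x"
  define h where "h = e powr -6"
  define R where "R = r powr (1 / b)"
  define k where "k = q x * b"
  have e: "1 \<le> ln e" using ln_exp1_plus_ge_1[of "norm x"] by (simp add: e_def)
  have "1 < e" using exp_ge_add_one_self[of 1] norm_ge_zero[of x] unfolding e_def by linarith
  note e = e this
  have h: "0 < h" using e by (simp add: h_def)
  have k: "k \<le> 1" "0 < k" using q_le[of x] q_pos[of x] ab by (auto simp: k_def field_simps)
  have hk: "h powr (k - 1) \<le> exp (6 * c / b)"
  proof -
    have "(1 - k) = q x * (1 / q x - b)" using q_pos[of x] by (simp add: k_def right_diff_distrib)
    also have "\<dots> \<le> (1 / b) * (c / ln e)"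
      using q_decay[of x] q_le[of x] q_pos[of x] inverse_q_bounds[of x] ab
      by (intro mult_mono) (auto simp: e_def)
    finally have "(1 - k) * ln e \<le> (1 / b) * (c / ln e) * ln e"
      using e by (intro mult_right_mono) auto
    then have "(1 - k) * ln e \<le> c / b" using e by simp
    then have "6 * ((1 - k) * ln e) \<le> 6 * (c / b)" by linarith
    then have "6 * (1 - k) * ln e \<le> 6 * c / b" by (simp only: mult.assoc times_divide_eq_right)
    moreover have "h powr (k - 1) = exp (6 * (1 - k) * ln e)"
      using e by (simp add: h_def powr_powr powr_def algebra_simps)
    ultimately show ?thesis by simp
  qed
  have rR: "r powr q x = R powr k" using ab by (simp add: R_def k_def powr_powr)
  have *: "y powr k = y * y powr (k - 1)" if "0 < y" for y
    using that powr_add[of y 1 "k - 1"] by simp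
  have "r powr q x \<le> exp (6 * c / b) * (R + h)"
  proof (cases "h \<le> R")
    case True
    then have "R powr (k - 1) \<le> h powr (k - 1)" using h k by (intro powr_mono2') auto
    then have "R * R powr (k - 1) \<le> R * exp (6 * c / b)" using hk True h by (intro mult_left_mono) auto
    then have "R powr k \<le> exp (6 * c / b) * R" using *[of R] True h by (simp add: mult.commute)
    also have "\<dots> \<le> exp (6 * c / b) * (R + h)" using h by simp
    finally show ?thesis by (simp add: rR)
  next
    case False
    have R0: "0 \<le> R" by (simp add: R_def)
    have "R powr k \<le> h powr k" using False k R0 by (intro powr_mono2) auto
    also have "\<dots> \<le> exp (6 * c / b) * h" using *[OF h] hk h by (simp add: mult.commute)
    also have "\<dots> \<le> exp (6 * c / b) * (R + h)" using R0 by simp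
    finally show ?thesis by (simp add: rR)
  qed
  then have "ennreal (r powr q x) \<le> ennreal (exp (6 * c / b) * (R + h))" by (rule ennreal_leI)
  then show ?thesis using real
    by (simp add: R_def h_def e_def ennreal_mult' ennreal_plus)
qed (simp add: ennreal_mult_top)

text \<open>The decay of \<open>1 / q\<close> towards \<open>b = 1 / sup q\<close> makes \<open>L\<^bsup>1/b\<^esup>\<close> embed into \<open>L\<^bsup>q(\<cdot>)\<^esup>\<close>.\<close>

lemma (in log_Hoelder_exponent) Lux_le_embedding:
  "\<exists>C\<ge>1. \<forall>w d. Lux_le (\<lambda>_. 1 / b) w d \<longrightarrow> Lux_le q w (C * d)"
proof -
  define H where "H = enn2real (\<integral>\<^sup>+(x::real^3). ennreal ((exp 1 + norm x) powr -6) \<partial>lborel)"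
  have H: "(\<integral>\<^sup>+(x::real^3). ennreal ((exp 1 + norm x) powr -6) \<partial>lborel) = ennreal H" "0 \<le> H"
    using nn_integral_decay_finite by (simp_all add: H_def less_top)
  define C where "C = exp (6 * c / b) * (1 + H)"
  have "1 * 1 \<le> exp (6 * c / b) * (1 + H)"
    using ab H by (intro mult_mono) auto
  then have C: "1 \<le> C" by (simp add: C_def)
  have 1: "Lux_le q w C" if "Lux_le (\<lambda>_. 1 / b) w 1" for w
  proof -
    have [measurable]: "w \<in> borel_measurable borel" using that by (rule Lux_leD)
    have "(\<integral>\<^sup>+x. epow (w x) (q x) \<partial>lborel)
      \<le> (\<integral>\<^sup>+x. ennreal (exp (6 * c / b)) * (epow (w x) (1 / b) + ennreal ((exp 1 + norm x) powr -6)) \<partial>lborel)"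
      by (intro nn_integral_mono epow_decay_bound)
    also have "\<dots> = ennreal (exp (6 * c / b)) * ((\<integral>\<^sup>+x. epow (w x) (1 / b) \<partial>lborel) + ennreal H)"
      by (simp add: nn_integral_cmult nn_integral_add H)
    also have "\<dots> \<le> ennreal (exp (6 * c / b)) * (1 + ennreal H)"
      using that by (intro mult_left_mono add_right_mono) (auto simp: Lux_le_1_iff)
    also have "\<dots> = ennreal C"
      using H by (simp add: C_def ennreal_mult ennreal_plus)
    finally show ?thesis
      by (intro Lux_le_of_modular C) (auto simp: q_gt_1 less_imp_le)
  qed
  have "Lux_le q w (C * d)" if "Lux_le (\<lambda>_. 1 / b) w d" for w d
    by (rule Lux_le_homogeneous[where A = "\<lambda>w. w", OF 1 _ that]) auto
  then show ?thesis using C by blast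
qed

section \<open>Averages over balls\<close>

definition ball_kernel :: "real \<Rightarrow> real^3 \<Rightarrow> ennreal" where
  "ball_kernel r z = (if norm z \<le> r then ennreal (1 / (4 / 3 * pi * r ^ 3)) else 0)"

definition ball_average :: "real \<Rightarrow> (real^3 \<Rightarrow> ennreal) \<Rightarrow> real^3 \<Rightarrow> ennreal" where
  "ball_average r w x = (\<integral>\<^sup>+y. w y * ball_kernel r (x - y) \<partial>lborel)"

lemma ball_kernel_measurable [measurable (raw)]:
  assumes [measurable]: "r \<in> borel_measurable M" "z \<in> borel_measurable M"
  shows "(\<lambda>x. ball_kernel (r x) (z x)) \<in> borel_measurable M"
  unfolding ball_kernel_def by measurable

lemma emeasure_cball_3: "0 \<le> r \<Longrightarrow> emeasure lborel (cball (x::real^3) r) = ennreal (4 / 3 * pi * r ^ 3)"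
  by (simp add: emeasure_cball eval_unit_ball_vol)

lemma nn_integral_ball_kernel:
  assumes "0 < r"
  shows "(\<integral>\<^sup>+y. ball_kernel r (x - y) \<partial>lborel) = 1" "(\<integral>\<^sup>+y. ball_kernel r (y - x) \<partial>lborel) = 1"
proof -
  have "ball_kernel r (x - y) = ennreal (1 / (4 / 3 * pi * r ^ 3)) * indicator (cball x r) y"
    "ball_kernel r (y - x) = ennreal (1 / (4 / 3 * pi * r ^ 3)) * indicator (cball x r) y" for y
    by (auto simp: ball_kernel_def dist_norm norm_minus_commute split: split_indicator)
  moreover have "ennreal (1 / (4 / 3 * pi * r ^ 3)) * ennreal (4 / 3 * pi * r ^ 3) = 1"
    using assms by (subst ennreal_mult[symmetric]) (auto simp: field_simps)
  ultimately show "(\<integral>\<^sup>+y. ball_kernel r (x - y) \<partial>lborel) = 1" "(\<integral>\<^sup>+y. ball_kernel r (y - x) \<partial>lborel) = 1"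
    using assms by (simp_all add: nn_integral_cmult_indicator emeasure_cball_3)
qed

lemma ball_kernel_le: "0 < r \<Longrightarrow> ball_kernel r z \<le> ennreal (r powr -3)"
proof -
  assume r: "0 < r"
  have "1 * r ^ 3 \<le> (4 / 3 * pi) * r ^ 3" using r pi_gt3 by (intro mult_right_mono) auto
  then have "1 / (4 / 3 * pi * r ^ 3) \<le> 1 / r ^ 3" using r by (intro divide_left_mono) auto
  also have "1 / r ^ 3 = r powr -3" using r by (simp add: powr_minus powr_realpow field_simps)
  finally show ?thesis by (auto simp: ball_kernel_def ennreal_leI)
qed

lemma ball_average_measurable [measurable (raw)]:
  assumes [measurable]: "r \<in> borel_measurable M" "w \<in> borel_measurable borel" "f \<in> borel_measurable M"
  shows "(\<lambda>x. ball_average (r x) w (f x)) \<in> borel_measurable M"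
  unfolding ball_average_def by measurable

lemma ball_average_add:
  assumes [measurable]: "v \<in> borel_measurable borel" "w \<in> borel_measurable borel"
  shows "ball_average r (\<lambda>y. v y + w y) x = ball_average r v x + ball_average r w x"
  unfolding ball_average_def by (subst nn_integral_add[symmetric]) (auto simp: distrib_right)

lemma ball_average_Jensen:
  assumes [measurable]: "w \<in> borel_measurable borel" and "1 < s" "0 < r"
  shows "epow (ball_average r w x) s \<le> ball_average r (\<lambda>y. epow (w y) s) x"
  unfolding ball_average_def
  by (rule nn_integral_Jensen) (use assms in \<open>auto simp: nn_integral_ball_kernel\<close>)

lemma nn_integral_ball_average:
  assumes [measurable]: "w \<in> borel_measurable borel" and "0 < r"
  shows "(\<integral>\<^sup>+x. ball_average r w x \<partial>lborel) = (\<integral>\<^sup>+y. w y \<partial>lborel)"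
proof -
  have "(\<integral>\<^sup>+x. ball_average r w x \<partial>lborel) = (\<integral>\<^sup>+y. (\<integral>\<^sup>+x. w y * ball_kernel r (x - y) \<partial>lborel) \<partial>lborel)"
    unfolding ball_average_def by (rule lborel_pair.Fubini') measurable
  also have "\<dots> = (\<integral>\<^sup>+y. w y \<partial>lborel)"
    by (simp add: nn_integral_cmult nn_integral_ball_kernel assms)
  finally show ?thesis .
qed

lemma ball_average_le:
  assumes [measurable]: "w \<in> borel_measurable borel" and "0 < r" "(\<integral>\<^sup>+y. w y \<partial>lborel) \<le> 1"
  shows "ball_average r w x \<le> ennreal (r powr -3)"
proof -
  have "ball_average r w x \<le> (\<integral>\<^sup>+y. w y * ennreal (r powr -3) \<partial>lborel)"
    unfolding ball_average_def by (intro nn_integral_mono mult_left_mono ball_kernel_le assms) auto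
  also have "\<dots> = (\<integral>\<^sup>+y. w y \<partial>lborel) * ennreal (r powr -3)" by (rule nn_integral_multc) measurable
  also have "\<dots> \<le> 1 * ennreal (r powr -3)" by (intro mult_right_mono assms) auto
  finally show ?thesis by simp
qed

text \<open>On a small ball, \<open>q\<close> is replaced by a lower bound \<open>s\<close>. Jensen's inequality for the exponent
  \<open>s\<close> then loses a power \<open>q x / s - 1 = O(1 / \<bar>log r\<bar>)\<close> of the average, which is at most \<open>r\<^bsup>-3\<^esup>\<close>.\<close>

lemma (in log_Hoelder_exponent) ball_average_large_pointwise:
  assumes [measurable]: "w \<in> borel_measurable borel" and r: "0 < r"
    and w1: "(\<integral>\<^sup>+y. epow (w y) (q y) \<partial>lborel) \<le> 1"
    and w: "\<And>y. w y = 0 \<or> 1 \<le> w y"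
  shows "epow (ball_average r w x) (q x)
      \<le> ennreal (exp (3 * c / b)) * ball_average r (\<lambda>y. epow (w y) (q y)) x"
proof -
  define J where "J = ball_average r (\<lambda>y. epow (w y) (q y)) x"
  have Jr: "J \<le> ennreal (r powr -3)"
    unfolding J_def by (rule ball_average_le) (use r w1 in auto)
  \<comment> \<open>The values of \<open>w\<close> are 0 or at least 1, so replacing
    \<open>q y\<close> by the smaller \<open>s\<close> can only decrease the power under the
    average.\<close>
  have base: "epow (ball_average r w x) s \<le> J"
    if s: "1 < s" "\<And>y. norm (x - y) \<le> r \<Longrightarrow> s \<le> q y" for s
  proof -
    have "epow (ball_average r w x) s \<le> ball_average r (\<lambda>y. epow (w y) s) x"
      by (rule ball_average_Jensen) (use s r in auto)
    also have "\<dots> \<le> J"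
      unfolding J_def ball_average_def
    proof (intro nn_integral_mono)
      fix y
      show "epow (w y) s * ball_kernel r (x - y) \<le> epow (w y) (q y) * ball_kernel r (x - y)"
      proof (cases "norm (x - y) \<le> r")
        case True
        then have "epow (w y) s \<le> epow (w y) (q y)"
          using w[of y] s(2)[of y] by (cases "w y = 0") (auto intro: epow_exponent_mono)
        then show ?thesis by (rule mult_right_mono) auto
      qed (simp add: ball_kernel_def)
    qed
    finally show ?thesis .
  qed
  have C1: "1 \<le> ennreal (exp (3 * c / b))" using ab by simp
  show ?thesis
  proof (cases "1 \<le> r")
    \<comment> \<open>For \<open>r \<ge> 1\<close> no continuity of \<open>q\<close> is used: the
      average is at most 1, and the exponent may be raised from the global lower bound
      \<open>1 / a\<close> to \<open>q x\<close>.\<close>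
    case True
    have "epow (ball_average r w x) (1 / a) \<le> J"
      by (rule base) (use q_ge inverse_gt_2 in auto)
    moreover have "r powr -3 \<le> 1" using True powr_mono2'[of "-3" 1 r] by simp
    then have "J \<le> 1" using order.trans[OF Jr] by (simp add: ennreal_le_1)
    ultimately have "epow (ball_average r w x) (1 / a) \<le> 1" "epow (ball_average r w x) (1 / a) \<le> J"
      by auto
    moreover from this(1) have "epow (epow (ball_average r w x) (1 / a)) a \<le> 1"
      by (rule epow_le_1) (use a_pos in simp)
    then have "ball_average r w x \<le> 1" using a_pos by (simp add: epow_epow)
    then have "epow (ball_average r w x) (q x) \<le> epow (ball_average r w x) (1 / a)"
      by (intro epow_exponent_mono') (use q_ge in auto)
    ultimately have "epow (ball_average r w x) (q x) \<le> 1 * J" by simp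
    also have "\<dots> \<le> ennreal (exp (3 * c / b)) * J" by (intro mult_right_mono C1) auto
    finally show ?thesis by (simp add: J_def)
  next
    case False
    define \<delta> where "\<delta> = c / ln (exp 1 + 1 / r)"
    \<comment> \<open>On the ball \<open>1 / q y \<le> 1 / q x + \<delta>\<close>, so the first
      entry is a lower bound of \<open>q\<close> there. The maximum with \<open>1 / a\<close> keeps
      \<open>s > 1\<close>, as Jensen's inequality demands.\<close>
    define s where "s = max (1 / (1 / q x + \<delta>)) (1 / a)"
    have ln: "1 \<le> ln (exp 1 + 1 / r)" using r by (intro ln_exp1_plus_ge_1) auto
    have \<delta>: "0 < \<delta>" using ln ab by (simp add: \<delta>_def)
    have s1: "1 < s" using inverse_gt_2 by (simp add: s_def)
    have sq: "s \<le> q y" if "norm (x - y) \<le> r" for y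
    proof -
      have "\<bar>1 / q x - 1 / q y\<bar> \<le> \<delta>"
      proof (cases "x = y")
        case True
        then show ?thesis using \<delta> by simp
      next
        case False
        then have "0 < norm (x - y)" by simp
        then have "1 / r \<le> 1 / norm (x - y)" using that r by (intro divide_left_mono) auto
        then have "ln (exp 1 + 1 / r) \<le> ln (exp 1 + 1 / norm (x - y))"
          using r by (intro ln_mono) (auto intro: add_pos_pos)
        then have "c / ln (exp 1 + 1 / norm (x - y)) \<le> \<delta>"
          unfolding \<delta>_def using ln ab by (intro divide_left_mono) auto
        then show ?thesis using q_local[of x y] by linarith
      qed
      then have "1 / q y \<le> 1 / q x + \<delta>" by linarith
      then have "1 / (1 / q x + \<delta>) \<le> 1 / (1 / q y)"
        using q_pos[of x] q_pos[of y] \<delta>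
        by (intro divide_left_mono) (auto intro!: mult_pos_pos divide_pos_pos add_pos_pos)
      then show ?thesis using q_ge[of y] by (simp add: s_def)
    qed
    have As: "epow (ball_average r w x) s \<le> J" using base[OF s1 sq] .
    \<comment> \<open>The excess of \<open>q x\<close> over \<open>s\<close>, relative to
      \<open>s\<close>. It satisfies \<open>e \<le> \<delta> / b\<close>, and \<delta> times the
      logarithm in its denominator is \<open>c\<close>; hence \<open>(r powr -3) powr e\<close>
      stays below \<open>exp (3 * c / b)\<close> for all \<open>r < 1\<close>.\<close>
    define e where "e = q x / s - 1"
    have e0: "0 \<le> e" using sq[of x] s1 r by (simp add: e_def)
    have e_le: "e \<le> \<delta> / b"
    proof -
      have "0 < 1 / q x + \<delta>" using q_pos[of x] \<delta> by (simp add: add_pos_pos)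
      then have "q x / s \<le> q x / (1 / (1 / q x + \<delta>))"
        using q_pos[of x] s1 by (intro divide_left_mono) (auto simp: s_def)
      also have "\<dots> = 1 + q x * \<delta>" using q_pos[of x] by (simp add: distrib_left)
      also have "\<dots> \<le> 1 + (1 / b) * \<delta>" using q_le[of x] \<delta> by (intro add_left_mono mult_right_mono) auto
      finally show ?thesis by (simp add: e_def)
    qed
    have "epow (ball_average r w x) (q x) = epow (epow (ball_average r w x) s) (1 + e)"
      using s1 by (simp add: epow_epow e_def)
    also have "\<dots> \<le> epow J (1 + e)" by (intro epow_mono As) (use e0 in auto)
    also have "\<dots> = epow J e * J" by (simp add: epow_add mult.commute)
    also have "epow J e \<le> ennreal (exp (3 * c / b))"
    proof -
      have "epow J e \<le> epow (ennreal (r powr -3)) e" by (intro epow_mono Jr e0)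
      also have "\<dots> = ennreal (exp (3 * e * ln (1 / r)))"
        using r by (simp add: powr_powr powr_def ln_div)
      also have "\<dots> \<le> ennreal (exp (3 * c / b))"
      proof (intro ennreal_leI iffD2[OF exp_le_cancel_iff])
        have l: "ln (1 / r) \<le> ln (exp 1 + 1 / r)" using r by (intro ln_mono) (auto intro: add_pos_pos)
        have l0: "0 \<le> ln (1 / r)" using r False by (simp add: ln_div)
        have "e * ln (1 / r) \<le> (\<delta> / b) * ln (exp 1 + 1 / r)"
          using e_le e0 l l0 \<delta> ab by (intro mult_mono) auto
        also have "\<dots> = c / b" using ln by (simp add: \<delta>_def)
        finally show "3 * e * ln (1 / r) \<le> 3 * c / b" by simp
      qed
      finally show ?thesis .
    qed
    then have "epow J e * J \<le> ennreal (exp (3 * c / b)) * J" by (rule mult_right_mono) auto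
    finally show ?thesis by (simp add: J_def)
  qed
qed

text \<open>The values above 1 are covered by the pointwise estimate and the invariance of the
  integral under averaging. The remaining values lie in \<open>L^(1/b)\<close>, where Jensen's
  inequality with a constant exponent suffices, and the embedding returns them to
  \<open>L^q(.)\<close>. No bound depends on the radius.\<close>

lemma (in log_Hoelder_exponent) Lux_le_ball_average:
  "\<exists>C\<ge>1. \<forall>r w. 0 < r \<longrightarrow> Lux_le q w 1 \<longrightarrow> Lux_le q (ball_average r w) C"
proof -
  obtain E where E: "1 \<le> E" "\<And>w d. Lux_le (\<lambda>_. 1 / b) w d \<Longrightarrow> Lux_le q w (E * d)"
    using Lux_le_embedding by blast
  define C where "C = exp (3 * c / b) + E"
  have "Lux_le q (ball_average r w) C" if r: "0 < r" and w: "Lux_le q w 1" for r w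
  proof -
    have [measurable]: "w \<in> borel_measurable borel" using w by (rule Lux_leD)
    define w1 where "w1 x = (if ennreal 1 < w x then w x else 0)" for x
    define w2 where "w2 x = (if ennreal 1 < w x then 0 else w x)" for x
    have [measurable]: "w1 \<in> borel_measurable borel" "w2 \<in> borel_measurable borel"
      by (auto simp: w1_def[abs_def] w2_def[abs_def])
    have "(\<integral>\<^sup>+x. epow (w1 x) (q x) \<partial>lborel) \<le> (\<integral>\<^sup>+x. epow (w x) (q x) \<partial>lborel)"
      by (intro nn_integral_mono epow_mono) (auto simp: w1_def q_nonneg)
    also have "\<dots> \<le> 1" using w by (simp add: Lux_le_1_iff)
    finally have m1: "(\<integral>\<^sup>+x. epow (w1 x) (q x) \<partial>lborel) \<le> 1" .
    have "(\<integral>\<^sup>+x. epow (ball_average r w1 x) (q x) \<partial>lborel)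
       \<le> (\<integral>\<^sup>+x. ennreal (exp (3 * c / b)) * ball_average r (\<lambda>y. epow (w1 y) (q y)) x \<partial>lborel)"
      by (intro nn_integral_mono ball_average_large_pointwise r m1) (auto simp: w1_def)
    also have "\<dots> = ennreal (exp (3 * c / b)) * (\<integral>\<^sup>+y. epow (w1 y) (q y) \<partial>lborel)"
      by (simp add: nn_integral_cmult nn_integral_ball_average r)
    also have "\<dots> \<le> ennreal (exp (3 * c / b)) * 1" by (intro mult_left_mono m1) auto
    finally have "Lux_le q (ball_average r w1) (exp (3 * c / b))"
      by (intro Lux_le_of_modular) (use ab in \<open>auto simp: q_gt_1 less_imp_le\<close>)
    moreover have "Lux_le q (ball_average r w2) (E * 1)"
    proof (rule E)
      have w2: "(\<integral>\<^sup>+x. epow (w2 x) (1 / b) \<partial>lborel) \<le> 1"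
        using Lux_le_split(2)[OF w q_ge q_le] a_pos by (simp add: Lux_le_1_iff w2_def)
      have "(\<integral>\<^sup>+x. epow (ball_average r w2 x) (1 / b) \<partial>lborel)
         \<le> (\<integral>\<^sup>+x. ball_average r (\<lambda>y. epow (w2 y) (1 / b)) x \<partial>lborel)"
        by (intro nn_integral_mono ball_average_Jensen) (use r inverse_gt_2 in auto)
      also have "\<dots> \<le> 1" using w2 r by (simp add: nn_integral_ball_average)
      finally show "Lux_le (\<lambda>_. 1 / b) (ball_average r w2) 1" by (simp add: Lux_le_1_iff)
    qed
    ultimately have "Lux_le q (\<lambda>x. ball_average r w1 x + ball_average r w2 x) (exp (3 * c / b) + E * 1)"
      by (intro Lux_le_add) (auto simp: q_gt_1)
    moreover have "w1 y + w2 y = w y" for y by (auto simp: w1_def w2_def)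
    then have "ball_average r w = ball_average r (\<lambda>y. w1 y + w2 y)" by simp
    moreover have "ball_average r (\<lambda>y. w1 y + w2 y) = (\<lambda>x. ball_average r w1 x + ball_average r w2 x)"
      by (intro ext ball_average_add) measurable
    ultimately show ?thesis by (simp add: C_def)
  qed
  moreover have "1 \<le> C" using E by (simp add: C_def add_increasing)
  ultimately show ?thesis by blast
qed


subsection \<open>Gaussian convolutions\<close>

definition gauss :: "real \<Rightarrow> real^3 \<Rightarrow> real" where
  "gauss s x = exp (- (norm x)\<^sup>2 / (4 * s)) / (4 * pi * s) powr (3 / 2)"

lemma gauss_nonneg [simp]: "0 \<le> gauss s x"
  by (simp add: gauss_def)

lemma gauss_measurable [measurable (raw)]:
  assumes [measurable]: "s \<in> borel_measurable M" "z \<in> borel_measurable M"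
  shows "(\<lambda>x. gauss (s x) (z x)) \<in> borel_measurable M"
  unfolding gauss_def by measurable

lemma norm_square_Basis: "(norm x)\<^sup>2 = (\<Sum>b\<in>Basis. (x \<bullet> b)\<^sup>2)"
  for x :: "'a::euclidean_space"
  unfolding power2_norm_eq_inner by (subst euclidean_inner) (simp add: power2_eq_square)

lemma gauss_eq_prod_normal_density:
  assumes "0 < s"
  shows "gauss s x = (\<Prod>b\<in>Basis. normal_density 0 (sqrt (2 * s)) (x \<bullet> b))"
proof -
  have "normal_density 0 (sqrt (2 * s)) y = 1 / sqrt (4 * pi * s) * exp (- y\<^sup>2 / (4 * s))" for y
    using assms by (simp add: normal_density_def mult.commute mult.left_commute)
  then have "(\<Prod>b\<in>Basis. normal_density 0 (sqrt (2 * s)) (x \<bullet> b))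
    = (\<Prod>b\<in>(Basis::(real^3) set). 1 / sqrt (4 * pi * s)) * (\<Prod>b\<in>Basis. exp (- (x \<bullet> b)\<^sup>2 / (4 * s)))"
    by (simp only: prod.distrib)
  also have "(\<Prod>b\<in>Basis. exp (- (x \<bullet> b)\<^sup>2 / (4 * s))) = exp (- (norm x)\<^sup>2 / (4 * s))"
    by (simp add: exp_sum[symmetric] norm_square_Basis sum_negf sum_divide_distrib)
  also have "(\<Prod>b\<in>(Basis::(real^3) set). 1 / sqrt (4 * pi * s)) = 1 / (4 * pi * s) powr (3 / 2)"
    using assms by (simp add: powr_half_sqrt[symmetric] powr_power power_divide)
  finally show ?thesis by (simp add: gauss_def)
qed

lemma nn_integral_gauss:
  assumes "0 < s"
  shows "(\<integral>\<^sup>+x. ennreal (gauss s x) \<partial>lborel) = 1"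
proof -
  have "(\<integral>\<^sup>+x. ennreal (gauss s x) \<partial>lborel)
    = (\<integral>\<^sup>+(x::real^3). (\<Prod>b\<in>Basis. ennreal (normal_density 0 (sqrt (2 * s)) (x \<bullet> b))) \<partial>lborel)"
    using assms by (simp add: gauss_eq_prod_normal_density prod_ennreal)
  also have "\<dots> = (\<Prod>b\<in>(Basis::(real^3) set). (\<integral>\<^sup>+x. ennreal (normal_density 0 (sqrt (2 * s)) x) \<partial>lborel))"
    by (rule nn_integral_lborel_prod) auto
  also have "(\<integral>\<^sup>+x. ennreal (normal_density 0 (sqrt (2 * s)) x) \<partial>lborel) = 1"
    using assms by (subst nn_integral_eq_integral) auto
  finally show ?thesis by simp
qed

lemma nn_integral_shift:
  fixes y :: "'a::euclidean_space"
  assumes [measurable]: "f \<in> borel_measurable borel"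
  shows "(\<integral>\<^sup>+x. f (x - y) \<partial>lborel) = (\<integral>\<^sup>+x. f x \<partial>lborel)"
    and "(\<integral>\<^sup>+x. f (y - x) \<partial>lborel) = (\<integral>\<^sup>+x. f x \<partial>lborel)"
proof -
  have "(\<integral>\<^sup>+x. f x \<partial>lborel) = (\<integral>\<^sup>+x. f x \<partial>distr lborel borel ((+) (- y)))"
    by (simp add: lborel_distr_plus)
  also have "\<dots> = (\<integral>\<^sup>+x. f (x - y) \<partial>lborel)"
    by (subst nn_integral_distr) auto
  finally show "(\<integral>\<^sup>+x. f (x - y) \<partial>lborel) = (\<integral>\<^sup>+x. f x \<partial>lborel)" by simp
  have "(lborel :: 'a measure) = density (distr lborel borel (\<lambda>x. y + (-1) *\<^sub>R x)) (\<lambda>_. ennreal 1)"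
    using lborel_affine[of "-1" y] by simp
  then have "(\<integral>\<^sup>+x. f x \<partial>lborel)
      = (\<integral>\<^sup>+x. f x \<partial>density (distr lborel borel (\<lambda>x. y + (-1) *\<^sub>R x)) (\<lambda>_. ennreal 1))"
    by metis
  also have "\<dots> = (\<integral>\<^sup>+x. f (y - x) \<partial>lborel)"
    by (simp add: nn_integral_density nn_integral_distr density_1)
  finally show "(\<integral>\<^sup>+x. f (y - x) \<partial>lborel) = (\<integral>\<^sup>+x. f x \<partial>lborel)" by simp
qed

text \<open>The law of the radius when a Gaussian is written as a mixture of uniform distributions on
  balls.\<close>

definition gauss_radius :: "real \<Rightarrow> real \<Rightarrow> ennreal" where
  "gauss_radius s \<rho> = ennreal (4 / 3 * pi * \<rho> ^ 3) *
     ennreal (\<rho> / (2 * s) * exp (- \<rho>\<^sup>2 / (4 * s)) / (4 * pi * s) powr (3 / 2)) * indicator {0<..} \<rho>"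

lemma gauss_radius_measurable [measurable]: "gauss_radius s \<in> borel_measurable borel"
  unfolding gauss_radius_def by measurable

text \<open>The layer-cake formula: a radially decreasing profile \<open>g\<close> vanishing at
  infinity is the integral of \<open>- g'(\<rho>)\<close> over \<open>\<rho> \<ge> norm x\<close>.
  The factor \<open>4 / 3 * pi * \<rho> ^ 3\<close> in \<open>gauss_radius\<close> compensates the
  normalization of \<open>ball_kernel\<close>.\<close>

lemma gauss_mixture:
  assumes s: "0 < s"
  shows "(\<integral>\<^sup>+\<rho>. gauss_radius s \<rho> * ball_kernel \<rho> x \<partial>lborel) = ennreal (gauss s x)"
proof -
  let ?K = "(4 * pi * s) powr (3 / 2)"
  let ?f = "\<lambda>\<rho>. \<rho> / (2 * s) * exp (- \<rho>\<^sup>2 / (4 * s)) / ?K"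
  let ?F = "\<lambda>\<rho>. - exp (- \<rho>\<^sup>2 / (4 * s)) / ?K"
  have K: "0 < ?K" using s by simp
  have "gauss_radius s \<rho> * ball_kernel \<rho> x = ennreal (?f \<rho>) * indicator {norm x..} \<rho>" for \<rho>
  proof (cases "0 < \<rho>")
    case True
    have "ennreal (4 / 3 * pi * \<rho> ^ 3) * ennreal (1 / (4 / 3 * pi * \<rho> ^ 3)) = 1"
      using True by (subst ennreal_mult[symmetric]) auto
    moreover have "A * F * B = F" if "A * B = 1" for A B F :: ennreal
      using that by (metis mult.assoc mult.commute mult.right_neutral)
    ultimately have "ennreal (4 / 3 * pi * \<rho> ^ 3) * ennreal (?f \<rho>) * ennreal (1 / (4 / 3 * pi * \<rho> ^ 3)) = ennreal (?f \<rho>)"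
      by blast
    then show ?thesis
      using True unfolding gauss_radius_def ball_kernel_def by (cases "norm x \<le> \<rho>") simp_all
  next
    case False
    then have "\<rho> = 0 \<or> \<not> norm x \<le> \<rho>" using norm_ge_zero[of x] by linarith
    then show ?thesis using False by (auto simp: gauss_radius_def)
  qed
  then have "(\<integral>\<^sup>+\<rho>. gauss_radius s \<rho> * ball_kernel \<rho> x \<partial>lborel)
    = (\<integral>\<^sup>+\<rho>. ennreal (?f \<rho>) * indicator {norm x..} \<rho> \<partial>lborel)" by simp
  also have "\<dots> = ennreal (0 - ?F (norm x))"
  proof (rule nn_integral_FTC_atLeast)
    show "(?F has_real_derivative ?f \<rho>) (at \<rho>)" for \<rho>
      using s K by (auto intro!: derivative_eq_intros simp: field_simps)
    show "0 \<le> ?f \<rho>" if "norm x \<le> \<rho>" for \<rho>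
      using that s norm_ge_zero[of x] by (auto intro!: divide_nonneg_nonneg mult_nonneg_nonneg simp del: norm_ge_zero)
    have "filterlim (\<lambda>\<rho>::real. 1 / (4 * s) * \<rho>\<^sup>2) at_top at_top"
      using s by (intro filterlim_tendsto_pos_mult_at_top[OF tendsto_const] filterlim_pow_at_top filterlim_ident) auto
    then have "filterlim (\<lambda>\<rho>::real. - (\<rho>\<^sup>2) / (4 * s)) at_bot at_top"
      by (simp add: filterlim_uminus_at_top)
    then have "((\<lambda>\<rho>::real. exp (- (\<rho>\<^sup>2) / (4 * s))) \<longlongrightarrow> 0) at_top"
      by (rule filterlim_compose[OF exp_at_bot])
    then have "((\<lambda>\<rho>::real. - exp (- (\<rho>\<^sup>2) / (4 * s)) / ?K) \<longlongrightarrow> - 0 / ?K) at_top"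
      by (intro tendsto_intros) (use K in auto)
    then show "(?F \<longlongrightarrow> 0) at_top" by simp
  qed measurable
  also have "\<dots> = ennreal (gauss s x)" by (simp add: gauss_def)
  finally show ?thesis .
qed

text \<open>Integrating the mixture identity over \<open>x\<close> replaces the computation of a
  radial moment, since the Gaussian and the ball kernels all have mass 1.\<close>

lemma nn_integral_gauss_radius:
  assumes s: "0 < s"
  shows "(\<integral>\<^sup>+\<rho>. gauss_radius s \<rho> \<partial>lborel) = 1"
proof -
  have "1 = (\<integral>\<^sup>+x. (\<integral>\<^sup>+\<rho>. gauss_radius s \<rho> * ball_kernel \<rho> x \<partial>lborel) \<partial>lborel)"
    using nn_integral_gauss[OF s] by (simp add: gauss_mixture s)
  also have "\<dots> = (\<integral>\<^sup>+\<rho>. (\<integral>\<^sup>+x. gauss_radius s \<rho> * ball_kernel \<rho> x \<partial>lborel) \<partial>lborel)"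
    by (rule lborel_pair.Fubini') measurable
  also have "\<dots> = (\<integral>\<^sup>+\<rho>. gauss_radius s \<rho> \<partial>lborel)"
  proof (rule nn_integral_cong)
    fix \<rho>
    show "(\<integral>\<^sup>+x. gauss_radius s \<rho> * ball_kernel \<rho> x \<partial>lborel) = gauss_radius s \<rho>"
    proof (cases "0 < \<rho>")
      case True
      then show ?thesis using nn_integral_ball_kernel(2)[of \<rho> 0] by (simp add: nn_integral_cmult)
    qed (simp add: gauss_radius_def)
  qed
  finally show ?thesis by simp
qed

definition gauss_conv :: "real \<Rightarrow> (real^3 \<Rightarrow> ennreal) \<Rightarrow> real^3 \<Rightarrow> ennreal" where
  "gauss_conv s w x = (\<integral>\<^sup>+y. w y * ennreal (gauss s (x - y)) \<partial>lborel)"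

lemma gauss_conv_measurable [measurable (raw)]:
  assumes [measurable]: "s \<in> borel_measurable M" "w \<in> borel_measurable borel" "f \<in> borel_measurable M"
  shows "(\<lambda>x. gauss_conv (s x) w (f x)) \<in> borel_measurable M"
  unfolding gauss_conv_def by measurable

lemma gauss_conv_eq_ball_averages:
  assumes [measurable]: "w \<in> borel_measurable borel" and "0 < s"
  shows "gauss_conv s w x = (\<integral>\<^sup>+\<rho>. ball_average \<rho> w x \<partial>density lborel (gauss_radius s))"
proof -
  have "gauss_conv s w x = (\<integral>\<^sup>+y. (\<integral>\<^sup>+\<rho>. gauss_radius s \<rho> * (w y * ball_kernel \<rho> (x - y)) \<partial>lborel) \<partial>lborel)"
    unfolding gauss_conv_def gauss_mixture[OF assms(2), symmetric]
    by (intro nn_integral_cong) (simp add: nn_integral_cmult[symmetric] mult.left_commute)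
  also have "\<dots> = (\<integral>\<^sup>+\<rho>. (\<integral>\<^sup>+y. gauss_radius s \<rho> * (w y * ball_kernel \<rho> (x - y)) \<partial>lborel) \<partial>lborel)"
    by (rule lborel_pair.Fubini') measurable
  also have "\<dots> = (\<integral>\<^sup>+\<rho>. gauss_radius s \<rho> * ball_average \<rho> w x \<partial>lborel)"
    by (simp add: nn_integral_cmult ball_average_def)
  finally show ?thesis by (simp add: nn_integral_density)
qed

text \<open>Ball averages are bounded uniformly in the radius, and Minkowski's inequality for the
  probability law of the radius preserves the constant; so it is independent of
  \<open>s\<close>.\<close>

lemma (in log_Hoelder_exponent) Lux_le_gauss_conv:
  "\<exists>C\<ge>1. \<forall>s w d. 0 < s \<longrightarrow> Lux_le q w d \<longrightarrow> Lux_le q (gauss_conv s w) (C * d)"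
proof -
  obtain C where C: "1 \<le> C" "\<And>r w. 0 < r \<Longrightarrow> Lux_le q w 1 \<Longrightarrow> Lux_le q (ball_average r w) C"
    using Lux_le_ball_average by blast
  have "Lux_le q (gauss_conv s w) C" if s: "0 < s" and w: "Lux_le q w 1" for s w
  proof -
    have [measurable]: "w \<in> borel_measurable borel" using w by (rule Lux_leD)
    let ?\<mu> = "density lborel (gauss_radius s)"
    have 1: "emeasure ?\<mu> (space ?\<mu>) = 1" using s by (simp add: emeasure_density nn_integral_gauss_radius)
    then interpret \<mu>: prob_space ?\<mu> by (rule prob_spaceI)
    have "Lux_le q (\<lambda>x. \<integral>\<^sup>+\<rho>. ball_average \<rho> w x \<partial>?\<mu>) C"
    proof (rule Lux_le_nn_integral[where c = "\<lambda>_. C"])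
      show "sigma_finite_measure ?\<mu>" ..
      show "AE \<rho> in ?\<mu>. Lux_le q (ball_average \<rho> w) C"
        by (subst AE_density) (auto intro!: AE_I2 C(2) w simp: gauss_radius_def split: split_indicator_asm)
      show "(\<lambda>(i, x). ball_average i w x) \<in> borel_measurable (?\<mu> \<Otimes>\<^sub>M lborel)"
        by measurable
      show "(\<integral>\<^sup>+i. ennreal C \<partial>?\<mu>) \<le> ennreal C" using 1 by (simp del: space_density)
    qed (use C q_gt_1 in auto)
    moreover have "gauss_conv s w = (\<lambda>x. \<integral>\<^sup>+\<rho>. ball_average \<rho> w x \<partial>?\<mu>)"
      by (intro ext gauss_conv_eq_ball_averages) (use s in auto)
    ultimately show ?thesis by simp
  qed
  moreover have "gauss_conv s (\<lambda>x. ennreal r * w x) = (\<lambda>x. ennreal r * gauss_conv s w x)"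
    if [measurable]: "w \<in> borel_measurable borel" for s r w
    by (auto simp: gauss_conv_def mult.assoc nn_integral_cmult)
  ultimately have "Lux_le q (gauss_conv s w) (C * d)" if "0 < s" "Lux_le q w d" for s w d
    using that by (intro Lux_le_homogeneous[where A = "gauss_conv s"]) auto
  then show ?thesis using C by blast
qed

subsection \<open>Young's convolution inequality\<close>

text \<open>Hoelder's inequality with exponents written as reciprocals, so that the parameters add.
  All constant-exponent estimates below use this parametrization.\<close>

lemma Lux_le_mult:
  assumes AB: "0 < A" "0 < B"
    and F: "Lux_le (\<lambda>_. 1 / A) F c" and G: "Lux_le (\<lambda>_. 1 / B) G d"
  shows "Lux_le (\<lambda>_. 1 / (A + B)) (\<lambda>x. F x * G x) (c * d)"
proof -
  have cd: "0 < c" "0 < d" and [measurable]: "F \<in> borel_measurable borel" "G \<in> borel_measurable borel"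
    using F G by (auto dest: Lux_leD)
  have eq: "epow (ennreal (1 / (c * d)) * (F x * G x)) (1 / (A + B)) =
      epow (epow (ennreal (1 / c) * F x) (1 / A)) (A / (A + B)) *
      epow (epow (ennreal (1 / d) * G x) (1 / B)) (B / (A + B))" for x
  proof -
    have "ennreal (1 / (c * d)) * (F x * G x) = (ennreal (1 / c) * F x) * (ennreal (1 / d) * G x)"
      using cd by (simp add: ennreal_mult[of "1 / c" "1 / d", simplified] ac_simps)
    then show ?thesis using AB by (simp only: epow_mult epow_epow) simp
  qed
  have "(\<integral>\<^sup>+x. epow (ennreal (1 / (c * d)) * (F x * G x)) (1 / (A + B)) \<partial>lborel)
    \<le> epow (\<integral>\<^sup>+x. epow (ennreal (1 / c) * F x) (1 / A) \<partial>lborel) (A / (A + B)) *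
      epow (\<integral>\<^sup>+x. epow (ennreal (1 / d) * G x) (1 / B) \<partial>lborel) (B / (A + B))"
    unfolding eq by (rule nn_integral_Holder) (use AB in \<open>auto simp: add_divide_distrib[symmetric]\<close>)
  also have "\<dots> \<le> 1 * 1"
    by (intro mult_mono epow_le_1 Lux_leD(3)[OF F] Lux_leD(3)[OF G]) (use AB in auto)
  finally show ?thesis using cd by (auto simp: Lux_le_def)
qed

text \<open>With \<open>r = 1 / (1 + b - M)\<close> and \<open>m = 1 / M\<close> one has
  \<open>k f = (k^r f^m)^b * (k^r)^(1 - M) * (f^m)^(M - b)\<close>, a three-factor Hoelder splitting
  because \<open>b + (1 - M) + (M - b) = 1\<close>. The last two factors integrate to at most 1, and
  the first is integrated over \<open>x\<close> by Tonelli.\<close>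

lemma Young_convolution_1:
  assumes e: "0 < b" "b < M" "M < 1"
    and k: "Lux_le (\<lambda>_. 1 / (1 + b - M)) k 1" and f: "Lux_le (\<lambda>_. 1 / M) f 1"
  shows "Lux_le (\<lambda>_. 1 / b) (\<lambda>x. \<integral>\<^sup>+y. k (x - y) * f y \<partial>lborel) 1"
proof -
  define r where "r = 1 / (1 + b - M)"
  define m where "m = 1 / M"
  have rm: "r * b + r * (1 - M) = 1" "m * b + m * (M - b) = 1"
  proof -
    have "r * (1 + b - M) = 1" "m * M = 1" using e by (auto simp: r_def m_def)
    then show "r * b + r * (1 - M) = 1" "m * b + m * (M - b) = 1" by (simp_all add: algebra_simps)
  qed
  have [measurable]: "k \<in> borel_measurable borel" "f \<in> borel_measurable borel"
    using k f by (auto dest: Lux_leD)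
  have kr: "(\<integral>\<^sup>+y. epow (k y) r \<partial>lborel) \<le> 1" and fm: "(\<integral>\<^sup>+y. epow (f y) m \<partial>lborel) \<le> 1"
    using k f by (auto simp: Lux_le_1_iff r_def m_def)
  have kr': "(\<integral>\<^sup>+y. epow (k (x - y)) r \<partial>lborel) \<le> 1" "(\<integral>\<^sup>+y. epow (k (y - x)) r \<partial>lborel) \<le> 1" for x
    using kr nn_integral_shift[of "\<lambda>y. epow (k y) r" x] by auto
  define J where "J x = (\<integral>\<^sup>+y. epow (k (x - y)) r * epow (f y) m \<partial>lborel)" for x
  have pt: "epow (\<integral>\<^sup>+y. k (x - y) * f y \<partial>lborel) (1 / b) \<le> J x" for x
  proof -
    let ?g = "\<lambda>y. epow (epow (k (x - y)) r) ((1 - M) / (1 - b)) * epow (epow (f y) m) ((M - b) / (1 - b))"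
    have eq: "k (x - y) * f y = epow (epow (k (x - y)) r * epow (f y) m) b * epow (?g y) (1 - b)" for y
    proof -
      have "k (x - y) = epow (k (x - y)) (r * b) * epow (k (x - y)) (r * (1 - M))"
        by (simp add: epow_add[symmetric] rm)
      moreover have "f y = epow (f y) (m * b) * epow (f y) (m * (M - b))"
        by (simp add: epow_add[symmetric] rm)
      moreover have "epow (epow (k (x - y)) r * epow (f y) m) b * epow (?g y) (1 - b)
        = (epow (k (x - y)) (r * b) * epow (k (x - y)) (r * (1 - M))) *
          (epow (f y) (m * b) * epow (f y) (m * (M - b)))"
        using e by (simp only: epow_mult epow_epow) (simp add: ac_simps)
      ultimately show ?thesis by simp
    qed
    have "(\<integral>\<^sup>+y. ?g y \<partial>lborel) \<le> epow (\<integral>\<^sup>+y. epow (k (x - y)) r \<partial>lborel) ((1 - M) / (1 - b)) *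
        epow (\<integral>\<^sup>+y. epow (f y) m \<partial>lborel) ((M - b) / (1 - b))"
      by (rule nn_integral_Holder) (use e in \<open>auto simp: add_divide_distrib[symmetric]\<close>)
    also have "\<dots> \<le> 1 * 1" by (intro mult_mono epow_le_1 kr' fm) (use e in auto)
    finally have g: "(\<integral>\<^sup>+y. ?g y \<partial>lborel) \<le> 1" by simp
    have "(\<integral>\<^sup>+y. k (x - y) * f y \<partial>lborel) \<le> epow (J x) b * epow (\<integral>\<^sup>+y. ?g y \<partial>lborel) (1 - b)"
      unfolding eq J_def by (rule nn_integral_Holder) (use e in auto)
    also have "\<dots> \<le> epow (J x) b * 1" by (intro mult_left_mono epow_le_1 g) (use e in auto)
    finally have "(\<integral>\<^sup>+y. k (x - y) * f y \<partial>lborel) \<le> epow (J x) b" by simp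
    then have "epow (\<integral>\<^sup>+y. k (x - y) * f y \<partial>lborel) (1 / b) \<le> epow (epow (J x) b) (1 / b)"
      using e by (intro epow_mono) auto
    then show ?thesis using e by (simp add: epow_inverse)
  qed
  have "(\<integral>\<^sup>+x. epow (\<integral>\<^sup>+y. k (x - y) * f y \<partial>lborel) (1 / b) \<partial>lborel) \<le> (\<integral>\<^sup>+x. J x \<partial>lborel)"
    by (intro nn_integral_mono pt)
  also have "\<dots> = (\<integral>\<^sup>+y. (\<integral>\<^sup>+x. epow (k (x - y)) r * epow (f y) m \<partial>lborel) \<partial>lborel)"
    unfolding J_def by (rule lborel_pair.Fubini') measurable
  also have "\<dots> = (\<integral>\<^sup>+y. (\<integral>\<^sup>+x. epow (k (x - y)) r \<partial>lborel) * epow (f y) m \<partial>lborel)"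
    by (simp add: nn_integral_multc)
  also have "\<dots> \<le> (\<integral>\<^sup>+y. 1 * epow (f y) m \<partial>lborel)"
    by (intro nn_integral_mono mult_right_mono kr') auto
  also have "\<dots> \<le> 1" using fm by simp
  finally show ?thesis by (simp add: Lux_le_1_iff)
qed

lemma Young_convolution:
  assumes e: "0 < b" "b < M" "M < 1"
    and k: "Lux_le (\<lambda>_. 1 / (1 + b - M)) k \<kappa>" and f: "Lux_le (\<lambda>_. 1 / M) f d"
  shows "Lux_le (\<lambda>_. 1 / b) (\<lambda>x. \<integral>\<^sup>+y. k (x - y) * f y \<partial>lborel) (\<kappa> * d)"
proof -
  have 1: "Lux_le (\<lambda>_. 1 / b) (\<lambda>x. \<integral>\<^sup>+y. k (x - y) * f y \<partial>lborel) \<kappa>"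
    if f: "Lux_le (\<lambda>_. 1 / M) f 1" for f
  proof -
    have [measurable]: "f \<in> borel_measurable borel" using f by (rule Lux_leD)
    have "Lux_le (\<lambda>_. 1 / b) ((\<lambda>k x. \<integral>\<^sup>+y. k (x - y) * f y \<partial>lborel) k) (1 * \<kappa>)"
      by (rule Lux_le_homogeneous[OF Young_convolution_1[OF e _ f] _ k])
        (auto simp: nn_integral_cmult mult.assoc)
    then show ?thesis by simp
  qed
  have [measurable]: "k \<in> borel_measurable borel" using k by (rule Lux_leD)
  show ?thesis
    by (rule Lux_le_homogeneous[where A = "\<lambda>f x. \<integral>\<^sup>+y. k (x - y) * f y \<partial>lborel", OF 1 _ f])
      (auto simp: nn_integral_cmult[symmetric] mult.left_commute)
qed

text \<open>Interpolation between \<open>L^1\<close> and \<open>L^\<infinity>\<close>, from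
  \<open>k^r \<le> S^(r - 1) k\<close> at each point.\<close>

lemma Lux_le_interpolation:
  assumes [measurable]: "k \<in> borel_measurable borel" and r: "1 < r"
    and S: "\<And>x. k x \<le> ennreal S" "0 < S"
    and L: "(\<integral>\<^sup>+x. k x \<partial>lborel) \<le> ennreal L" "0 < L"
  shows "Lux_le (\<lambda>_. r) k (S powr (1 - 1 / r) * L powr (1 / r))"
proof -
  define \<kappa> where "\<kappa> = S powr (1 - 1 / r) * L powr (1 / r)"
  have \<kappa>: "0 < \<kappa>" using S L by (simp add: \<kappa>_def)
  have \<kappa>r: "(1 / \<kappa>) powr r * S powr (r - 1) * L = 1"
  proof -
    have "\<kappa> powr r = S powr (r - 1) * L"
      using S L r by (simp add: \<kappa>_def powr_mult powr_powr algebra_simps)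
    then show ?thesis using \<kappa> S L by (simp add: powr_divide)
  qed
  have "(\<integral>\<^sup>+x. epow (ennreal (1 / \<kappa>) * k x) r \<partial>lborel)
    \<le> (\<integral>\<^sup>+x. ennreal ((1 / \<kappa>) powr r * S powr (r - 1)) * k x \<partial>lborel)"
  proof (rule nn_integral_mono)
    fix x
    have "epow (k x) r = epow (k x) (r - 1) * k x" using epow_add[of "k x" "r - 1" 1] by simp
    also have "\<dots> \<le> epow (ennreal S) (r - 1) * k x"
      by (intro mult_right_mono epow_mono S) (use r in auto)
    finally have "epow (ennreal (1 / \<kappa>)) r * epow (k x) r
        \<le> epow (ennreal (1 / \<kappa>)) r * (epow (ennreal S) (r - 1) * k x)"
      by (rule mult_left_mono) auto
    then show "epow (ennreal (1 / \<kappa>) * k x) r \<le> ennreal ((1 / \<kappa>) powr r * S powr (r - 1)) * k x"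
      using \<kappa> S by (simp add: epow_mult ennreal_mult mult.assoc)
  qed
  also have "\<dots> = ennreal ((1 / \<kappa>) powr r * S powr (r - 1)) * (\<integral>\<^sup>+x. k x \<partial>lborel)"
    by (rule nn_integral_cmult) measurable
  also have "\<dots> \<le> ennreal ((1 / \<kappa>) powr r * S powr (r - 1)) * ennreal L"
    by (intro mult_left_mono L) auto
  also have "\<dots> = 1" using \<kappa>r L by (simp add: ennreal_mult[symmetric])
  finally show ?thesis using \<kappa> by (simp add: Lux_le_def \<kappa>_def)
qed

subsection \<open>Stable subordinators\<close>

lemma nn_integral_powr_exp:
  assumes "0 < s" "0 < l"
  shows "(\<integral>\<^sup>+t. ennreal (indicator {0..} t * t powr (s - 1) * exp (- l * t)) \<partial>lborel)
    = ennreal (Gamma s * l powr (- s))"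
proof -
  have "ennreal (Gamma s) = (\<integral>\<^sup>+t. ennreal (indicator {0..} t * t powr (s - 1) / exp t) \<partial>lborel)"
    using assms by (simp add: Gamma_conv_nn_integral_real)
  also have "\<dots> = ennreal l * (\<integral>\<^sup>+t. ennreal (indicator {0..} (l * t) * (l * t) powr (s - 1) / exp (l * t)) \<partial>lborel)"
    using assms by (subst nn_integral_real_affine[where c = l and t = 0]) auto
  also have "(\<lambda>t. ennreal (indicator {0..} (l * t) * (l * t) powr (s - 1) / exp (l * t)))
      = (\<lambda>t. ennreal (l powr (s - 1)) * ennreal (indicator {0..} t * t powr (s - 1) * exp (- l * t)))"
    using assms
    by (auto simp: fun_eq_iff powr_mult exp_minus field_simps ennreal_mult'[symmetric] zero_le_mult_iff
        split: split_indicator)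
  also have "(\<integral>\<^sup>+t. ennreal (l powr (s - 1)) * ennreal (indicator {0..} t * t powr (s - 1) * exp (- l * t)) \<partial>lborel)
      = ennreal (l powr (s - 1)) * (\<integral>\<^sup>+t. ennreal (indicator {0..} t * t powr (s - 1) * exp (- l * t)) \<partial>lborel)"
    by (rule nn_integral_cmult) measurable
  finally have *: "ennreal (Gamma s) = ennreal l * (ennreal (l powr (s - 1)) *
      (\<integral>\<^sup>+t. ennreal (indicator {0..} t * t powr (s - 1) * exp (- l * t)) \<partial>lborel))" (is "_ = _ * (_ * ?I)") .
  have "ennreal (l powr (- s)) * ennreal (Gamma s) = ennreal (l powr (- s) * l * l powr (s - 1)) * ?I"
    using assms by (subst *) (simp add: ennreal_mult mult.assoc)
  also have "l powr (- s) * l * l powr (s - 1) = 1"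
  proof -
    have "l powr (- s) * l powr 1 * l powr (s - 1) = l powr 0"
      unfolding powr_add[symmetric] by simp
    then show ?thesis using assms by simp
  qed
  finally show ?thesis using assms by (simp add: ennreal_mult mult.commute)
qed

lemma nn_integral_powr_tail:
  assumes "0 < \<alpha>" "0 < e"
  shows "(\<integral>\<^sup>+u. ennreal (\<alpha> * u powr (- 1 - \<alpha>)) * indicator {e..} u \<partial>lborel) = ennreal (e powr - \<alpha>)"
proof -
  have "(\<integral>\<^sup>+u. ennreal (\<alpha> * u powr (- 1 - \<alpha>)) * indicator {e..} u \<partial>lborel) = ennreal (0 - (- (e powr - \<alpha>)))"
  proof (rule nn_integral_FTC_atLeast)
    show "((\<lambda>u. - (u powr - \<alpha>)) has_real_derivative \<alpha> * u powr (- 1 - \<alpha>)) (at u)" if "e \<le> u" for u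
      using that assms by (auto intro!: derivative_eq_intros simp: minus_diff_commute[of \<alpha> 1])
    show "((\<lambda>u. - (u powr - \<alpha>)) \<longlongrightarrow> 0) at_top"
      using tendsto_minus[OF tendsto_neg_powr[of "- \<alpha>" "\<lambda>u::real. u" at_top]] assms
      by (simp add: filterlim_ident)
  qed (use assms in auto)
  then show ?thesis by simp
qed

section \<open>Laplace transforms and the Levy measure of a stable law\<close>

definition Laplace :: "real measure \<Rightarrow> real \<Rightarrow> ennreal" where
  "Laplace M l = (\<integral>\<^sup>+s. ennreal (exp (- l * s)) \<partial>M)"

text \<open>Integrated over \<open>u\<close> this is the Laplace exponent of the subordinator with
  Levy measure \<open>\<alpha> * u powr (- 1 - \<alpha>) du\<close>. By scaling it is a multiple of
  \<open>l powr \<alpha>\<close>.\<close>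

definition Levy_integrand :: "real \<Rightarrow> real \<Rightarrow> real \<Rightarrow> real" where
  "Levy_integrand \<alpha> l u = indicator {0<..} u * (1 - exp (- l * u)) * (\<alpha> * u powr (- 1 - \<alpha>))"

lemma Levy_integrand_measurable [measurable]: "Levy_integrand \<alpha> l \<in> borel_measurable borel"
  unfolding Levy_integrand_def by measurable

lemma Levy_integral_scale:
  assumes "0 < \<alpha>" "0 < l"
  shows "(\<integral>\<^sup>+u. ennreal (Levy_integrand \<alpha> l u) \<partial>lborel)
     = ennreal (l powr \<alpha>) * (\<integral>\<^sup>+u. ennreal (Levy_integrand \<alpha> 1 u) \<partial>lborel)" (is "?L = _ * ?I")
proof -
  have "?I = ennreal l * (\<integral>\<^sup>+u. ennreal (Levy_integrand \<alpha> 1 (l * u)) \<partial>lborel)"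
    using assms by (subst nn_integral_real_affine[where c = l and t = 0]) auto
  also have "(\<lambda>u. ennreal (Levy_integrand \<alpha> 1 (l * u))) = (\<lambda>u. ennreal (l powr (- 1 - \<alpha>)) * ennreal (Levy_integrand \<alpha> l u))"
    using assms
    by (auto simp: fun_eq_iff Levy_integrand_def powr_mult ennreal_mult'[symmetric] zero_less_mult_iff mult_ac
        split: split_indicator)
  also have "(\<integral>\<^sup>+u. ennreal (l powr (- 1 - \<alpha>)) * ennreal (Levy_integrand \<alpha> l u) \<partial>lborel) = ennreal (l powr (- 1 - \<alpha>)) * ?L"
    by (rule nn_integral_cmult) measurable
  finally have "ennreal (l powr \<alpha>) * ?I = ennreal (l powr \<alpha> * l * l powr (- 1 - \<alpha>)) * ?L"
    using assms by (simp add: ennreal_mult mult.assoc)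
  also have "l powr \<alpha> * l * l powr (- 1 - \<alpha>) = 1"
  proof -
    have "l powr \<alpha> * l powr 1 * l powr (- 1 - \<alpha>) = l powr 0"
      unfolding powr_add[symmetric] by simp
    then show ?thesis using assms by simp
  qed
  finally show ?thesis by simp
qed

text \<open>Below 1 the bound \<open>1 - exp (- u) \<le> u\<close>, together with an inserted factor
  \<open>exp 1 * exp (- u) \<ge> 1\<close>, leads to a Gamma integral of parameter
  \<open>1 - \<alpha>\<close>. Above 1 only the power tail remains.\<close>

lemma Levy_integral_finite:
  assumes "0 < \<alpha>" "\<alpha> < 1"
  shows "(\<integral>\<^sup>+u. ennreal (Levy_integrand \<alpha> 1 u) \<partial>lborel) < \<infinity>"
proof -
  have "ennreal (Levy_integrand \<alpha> 1 u)
     \<le> ennreal (\<alpha> * exp 1) * ennreal (indicator {0..} u * u powr ((1 - \<alpha>) - 1) * exp (- 1 * u)) +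
       ennreal (\<alpha> * u powr (- 1 - \<alpha>)) * indicator {1..} u" for u
  proof -
    consider "u \<le> 0" | "0 < u" "u < 1" | "1 \<le> u" by linarith
    then show ?thesis
    proof cases
      case 2
      have "(1 - exp (- u)) \<le> u" using exp_ge_add_one_self[of "- u"] by linarith
      then have "(1 - exp (- u)) * (\<alpha> * u powr (- 1 - \<alpha>)) \<le> u * (\<alpha> * u powr (- 1 - \<alpha>))"
        by (rule mult_right_mono) (use assms in auto)
      also have "\<dots> = \<alpha> * u powr (- \<alpha>) * 1" using powr_add[of u 1 "- 1 - \<alpha>"] 2 by simp
      also have "\<alpha> * u powr (- \<alpha>) * 1 \<le> \<alpha> * u powr (- \<alpha>) * (exp 1 * exp (- u))"
        using 2 assms by (intro mult_left_mono) (auto simp: exp_add[symmetric])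
      finally have "Levy_integrand \<alpha> 1 u \<le> \<alpha> * exp 1 * (indicator {0..} u * u powr ((1 - \<alpha>) - 1) * exp (- 1 * u))"
        using 2 by (simp add: Levy_integrand_def mult_ac)
      then show ?thesis using 2 assms by (simp add: ennreal_mult'[symmetric] ennreal_leI)
    next
      case 3
      then have "(1 - exp (- u)) * (\<alpha> * u powr (- 1 - \<alpha>)) \<le> 1 * (\<alpha> * u powr (- 1 - \<alpha>))"
        by (intro mult_right_mono) (use assms in auto)
      then have "ennreal (Levy_integrand \<alpha> 1 u) \<le> ennreal (\<alpha> * u powr (- 1 - \<alpha>)) * indicator {1..} u"
        using 3 by (auto simp: Levy_integrand_def ennreal_leI)
      then show ?thesis by (rule order.trans) simp
    qed (simp add: Levy_integrand_def)
  qed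
  then have "(\<integral>\<^sup>+u. ennreal (Levy_integrand \<alpha> 1 u) \<partial>lborel) \<le> (\<integral>\<^sup>+u.
      ennreal (\<alpha> * exp 1) * ennreal (indicator {0..} u * u powr ((1 - \<alpha>) - 1) * exp (- 1 * u)) +
       ennreal (\<alpha> * u powr (- 1 - \<alpha>)) * indicator {1..} u \<partial>lborel)"
    by (rule nn_integral_mono)
  also have "\<dots> = ennreal (\<alpha> * exp 1) * (\<integral>\<^sup>+u. ennreal (indicator {0..} u * u powr ((1 - \<alpha>) - 1) * exp (- 1 * u)) \<partial>lborel)
     + (\<integral>\<^sup>+u. ennreal (\<alpha> * u powr (- 1 - \<alpha>)) * indicator {1..} u \<partial>lborel)"
    by (subst nn_integral_add) (auto simp: nn_integral_cmult)
  also have "\<dots> < \<infinity>"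
    using assms by (subst nn_integral_powr_exp) (auto simp: nn_integral_powr_tail ennreal_mult_less_top)
  finally show ?thesis .
qed

lemma Levy_integral_pos:
  assumes "0 < \<alpha>"
  shows "0 < (\<integral>\<^sup>+u. ennreal (Levy_integrand \<alpha> 1 u) \<partial>lborel)"
proof -
  have "0 < ennreal (1 - exp (- 1)) * ennreal (1 powr - \<alpha>)" by (simp add: ennreal_zero_less_mult_iff)
  also have "\<dots> = (\<integral>\<^sup>+u. ennreal (1 - exp (- 1)) * (ennreal (\<alpha> * u powr (- 1 - \<alpha>)) * indicator {1..} u) \<partial>lborel)"
    using assms by (subst nn_integral_cmult) (auto simp: nn_integral_powr_tail)
  also have "\<dots> \<le> (\<integral>\<^sup>+u. ennreal (Levy_integrand \<alpha> 1 u) \<partial>lborel)"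
    using assms
    by (intro nn_integral_mono)
      (auto simp: Levy_integrand_def ennreal_mult'[symmetric] intro!: ennreal_leI mult_right_mono split: split_indicator)
  finally show ?thesis .
qed

text \<open>The Levy measure restricted to \<open>{e..}\<close> and normalized. One minus its
  Laplace transform is therefore a truncated Levy integral times
  \<open>e powr \<alpha>\<close>.\<close>

definition Pareto :: "real \<Rightarrow> real \<Rightarrow> real measure" where
  "Pareto \<alpha> e = density lborel (\<lambda>s. ennreal (e powr \<alpha>) * (ennreal (\<alpha> * s powr (- 1 - \<alpha>)) * indicator {e..} s))"

lemma sets_Pareto [simp, measurable_cong]: "sets (Pareto \<alpha> e) = sets borel"
  by (simp add: Pareto_def)

lemma space_Pareto [simp]: "space (Pareto \<alpha> e) = UNIV"
  by (simp add: Pareto_def)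

lemma nn_integral_Pareto:
  assumes [measurable]: "f \<in> borel_measurable borel"
  shows "(\<integral>\<^sup>+s. f s \<partial>Pareto \<alpha> e)
     = ennreal (e powr \<alpha>) * (\<integral>\<^sup>+s. ennreal (\<alpha> * s powr (- 1 - \<alpha>)) * indicator {e..} s * f s \<partial>lborel)"
  unfolding Pareto_def by (simp add: nn_integral_density nn_integral_cmult mult.assoc)

lemma prob_space_Pareto: "0 < \<alpha> \<Longrightarrow> 0 < e \<Longrightarrow> prob_space (Pareto \<alpha> e)"
proof (rule prob_spaceI)
  assume "0 < \<alpha>" "0 < e"
  moreover have "emeasure (Pareto \<alpha> e) (space (Pareto \<alpha> e)) = (\<integral>\<^sup>+s. 1 \<partial>Pareto \<alpha> e)" by simp
  ultimately show "emeasure (Pareto \<alpha> e) (space (Pareto \<alpha> e)) = 1"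
    by (simp only: nn_integral_Pareto[OF borel_measurable_const] mult_1_right nn_integral_powr_tail)
      (simp add: ennreal_mult[symmetric] powr_add[symmetric])
qed

lemma AE_Pareto_pos: "0 < e \<Longrightarrow> AE s in Pareto \<alpha> e. 0 < s"
  unfolding Pareto_def by (subst AE_density) (auto intro!: AE_I2 split: split_indicator_asm)

primrec convolution_power :: "real measure \<Rightarrow> nat \<Rightarrow> real measure" where
  "convolution_power M 0 = return borel 0"
| "convolution_power M (Suc n) = convolution M (convolution_power M n)"

lemma convolution_power:
  assumes M: "prob_space M" "sets M = sets borel" and pos: "AE s in M. 0 < s"
  shows "prob_space (convolution_power M n) \<and> sets (convolution_power M n) = sets borel \<and>
    (AE s in convolution_power M n. 0 \<le> s) \<and> Laplace (convolution_power M n) l = (Laplace M l) ^ n"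
proof (induction n)
  case 0
  have "AE s in return borel (0::real). 0 \<le> s" by (subst AE_return) auto
  then show ?case unfolding convolution_power.simps(1)
    by (intro conjI) (auto simp: prob_space_return Laplace_def nn_integral_return)
next
  case (Suc n)
  let ?N = "convolution_power M n"
  note M(2)[measurable_cong]
  have sN[measurable_cong]: "sets ?N = sets borel" and N: "AE s in ?N. 0 \<le> s" using Suc by auto
  interpret M: prob_space M by (rule M)
  interpret N: prob_space ?N using Suc by auto
  have fin: "finite_measure M" "finite_measure ?N"
    by (rule M.finite_measure_axioms N.finite_measure_axioms)+
  note conv = nn_integral_convolution[OF fin sN M(2)]
  have "emeasure (convolution M ?N) UNIV = (\<integral>\<^sup>+x. 1 \<partial>convolution M ?N)" by simp
  also have "\<dots> = 1" using N.emeasure_space_1 M.emeasure_space_1 by (subst conv) auto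
  finally have 1: "prob_space (convolution M ?N)" by (intro prob_spaceI) simp
  have "(\<integral>\<^sup>+x. indicator {..<0} x \<partial>convolution M ?N) = (\<integral>\<^sup>+x. \<integral>\<^sup>+y. indicator {..<0} (x + y) \<partial>?N \<partial>M)"
    by (subst conv) auto
  also have "\<dots> = (\<integral>\<^sup>+x. 0 \<partial>M)"
  proof (rule nn_integral_cong_AE)
    from pos show "AE x in M. (\<integral>\<^sup>+y. indicator {..<0} (x + y) \<partial>?N) = 0"
    proof eventually_elim
      case (elim x)
      have "(\<integral>\<^sup>+y. indicator {..<0} (x + y) \<partial>?N) = (\<integral>\<^sup>+y. 0 \<partial>?N)"
        by (rule nn_integral_cong_AE) (use N elim in \<open>auto split: split_indicator\<close>)
      then show ?case by simp
    qed
  qed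
  finally have "emeasure (convolution M ?N) {..<0} = 0" by simp
  then have "AE x in convolution M ?N. x \<notin> {..<0}" by (intro AE_not_in) (auto simp: null_sets_def)
  then have 2: "AE x in convolution M ?N. 0 \<le> x" by eventually_elim auto
  have "Laplace (convolution M ?N) l = (\<integral>\<^sup>+x. \<integral>\<^sup>+y. ennreal (exp (- l * (x + y))) \<partial>?N \<partial>M)"
    unfolding Laplace_def by (subst conv) auto
  also have "\<dots> = (\<integral>\<^sup>+x. ennreal (exp (- l * x)) * Laplace ?N l \<partial>M)"
    unfolding Laplace_def
    by (subst nn_integral_cmult[symmetric]) (auto simp: distrib_left exp_add ennreal_mult exp_diff exp_minus field_simps ennreal_mult'[symmetric])
  also have "\<dots> = Laplace M l * Laplace ?N l"
    unfolding Laplace_def by (rule nn_integral_multc) measurable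
  also have "\<dots> = Laplace M l ^ Suc n" using Suc by simp
  finally show ?case unfolding convolution_power.simps(2) using 1 2 by simp
qed


text \<open>Powers with exponent \<open>n\<close> of numbers of modulus at most 1 differ by at most
  \<open>n\<close> times the difference of the bases. So the convergent sequence may be replaced by
  its limit in the classical formula for the exponential, once \<open>n \<ge> L\<close> keeps that
  base in range.\<close>

lemma tendsto_one_minus_power_exp:
  assumes a: "a \<longlonglongrightarrow> (L::real)" and b: "\<And>n. 0 \<le> a n" "\<And>n. a n \<le> real (Suc n)" "0 \<le> L"
  shows "(\<lambda>n. (1 - a n / real (Suc n)) ^ Suc n) \<longlonglongrightarrow> exp (- L)"
proof -
  obtain n0 :: nat where n0: "L \<le> real n0" using real_arch_simple by blast
  have "(\<lambda>n. (1 + (- L) / real n) ^ n) \<longlonglongrightarrow> exp (- L)" by (rule tendsto_exp_limit_sequentially)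
  then have 1: "(\<lambda>n. (1 - L / real (Suc n)) ^ Suc n) \<longlonglongrightarrow> exp (- L)"
    using LIMSEQ_Suc by fastforce
  have 2: "(\<lambda>n. (1 - a n / real (Suc n)) ^ Suc n - (1 - L / real (Suc n)) ^ Suc n) \<longlonglongrightarrow> 0"
  proof (rule Lim_null_comparison)
    show "(\<lambda>n. \<bar>a n - L\<bar>) \<longlonglongrightarrow> 0" using a by (simp add: tendsto_rabs_zero LIM_zero)
    show "\<forall>\<^sub>F n in sequentially. norm ((1 - a n / real (Suc n)) ^ Suc n - (1 - L / real (Suc n)) ^ Suc n) \<le> \<bar>a n - L\<bar>"
      using eventually_ge_at_top[of n0]
    proof eventually_elim
      case (elim n)
      have "norm ((1 - a n / real (Suc n)) ^ Suc n - (1 - L / real (Suc n)) ^ Suc n)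
        \<le> real (Suc n) * norm ((1 - a n / real (Suc n)) - (1 - L / real (Suc n)))"
        by (rule norm_power_diff) (use b(1,2)[of n] b(3) n0 elim in \<open>auto simp: abs_le_iff divide_le_eq\<close>)
      also have "(1 - a n / real (Suc n)) - (1 - L / real (Suc n)) = (L - a n) / real (Suc n)"
        by (simp add: diff_divide_distrib)
      also have "real (Suc n) * norm ((L - a n) / real (Suc n)) = \<bar>a n - L\<bar>"
        by (simp add: abs_divide abs_minus_commute del: of_nat_Suc)
      finally show ?case .
    qed
  qed
  show ?thesis using tendsto_add[OF 2 1] by simp
qed

text \<open>The measures are the laws of sums of \<open>n\<close> independent Pareto variables scaled by \<open>n\<^bsup>-1/\<alpha>\<^esup>\<close>.\<close>

lemma stable_approximation:
  assumes \<alpha>: "0 < \<alpha>" "\<alpha> < 1"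
  obtains \<nu> :: "nat \<Rightarrow> real measure"
  where "\<And>n. prob_space (\<nu> n)" "\<And>n. sets (\<nu> n) = sets borel" "\<And>n. AE s in \<nu> n. 0 \<le> s"
    "\<And>n l. 0 < l \<Longrightarrow> 1 - ennreal (l powr \<alpha>) \<le> Laplace (\<nu> n) l"
    "\<And>l. 0 < l \<Longrightarrow> (\<lambda>n. Laplace (\<nu> n) l) \<longlonglongrightarrow> ennreal (exp (- (l powr \<alpha>)))"
proof -
  define I where "I = enn2real (\<integral>\<^sup>+u. ennreal (Levy_integrand \<alpha> 1 u) \<partial>lborel)"
  have I: "(\<integral>\<^sup>+u. ennreal (Levy_integrand \<alpha> 1 u) \<partial>lborel) = ennreal I" "0 < I"
    using Levy_integral_finite[OF \<alpha>] Levy_integral_pos[OF \<alpha>(1)]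
    by (auto simp: I_def less_top enn2real_positive_iff)
  \<comment> \<open>The truncation level for which \<open>e n powr \<alpha> * I = 1 / Suc n\<close>:
    each of the \<open>Suc n\<close> summands then contributes \<open>\<Psi> n l / Suc n\<close> to
    the Laplace exponent, and \<open>\<Psi> n l\<close> tends to
    \<open>l powr \<alpha>\<close>.\<close>
  define e where "e n = (1 / (real (Suc n) * I)) powr (1 / \<alpha>)" for n
  have e: "0 < e n" "e n powr \<alpha> = 1 / (real (Suc n) * I)" for n
    using I \<alpha> by (auto simp: e_def powr_powr simp del: of_nat_Suc)
  define J where "J n l = (\<integral>\<^sup>+u. ennreal (Levy_integrand \<alpha> l u) * indicator {e n..} u \<partial>lborel)" for n l
  define \<Psi> where "\<Psi> n l = enn2real (J n l) / I" for n l
  have full: "(\<integral>\<^sup>+u. ennreal (Levy_integrand \<alpha> l u) \<partial>lborel) = ennreal (l powr \<alpha> * I)" if "0 < l" for l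
    using that \<alpha> I by (subst Levy_integral_scale) (auto simp: ennreal_mult)
  have J_le: "J n l \<le> ennreal (l powr \<alpha> * I)" if "0 < l" for n l
    unfolding J_def full[OF that, symmetric] by (intro nn_integral_mono) (auto split: split_indicator)
  then have J: "J n l = ennreal (I * \<Psi> n l)" if "0 < l" for n l
  proof -
    have "J n l < \<top>" using J_le[OF that, of n] by (rule order.strict_trans1) simp
    then show ?thesis using I(2) by (simp add: \<Psi>_def)
  qed
  have \<Psi>0: "0 \<le> \<Psi> n l" for n l using I by (simp add: \<Psi>_def)
  have \<Psi>l: "\<Psi> n l \<le> l powr \<alpha>" if "0 < l" for n l
    using J_le[OF that, of n] I \<Psi>0[of n l] unfolding J[OF that] by (simp add: mult.commute)
  have tail: "(\<integral>\<^sup>+s. ennreal (1 - exp (- l * s)) \<partial>Pareto \<alpha> (e n)) = ennreal (\<Psi> n l / real (Suc n))"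
    if l: "0 < l" for n l
  proof -
    have "ennreal (\<alpha> * s powr (- 1 - \<alpha>)) * indicator {e n..} s * ennreal (1 - exp (- l * s))
        = ennreal (Levy_integrand \<alpha> l s) * indicator {e n..} s" for s
      using e(1)[of n] \<alpha> l
      by (auto simp: Levy_integrand_def ennreal_mult'[symmetric] mult.commute split: split_indicator)
    then have "(\<integral>\<^sup>+s. ennreal (1 - exp (- l * s)) \<partial>Pareto \<alpha> (e n)) = ennreal (e n powr \<alpha>) * J n l"
      by (subst nn_integral_Pareto) (auto simp: J_def)
    also have "\<dots> = ennreal (\<Psi> n l / real (Suc n))"
      using I by (simp add: e(2) J l ennreal_mult'[symmetric] del: of_nat_Suc)
    finally show ?thesis .
  qed
  have sum1: "Laplace (Pareto \<alpha> (e n)) l + ennreal (\<Psi> n l / real (Suc n)) = 1" if l: "0 < l" for n l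
  proof -
    interpret prob_space "Pareto \<alpha> (e n)" using \<alpha> e by (intro prob_space_Pareto)
    have "Laplace (Pareto \<alpha> (e n)) l + ennreal (\<Psi> n l / real (Suc n)) =
        (\<integral>\<^sup>+s. ennreal (exp (- l * s)) + ennreal (1 - exp (- l * s)) \<partial>Pareto \<alpha> (e n))"
      unfolding Laplace_def tail[OF l, symmetric] by (rule nn_integral_add[symmetric]) measurable
    also have "\<dots> = (\<integral>\<^sup>+s. 1 \<partial>Pareto \<alpha> (e n))"
    proof (rule nn_integral_cong_AE)
      show "AE s in Pareto \<alpha> (e n). ennreal (exp (- l * s)) + ennreal (1 - exp (- l * s)) = 1"
        using AE_Pareto_pos[OF e(1)]
        by eventually_elim (use l in \<open>simp add: ennreal_plus[symmetric] del: ennreal_plus\<close>)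
    qed
    finally show ?thesis using emeasure_space_1 by simp
  qed
  have \<Psi>n: "\<Psi> n l / real (Suc n) \<le> 1" if "0 < l" for n l
  proof -
    have "ennreal (\<Psi> n l / real (Suc n)) \<le> 1" unfolding sum1[OF that, of n, symmetric] by simp
    then show ?thesis by simp
  qed
  have L: "Laplace (Pareto \<alpha> (e n)) l = ennreal (1 - \<Psi> n l / real (Suc n))" if l: "0 < l" for n l
  proof -
    have "Laplace (Pareto \<alpha> (e n)) l = 1 - ennreal (\<Psi> n l / real (Suc n))"
      using sum1[OF l, of n] by (metis ennreal_add_diff_cancel_right ennreal_neq_top)
    then show ?thesis using \<Psi>0[of n l] by (simp add: ennreal_minus ennreal_1[symmetric] del: ennreal_1 of_nat_Suc)
  qed
  define \<nu> where "\<nu> n = convolution_power (Pareto \<alpha> (e n)) (Suc n)" for n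
  have \<nu>: "prob_space (\<nu> n) \<and> sets (\<nu> n) = sets borel \<and> (AE s in \<nu> n. 0 \<le> s) \<and>
      Laplace (\<nu> n) l = Laplace (Pareto \<alpha> (e n)) l ^ Suc n" for n l
    unfolding \<nu>_def
    by (rule convolution_power) (use \<alpha> e in \<open>auto intro: prob_space_Pareto AE_Pareto_pos\<close>)
  have \<nu>L: "Laplace (\<nu> n) l = ennreal ((1 - \<Psi> n l / real (Suc n)) ^ Suc n)" if l: "0 < l" for n l
  proof -
    have "Laplace (\<nu> n) l = Laplace (Pareto \<alpha> (e n)) l ^ Suc n" using \<nu> by blast
    then show ?thesis using L[OF l, of n] \<Psi>n[OF l, of n] by (simp only: ennreal_power diff_ge_0_iff_ge)
  qed
  show thesis
  proof (rule that)
    show "prob_space (\<nu> n)" "sets (\<nu> n) = sets borel" "AE s in \<nu> n. 0 \<le> s" for n using \<nu> by auto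
    show "1 - ennreal (l powr \<alpha>) \<le> Laplace (\<nu> n) l" if l: "0 < l" for n l
    proof -
      \<comment> \<open>Bernoulli's inequality gives a lower bound that does not depend on
        \<open>n\<close>; it is the input for tightness.\<close>
      have "1 + real (Suc n) * (- (\<Psi> n l / real (Suc n))) \<le> (1 + (- (\<Psi> n l / real (Suc n)))) ^ Suc n"
        by (rule Bernoulli_inequality) (use \<Psi>n[OF l, of n] in simp)
      then have "1 - l powr \<alpha> \<le> (1 - \<Psi> n l / real (Suc n)) ^ Suc n"
        using \<Psi>l[OF l, of n] by (simp del: of_nat_Suc power_Suc)
      then have "ennreal (1 - l powr \<alpha>) \<le> Laplace (\<nu> n) l"
        unfolding \<nu>L[OF l] by (rule ennreal_leI)
      then show ?thesis by (simp add: ennreal_minus ennreal_1[symmetric] del: ennreal_1)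
    qed
    show "(\<lambda>n. Laplace (\<nu> n) l) \<longlonglongrightarrow> ennreal (exp (- (l powr \<alpha>)))" if l: "0 < l" for l
    proof -
      have inf0: "(\<lambda>n. 1 / (real (Suc n) * I)) \<longlonglongrightarrow> 0"
      proof -
        have "(\<lambda>n. (1 / I) * (1 / real (Suc n))) \<longlonglongrightarrow> (1 / I) * 0"
          using LIMSEQ_inverse_real_of_nat by (intro tendsto_intros) (simp add: inverse_eq_divide)
        then show ?thesis by (simp add: mult.commute)
      qed
      have e0: "e \<longlonglongrightarrow> 0"
        unfolding e_def[abs_def] using tendsto_powr2[OF inf0 tendsto_const, of "1 / \<alpha>"] \<alpha> I
        by (simp add: eventually_sequentially)
      have "(\<lambda>n. J n l) \<longlonglongrightarrow> (\<integral>\<^sup>+u. ennreal (Levy_integrand \<alpha> l u) \<partial>lborel)"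
        unfolding J_def
      proof (rule nn_integral_dominated_convergence)
        show "(\<integral>\<^sup>+u. ennreal (Levy_integrand \<alpha> l u) \<partial>lborel) < \<infinity>" by (simp add: full l)
        show "AE u in lborel. (\<lambda>n. ennreal (Levy_integrand \<alpha> l u) * indicator {e n..} u)
            \<longlonglongrightarrow> ennreal (Levy_integrand \<alpha> l u)"
        proof (intro AE_I2 tendsto_eventually)
          fix u
          show "\<forall>\<^sub>F n in sequentially. ennreal (Levy_integrand \<alpha> l u) * indicator {e n..} u = ennreal (Levy_integrand \<alpha> l u)"
          proof (cases "0 < u")
            case True
            then have "\<forall>\<^sub>F n in sequentially. e n < u" using e0 by (simp add: order_tendstoD)
            then show ?thesis by eventually_elim simp
          qed (simp add: Levy_integrand_def)
        qed
      qed (auto split: split_indicator)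
      then have "(\<lambda>n. enn2real (J n l)) \<longlonglongrightarrow> enn2real (ennreal (l powr \<alpha> * I))"
        unfolding full[OF l] by (intro tendsto_enn2real) auto
      then have "(\<lambda>n. \<Psi> n l) \<longlonglongrightarrow> enn2real (ennreal (l powr \<alpha> * I)) / I"
        unfolding \<Psi>_def by (rule tendsto_divide[OF _ tendsto_const]) (use I in auto)
      then have "(\<lambda>n. \<Psi> n l) \<longlonglongrightarrow> l powr \<alpha>" using I by simp
      then have "(\<lambda>n. (1 - \<Psi> n l / real (Suc n)) ^ Suc n) \<longlonglongrightarrow> exp (- (l powr \<alpha>))"
        by (rule tendsto_one_minus_power_exp) (use \<Psi>0 \<Psi>n[OF l] in \<open>auto simp: divide_le_eq simp del: of_nat_Suc\<close>)
      then show ?thesis unfolding \<nu>L[OF l] by (rule tendsto_ennrealI)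
    qed
  qed
qed


text \<open>Beyond \<open>1 / l\<close> the integrand of the Laplace transform is at most
  \<open>exp (- 1)\<close>, so mass there lowers the transform by at least
  \<open>1 - exp (- 1)\<close> times that mass. A transform near 1 at a small \<open>l\<close>,
  uniformly in \<open>n\<close>, thus bounds all tails at once.\<close>

lemma tight_stable_approximation:
  assumes \<alpha>: "0 < \<alpha>"
    and \<nu>: "\<And>n. prob_space (\<nu> n)" "\<And>n. sets (\<nu> n) = sets borel" "\<And>n. AE s in \<nu> n. 0 \<le> s"
    and L: "\<And>n l. 0 < l \<Longrightarrow> 1 - ennreal (l powr \<alpha>) \<le> Laplace (\<nu> n) l"
  shows "tight \<nu>"
  unfolding tight_def
proof (intro conjI allI impI)
  show "real_distribution (\<nu> n)" for n
    using \<nu> by (simp add: real_distribution_def real_distribution_axioms_def)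
  fix \<epsilon> :: real assume \<epsilon>: "0 < \<epsilon>"
  define d where "d = 1 - exp (- 1 :: real)"
  have d: "0 < d" by (simp add: d_def)
  define l where "l = (\<epsilon> * d / 2) powr (1 / \<alpha>)"
  have l: "0 < l" "l powr \<alpha> = \<epsilon> * d / 2" using \<epsilon> d \<alpha> by (auto simp: l_def powr_powr)
  define B where "B = 1 / l"
  have B: "0 < B" "l * B = 1" using l by (auto simp: B_def)
  \<comment> \<open>The left end -1 keeps a possible atom at 0 inside the half-open
    interval.\<close>
  have "measure (\<nu> n) {-1<..B} > 1 - \<epsilon>" for n
  proof -
    interpret prob_space "\<nu> n" by (rule \<nu>)
    note \<nu>(2)[measurable_cong]
    have [simp]: "space (\<nu> n) = UNIV" using sets_eq_imp_space_eq[OF \<nu>(2)[of n]] by simp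
    have [measurable]: "{-1<..B} \<in> sets (\<nu> n)" "{B<..} \<in> sets (\<nu> n)" by auto
    define P where "P = prob {-1<..B}"
    have PQ: "P + prob {B<..} \<le> 1"
      unfolding P_def by (subst finite_measure_Union[symmetric]) auto
    have "1 - ennreal (l powr \<alpha>) \<le> Laplace (\<nu> n) l" by (rule L[OF l(1)])
    also have "\<dots> \<le> (\<integral>\<^sup>+s. indicator {-1<..B} s + ennreal (exp (- 1)) * indicator {B<..} s \<partial>\<nu> n)"
      unfolding Laplace_def
    proof (rule nn_integral_mono_AE)
      show "AE s in \<nu> n. ennreal (exp (- l * s)) \<le> indicator {-1<..B} s + ennreal (exp (- 1)) * indicator {B<..} s"
        using \<nu>(3)
      proof eventually_elim
        case (elim s)
        show ?case
        proof (cases "s \<le> B")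
          case False
          then have "l * B \<le> l * s" using l by (intro mult_left_mono) auto
          then show ?thesis using False B by (simp add: ennreal_leI)
        qed (use elim l in auto)
      qed
    qed
    also have "\<dots> = ennreal P + ennreal (exp (- 1)) * ennreal (prob {B<..})"
      by (subst nn_integral_add) (auto simp: nn_integral_cmult emeasure_eq_measure P_def)
    also have "\<dots> = ennreal (P + exp (- 1) * prob {B<..})"
      by (simp add: ennreal_mult ennreal_plus P_def)
    finally have "ennreal (1 - l powr \<alpha>) \<le> ennreal (P + exp (- 1) * prob {B<..})"
      by (simp add: ennreal_minus ennreal_1[symmetric] del: ennreal_1 ennreal_plus)
    then have "1 - l powr \<alpha> \<le> P + exp (- 1) * prob {B<..}"
      by (simp add: P_def del: ennreal_plus)
    also have "\<dots> \<le> P + exp (- 1) * (1 - P)" using PQ by (intro add_left_mono mult_left_mono) auto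
    finally have "1 - \<epsilon> * d / 2 \<le> P + exp (- 1) * (1 - P)" by (simp only: l)
    moreover have "d * (1 - P) = 1 - (P + exp (- 1) * (1 - P))" by (simp add: d_def algebra_simps)
    ultimately have "d * (1 - P) \<le> d * (\<epsilon> / 2)" by (simp add: mult.commute)
    then have "1 - P \<le> \<epsilon> / 2" using d by simp
    then show ?thesis using \<epsilon> by (simp add: P_def)
  qed
  then show "\<exists>a b. a < b \<and> (\<forall>n. 1 - \<epsilon> < measure (\<nu> n) {a<..b})"
    using B by (intro exI[of _ "-1"] exI[of _ B]) auto
qed

text \<open>For \<open>\<alpha> = 1\<close> the law is the unit mass at 1. Otherwise tightness
  provides a weak limit along a subsequence; its Laplace transform is the limit already known for
  the full sequence.\<close>

theorem stable_subordinator_exists: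
  assumes \<alpha>: "0 < \<alpha>" "\<alpha> \<le> 1"
  obtains \<eta> :: "real measure"
  where "prob_space \<eta>" "sets \<eta> = sets borel" "AE s in \<eta>. 0 < s"
    "\<And>l. 0 < l \<Longrightarrow> Laplace \<eta> l = ennreal (exp (- (l powr \<alpha>)))"
proof (cases "\<alpha> = 1")
  case True
  have "AE s in return borel (1::real). 0 < s" by (subst AE_return) auto
  moreover have "Laplace (return borel 1) l = ennreal (exp (- (l powr \<alpha>)))" if "0 < l" for l
    unfolding Laplace_def using that True by (subst nn_integral_return) auto
  ultimately show thesis
    by (intro that[of "return borel 1"]) (auto intro: prob_space_return)
next
  case False
  then have \<alpha>1: "\<alpha> < 1" using \<alpha> by simp
  obtain \<nu> :: "nat \<Rightarrow> real measure" where \<nu>: "\<And>n. prob_space (\<nu> n)" "\<And>n. sets (\<nu> n) = sets borel"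
    "\<And>n. AE s in \<nu> n. 0 \<le> s"
    and L: "\<And>n l. 0 < l \<Longrightarrow> 1 - ennreal (l powr \<alpha>) \<le> Laplace (\<nu> n) l"
    "\<And>l. 0 < l \<Longrightarrow> (\<lambda>n. Laplace (\<nu> n) l) \<longlonglongrightarrow> ennreal (exp (- (l powr \<alpha>)))"
    using stable_approximation[OF \<alpha>(1) \<alpha>1] by metis
  have "tight \<nu>" using \<alpha> \<nu> L(1) by (intro tight_stable_approximation) auto
  from tight_imp_convergent_subsubsequence[OF this strict_mono_id]
  obtain r M where r: "strict_mono (r :: nat \<Rightarrow> nat)" "real_distribution M" "weak_conv_m (\<nu> \<circ> id \<circ> r) M"
    by blast
  interpret M: real_distribution M by (rule r)
  have dist: "real_distribution ((\<nu> \<circ> id \<circ> r) n)" for n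
    using \<nu> by (simp add: real_distribution_def real_distribution_axioms_def)
  \<comment> \<open>Cutting the exponential at 0 makes it bounded and continuous on the whole line,
    as weak convergence requires, and changes nothing on the half line that carries the
    approximating laws.\<close>
  define f where "f l s = exp (- l * max s 0)" for l s :: real
  have f_cont: "isCont (f l) s" for l s unfolding f_def by (intro continuous_intros)
  have [measurable]: "f l \<in> borel_measurable borel" for l unfolding f_def by measurable
  have f: "0 \<le> f l s" "f l s \<le> 1" if "0 < l" for l s
    using that by (auto simp: f_def)
  have fM: "(\<integral>\<^sup>+s. ennreal (f l s) \<partial>M) = ennreal (exp (- (l powr \<alpha>)))" if l: "0 < l" for l
  proof -
    have "(\<lambda>n. integral\<^sup>L ((\<nu> \<circ> id \<circ> r) n) (f l)) \<longlonglongrightarrow> integral\<^sup>L M (f l)"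
      using weak_conv_imp_integral_bdd_continuous_conv[OF dist r(2,3), of "f l" 1] f_cont f[OF l] by auto
    then have "(\<lambda>n. ennreal (integral\<^sup>L ((\<nu> \<circ> id \<circ> r) n) (f l))) \<longlonglongrightarrow> ennreal (integral\<^sup>L M (f l))"
      by (rule tendsto_ennrealI)
    moreover have "ennreal (integral\<^sup>L (\<nu> n) (f l)) = Laplace (\<nu> n) l" for n
    proof -
      interpret prob_space "\<nu> n" by (rule \<nu>)
      note \<nu>(2)[measurable_cong]
      have "integrable (\<nu> n) (f l)"
        by (rule integrable_const_bound[of _ 1]) (use f[OF l] in auto)
      then have "ennreal (integral\<^sup>L (\<nu> n) (f l)) = (\<integral>\<^sup>+s. ennreal (f l s) \<partial>\<nu> n)"
        by (intro nn_integral_eq_integral[symmetric]) (use f[OF l] in auto)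
      also have "\<dots> = Laplace (\<nu> n) l"
        unfolding Laplace_def
      proof (rule nn_integral_cong_AE)
        show "AE s in \<nu> n. ennreal (f l s) = ennreal (exp (- l * s))"
          using \<nu>(3)[of n] by eventually_elim (simp add: f_def)
      qed
      finally show ?thesis .
    qed
    ultimately have "(\<lambda>n. Laplace (\<nu> (r n)) l) \<longlonglongrightarrow> ennreal (integral\<^sup>L M (f l))" by simp
    moreover have "(\<lambda>n. Laplace (\<nu> (r n)) l) \<longlonglongrightarrow> ennreal (exp (- (l powr \<alpha>)))"
      using LIMSEQ_subseq_LIMSEQ[OF L(2)[OF l] r(1)] by (simp add: comp_def)
    ultimately have "ennreal (integral\<^sup>L M (f l)) = ennreal (exp (- (l powr \<alpha>)))"
      by (rule LIMSEQ_unique)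
    moreover have "integrable M (f l)"
      by (rule M.integrable_const_bound[of _ 1]) (use f[OF l] in auto)
    ultimately show ?thesis by (subst nn_integral_eq_integral) (use f[OF l] in auto)
  qed
  \<comment> \<open>Weak limits may create an atom at 0. On \<open>{..0}\<close> the test function
    is 1 for every \<open>l\<close>, while its integral \<open>exp (- (l powr \<alpha>))\<close>
    vanishes as \<open>l\<close> grows; so there is no mass there.\<close>
  have "M.prob {..0} \<le> exp (- real (Suc n))" for n
  proof -
    define l where "l = real (Suc n) powr (1 / \<alpha>)"
    have l: "0 < l" "l powr \<alpha> = real (Suc n)" using \<alpha> by (auto simp: l_def powr_powr)
    have "ennreal (M.prob {..0}) = (\<integral>\<^sup>+s. indicator {..0} s \<partial>M)" by (simp add: M.emeasure_eq_measure)
    also have "\<dots> \<le> (\<integral>\<^sup>+s. ennreal (f l s) \<partial>M)"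
      by (intro nn_integral_mono) (auto simp: f_def split: split_indicator)
    also have "\<dots> = ennreal (exp (- real (Suc n)))" unfolding fM[OF l(1)] l(2) ..
    finally show ?thesis by simp
  qed
  moreover have "(\<lambda>n. exp (- real (Suc n))) \<longlonglongrightarrow> 0"
    by (intro filterlim_compose[OF exp_at_bot] filterlim_compose[OF filterlim_uminus_at_bot_at_top]
        filterlim_compose[OF filterlim_real_sequentially] filterlim_Suc)
  ultimately have "M.prob {..0} \<le> 0" by (intro LIMSEQ_le_const) auto
  then have "emeasure M {..0} = 0" by (simp add: M.emeasure_eq_measure measure_le_0_iff)
  then have "AE s in M. s \<notin> {..0}" by (intro AE_not_in) (auto simp: null_sets_def)
  then have pos: "AE s in M. 0 < s" by eventually_elim auto
  moreover have "Laplace M l = ennreal (exp (- (l powr \<alpha>)))" if "0 < l" for l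
    unfolding Laplace_def fM[OF that, symmetric]
  proof (rule nn_integral_cong_AE)
    show "AE s in M. ennreal (exp (- l * s)) = ennreal (f l s)"
      using pos by eventually_elim (simp add: f_def)
  qed
  ultimately show thesis
    by (intro that[of M]) (auto intro: M.prob_space_axioms)
qed

text \<open>Since \<open>s powr -2\<close> is the integral of \<open>t * exp (- t * s)\<close> over
  \<open>t > 0\<close>, Tonelli turns the moment into the integral of
  \<open>t * exp (- (t powr \<alpha>))\<close>. The order 2 is the one demanded by the sup bound of
  the Oseen kernel.\<close>

lemma stable_negative_moment:
  assumes \<alpha>: "1 / 2 \<le> \<alpha>" and \<eta>: "prob_space \<eta>" "sets \<eta> = sets borel" "AE s in \<eta>. 0 < s"
    and L: "\<And>l. 0 < l \<Longrightarrow> Laplace \<eta> l = ennreal (exp (- (l powr \<alpha>)))"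
  shows "(\<integral>\<^sup>+s. ennreal (s powr -2) \<partial>\<eta>) < \<infinity>"
proof -
  note \<eta>(2)[measurable_cong]
  interpret prob_space \<eta> by (rule \<eta>)
  interpret P: pair_sigma_finite \<eta> lborel ..
  have "(\<integral>\<^sup>+s. ennreal (s powr -2) \<partial>\<eta>)
     = (\<integral>\<^sup>+s. (\<integral>\<^sup>+t. ennreal (indicator {0<..} t * t * exp (- t * s)) \<partial>lborel) \<partial>\<eta>)"
  proof (rule nn_integral_cong_AE)
    show "AE s in \<eta>. ennreal (s powr -2) = (\<integral>\<^sup>+t. ennreal (indicator {0<..} t * t * exp (- t * s)) \<partial>lborel)"
      using \<eta>(3)
    proof eventually_elim
      case (elim s)
      have "(\<integral>\<^sup>+t. ennreal (indicator {0<..} t * t * exp (- t * s)) \<partial>lborel)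
        = (\<integral>\<^sup>+t. ennreal (indicator {0..} t * t powr (2 - 1) * exp (- s * t)) \<partial>lborel)"
        by (intro nn_integral_cong) (auto simp: mult.commute split: split_indicator)
      also have "\<dots> = ennreal (Gamma 2 * s powr -2)" using elim by (intro nn_integral_powr_exp) auto
      also have "Gamma (2::real) = 1" using Gamma_fact[of 1, where ?'a = real] by simp
      finally show ?case by simp
    qed
  qed
  also have "\<dots> = (\<integral>\<^sup>+t. (\<integral>\<^sup>+s. ennreal (indicator {0<..} t * t * exp (- t * s)) \<partial>\<eta>) \<partial>lborel)"
    by (rule P.Fubini'[symmetric]) measurable
  \<comment> \<open>The constant is \<open>6 ^ 6\<close>: with
    \<open>x = t powr (1 / 2) \<le> t powr \<alpha>\<close> one has
    \<open>exp x \<ge> (x / 6) ^ 6 = t ^ 3 / 46656\<close>, which leaves an integrable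
    \<open>t powr -2\<close>.\<close>
  also have "\<dots> \<le> (\<integral>\<^sup>+t. indicator {0..1} t + ennreal 46656 * (ennreal (1 * t powr (- 1 - 1)) * indicator {1..} t) \<partial>lborel)"
  proof (rule nn_integral_mono)
    fix t :: real
    have eq: "(\<integral>\<^sup>+s. ennreal (indicator {0<..} t * t * exp (- t * s)) \<partial>\<eta>) = ennreal (t * exp (- (t powr \<alpha>)))" if "0 < t"
    proof -
      have "(\<integral>\<^sup>+s. ennreal (indicator {0<..} t * t * exp (- t * s)) \<partial>\<eta>) = ennreal t * Laplace \<eta> t"
        unfolding Laplace_def using that
        by (subst nn_integral_cmult[symmetric]) (auto simp: ennreal_mult'[symmetric])
      then show ?thesis using that by (simp add: L ennreal_mult)
    qed
    consider "t \<le> 0" | "0 < t" "t < 1" | "1 \<le> t" by linarith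
    then show "(\<integral>\<^sup>+s. ennreal (indicator {0<..} t * t * exp (- t * s)) \<partial>\<eta>)
      \<le> indicator {0..1} t + ennreal 46656 * (ennreal (1 * t powr (- 1 - 1)) * indicator {1..} t)"
    proof cases
      case 2
      have "t * exp (- (t powr \<alpha>)) \<le> 1 * 1" using 2 by (intro mult_mono) auto
      then show ?thesis unfolding eq[OF 2(1)] using 2 by simp
    next
      case 3
      define x where "x = t powr (1 / 2)"
      have x: "1 \<le> x" "x \<le> t powr \<alpha>" using 3 \<alpha> by (auto simp: x_def ge_one_powr_ge_zero powr_mono)
      have x6: "x ^ 6 = t ^ 3" using 3 by (simp add: x_def powr_power powr_realpow[of t 3, simplified])
      have "x / 6 \<le> exp (x / 6)" using exp_ge_add_one_self[of "x / 6"] by linarith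
      then have "(x / 6) ^ 6 \<le> exp (x / 6) ^ 6" using x by (intro power_mono) auto
      also have "\<dots> = exp x" by (simp add: exp_of_nat_mult[symmetric])
      also have "\<dots> \<le> exp (t powr \<alpha>)" using x by simp
      finally have "t ^ 3 / 46656 \<le> exp (t powr \<alpha>)" by (simp add: power_divide x6)
      then have "inverse (exp (t powr \<alpha>)) \<le> inverse (t ^ 3 / 46656)"
        using 3 by (intro le_imp_inverse_le) auto
      then have "t * exp (- (t powr \<alpha>)) \<le> t * inverse (t ^ 3 / 46656)"
        using 3 by (intro mult_left_mono) (auto simp: exp_minus)
      also have "\<dots> = 46656 * t powr -2"
        using 3 by (simp add: powr_minus power2_eq_square power3_eq_cube divide_simps)
      finally have "t * exp (- (t powr \<alpha>)) \<le> 46656 * t powr -2" .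
      then have "ennreal (t * exp (- (t powr \<alpha>))) \<le> ennreal 46656 * ennreal (t powr -2)"
        by (simp add: ennreal_mult'[symmetric] ennreal_leI del: ennreal_numeral)
      then show ?thesis using 3 by (subst eq) (simp_all add: add_increasing)
    qed simp
  qed
  also have "\<dots> = 1 + ennreal 46656 * (\<integral>\<^sup>+t. ennreal (1 * t powr (- 1 - 1)) * indicator {1..} t \<partial>lborel)"
    by (subst nn_integral_add) (auto simp: nn_integral_cmult)
  also have "\<dots> < \<infinity>" by (subst nn_integral_powr_tail) auto
  finally show ?thesis .
qed

subsection \<open>Fourier transforms of Gaussians times monomials\<close>

lemma cis_measurable [measurable (raw)]:
  "f \<in> borel_measurable M \<Longrightarrow> (\<lambda>x. cis (f x)) \<in> borel_measurable M"
  by (rule borel_measurable_continuous_on[where f = cis]) (auto intro: continuous_intros)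

definition gauss_moment_ft :: "nat \<Rightarrow> real \<Rightarrow> complex" where
  "gauss_moment_ft n y = (LINT x|lborel. of_real (x ^ n * exp (- x\<^sup>2 / 2)) * cis (y * x))"

lemma integrable_gauss_moment: "integrable lborel (\<lambda>x::real. x ^ n * exp (- x\<^sup>2 / 2))"
proof -
  have "integrable lborel (\<lambda>x::real. sqrt (2 * pi) * (std_normal_density x * x ^ n))"
    by (intro integrable_mult_right integrable_std_normal_moment)
  then show ?thesis by (simp add: std_normal_density_def mult.commute)
qed

lemma integrable_gauss_moment_cis:
  "integrable lborel (\<lambda>x. of_real (x ^ n * exp (- x\<^sup>2 / 2)) * cis (y * x))"
  by (rule Bochner_Integration.integrable_bound[OF integrable_norm[OF integrable_gauss_moment[of n]]])
    (auto simp: norm_mult norm_power abs_mult power_abs)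

lemma gauss_moment_ft_0: "gauss_moment_ft 0 y = of_real (sqrt (2 * pi) * exp (- y\<^sup>2 / 2))"
proof -
  have "complex_of_real (exp (- (y\<^sup>2) / 2)) = char std_normal_distribution y"
    by (simp add: char_std_normal_distribution)
  also have "\<dots> = (LINT x|lborel. std_normal_density x *\<^sub>R iexp (y * x))"
    unfolding char_def by (subst integral_density) auto
  also have "\<dots> = (LINT x|lborel. (1 / sqrt (2 * pi)) *\<^sub>R (of_real (x ^ 0 * exp (- x\<^sup>2 / 2)) * cis (y * x)))"
    by (intro Bochner_Integration.integral_cong)
      (auto simp: std_normal_density_def cis_conv_exp scaleR_conv_of_real)
  also have "\<dots> = (1 / sqrt (2 * pi)) *\<^sub>R gauss_moment_ft 0 y"
    unfolding gauss_moment_ft_def by (rule integral_scaleR_right)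
  finally have "sqrt (2 * pi) *\<^sub>R complex_of_real (exp (- (y\<^sup>2) / 2)) = gauss_moment_ft 0 y"
    by simp
  then show ?thesis by (simp add: scaleR_conv_of_real)
qed

text \<open>The derivative of \<open>x^n exp(-x^2/2) cis(y x)\<close> has integral 0 over the line.
  At \<open>n = 0\<close> the truncated index \<open>n - 1\<close> is harmless, because its
  coefficient is 0.\<close>

lemma gauss_moment_ft_Suc:
  "gauss_moment_ft (Suc n) y = of_nat n * gauss_moment_ft (n - 1) y + \<i> * of_real y * gauss_moment_ft n y"
proof -
  let ?g = "\<lambda>n x. of_real (x ^ n * exp (- x\<^sup>2 / 2)) * cis (y * x)"
  let ?F = "?g n"
  let ?f = "\<lambda>x. of_nat n * ?g (n - 1) x - ?g (Suc n) x + \<i> * of_real y * ?g n x"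
  have int: "integrable lborel ?f"
    by (intro Bochner_Integration.integrable_add Bochner_Integration.integrable_diff
        integrable_mult_right integrable_gauss_moment_cis)
  have le: "norm (?F x) \<le> exp (1 / 2) * (\<bar>x\<bar> ^ n / exp \<bar>x\<bar>)" for x
  proof -
    have "\<bar>x\<bar> - 1 / 2 \<le> x\<^sup>2 / 2"
      using zero_le_power2[of "\<bar>x\<bar> - 1"] by (simp add: power2_eq_square algebra_simps)
    then have "exp (- x\<^sup>2 / 2) \<le> exp (1 / 2 - \<bar>x\<bar>)" by simp
    then have "\<bar>x\<bar> ^ n * exp (- x\<^sup>2 / 2) \<le> \<bar>x\<bar> ^ n * exp (1 / 2 - \<bar>x\<bar>)" by (rule mult_left_mono) simp
    then show ?thesis by (simp add: norm_mult norm_power abs_mult power_abs exp_diff mult.commute)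
  qed
  have lim: "(?F \<longlongrightarrow> 0) F" if "filterlim (\<lambda>x::real. \<bar>x\<bar>) at_top F" for F
  proof (rule Lim_null_comparison[OF always_eventually])
    show "\<forall>x. norm (?F x) \<le> exp (1 / 2) * (\<bar>x\<bar> ^ n / exp \<bar>x\<bar>)" using le by blast
    have "((\<lambda>x. \<bar>x\<bar> ^ n / exp \<bar>x\<bar>) \<longlongrightarrow> 0) F"
      by (rule filterlim_compose[OF tendsto_power_div_exp_0 that])
    then show "((\<lambda>x. exp (1 / 2) * (\<bar>x\<bar> ^ n / exp \<bar>x\<bar>)) \<longlongrightarrow> 0) F"
      using tendsto_mult_right_zero by blast
  qed
  have "(LBINT x=-\<infinity>..\<infinity>. ?f x) = 0 - 0"
  proof (rule interval_integral_FTC_integrable[where F = ?F])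
    fix x :: real
    have "((\<lambda>x. exp (\<i> * of_real y * of_real x)) has_vector_derivative \<i> * of_real y * exp (\<i> * of_real y * of_real x)) (at x)"
      by (rule has_vector_derivative_real_field) (auto intro!: derivative_eq_intros)
    then have 1: "((\<lambda>x. cis (y * x)) has_vector_derivative \<i> * of_real y * cis (y * x)) (at x)"
      by (simp add: cis_conv_exp mult.assoc)
    have 2: "((\<lambda>x. x ^ n * exp (- x\<^sup>2 / 2)) has_real_derivative
        (real n * x ^ (n - 1) - x ^ Suc n) * exp (- x\<^sup>2 / 2)) (at x)"
      by (auto intro!: derivative_eq_intros simp: algebra_simps)
    have "((\<lambda>x. (x ^ n * exp (- x\<^sup>2 / 2)) *\<^sub>R cis (y * x)) has_vector_derivative ?f x) (at x)"
      using has_vector_derivative_scaleR[OF 2 1] by (rule has_vector_derivative_eq_rhs)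
        (simp add: scaleR_conv_of_real algebra_simps)
    then show "(?F has_vector_derivative ?f x) (at x)" by (simp add: scaleR_conv_of_real)
    show "isCont ?f x" unfolding cis_conv_exp by (auto intro!: continuous_intros)
  next
    show "set_integrable lborel (einterval (- \<infinity>) \<infinity>) ?f"
      using int by (simp add: set_integrable_def einterval_def)
    have "filterlim (\<lambda>x::real. \<bar>x\<bar>) at_top at_top" "filterlim (\<lambda>x::real. \<bar>x\<bar>) at_top at_bot"
      using filterlim_abs_real filterlim_compose[OF filterlim_abs_real filterlim_uminus_at_top_at_bot]
      by simp_all
    then show "((?F \<circ> real_of_ereal) \<longlongrightarrow> 0) (at_right (- \<infinity>))" "((?F \<circ> real_of_ereal) \<longlongrightarrow> 0) (at_left \<infinity>)"
      using lim by (auto simp: ereal_tendsto_simps)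
  qed simp
  then have "(LINT x|lborel. ?f x) = 0"
    by (simp add: interval_lebesgue_integral_def einterval_def set_lebesgue_integral_def)
  also have "(LINT x|lborel. ?f x) = of_nat n * gauss_moment_ft (n - 1) y - gauss_moment_ft (Suc n) y
      + \<i> * of_real y * gauss_moment_ft n y"
    unfolding gauss_moment_ft_def
    by (simp only: Bochner_Integration.integral_add Bochner_Integration.integral_diff integral_mult_right_zero
        integrable_mult_right integrable_gauss_moment_cis Bochner_Integration.integrable_diff)
  finally show ?thesis by (simp add: algebra_simps)
qed

text \<open>Up to factors of modulus 1 the transforms are Hermite polynomials times a Gaussian. Half
  of the Gaussian decay is given up to absorb the polynomial. Degree 3 is reached because the Oseen
  symbol, once \<open>1 / |\<xi>|^2\<close> is written as an integral, leads to cubic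
  monomials.\<close>

lemma gauss_moment_ft_bound:
  obtains C where "1 \<le> C" "\<And>n y. n \<le> 3 \<Longrightarrow> norm (gauss_moment_ft n y) \<le> C * exp (- y\<^sup>2 / 4)"
proof -
  define E where "E y = gauss_moment_ft 0 y" for y
  have e1: "gauss_moment_ft 1 y = \<i> * of_real y * E y" for y
    using gauss_moment_ft_Suc[of 0 y] by (simp add: E_def)
  have e2: "gauss_moment_ft 2 y = of_real (1 - y\<^sup>2) * E y" for y
  proof -
    have "gauss_moment_ft 2 y = E y + \<i> * of_real y * (\<i> * of_real y * E y)"
      using gauss_moment_ft_Suc[of 1 y] by (simp add: e1[simplified] E_def[symmetric] numeral_2_eq_2)
    also have "\<dots> = E y + (\<i> * \<i>) * (of_real (y\<^sup>2) * E y)"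
      by (simp only: power2_eq_square of_real_mult mult_ac)
    also have "\<dots> = of_real (1 - y\<^sup>2) * E y" by (simp add: left_diff_distrib)
    finally show ?thesis .
  qed
  have e3: "gauss_moment_ft 3 y = \<i> * of_real (3 * y - y ^ 3) * E y" for y
  proof -
    have "gauss_moment_ft 3 y = 2 * (\<i> * of_real y * E y) + \<i> * of_real y * (of_real (1 - y\<^sup>2) * E y)"
    proof -
      have "Suc 2 = 3" "2 - 1 = (1 :: nat)" by simp_all
      then show ?thesis using gauss_moment_ft_Suc[of 2 y] unfolding e2 by (simp only: e1) simp
    qed
    also have "\<dots> = \<i> * of_real (3 * y - y ^ 3) * E y"
    proof -
      have *: "3 * y - y ^ 3 = 2 * y + y * (1 - y\<^sup>2)"
        by (simp add: power2_eq_square power3_eq_cube right_diff_distrib)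
      show ?thesis unfolding * of_real_add of_real_mult by (simp add: distrib_left distrib_right mult_ac)
    qed
    finally show ?thesis .
  qed
  have poly: "norm (gauss_moment_ft n y) \<le> (4 + 4 * y ^ 4) * norm (E y)" if "n \<le> 3" for n y
  proof -
    have a: "\<bar>y\<bar> ^ k \<le> 1 + y ^ 4" if "k \<le> 4" for k
    proof (cases "\<bar>y\<bar> \<le> 1")
      case True
      then have "\<bar>y\<bar> ^ k \<le> 1" by (simp add: power_le_one)
      then show ?thesis by (simp add: add_increasing2)
    next
      case False
      then have "\<bar>y\<bar> ^ k \<le> \<bar>y\<bar> ^ 4" using that by (intro power_increasing) auto
      then show ?thesis by simp
    qed
    have sq: "y\<^sup>2 \<le> 1 + y ^ 4" and a1: "\<bar>y\<bar> \<le> 1 + y ^ 4" and a3: "\<bar>y\<bar> ^ 3 \<le> 1 + y ^ 4"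
      using a[of 2] a[of 1] a[of 3] by simp_all
    have p0: "0 \<le> y ^ 4" by simp
    have q3: "\<bar>3 * y - y ^ 3\<bar> \<le> 4 + 4 * y ^ 4"
    proof -
      have "\<bar>3 * y - y ^ 3\<bar> \<le> 3 * \<bar>y\<bar> + \<bar>y\<bar> ^ 3"
        using abs_triangle_ineq4[of "3 * y" "y ^ 3"] by (simp add: abs_mult power_abs)
      then show ?thesis using a1 a3 by linarith
    qed
    have q2: "\<bar>1 - y\<^sup>2\<bar> \<le> 4 + 4 * y ^ 4" using sq p0 zero_le_power2[of y] by linarith
    have q1: "\<bar>y\<bar> \<le> 4 + 4 * y ^ 4" "1 \<le> 4 + 4 * y ^ 4" using a1 p0 by linarith+
    from that consider "n = 0" | "n = 1" | "n = 2" | "n = 3" by linarith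
    then show ?thesis
    proof cases
      case 1
      then show ?thesis using mult_right_mono[OF q1(2), of "norm (E y)"]
        by (simp add: E_def[symmetric])
    next
      case 2
      then show ?thesis using mult_right_mono[OF q1(1), of "norm (E y)"] by (simp add: e1[simplified] norm_mult)
    next
      case 3
      then show ?thesis using mult_right_mono[OF q2 norm_ge_zero[of "E y"]]
        by (simp only: e2 norm_mult norm_of_real)
    next
      case 4
      then show ?thesis using mult_right_mono[OF q3 norm_ge_zero[of "E y"]]
        by (simp only: e3 norm_mult norm_of_real norm_ii mult_1_left)
    qed
  qed
  have gauss: "(4 + 4 * y ^ 4) * norm (E y) \<le> (260 * sqrt (2 * pi)) * exp (- y\<^sup>2 / 4)" for y
  proof -
    \<comment> \<open>From \<open>z\<^sup>2 \<le> exp (2 * z)\<close> follows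
      \<open>y ^ 4 \<le> 64 * exp (y\<^sup>2 / 4)\<close>, and
      \<open>4 + 4 * 64 = 260\<close>.\<close>
    define z where "z = y\<^sup>2 / 8"
    have z: "0 \<le> z" by (simp add: z_def)
    have "z\<^sup>2 \<le> (1 + z)\<^sup>2" using z by (intro power_mono) auto
    also have "\<dots> \<le> (exp z)\<^sup>2" using z exp_ge_add_one_self[of z] by (intro power_mono) auto
    also have "\<dots> = exp (y\<^sup>2 / 4)" by (simp add: z_def exp_double[symmetric] power2_eq_square mult_exp_exp)
    finally have "y ^ 4 \<le> 64 * exp (y\<^sup>2 / 4)" by (simp add: z_def power2_eq_square power4_eq_xxxx)
    then have "(4 + 4 * y ^ 4) \<le> 4 * exp (y\<^sup>2 / 4) + 256 * exp (y\<^sup>2 / 4)"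
      using one_le_exp_iff[of "y\<^sup>2 / 4"] by (intro add_mono) auto
    then have "(4 + 4 * y ^ 4) * exp (- y\<^sup>2 / 2) \<le> (260 * exp (y\<^sup>2 / 4)) * exp (- y\<^sup>2 / 2)"
      by (intro mult_right_mono) auto
    also have "\<dots> = 260 * exp (- y\<^sup>2 / 4)" by (simp add: mult_exp_exp)
    finally have "sqrt (2 * pi) * ((4 + 4 * y ^ 4) * exp (- y\<^sup>2 / 2)) \<le> sqrt (2 * pi) * (260 * exp (- y\<^sup>2 / 4))"
      by (rule mult_left_mono) simp
    then show ?thesis by (simp add: E_def gauss_moment_ft_0 norm_mult mult_ac)
  qed
  show thesis
  proof (rule that)
    have "1 * 1 \<le> 260 * sqrt (2 * pi)" using pi_gt3 by (intro mult_mono) auto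
    then show "1 \<le> 260 * sqrt (2 * pi)" by simp
    show "norm (gauss_moment_ft n y) \<le> (260 * sqrt (2 * pi)) * exp (- y\<^sup>2 / 4)" if "n \<le> 3" for n y
      using poly[OF that, of y] gauss[of y] by (rule order.trans)
  qed
qed

lemma gauss_moment_ft_scale:
  assumes s: "0 < s"
  shows "integrable lborel (\<lambda>x. of_real (x ^ n * exp (- s * x\<^sup>2)) * cis (y * x))"
    and "(LINT x|lborel. of_real (x ^ n * exp (- s * x\<^sup>2)) * cis (y * x))
      = of_real ((1 / sqrt (2 * s)) ^ Suc n) * gauss_moment_ft n (y / sqrt (2 * s))"
proof -
  define c where "c = sqrt (2 * s)"
  have c: "0 < c" "c\<^sup>2 = 2 * s" using s by (auto simp: c_def)
  let ?g = "\<lambda>x. of_real (x ^ n * exp (- x\<^sup>2 / 2)) * cis (y / c * x)"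
  have eq: "of_real (x ^ n * exp (- s * x\<^sup>2)) * cis (y * x) = of_real ((1 / c) ^ n) * ?g (0 + c * x)" for x
    using c s by (simp add: power_mult_distrib power_divide mult_ac)
  show "integrable lborel (\<lambda>x. of_real (x ^ n * exp (- s * x\<^sup>2)) * cis (y * x))"
    unfolding eq
    by (intro integrable_mult_right lborel_integrable_real_affine integrable_gauss_moment_cis) (use c in auto)
  have "gauss_moment_ft n (y / c) = c *\<^sub>R (LINT x|lborel. ?g (0 + c * x))"
    unfolding gauss_moment_ft_def using c by (subst lborel_integral_real_affine[where c = c and t = 0]) auto
  then have "(LINT x|lborel. ?g (0 + c * x)) = of_real (1 / c) * gauss_moment_ft n (y / c)"
    using c by (simp add: scaleR_conv_of_real)
  then show "(LINT x|lborel. of_real (x ^ n * exp (- s * x\<^sup>2)) * cis (y * x))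
      = of_real ((1 / sqrt (2 * s)) ^ Suc n) * gauss_moment_ft n (y / sqrt (2 * s))"
    unfolding eq c_def[symmetric] integral_mult_right_zero by simp
qed

section \<open>Passage from one dimension to three by products over coordinates\<close>

lemma
  fixes f :: "'a::euclidean_space \<Rightarrow> real \<Rightarrow> 'b::{real_normed_field, banach, second_countable_topology}"
  assumes "\<And>b. b \<in> Basis \<Longrightarrow> integrable lborel (f b)"
  shows integrable_lborel_prod: "integrable lborel (\<lambda>x. \<Prod>b\<in>Basis. f b (x \<bullet> b))"
    and integral_lborel_prod: "(LINT x|lborel. (\<Prod>b\<in>Basis. f b (x \<bullet> b))) = (\<Prod>b\<in>Basis. (LINT x|lborel. f b x))"
proof -
  interpret product_sigma_finite "\<lambda>_::'a. lborel :: real measure" ..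
  have [measurable]: "f b \<in> borel_measurable borel" if "b \<in> Basis" for b
    using assms[OF that] by auto
  have comp: "(\<Sum>b\<in>Basis. g b *\<^sub>R b) \<bullet> b' = g b'" if "b' \<in> Basis" for g and b' :: 'a
    using that by simp
  have eq: "(\<Prod>b'\<in>Basis. f b' ((\<Sum>b\<in>Basis. g b *\<^sub>R b) \<bullet> b')) = (\<Prod>b\<in>Basis. f b (g b))" for g
    by (intro prod.cong) (simp_all only: comp)
  have [measurable]: "(\<lambda>x. \<Prod>b\<in>Basis. f b (x \<bullet> b)) \<in> borel_measurable borel"
    by (intro borel_measurable_prod) measurable
  have L: "(lborel :: 'a measure) = distr (\<Pi>\<^sub>M b\<in>Basis. lborel) borel (\<lambda>f. \<Sum>b\<in>Basis. f b *\<^sub>R b)"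
    by (rule lborel_eq)
  show "integrable lborel (\<lambda>x. \<Prod>b\<in>Basis. f b (x \<bullet> b))"
    by (subst L, subst integrable_distr_eq) (auto simp: eq intro!: product_integrable_prod assms)
  show "(LINT x|lborel. (\<Prod>b\<in>Basis. f b (x \<bullet> b))) = (\<Prod>b\<in>Basis. (LINT x|lborel. f b x))"
    by (subst L, subst integral_distr) (auto simp: eq intro!: product_integral_prod assms)
qed

lemma prod_Basis_vec: "(\<Prod>b\<in>(Basis::(real^'n::finite) set). f b) = (\<Prod>i\<in>UNIV. f (axis i 1))"
proof -
  have inj: "inj (\<lambda>i::'n. axis i (1::real))" by (auto simp: inj_on_def axis_eq_axis)
  have "(Basis::(real^'n) set) = range (\<lambda>i. axis i 1)" by (auto simp: Basis_vec_def)
  then show ?thesis using prod.reindex[OF inj, of f] by (simp add: comp_def)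
qed

definition monomial_symbol :: "(3 \<Rightarrow> nat) \<Rightarrow> real \<Rightarrow> real^3 \<Rightarrow> real" where
  "monomial_symbol n s \<xi> = (\<Prod>i\<in>UNIV. (\<xi> $ i) ^ n i) * exp (- s * (norm \<xi>)\<^sup>2)"

text \<open>The normalization \<open>1 / (2 * pi) ^ 3\<close> of \<open>kernel\<close> is left out.
  It is below 1 and is discarded when kernels are estimated.\<close>

definition monomial_kernel :: "(3 \<Rightarrow> nat) \<Rightarrow> real \<Rightarrow> real^3 \<Rightarrow> complex" where
  "monomial_kernel n s x = (LINT \<xi>|lborel. cis (x \<bullet> \<xi>) * of_real (monomial_symbol n s \<xi>))"

lemma cis_sum: "finite A \<Longrightarrow> cis (\<Sum>i\<in>A. f i) = (\<Prod>i\<in>A. cis (f i))"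
  by (induction A rule: finite_induct) (auto simp: cis_mult[symmetric])

lemma norm_square_vec: "(norm x)\<^sup>2 = (\<Sum>i\<in>UNIV. (x $ i)\<^sup>2)" for x :: "real^'n::finite"
  by (simp add: norm_vec_def L2_set_def sum_nonneg)

lemma monomial_symbol_prod:
  "cis (x \<bullet> \<xi>) * of_real (monomial_symbol n s \<xi>) =
     (\<Prod>i\<in>UNIV. of_real ((\<xi> $ i) ^ n i * exp (- s * (\<xi> $ i)\<^sup>2)) * cis (x $ i * \<xi> $ i))"
proof -
  have "exp (- s * (norm \<xi>)\<^sup>2) = (\<Prod>i\<in>UNIV. exp (- s * (\<xi> $ i)\<^sup>2))"
    unfolding norm_square_vec by (simp add: exp_sum[symmetric] sum_distrib_left)
  then have "monomial_symbol n s \<xi> = (\<Prod>i\<in>UNIV. (\<xi> $ i) ^ n i * exp (- s * (\<xi> $ i)\<^sup>2))"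
    by (simp add: monomial_symbol_def prod.distrib)
  moreover have "cis (x \<bullet> \<xi>) = (\<Prod>i\<in>UNIV. cis (x $ i * \<xi> $ i))"
    by (simp add: inner_vec_def cis_sum)
  ultimately show ?thesis by (simp add: prod.distrib mult_ac)
qed

text \<open>The Fourier integral factors over the coordinates. Every power of a frequency costs
  \<open>s powr (- (1 / 2))\<close>, and the weakened decay \<open>exp (- y\<^sup>2 / 4)\<close> of
  the one-dimensional factors is that of a Gaussian at the doubled parameter
  \<open>2 * s\<close>.\<close>

lemma monomial_kernel_bound:
  obtains C where "1 \<le> C"
    "\<And>n s x. 0 < s \<Longrightarrow> (\<And>i. n i \<le> 3) \<Longrightarrow>
      norm (monomial_kernel n s x) \<le> C * s powr (- (real (\<Sum>i\<in>UNIV. n i) / 2)) * gauss (2 * s) x"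
proof -
  obtain C where C: "1 \<le> C" "\<And>n y. n \<le> 3 \<Longrightarrow> norm (gauss_moment_ft n y) \<le> C * exp (- y\<^sup>2 / 4)"
    using gauss_moment_ft_bound by metis
  have bound: "norm (monomial_kernel n s x) \<le> C ^ 3 * (4 * pi) powr (3 / 2) * s powr (- (real (\<Sum>i\<in>UNIV. n i) / 2)) * gauss (2 * s) x"
    if s: "0 < s" and n: "\<And>i. n i \<le> 3" for n :: "3 \<Rightarrow> nat" and s x
  proof -
    let ?c = "sqrt (2 * s)"
    \<comment> \<open>Recovers the coordinate index from a basis vector: the product formula runs
      over \<open>Basis\<close>, while the exponents are indexed by \<open>3\<close>.\<close>
    define I where "I b = (THE i. b = axis i (1::real))" for b :: "real^3"
    have I: "I (axis i 1) = i" for i unfolding I_def by (auto simp: axis_eq_axis)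
    let ?f = "\<lambda>b \<xi>. of_real (\<xi> ^ n (I b) * exp (- s * \<xi>\<^sup>2)) * cis (x $ I b * \<xi>)"
    have "monomial_kernel n s x = (LINT \<xi>|lborel. (\<Prod>b\<in>Basis. ?f b (\<xi> \<bullet> b)))"
      unfolding monomial_kernel_def monomial_symbol_prod prod_Basis_vec I by (simp add: inner_axis)
    also have "\<dots> = (\<Prod>b\<in>Basis. (LINT \<xi>|lborel. ?f b \<xi>))"
      by (intro integral_lborel_prod gauss_moment_ft_scale s)
    also have "\<dots> = (\<Prod>i\<in>UNIV. of_real ((1 / ?c) ^ Suc (n i)) * gauss_moment_ft (n i) (x $ i / ?c))"
      unfolding prod_Basis_vec I gauss_moment_ft_scale(2)[OF s] ..
    finally have "norm (monomial_kernel n s x) = (\<Prod>i\<in>UNIV. (1 / ?c) ^ Suc (n i) * norm (gauss_moment_ft (n i) (x $ i / ?c)))"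
      using s by (simp add: prod_norm[symmetric] norm_mult norm_power norm_divide)
    also have "\<dots> \<le> (\<Prod>i\<in>UNIV. (1 / ?c) ^ Suc (n i) * (C * exp (- (x $ i / ?c)\<^sup>2 / 4)))"
      using s by (intro prod_mono conjI mult_left_mono C n) auto
    also have "\<dots> = (\<Prod>i\<in>UNIV. (1 / ?c) ^ Suc (n i)) * (C ^ 3 * (\<Prod>i\<in>UNIV. exp (- (x $ i / ?c)\<^sup>2 / 4)))"
      by (simp only: prod.distrib) simp
    also have "(\<Prod>i\<in>UNIV. exp (- (x $ i / ?c)\<^sup>2 / 4)) = exp (- (norm x)\<^sup>2 / (8 * s))"
      using s by (simp add: exp_sum[symmetric] norm_square_vec sum_negf sum_divide_distrib power_divide)
    also have "(\<Prod>i\<in>UNIV. (1 / ?c) ^ Suc (n i)) = (2 * s) powr (- (real (\<Sum>i\<in>UNIV. n i) / 2)) * (2 * s) powr (- (3 / 2))"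
    proof -
      have "(\<Prod>i\<in>UNIV. (1 / ?c) ^ Suc (n i)) = (1 / ?c) ^ (\<Sum>i\<in>UNIV. Suc (n i))" by (simp add: power_sum)
      also have "(\<Sum>i\<in>UNIV. Suc (n i)) = (\<Sum>i\<in>UNIV. n i) + 3" unfolding Suc_eq_plus1 sum.distrib by simp
      also have "(1 / ?c) ^ ((\<Sum>i\<in>UNIV. n i) + 3) = ((2 * s) powr (- (1 / 2))) ^ ((\<Sum>i\<in>UNIV. n i) + 3)"
        using s by (simp add: powr_minus powr_half_sqrt inverse_eq_divide)
      also have "((2 * s) powr (- (1 / 2))) ^ ((\<Sum>i\<in>UNIV. n i) + 3) = (2 * s) powr (- (1 / 2) * real ((\<Sum>i\<in>UNIV. n i) + 3))"
        using s by (simp add: powr_power)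
      also have "- (1 / 2) * real ((\<Sum>i\<in>UNIV. n i) + 3) = - (real (\<Sum>i\<in>UNIV. n i) / 2) + - (3 / 2)"
        unfolding of_nat_add by (simp only: distrib_left)
      finally show ?thesis by (simp only: powr_add)
    qed
    also have "(2 * s) powr (- (real (\<Sum>i\<in>UNIV. n i) / 2)) * (2 * s) powr (- (3 / 2)) * (C ^ 3 * exp (- (norm x)\<^sup>2 / (8 * s)))
       \<le> s powr (- (real (\<Sum>i\<in>UNIV. n i) / 2)) * (2 * s) powr (- (3 / 2)) * (C ^ 3 * exp (- (norm x)\<^sup>2 / (8 * s)))"
      using s C by (intro mult_right_mono powr_mono2') (auto simp: sum_nonneg)
    also have "exp (- (norm x)\<^sup>2 / (8 * s)) = (8 * pi * s) powr (3 / 2) * gauss (2 * s) x"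
      using s by (simp add: gauss_def mult_ac)
    also have "(8 * pi * s) powr (3 / 2) = (4 * pi) powr (3 / 2) * (2 * s) powr (3 / 2)"
      using s by (simp add: powr_mult[symmetric] mult_ac)
    also have "s powr (- (real (\<Sum>i\<in>UNIV. n i) / 2)) * (2 * s) powr (- (3 / 2)) *
        (C ^ 3 * ((4 * pi) powr (3 / 2) * (2 * s) powr (3 / 2) * gauss (2 * s) x))
      = ((2 * s) powr (- (3 / 2)) * (2 * s) powr (3 / 2)) *
         (C ^ 3 * (4 * pi) powr (3 / 2) * s powr (- (real (\<Sum>i\<in>UNIV. n i) / 2)) * gauss (2 * s) x)"
      by (simp only: mult_ac)
    also have "(2 * s) powr (- (3 / 2)) * (2 * s) powr (3 / 2) = 1"
      using s by (simp add: powr_add[symmetric])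
    finally show ?thesis by simp
  qed
  have "1 * 1 \<le> C ^ 3 * (4 * pi) powr (3 / 2)"
    using C pi_gt3 by (intro mult_mono one_le_power ge_one_powr_ge_zero) auto
  then show thesis using that[of "C ^ 3 * (4 * pi) powr (3 / 2)"] bound by simp
qed

subsection \<open>Kernels as mixtures of Gaussian kernels\<close>

lemma nn_integral_exp_norm_square:
  assumes s: "0 < s"
  shows "(\<integral>\<^sup>+(\<xi>::real^3). ennreal (exp (- s * (norm \<xi>)\<^sup>2)) \<partial>lborel) = ennreal ((pi / s) powr (3 / 2))"
proof -
  have "exp (- s * (norm \<xi>)\<^sup>2) = (pi / s) powr (3 / 2) * gauss (1 / (4 * s)) \<xi>" for \<xi> :: "real^3"
    using s by (simp add: gauss_def)
  then have "(\<integral>\<^sup>+(\<xi>::real^3). ennreal (exp (- s * (norm \<xi>)\<^sup>2)) \<partial>lborel)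
      = (\<integral>\<^sup>+(\<xi>::real^3). ennreal ((pi / s) powr (3 / 2)) * ennreal (gauss (1 / (4 * s)) \<xi>) \<partial>lborel)"
    by (simp add: ennreal_mult)
  also have "\<dots> = ennreal ((pi / s) powr (3 / 2))"
    using s by (simp add: nn_integral_cmult nn_integral_gauss)
  finally show ?thesis .
qed

lemma nn_integral_norm_exp_norm_square:
  assumes s: "0 < s"
  shows "(\<integral>\<^sup>+(\<xi>::real^3). ennreal (norm \<xi> * exp (- s * (norm \<xi>)\<^sup>2)) \<partial>lborel)
    \<le> ennreal ((2 * pi) powr (3 / 2) * s powr -2)"
proof -
  have "norm \<xi> * exp (- s * (norm \<xi>)\<^sup>2) \<le> s powr (- (1 / 2)) * exp (- (s / 2) * (norm \<xi>)\<^sup>2)" for \<xi> :: "real^3"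
  proof -
    define y where "y = sqrt s * norm \<xi>"
    have "y \<le> 1 + y\<^sup>2 / 2" using zero_le_power2[of "y - 1"] by (simp add: power2_eq_square algebra_simps)
    also have "\<dots> \<le> exp (y\<^sup>2 / 2)" by (rule exp_ge_add_one_self)
    finally have "y * exp (- y\<^sup>2) \<le> exp (y\<^sup>2 / 2) * exp (- y\<^sup>2)" by (rule mult_right_mono) simp
    also have "\<dots> = exp (- (y\<^sup>2 / 2))" by (simp add: mult_exp_exp)
    finally have "s powr (- (1 / 2)) * (y * exp (- y\<^sup>2)) \<le> s powr (- (1 / 2)) * exp (- (y\<^sup>2 / 2))"
      by (rule mult_left_mono) simp
    moreover have "s powr (- (1 / 2)) * (y * exp (- y\<^sup>2)) = norm \<xi> * exp (- s * (norm \<xi>)\<^sup>2)"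
      using s by (simp add: y_def power_mult_distrib powr_minus powr_half_sqrt)
    moreover have "exp (- (y\<^sup>2 / 2)) = exp (- (s / 2) * (norm \<xi>)\<^sup>2)" using s by (simp add: y_def power_mult_distrib)
    ultimately show ?thesis by (simp only:)
  qed
  then have "(\<integral>\<^sup>+(\<xi>::real^3). ennreal (norm \<xi> * exp (- s * (norm \<xi>)\<^sup>2)) \<partial>lborel)
    \<le> (\<integral>\<^sup>+(\<xi>::real^3). ennreal (s powr (- (1 / 2))) * ennreal (exp (- (s / 2) * (norm \<xi>)\<^sup>2)) \<partial>lborel)"
    by (intro nn_integral_mono) (simp add: ennreal_mult[symmetric] ennreal_leI)
  also have "\<dots> = ennreal (s powr (- (1 / 2))) * ennreal ((pi / (s / 2)) powr (3 / 2))"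
    using nn_integral_exp_norm_square[of "s / 2"] s by (simp add: nn_integral_cmult)
  also have "\<dots> = ennreal (s powr (- (1 / 2)) * (2 * pi * (1 / s)) powr (3 / 2))"
    by (simp add: ennreal_mult mult.commute)
  also have "s powr (- (1 / 2)) * (2 * pi * (1 / s)) powr (3 / 2) = (2 * pi) powr (3 / 2) * (s powr (- (1 / 2)) * s powr (- (3 / 2)))"
    using s by (subst powr_mult) (auto simp: powr_divide powr_minus inverse_eq_divide)
  also have "s powr (- (1 / 2)) * s powr (- (3 / 2)) = s powr -2"
    unfolding powr_add[symmetric] by simp
  finally show ?thesis .
qed

text \<open>Fubini moves the inverse Fourier transform inside the mixture, and the triangle
  inequality for integrals follows. The measure is only sigma-finite because two mixtures occur: the
  law \<eta>, and Lebesgue measure on a half line, which represents \<open>1 / |\<xi>|^2\<close>.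
  The latter diverges at the origin, so \<open>\<xi> = 0\<close> is excluded.\<close>

lemma Gaussian_mixture_bound:
  fixes P :: "real^3 \<Rightarrow> complex"
  assumes M: "sigma_finite_measure M" and sets: "sets M = sets borel"
    and [measurable]: "P \<in> borel_measurable borel" "m \<in> borel_measurable borel"
    and m: "\<And>\<xi>. \<xi> \<noteq> 0 \<Longrightarrow> (\<integral>\<^sup>+s. ennreal (exp (- (\<tau> * s) * (norm \<xi>)\<^sup>2)) \<partial>M) = ennreal (m \<xi>)"
      "\<And>\<xi>. \<xi> \<noteq> 0 \<Longrightarrow> 0 \<le> m \<xi>"
    and fin: "(\<integral>\<^sup>+\<xi>. ennreal (norm (P \<xi>)) * ennreal (m \<xi>) \<partial>lborel) < \<infinity>"
  shows "ennreal (norm (LINT \<xi>|lborel. cis (x \<bullet> \<xi>) * (P \<xi> * of_real (m \<xi>))))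
    \<le> (\<integral>\<^sup>+s. ennreal (norm (LINT \<xi>|lborel. cis (x \<bullet> \<xi>) * (P \<xi> * of_real (exp (- (\<tau> * s) * (norm \<xi>)\<^sup>2))))) \<partial>M)"
proof -
  note sets[measurable_cong]
  interpret M: sigma_finite_measure M by (rule M)
  interpret P: pair_sigma_finite "lborel :: (real^3) measure" M ..
  define G where "G \<xi> s = cis (x \<bullet> \<xi>) * (P \<xi> * of_real (exp (- (\<tau> * s) * (norm \<xi>)\<^sup>2)))" for \<xi> s
  have G[measurable]: "case_prod G \<in> borel_measurable (lborel \<Otimes>\<^sub>M M)" unfolding G_def by measurable
  have nn: "(\<integral>\<^sup>+s. ennreal (norm (G \<xi> s)) \<partial>M) = ennreal (norm (P \<xi>)) * ennreal (m \<xi>)" if "\<xi> \<noteq> 0" for \<xi>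
  proof -
    have "(\<integral>\<^sup>+s. ennreal (norm (G \<xi> s)) \<partial>M) = (\<integral>\<^sup>+s. ennreal (norm (P \<xi>)) * ennreal (exp (- (\<tau> * s) * (norm \<xi>)\<^sup>2)) \<partial>M)"
      by (simp add: G_def norm_mult ennreal_mult)
    also have "\<dots> = ennreal (norm (P \<xi>)) * ennreal (m \<xi>)"
      using m(1)[OF that] by (subst nn_integral_cmult) auto
    finally show ?thesis .
  qed
  have int: "integrable (lborel \<Otimes>\<^sub>M M) (case_prod G)"
  proof (rule integrableI_bounded)
    have "(\<integral>\<^sup>+z. ennreal (norm (case_prod G z)) \<partial>(lborel \<Otimes>\<^sub>M M)) = (\<integral>\<^sup>+\<xi>. \<integral>\<^sup>+s. ennreal (norm (G \<xi> s)) \<partial>M \<partial>lborel)"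
      by (subst M.nn_integral_fst[symmetric]) auto
    also have "\<dots> = (\<integral>\<^sup>+\<xi>. ennreal (norm (P \<xi>)) * ennreal (m \<xi>) \<partial>lborel)"
      by (rule nn_integral_cong_AE) (use AE_lborel_singleton[of "0::real^3"] in \<open>eventually_elim, simp add: nn\<close>)
    finally show "(\<integral>\<^sup>+z. ennreal (norm (case_prod G z)) \<partial>(lborel \<Otimes>\<^sub>M M)) < \<infinity>" using fin by simp
  qed (rule G)
  have inner: "(LINT s|M. G \<xi> s) = cis (x \<bullet> \<xi>) * (P \<xi> * of_real (m \<xi>))" if "\<xi> \<noteq> 0" for \<xi>
  proof -
    have "has_bochner_integral M (\<lambda>s. exp (- (\<tau> * s) * (norm \<xi>)\<^sup>2)) (m \<xi>)"
      by (rule has_bochner_integral_nn_integral) (use m that in auto)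
    then have "(LINT s|M. exp (- (\<tau> * s) * (norm \<xi>)\<^sup>2)) = m \<xi>" by (rule has_bochner_integral_integral_eq)
    then show ?thesis unfolding G_def by simp
  qed
  have "(LINT \<xi>|lborel. cis (x \<bullet> \<xi>) * (P \<xi> * of_real (m \<xi>))) = (LINT \<xi>|lborel. LINT s|M. G \<xi> s)"
  proof (rule integral_cong_AE)
    show "AE \<xi> in lborel. cis (x \<bullet> \<xi>) * (P \<xi> * of_real (m \<xi>)) = (LINT s|M. G \<xi> s)"
      using AE_lborel_singleton[of "0::real^3"] by eventually_elim (simp add: inner)
  qed measurable
  also have "\<dots> = (LINT s|M. LINT \<xi>|lborel. G \<xi> s)"
    by (rule P.Fubini_integral[OF int, symmetric])
  finally have eq: "(LINT \<xi>|lborel. cis (x \<bullet> \<xi>) * (P \<xi> * of_real (m \<xi>))) = (LINT s|M. LINT \<xi>|lborel. G \<xi> s)" .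
  show ?thesis unfolding eq G_def[symmetric]
    by (rule integral_norm_bound_ennreal) (rule P.integrable_snd[OF int])
qed

section \<open>Subordination of kernels\<close>

locale stable_subordinator =
  fixes \<alpha> :: real and \<eta> :: "real measure"
  assumes \<alpha>: "1 / 2 < \<alpha>" "\<alpha> \<le> 1"
    and prob_\<eta>: "prob_space \<eta>" and sets_\<eta> [simp, measurable_cong]: "sets \<eta> = sets borel"
    and \<eta>_pos: "AE s in \<eta>. 0 < s"
    and \<eta>_Laplace: "\<And>l. 0 < l \<Longrightarrow> Laplace \<eta> l = ennreal (exp (- (l powr \<alpha>)))"
begin

sublocale prob_space \<eta> by (rule prob_\<eta>)

text \<open>The weight \<open>1 + s powr -2\<close> dominates all the powers of \<open>s\<close>
  that the kernel estimates produce, of orders \<open>-1/2\<close>, \<open>-3/2\<close> and -2, so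
  that a single constant \<open>K\<close> serves them.\<close>

lemma negative_moment:
  obtains K where "1 \<le> K" "(\<integral>\<^sup>+s. ennreal (1 + s powr -2) \<partial>\<eta>) = ennreal K"
proof -
  have fin: "(\<integral>\<^sup>+s. ennreal (s powr -2) \<partial>\<eta>) < \<infinity>"
    by (rule stable_negative_moment[OF _ prob_\<eta> sets_\<eta> \<eta>_pos \<eta>_Laplace]) (use \<alpha> in auto)
  have "(\<integral>\<^sup>+s. ennreal (1 + s powr -2) \<partial>\<eta>) = 1 + (\<integral>\<^sup>+s. ennreal (s powr -2) \<partial>\<eta>)"
    by (simp add: nn_integral_add emeasure_space_1)
  also have "\<dots> = ennreal (1 + enn2real (\<integral>\<^sup>+s. ennreal (s powr -2) \<partial>\<eta>))"
    using fin by (subst ennreal_plus) (auto simp: less_top)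
  finally show thesis by (rule that[rotated]) simp
qed

text \<open>If \<open>s\<close> has law \<eta>, then \<open>t powr (1 / \<alpha>) * s\<close> has
  the law of the stable subordinator at time \<open>t\<close>, whose Laplace transform is evaluated
  at the square of the frequency.\<close>

lemma mixture_symbol:
  assumes "0 < t" "\<xi> \<noteq> 0"
  shows "(\<integral>\<^sup>+s. ennreal (exp (- (t powr (1 / \<alpha>) * s) * (norm \<xi>)\<^sup>2)) \<partial>\<eta>) = ennreal (exp (- t * norm \<xi> powr (2 * \<alpha>)))"
proof -
  have "(\<integral>\<^sup>+s. ennreal (exp (- (t powr (1 / \<alpha>) * s) * (norm \<xi>)\<^sup>2)) \<partial>\<eta>) = Laplace \<eta> (t powr (1 / \<alpha>) * (norm \<xi>)\<^sup>2)"
    unfolding Laplace_def by (simp add: mult_ac)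
  also have "\<dots> = ennreal (exp (- ((t powr (1 / \<alpha>) * (norm \<xi>)\<^sup>2) powr \<alpha>)))"
    by (rule \<eta>_Laplace) (use assms in simp)
  also have "(t powr (1 / \<alpha>) * (norm \<xi>)\<^sup>2) powr \<alpha> = t * norm \<xi> powr (2 * \<alpha>)"
  proof -
    have "(norm \<xi>)\<^sup>2 = norm \<xi> powr 2" using assms by simp
    then have "((norm \<xi>)\<^sup>2) powr \<alpha> = norm \<xi> powr (2 * \<alpha>)" by (simp only: powr_powr)
    then show ?thesis using assms \<alpha> by (simp add: powr_mult powr_powr)
  qed
  finally show ?thesis by simp
qed

text \<open>The linear growth allowed for \<open>P\<close> covers both the heat symbol and the Oseen
  symbol. Absolute convergence holds because the Gaussian integrals of 1 and of the norm are of
  order \<open>-3/2\<close> and -2 in the parameter, which the negative moment of \<eta>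
  controls.\<close>

lemma subordination_bound:
  fixes P :: "real^3 \<Rightarrow> complex"
  assumes [measurable]: "P \<in> borel_measurable borel"
    and P: "\<And>\<xi>. norm (P \<xi>) \<le> c * (1 + norm \<xi>)" and t: "0 < t"
  shows "ennreal \<bar>kernel (\<lambda>\<xi>. P \<xi> * of_real (exp (- t * norm \<xi> powr (2 * \<alpha>)))) x\<bar>
    \<le> (\<integral>\<^sup>+s. ennreal (norm (LINT \<xi>|lborel. cis (x \<bullet> \<xi>) * (P \<xi> * of_real (exp (- (t powr (1 / \<alpha>) * s) * (norm \<xi>)\<^sup>2))))) \<partial>\<eta>)"
proof -
  let ?m = "\<lambda>\<xi>::real^3. exp (- t * norm \<xi> powr (2 * \<alpha>))"
  define \<tau> where "\<tau> = t powr (1 / \<alpha>)"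
  have \<tau>: "0 < \<tau>" using t by (simp add: \<tau>_def)
  interpret P: pair_sigma_finite "lborel :: (real^3) measure" \<eta> ..
  obtain K where K: "1 \<le> K" "(\<integral>\<^sup>+s. ennreal (1 + s powr -2) \<partial>\<eta>) = ennreal K" by (rule negative_moment)
  have c: "0 \<le> c" using order.trans[OF norm_ge_zero P[of 0]] by simp
  define D where "D = (pi / \<tau>) powr (3 / 2) + (2 * pi) powr (3 / 2) * \<tau> powr -2"
  have D: "0 \<le> D" by (simp add: D_def)
  have fin: "(\<integral>\<^sup>+\<xi>. ennreal (norm (P \<xi>)) * ennreal (?m \<xi>) \<partial>lborel) < \<infinity>"
  proof -
    have "(\<integral>\<^sup>+\<xi>. ennreal (norm (P \<xi>)) * ennreal (?m \<xi>) \<partial>lborel)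
      \<le> (\<integral>\<^sup>+(\<xi>::real^3). (\<integral>\<^sup>+s. ennreal (c * (1 + norm \<xi>)) * ennreal (exp (- (\<tau> * s) * (norm \<xi>)\<^sup>2)) \<partial>\<eta>) \<partial>lborel)"
    proof (rule nn_integral_mono_AE)
      show "AE \<xi>::real^3 in lborel. ennreal (norm (P \<xi>)) * ennreal (?m \<xi>) \<le>
          (\<integral>\<^sup>+s. ennreal (c * (1 + norm \<xi>)) * ennreal (exp (- (\<tau> * s) * (norm \<xi>)\<^sup>2)) \<partial>\<eta>)"
        using AE_lborel_singleton[of "0::real^3"]
      proof eventually_elim
        case (elim \<xi>)
        have "(\<integral>\<^sup>+s. ennreal (c * (1 + norm \<xi>)) * ennreal (exp (- (\<tau> * s) * (norm \<xi>)\<^sup>2)) \<partial>\<eta>)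
          = ennreal (c * (1 + norm \<xi>)) * ennreal (?m \<xi>)"
          unfolding \<tau>_def mixture_symbol[OF t elim, symmetric] by (rule nn_integral_cmult) measurable
        then show ?case by (auto intro!: mult_right_mono ennreal_leI P)
      qed
    qed
    also have "\<dots> = (\<integral>\<^sup>+s. (\<integral>\<^sup>+(\<xi>::real^3). ennreal (c * (1 + norm \<xi>)) * ennreal (exp (- (\<tau> * s) * (norm \<xi>)\<^sup>2)) \<partial>lborel) \<partial>\<eta>)"
      by (rule P.Fubini'[symmetric]) measurable
    also have "\<dots> \<le> (\<integral>\<^sup>+s. ennreal (c * D) * ennreal (1 + s powr -2) \<partial>\<eta>)"
    proof (rule nn_integral_mono_AE)
      show "AE s in \<eta>. (\<integral>\<^sup>+(\<xi>::real^3). ennreal (c * (1 + norm \<xi>)) * ennreal (exp (- (\<tau> * s) * (norm \<xi>)\<^sup>2)) \<partial>lborel)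
        \<le> ennreal (c * D) * ennreal (1 + s powr -2)"
        using \<eta>_pos
      proof eventually_elim
        case (elim s)
        have s\<tau>: "0 < \<tau> * s" using elim \<tau> by simp
        have "(\<integral>\<^sup>+(\<xi>::real^3). ennreal (c * (1 + norm \<xi>)) * ennreal (exp (- (\<tau> * s) * (norm \<xi>)\<^sup>2)) \<partial>lborel)
          = (\<integral>\<^sup>+(\<xi>::real^3). ennreal c * (ennreal (exp (- (\<tau> * s) * (norm \<xi>)\<^sup>2)) + ennreal (norm \<xi> * exp (- (\<tau> * s) * (norm \<xi>)\<^sup>2))) \<partial>lborel)"
          using c by (intro nn_integral_cong) (simp add: ennreal_mult[symmetric] ennreal_plus[symmetric] distrib_left distrib_right mult.assoc del: ennreal_plus)
        also have "\<dots> = ennreal c * ((\<integral>\<^sup>+(\<xi>::real^3). ennreal (exp (- (\<tau> * s) * (norm \<xi>)\<^sup>2)) \<partial>lborel)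
            + (\<integral>\<^sup>+(\<xi>::real^3). ennreal (norm \<xi> * exp (- (\<tau> * s) * (norm \<xi>)\<^sup>2)) \<partial>lborel))"
          by (simp add: nn_integral_cmult nn_integral_add)
        also have "\<dots> \<le> ennreal c * (ennreal ((pi / (\<tau> * s)) powr (3 / 2)) + ennreal ((2 * pi) powr (3 / 2) * (\<tau> * s) powr -2))"
          by (intro mult_left_mono add_mono eq_refl[OF nn_integral_exp_norm_square] nn_integral_norm_exp_norm_square s\<tau>) auto
        also have "\<dots> = ennreal (c * ((pi / (\<tau> * s)) powr (3 / 2) + (2 * pi) powr (3 / 2) * (\<tau> * s) powr -2))"
          using c by (simp add: ennreal_mult)
        also have "\<dots> \<le> ennreal (c * (D * (1 + s powr -2)))"
        proof (intro ennreal_leI mult_left_mono c)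
          have "s powr (- (3 / 2)) \<le> 1 + s powr -2"
          proof (cases "1 \<le> s")
            case True
            then have "s powr (- (3 / 2)) \<le> 1" using powr_mono2'[of "- (3 / 2)" 1 s] by simp
            then show ?thesis by (simp add: add_increasing2)
          next
            case False
            then have "s powr (- (3 / 2)) \<le> s powr -2" using elim by (intro powr_mono') auto
            then show ?thesis by simp
          qed
          moreover have "(pi / (\<tau> * s)) powr (3 / 2) = (pi / \<tau>) powr (3 / 2) * s powr (- (3 / 2))"
            using elim \<tau> by (simp add: powr_divide powr_mult powr_minus field_simps)
          ultimately have "(pi / (\<tau> * s)) powr (3 / 2) \<le> (pi / \<tau>) powr (3 / 2) * (1 + s powr -2)"
            by (simp add: mult_left_mono)
          moreover have "(\<tau> * s) powr -2 = \<tau> powr -2 * s powr -2" using elim \<tau> by (simp add: powr_mult)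
          then have "(2 * pi) powr (3 / 2) * (\<tau> * s) powr -2 \<le> (2 * pi) powr (3 / 2) * \<tau> powr -2 * (1 + s powr -2)"
            by (simp add: mult_left_mono mult.assoc)
          ultimately show "(pi / (\<tau> * s)) powr (3 / 2) + (2 * pi) powr (3 / 2) * (\<tau> * s) powr -2 \<le> D * (1 + s powr -2)"
            unfolding D_def distrib_right by (rule add_mono)
        qed
        finally show ?case using c D by (simp add: ennreal_mult mult.assoc)
      qed
    qed
    also have "\<dots> = ennreal (c * D) * ennreal K" using K(2) by (subst nn_integral_cmult) auto
    also have "\<dots> < \<infinity>" by (simp add: ennreal_mult_less_top)
    finally show ?thesis .
  qed
  have "kernel (\<lambda>\<xi>. P \<xi> * of_real (?m \<xi>)) x = Re ((LINT \<xi>|lborel. cis (x \<bullet> \<xi>) * (P \<xi> * of_real (?m \<xi>))) / (2 * pi) ^ 3)"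
    unfolding kernel_def by (subst integral_completion) auto
  then have "\<bar>kernel (\<lambda>\<xi>. P \<xi> * of_real (?m \<xi>)) x\<bar> \<le> norm ((LINT \<xi>|lborel. cis (x \<bullet> \<xi>) * (P \<xi> * of_real (?m \<xi>))) / (2 * pi) ^ 3)"
    by (simp only: abs_Re_le_cmod)
  also have "\<dots> \<le> norm (LINT \<xi>|lborel. cis (x \<bullet> \<xi>) * (P \<xi> * of_real (?m \<xi>))) / 1"
  proof -
    have "1 \<le> (2 * pi) ^ 3" using pi_gt3 by (intro one_le_power) simp
    then show ?thesis unfolding norm_divide norm_power by (intro divide_left_mono) (auto simp: norm_mult norm_power)
  qed
  finally have "ennreal \<bar>kernel (\<lambda>\<xi>. P \<xi> * of_real (?m \<xi>)) x\<bar> \<le> ennreal (norm (LINT \<xi>|lborel. cis (x \<bullet> \<xi>) * (P \<xi> * of_real (?m \<xi>))))"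
    by (simp add: ennreal_leI)
  also have "\<dots> \<le> (\<integral>\<^sup>+s. ennreal (norm (LINT \<xi>|lborel. cis (x \<bullet> \<xi>) * (P \<xi> * of_real (exp (- (\<tau> * s) * (norm \<xi>)\<^sup>2))))) \<partial>\<eta>)"
    by (rule Gaussian_mixture_bound) (use mixture_symbol[OF t] fin in \<open>auto simp: \<tau>_def intro: sigma_finite_measure_axioms\<close>)
  finally show ?thesis by (simp add: \<tau>_def)
qed

lemma heat_kernel_bound:
  "\<exists>C>0. \<forall>t x. 0 < t \<longrightarrow> ennreal \<bar>heat_kernel \<alpha> t x\<bar>
     \<le> (\<integral>\<^sup>+s. ennreal C * ennreal (gauss (2 * (t powr (1 / \<alpha>) * s)) x) \<partial>\<eta>)"
proof -
  obtain C where C: "1 \<le> C" "\<And>n s x. 0 < s \<Longrightarrow> (\<And>i. n i \<le> 3) \<Longrightarrow>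
      norm (monomial_kernel n s x) \<le> C * s powr (- (real (\<Sum>i\<in>UNIV. n i) / 2)) * gauss (2 * s) x"
    by (rule monomial_kernel_bound) metis
  have "ennreal \<bar>heat_kernel \<alpha> t x\<bar> \<le> (\<integral>\<^sup>+s. ennreal C * ennreal (gauss (2 * (t powr (1 / \<alpha>) * s)) x) \<partial>\<eta>)"
    if t: "0 < t" for t x
  proof -
    have "ennreal \<bar>heat_kernel \<alpha> t x\<bar> \<le> (\<integral>\<^sup>+s. ennreal (norm (LINT \<xi>|lborel. cis (x \<bullet> \<xi>) *
        (1 * of_real (exp (- (t powr (1 / \<alpha>) * s) * (norm \<xi>)\<^sup>2))))) \<partial>\<eta>)"
      using subordination_bound[of "\<lambda>_. 1" 1 t x] t by (simp add: heat_kernel_def)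
    also have "\<dots> \<le> (\<integral>\<^sup>+s. ennreal C * ennreal (gauss (2 * (t powr (1 / \<alpha>) * s)) x) \<partial>\<eta>)"
    proof (rule nn_integral_mono_AE)
      show "AE s in \<eta>. ennreal (norm (LINT \<xi>|lborel. cis (x \<bullet> \<xi>) * (1 * of_real (exp (- (t powr (1 / \<alpha>) * s) * (norm \<xi>)\<^sup>2)))))
         \<le> ennreal C * ennreal (gauss (2 * (t powr (1 / \<alpha>) * s)) x)"
        using \<eta>_pos
      proof eventually_elim
        case (elim s)
        have "(LINT \<xi>|lborel. cis (x \<bullet> \<xi>) * (1 * of_real (exp (- (t powr (1 / \<alpha>) * s) * (norm \<xi>)\<^sup>2))))
          = monomial_kernel (\<lambda>_. 0) (t powr (1 / \<alpha>) * s) x"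
          by (simp add: monomial_kernel_def monomial_symbol_def)
        then show ?case using C(2)[of "t powr (1 / \<alpha>) * s" "\<lambda>_. 0" x] C(1) t elim
          by (simp add: ennreal_mult[symmetric] ennreal_leI)
      qed
    qed
    finally show ?thesis .
  qed
  then show ?thesis using C(1) by (intro exI[of _ C]) auto
qed


end

section \<open>The Oseen symbol and its kernel\<close>

definition oseen_symbol :: "3 \<Rightarrow> 3 \<Rightarrow> 3 \<Rightarrow> real^3 \<Rightarrow> complex" where
  "oseen_symbol j h k \<xi> = \<i> * of_real (\<xi> $ k * ((if j = h then 1 else 0) - \<xi> $ j * \<xi> $ h / (norm \<xi>)\<^sup>2))"

lemma vec_nth_measurable [measurable (raw)]:
  fixes f :: "'a \<Rightarrow> 'b::{second_countable_topology, t2_space}^'n::finite"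
  shows "f \<in> borel_measurable M \<Longrightarrow> (\<lambda>x. f x $ i) \<in> borel_measurable M"
  by (rule borel_measurable_continuous_on[where f = "\<lambda>v. v $ i"]) (auto intro: continuous_intros)

lemma oseen_symbol_measurable [measurable]: "oseen_symbol j h k \<in> borel_measurable borel"
  unfolding oseen_symbol_def by measurable

lemma abs_vec_nth_le: "\<bar>\<xi> $ i\<bar> \<le> norm \<xi>" for \<xi> :: "real^'n::finite"
  by (rule component_le_norm_cart)

lemma abs_nth_mult_nth_le: "\<bar>\<xi> $ j * \<xi> $ h / (norm \<xi>)\<^sup>2\<bar> \<le> 1" for \<xi> :: "real^'n::finite"
proof (cases "\<xi> = 0")
  case False
  have "\<bar>\<xi> $ j * \<xi> $ h\<bar> \<le> norm \<xi> * norm \<xi>"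
    unfolding abs_mult by (intro mult_mono abs_vec_nth_le) auto
  then show ?thesis using False by (simp add: abs_mult power2_eq_square divide_le_eq)
qed simp

lemma norm_oseen_symbol: "norm (oseen_symbol j h k \<xi>) \<le> 2 * (1 + norm \<xi>)"
proof -
  have "\<bar>(if j = h then 1 else 0) - \<xi> $ j * \<xi> $ h / (norm \<xi>)\<^sup>2\<bar> \<le> 2"
  proof -
    have "\<bar>d - z\<bar> \<le> 2" if "\<bar>z\<bar> \<le> 1" "\<bar>d\<bar> \<le> 1" for d z :: real using that by linarith
    then show ?thesis using abs_nth_mult_nth_le[of \<xi> j h] by simp
  qed
  then have "\<bar>\<xi> $ k\<bar> * \<bar>(if j = h then 1 else 0) - \<xi> $ j * \<xi> $ h / (norm \<xi>)\<^sup>2\<bar> \<le> norm \<xi> * 2"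
    by (intro mult_mono abs_vec_nth_le) auto
  then show ?thesis unfolding oseen_symbol_def norm_mult norm_of_real abs_mult by simp
qed

lemma monomial_kernel_measurable [measurable]: "(\<lambda>s. monomial_kernel n s x) \<in> borel_measurable borel"
  unfolding monomial_kernel_def monomial_symbol_def by measurable

lemma prod_power_indicator: "(\<Prod>i\<in>UNIV. (\<xi> $ i) ^ (if i = k then 1 else 0)) = \<xi> $ k" for \<xi> :: "real^'n::finite"
proof -
  have "(\<xi> $ i) ^ (if i = k then 1 else 0) = (if i = k then \<xi> $ k else 1)" for i by simp
  then show ?thesis by (simp only: prod.delta finite_class.finite_UNIV) simp
qed

lemma mixture_tail:
  assumes "\<xi> \<noteq> 0"
  shows "(\<integral>\<^sup>+s. ennreal (exp (- (1 * s) * (norm \<xi>)\<^sup>2)) \<partial>density lborel (indicator {\<sigma>..}))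
    = ennreal (exp (- \<sigma> * (norm \<xi>)\<^sup>2) / (norm \<xi>)\<^sup>2)"
proof -
  let ?n = "(norm \<xi>)\<^sup>2"
  have n: "0 < ?n" using assms by simp
  have "(\<integral>\<^sup>+s. ennreal (exp (- (1 * s) * ?n)) \<partial>density lborel (indicator {\<sigma>..}))
     = (\<integral>\<^sup>+s. ennreal (exp (- s * ?n)) * indicator {\<sigma>..} s \<partial>lborel)"
    by (simp add: nn_integral_density mult.commute)
  also have "\<dots> = ennreal (0 - (- exp (- \<sigma> * ?n) / ?n))"
  proof (rule nn_integral_FTC_atLeast)
    have "((\<lambda>s. - exp (- s * n) / n) has_real_derivative exp (- s * n)) (at s)" if "0 < n" for n s :: real
      using that by (auto intro!: derivative_eq_intros)
    from this[OF n] show "((\<lambda>s. - exp (- s * ?n) / ?n) has_real_derivative exp (- s * ?n)) (at s)" for s .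
    have "filterlim (\<lambda>s::real. ?n * s) at_top at_top"
      by (rule filterlim_tendsto_pos_mult_at_top[OF tendsto_const n filterlim_ident])
    then have "filterlim (\<lambda>s::real. - s * ?n) at_bot at_top"
      by (simp add: filterlim_uminus_at_top mult.commute)
    then have "((\<lambda>s::real. exp (- s * ?n)) \<longlongrightarrow> 0) at_top" by (rule filterlim_compose[OF exp_at_bot])
    then have "((\<lambda>s::real. - exp (- s * ?n) / ?n) \<longlongrightarrow> - 0 / ?n) at_top"
      by (intro tendsto_intros) (use n in auto)
    then show "((\<lambda>s::real. - exp (- s * ?n) / ?n) \<longlongrightarrow> 0) at_top" by simp
  qed auto
  finally show ?thesis by simp
qed

text \<open>The Riesz transforms disappear by \<open>e\<^bsup>-\<sigma>\<bar>\<xi>\<bar>\<^sup>2\<^esup> / \<bar>\<xi>\<bar>\<^sup>2 = \<integral>\<^sub>\<sigma>\<^sup>\<infinity> e\<^bsup>-s\<bar>\<xi>\<bar>\<^sup>2\<^esup> ds\<close>.\<close>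

lemma oseen_Gaussian_bound:
  obtains C where "1 \<le> C"
    "\<And>\<sigma> x j h k. 0 < \<sigma> \<Longrightarrow>
      ennreal (norm (LINT \<xi>|lborel. cis (x \<bullet> \<xi>) * (oseen_symbol j h k \<xi> * of_real (exp (- \<sigma> * (norm \<xi>)\<^sup>2)))))
      \<le> ennreal C * (ennreal (\<sigma> powr (- (1 / 2)) * gauss (2 * \<sigma>) x) +
         (\<integral>\<^sup>+s. ennreal (s powr (- (3 / 2)) * gauss (2 * s) x) * indicator {\<sigma>..} s \<partial>lborel))"
proof -
  obtain C where C: "1 \<le> C" "\<And>n s x. 0 < s \<Longrightarrow> (\<And>i. n i \<le> 3) \<Longrightarrow>
      norm (monomial_kernel n s x) \<le> C * s powr (- (real (\<Sum>i\<in>UNIV. n i) / 2)) * gauss (2 * s) x"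
    by (rule monomial_kernel_bound) metis
  show thesis
  proof (rule that[OF C(1)])
    fix \<sigma> :: real and x :: "real^3" and j h k :: 3
    assume \<sigma>: "0 < \<sigma>"
    let ?c = "\<lambda>\<xi>. cis (x \<bullet> \<xi>)"
    \<comment> \<open>Multi-indices of the monomials with indices \<open>k\<close> and
      \<open>k, j, h\<close>. Coinciding indices accumulate, so a single coordinate can have
      exponent 3.\<close>
    define n1 where "n1 i = (if i = k then 1 else 0 :: nat)" for i
    define n3 where "n3 i = (if i = k then 1 else 0) + (if i = j then 1 else 0) + (if i = h then 1 else 0 :: nat)" for i
    have n1: "n1 i \<le> 3" "(\<Sum>i\<in>UNIV. n1 i) = 1" for i by (auto simp: n1_def)
    have n3: "n3 i \<le> 3" "(\<Sum>i\<in>UNIV. n3 i) = 3" for i by (auto simp: n3_def sum.distrib)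
    have m1: "monomial_symbol n1 s \<xi> = \<xi> $ k * exp (- s * (norm \<xi>)\<^sup>2)" for s \<xi>
      unfolding monomial_symbol_def n1_def prod_power_indicator ..
    have m3: "monomial_symbol n3 s \<xi> = \<xi> $ k * \<xi> $ j * \<xi> $ h * exp (- s * (norm \<xi>)\<^sup>2)" for s \<xi>
      unfolding monomial_symbol_def n3_def power_add prod.distrib prod_power_indicator ..
    define R where "R \<xi> = exp (- \<sigma> * (norm \<xi>)\<^sup>2) / (norm \<xi>)\<^sup>2" for \<xi> :: "real^3"
    define Q where "Q \<xi> = complex_of_real (\<xi> $ k * \<xi> $ j * \<xi> $ h)" for \<xi> :: "real^3"
    have [measurable]: "R \<in> borel_measurable borel" "Q \<in> borel_measurable borel"
      unfolding R_def Q_def by measurable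
    have QR: "norm (Q \<xi> * of_real (R \<xi>)) \<le> norm \<xi> * exp (- \<sigma> * (norm \<xi>)\<^sup>2)" for \<xi>
    proof -
      have "\<bar>\<xi> $ k\<bar> * \<bar>\<xi> $ j * \<xi> $ h / (norm \<xi>)\<^sup>2\<bar> \<le> norm \<xi> * 1"
        by (intro mult_mono abs_vec_nth_le abs_nth_mult_nth_le) auto
      then have "\<bar>\<xi> $ k\<bar> * \<bar>\<xi> $ j * \<xi> $ h / (norm \<xi>)\<^sup>2\<bar> * exp (- \<sigma> * (norm \<xi>)\<^sup>2) \<le> norm \<xi> * 1 * exp (- \<sigma> * (norm \<xi>)\<^sup>2)"
        by (rule mult_right_mono) simp
      then show ?thesis by (simp add: Q_def R_def norm_mult abs_mult mult.assoc norm_divide norm_power)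
    qed
    have fin: "(\<integral>\<^sup>+(\<xi>::real^3). ennreal (norm \<xi> * exp (- \<sigma> * (norm \<xi>)\<^sup>2)) \<partial>lborel) < \<infinity>"
      using order.strict_trans1[OF nn_integral_norm_exp_norm_square[OF \<sigma>]] by simp
    have int0: "integrable lborel (\<lambda>\<xi>::real^3. norm \<xi> * exp (- \<sigma> * (norm \<xi>)\<^sup>2))"
      by (rule integrableI_bounded) (use fin in auto)
    have int2: "integrable lborel (\<lambda>\<xi>. ?c \<xi> * (Q \<xi> * of_real (R \<xi>)))"
      by (rule Bochner_Integration.integrable_bound[OF int0])
        (use QR in \<open>auto simp: norm_mult intro!: AE_I2 order.trans[OF _ abs_ge_self]\<close>)
    have int1: "integrable lborel (\<lambda>\<xi>. ?c \<xi> * of_real (monomial_symbol n1 \<sigma> \<xi>))"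
      by (rule Bochner_Integration.integrable_bound[OF int0])
        (auto simp: m1 norm_mult abs_mult intro!: mult_right_mono abs_vec_nth_le)
    have "?c \<xi> * (oseen_symbol j h k \<xi> * of_real (exp (- \<sigma> * (norm \<xi>)\<^sup>2))) =
       (\<i> * of_real (if j = h then 1 else 0)) * (?c \<xi> * of_real (monomial_symbol n1 \<sigma> \<xi>)) - \<i> * (?c \<xi> * (Q \<xi> * of_real (R \<xi>)))" for \<xi>
      by (simp add: oseen_symbol_def m1 Q_def R_def algebra_simps)
    then have "(LINT \<xi>|lborel. ?c \<xi> * (oseen_symbol j h k \<xi> * of_real (exp (- \<sigma> * (norm \<xi>)\<^sup>2))))
      = (\<i> * of_real (if j = h then 1 else 0)) * monomial_kernel n1 \<sigma> x - \<i> * (LINT \<xi>|lborel. ?c \<xi> * (Q \<xi> * of_real (R \<xi>)))"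
      unfolding monomial_kernel_def using int1 int2
      by (simp only: Bochner_Integration.integral_diff integrable_mult_right integral_mult_right_zero)
    then have "norm (LINT \<xi>|lborel. ?c \<xi> * (oseen_symbol j h k \<xi> * of_real (exp (- \<sigma> * (norm \<xi>)\<^sup>2))))
      \<le> norm (monomial_kernel n1 \<sigma> x) + norm (LINT \<xi>|lborel. ?c \<xi> * (Q \<xi> * of_real (R \<xi>)))"
      by (auto simp: norm_mult intro!: order.trans[OF norm_triangle_ineq4])
    then have "ennreal (norm (LINT \<xi>|lborel. ?c \<xi> * (oseen_symbol j h k \<xi> * of_real (exp (- \<sigma> * (norm \<xi>)\<^sup>2)))))
      \<le> ennreal (norm (monomial_kernel n1 \<sigma> x)) + ennreal (norm (LINT \<xi>|lborel. ?c \<xi> * (Q \<xi> * of_real (R \<xi>))))"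
      by (simp add: ennreal_plus[symmetric] ennreal_leI del: ennreal_plus)
    also have "ennreal (norm (monomial_kernel n1 \<sigma> x)) \<le> ennreal C * ennreal (\<sigma> powr (- (1 / 2)) * gauss (2 * \<sigma>) x)"
      using C(2)[of \<sigma> n1 x, OF \<sigma> n1(1)] C(1) by (simp add: n1(2) ennreal_mult[symmetric] ennreal_leI mult.assoc)
    also have "ennreal (norm (LINT \<xi>|lborel. ?c \<xi> * (Q \<xi> * of_real (R \<xi>))))
      \<le> (\<integral>\<^sup>+s. ennreal (norm (LINT \<xi>|lborel. ?c \<xi> * (Q \<xi> * of_real (exp (- (1 * s) * (norm \<xi>)\<^sup>2))))) \<partial>density lborel (indicator {\<sigma>..}))"
    proof (rule Gaussian_mixture_bound)
      show "sigma_finite_measure (density lborel (indicator {\<sigma>..}) :: real measure)"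
        by (subst sigma_finite_measure.sigma_finite_iff_density_finite[OF sigma_finite_lborel])
          (auto split: split_indicator)
      show "(\<integral>\<^sup>+s. ennreal (exp (- (1 * s) * (norm \<xi>)\<^sup>2)) \<partial>density lborel (indicator {\<sigma>..})) = ennreal (R \<xi>)"
        if "\<xi> \<noteq> 0" for \<xi> using mixture_tail[OF that, of \<sigma>] by (simp add: R_def)
      show "(\<integral>\<^sup>+\<xi>. ennreal (norm (Q \<xi>)) * ennreal (R \<xi>) \<partial>lborel) < \<infinity>"
      proof (rule order.strict_trans1[OF nn_integral_mono fin])
        show "ennreal (norm (Q \<xi>)) * ennreal (R \<xi>) \<le> ennreal (norm \<xi> * exp (- \<sigma> * (norm \<xi>)\<^sup>2))" for \<xi>
          using QR[of \<xi>] by (simp add: norm_mult norm_divide norm_power ennreal_mult[symmetric] ennreal_leI R_def)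
      qed
    qed (auto simp: R_def)
    also have "\<dots> = (\<integral>\<^sup>+s. ennreal (norm (monomial_kernel n3 s x)) * indicator {\<sigma>..} s \<partial>lborel)"
    proof -
      have "(LINT \<xi>|lborel. ?c \<xi> * (Q \<xi> * of_real (exp (- (1 * s) * (norm \<xi>)\<^sup>2)))) = monomial_kernel n3 s x" for s
        by (simp add: monomial_kernel_def m3 Q_def mult.assoc)
      then show ?thesis
        by (subst nn_integral_density) (auto simp: mult.commute)
    qed
    also have "\<dots> \<le> (\<integral>\<^sup>+s. ennreal C * (ennreal (s powr (- (3 / 2)) * gauss (2 * s) x) * indicator {\<sigma>..} s) \<partial>lborel)"
    proof (rule nn_integral_mono)
      fix s
      show "ennreal (norm (monomial_kernel n3 s x)) * indicator {\<sigma>..} s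
        \<le> ennreal C * (ennreal (s powr (- (3 / 2)) * gauss (2 * s) x) * indicator {\<sigma>..} s)"
        using C(2)[of s n3 x, OF _ n3(1)] C(1) \<sigma>
        by (auto simp: n3(2) ennreal_mult[symmetric] ennreal_leI mult.assoc split: split_indicator)
    qed
    also have "\<dots> = ennreal C * (\<integral>\<^sup>+s. ennreal (s powr (- (3 / 2)) * gauss (2 * s) x) * indicator {\<sigma>..} s \<partial>lborel)"
      by (rule nn_integral_cmult) measurable
    finally show "ennreal (norm (LINT \<xi>|lborel. ?c \<xi> * (oseen_symbol j h k \<xi> * of_real (exp (- \<sigma> * (norm \<xi>)\<^sup>2)))))
      \<le> ennreal C * (ennreal (\<sigma> powr (- (1 / 2)) * gauss (2 * \<sigma>) x) +
         (\<integral>\<^sup>+s. ennreal (s powr (- (3 / 2)) * gauss (2 * s) x) * indicator {\<sigma>..} s \<partial>lborel))"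
      by (simp add: distrib_left add_mono)
  qed
qed

lemma gauss_le: "0 < s \<Longrightarrow> gauss (2 * s) x \<le> s powr (- (3 / 2))"
proof -
  assume s: "0 < s"
  have "gauss (2 * s) x \<le> 1 / (8 * pi * s) powr (3 / 2)"
    unfolding gauss_def using s by (intro divide_mono) (auto simp: mult.assoc)
  also have "\<dots> \<le> 1 / s powr (3 / 2)"
    using s pi_gt3 by (intro divide_left_mono powr_mono2) auto
  finally show ?thesis by (simp add: powr_minus inverse_eq_divide)
qed

context stable_subordinator
begin

lemma oseen_kernel_eq:
  "oseen_kernel \<alpha> t j h k = kernel (\<lambda>\<xi>. oseen_symbol j h k \<xi> * of_real (exp (- t * norm \<xi> powr (2 * \<alpha>))))"
  unfolding oseen_kernel_def oseen_symbol_def by (simp only: of_real_mult mult.assoc)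

text \<open>One derivative costs \<open>t powr (- (1 / (2 * \<alpha>)))\<close>, and the sup norm
  costs a further \<open>t powr (- (3 / (2 * \<alpha>)))\<close> for the three dimensions. Both are
  read off the Gaussian envelope \<open>B\<close> at parameter
  \<open>t powr (1 / \<alpha>) * s\<close>, of sup norm at most \<open>2 * \<sigma> powr -2\<close>
  and integral at most \<open>3 * \<sigma> powr (- (1 / 2))\<close>, and then averaged over
  \<open>s\<close>.\<close>

lemma oseen_kernel_bounds:
  obtains C where "0 < C"
    "\<And>t j h k x. 0 < t \<Longrightarrow> ennreal \<bar>oseen_kernel \<alpha> t j h k x\<bar> \<le> ennreal (C * t powr (- (2 / \<alpha>)))"
    "\<And>t j h k. 0 < t \<Longrightarrow> (\<integral>\<^sup>+x. ennreal \<bar>oseen_kernel \<alpha> t j h k x\<bar> \<partial>lborel) \<le> ennreal (C * t powr (- (1 / (2 * \<alpha>))))"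
proof -
  obtain C where C: "1 \<le> C" "\<And>\<sigma> x j h k. 0 < \<sigma> \<Longrightarrow>
      ennreal (norm (LINT \<xi>|lborel. cis (x \<bullet> \<xi>) * (oseen_symbol j h k \<xi> * of_real (exp (- \<sigma> * (norm \<xi>)\<^sup>2)))))
      \<le> ennreal C * (ennreal (\<sigma> powr (- (1 / 2)) * gauss (2 * \<sigma>) x) +
         (\<integral>\<^sup>+s. ennreal (s powr (- (3 / 2)) * gauss (2 * s) x) * indicator {\<sigma>..} s \<partial>lborel))"
    by (rule oseen_Gaussian_bound, rule that)
  define B where "B \<sigma> x = ennreal (\<sigma> powr (- (1 / 2)) * gauss (2 * \<sigma>) x) +
         (\<integral>\<^sup>+s. ennreal (s powr (- (3 / 2)) * gauss (2 * s) x) * indicator {\<sigma>..} s \<partial>lborel)" for \<sigma> x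
  have B_eq: "B \<sigma> x = ennreal (\<sigma> powr (- (1 / 2)) * gauss (2 * \<sigma>) x) +
         (\<integral>\<^sup>+s. (if \<sigma> \<le> s then ennreal (s powr (- (3 / 2)) * gauss (2 * s) x) else 0) \<partial>lborel)" for \<sigma> x
    unfolding B_def by (auto intro!: arg_cong2[where f = "(+)"] nn_integral_cong split: split_indicator)
  have [measurable]: "case_prod B \<in> borel_measurable (borel \<Otimes>\<^sub>M borel)"
    unfolding B_eq by measurable
  have B_sup: "B \<sigma> x \<le> ennreal (2 * \<sigma> powr -2)" if \<sigma>: "0 < \<sigma>" for \<sigma> x
  proof -
    have e: "s powr r * s powr (- (3 / 2)) = s powr (r - 3 / 2)" for s r :: real
      by (simp add: powr_diff powr_minus_divide)
    have "\<sigma> powr (- (1 / 2)) * gauss (2 * \<sigma>) x \<le> \<sigma> powr (- (1 / 2)) * \<sigma> powr (- (3 / 2))"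
      by (intro mult_left_mono gauss_le \<sigma>) auto
    also have "\<dots> = \<sigma> powr -2" by (simp add: e)
    finally have 1: "ennreal (\<sigma> powr (- (1 / 2)) * gauss (2 * \<sigma>) x) \<le> ennreal (\<sigma> powr -2)" by (rule ennreal_leI)
    have "(\<integral>\<^sup>+s. ennreal (s powr (- (3 / 2)) * gauss (2 * s) x) * indicator {\<sigma>..} s \<partial>lborel)
       \<le> (\<integral>\<^sup>+s. ennreal (2 * s powr (- 1 - 2)) * indicator {\<sigma>..} s \<partial>lborel)"
    proof (rule nn_integral_mono)
      fix s
      show "ennreal (s powr (- (3 / 2)) * gauss (2 * s) x) * indicator {\<sigma>..} s \<le> ennreal (2 * s powr (- 1 - 2)) * indicator {\<sigma>..} s"
      proof (cases "\<sigma> \<le> s")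
        case True
        then have "s powr (- (3 / 2)) * gauss (2 * s) x \<le> s powr (- (3 / 2)) * s powr (- (3 / 2))"
          using \<sigma> by (intro mult_left_mono gauss_le) auto
        also have "\<dots> \<le> 2 * s powr (- 1 - 2)" by (simp add: e)
        finally show ?thesis by (intro mult_right_mono ennreal_leI) auto
      qed simp
    qed
    also have "\<dots> = ennreal (\<sigma> powr -2)" using \<sigma> by (intro nn_integral_powr_tail) auto
    finally have "B \<sigma> x \<le> ennreal (\<sigma> powr -2) + ennreal (\<sigma> powr -2)" unfolding B_def by (intro add_mono 1)
    then show ?thesis by (simp add: ennreal_plus[symmetric] del: ennreal_plus)
  qed
  have B_int: "(\<integral>\<^sup>+x. B \<sigma> x \<partial>lborel) \<le> ennreal (3 * \<sigma> powr (- (1 / 2)))" if \<sigma>: "0 < \<sigma>" for \<sigma>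
  proof -
    have "(\<integral>\<^sup>+x. B \<sigma> x \<partial>lborel) = (\<integral>\<^sup>+x. ennreal (\<sigma> powr (- (1 / 2)) * gauss (2 * \<sigma>) x) \<partial>lborel)
       + (\<integral>\<^sup>+x. (\<integral>\<^sup>+s. ennreal (s powr (- (3 / 2)) * gauss (2 * s) x) * indicator {\<sigma>..} s \<partial>lborel) \<partial>lborel)"
      unfolding B_def by (rule nn_integral_add) measurable
    also have "(\<integral>\<^sup>+x. ennreal (\<sigma> powr (- (1 / 2)) * gauss (2 * \<sigma>) x) \<partial>lborel) = ennreal (\<sigma> powr (- (1 / 2)))"
      using \<sigma> by (simp add: ennreal_mult nn_integral_cmult nn_integral_gauss)
    also have "(\<integral>\<^sup>+x. (\<integral>\<^sup>+s. ennreal (s powr (- (3 / 2)) * gauss (2 * s) x) * indicator {\<sigma>..} s \<partial>lborel) \<partial>lborel)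
      = (\<integral>\<^sup>+s. (\<integral>\<^sup>+x. ennreal (s powr (- (3 / 2)) * gauss (2 * s) x) * indicator {\<sigma>..} s \<partial>lborel) \<partial>lborel)"
      by (rule lborel_pair.Fubini') measurable
    also have "\<dots> = (\<integral>\<^sup>+s. ennreal 2 * (ennreal (1 / 2 * s powr (- 1 - 1 / 2)) * indicator {\<sigma>..} s) \<partial>lborel)"
    proof (rule nn_integral_cong)
      fix s :: real
      show "(\<integral>\<^sup>+x. ennreal (s powr (- (3 / 2)) * gauss (2 * s) x) * indicator {\<sigma>..} s \<partial>lborel)
         = ennreal 2 * (ennreal (1 / 2 * s powr (- 1 - 1 / 2)) * indicator {\<sigma>..} s)"
      proof (cases "\<sigma> \<le> s")
        case True
        then have "(\<integral>\<^sup>+x. ennreal (s powr (- (3 / 2)) * gauss (2 * s) x) * indicator {\<sigma>..} s \<partial>lborel) = ennreal (s powr (- (3 / 2)))"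
          using \<sigma> by (simp add: ennreal_mult nn_integral_cmult nn_integral_gauss)
        also have "\<dots> = ennreal 2 * ennreal (1 / 2 * s powr (- 1 - 1 / 2))" by (subst ennreal_mult[symmetric]) auto
        finally show ?thesis using True by simp
      qed simp
    qed
    also have "\<dots> = ennreal 2 * ennreal (\<sigma> powr (- (1 / 2)))"
      by (subst nn_integral_cmult, measurable, subst nn_integral_powr_tail) (use \<sigma> in auto)
    also have "ennreal (\<sigma> powr (- (1 / 2))) + ennreal 2 * ennreal (\<sigma> powr (- (1 / 2))) = ennreal (3 * \<sigma> powr (- (1 / 2)))"
      by (subst ennreal_mult[symmetric], simp, simp, subst ennreal_plus[symmetric]) auto
    finally show ?thesis by simp
  qed
  obtain K where K: "1 \<le> K" "(\<integral>\<^sup>+s. ennreal (1 + s powr -2) \<partial>\<eta>) = ennreal K" by (rule negative_moment)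
  have kB: "ennreal \<bar>oseen_kernel \<alpha> t j h k x\<bar> \<le> (\<integral>\<^sup>+s. ennreal C * B (t powr (1 / \<alpha>) * s) x \<partial>\<eta>)"
    if t: "0 < t" for t j h k x
  proof -
    have "ennreal \<bar>oseen_kernel \<alpha> t j h k x\<bar> \<le> (\<integral>\<^sup>+s. ennreal (norm (LINT \<xi>|lborel. cis (x \<bullet> \<xi>) *
        (oseen_symbol j h k \<xi> * of_real (exp (- (t powr (1 / \<alpha>) * s) * (norm \<xi>)\<^sup>2))))) \<partial>\<eta>)"
      unfolding oseen_kernel_eq by (rule subordination_bound[OF _ norm_oseen_symbol t]) measurable
    also have "\<dots> \<le> (\<integral>\<^sup>+s. ennreal C * B (t powr (1 / \<alpha>) * s) x \<partial>\<eta>)"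
    proof (rule nn_integral_mono_AE)
      show "AE s in \<eta>. ennreal (norm (LINT \<xi>|lborel. cis (x \<bullet> \<xi>) *
          (oseen_symbol j h k \<xi> * of_real (exp (- (t powr (1 / \<alpha>) * s) * (norm \<xi>)\<^sup>2)))))
        \<le> ennreal C * B (t powr (1 / \<alpha>) * s) x"
        using \<eta>_pos by eventually_elim (unfold B_def, rule C(2), use t in simp)
    qed
    finally show ?thesis .
  qed
  show thesis
  proof (rule that[of "3 * C * K"])
    show "0 < 3 * C * K" using C K by simp
    fix t j h k assume t: "(0::real) < t"
    define \<tau> where "\<tau> = t powr (1 / \<alpha>)"
    have \<tau>: "0 < \<tau>" using t by (simp add: \<tau>_def)
    have p2: "s powr -2 \<le> 1 + s powr -2" for s :: real by simp
    have p1: "s powr (- (1 / 2)) \<le> 1 + s powr -2" if "0 < s" for s :: real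
    proof (cases "1 \<le> s")
      case True
      then have "s powr (- (1 / 2)) \<le> 1" using powr_mono2'[of "- (1 / 2)" 1 s] by simp
      then show ?thesis by (simp add: add_increasing2)
    next
      case False
      then have "s powr (- (1 / 2)) \<le> s powr -2" using that by (intro powr_mono') auto
      then show ?thesis by simp
    qed
    show "ennreal \<bar>oseen_kernel \<alpha> t j h k x\<bar> \<le> ennreal (3 * C * K * t powr (- (2 / \<alpha>)))" for x
    proof -
      have "ennreal \<bar>oseen_kernel \<alpha> t j h k x\<bar> \<le> (\<integral>\<^sup>+s. ennreal C * B (\<tau> * s) x \<partial>\<eta>)"
        unfolding \<tau>_def by (rule kB[OF t])
      also have "\<dots> \<le> (\<integral>\<^sup>+s. ennreal (3 * C * \<tau> powr -2) * ennreal (1 + s powr -2) \<partial>\<eta>)"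
      proof (rule nn_integral_mono_AE)
        show "AE s in \<eta>. ennreal C * B (\<tau> * s) x \<le> ennreal (3 * C * \<tau> powr -2) * ennreal (1 + s powr -2)"
          using \<eta>_pos
        proof eventually_elim
          case (elim s)
          have "ennreal C * B (\<tau> * s) x \<le> ennreal C * ennreal (2 * (\<tau> * s) powr -2)"
            using elim \<tau> by (intro mult_left_mono B_sup) auto
          also have "\<dots> = ennreal (C * (2 * (\<tau> powr -2 * s powr -2)))"
            using C \<tau> elim by (simp add: ennreal_mult[symmetric] powr_mult)
          also have "\<dots> \<le> ennreal (C * (3 * (\<tau> powr -2 * (1 + s powr -2))))"
            using C by (intro ennreal_leI mult_left_mono mult_mono p2) auto
          also have "\<dots> = ennreal (3 * C * \<tau> powr -2) * ennreal (1 + s powr -2)"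
            using C by (subst ennreal_mult[symmetric]) (auto simp: mult_ac)
          finally show ?case .
        qed
      qed
      also have "\<dots> = ennreal (3 * C * \<tau> powr -2) * ennreal K" using K(2) by (subst nn_integral_cmult) auto
      also have "\<dots> = ennreal (3 * C * K * t powr (- (2 / \<alpha>)))"
        using C K by (subst ennreal_mult[symmetric]) (auto simp: \<tau>_def powr_powr mult_ac)
      finally show ?thesis .
    qed
    have "(\<integral>\<^sup>+x. ennreal \<bar>oseen_kernel \<alpha> t j h k x\<bar> \<partial>lborel) \<le> (\<integral>\<^sup>+x. (\<integral>\<^sup>+s. ennreal C * B (\<tau> * s) x \<partial>\<eta>) \<partial>lborel)"
      unfolding \<tau>_def by (intro nn_integral_mono kB t)
    also have "\<dots> = (\<integral>\<^sup>+s. (\<integral>\<^sup>+x. ennreal C * B (\<tau> * s) x \<partial>lborel) \<partial>\<eta>)"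
    proof -
      interpret P: pair_sigma_finite \<eta> "lborel :: (real^3) measure" ..
      show ?thesis by (rule P.Fubini') measurable
    qed
    also have "\<dots> \<le> (\<integral>\<^sup>+s. ennreal (3 * C * \<tau> powr (- (1 / 2))) * ennreal (1 + s powr -2) \<partial>\<eta>)"
    proof (rule nn_integral_mono_AE)
      show "AE s in \<eta>. (\<integral>\<^sup>+x. ennreal C * B (\<tau> * s) x \<partial>lborel) \<le> ennreal (3 * C * \<tau> powr (- (1 / 2))) * ennreal (1 + s powr -2)"
        using \<eta>_pos
      proof eventually_elim
        case (elim s)
        have "(\<integral>\<^sup>+x. ennreal C * B (\<tau> * s) x \<partial>lborel) = ennreal C * (\<integral>\<^sup>+x. B (\<tau> * s) x \<partial>lborel)"
          by (rule nn_integral_cmult) measurable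
        also have "\<dots> \<le> ennreal C * ennreal (3 * (\<tau> * s) powr (- (1 / 2)))"
          using elim \<tau> by (intro mult_left_mono B_int) auto
        also have "\<dots> = ennreal (C * (3 * (\<tau> powr (- (1 / 2)) * s powr (- (1 / 2)))))"
          using C \<tau> elim by (subst ennreal_mult[symmetric]) (auto simp: powr_mult)
        also have "\<dots> \<le> ennreal (C * (3 * (\<tau> powr (- (1 / 2)) * (1 + s powr -2))))"
          using C by (intro ennreal_leI mult_left_mono p1 elim) auto
        also have "\<dots> = ennreal (3 * C * \<tau> powr (- (1 / 2))) * ennreal (1 + s powr -2)"
          using C by (subst ennreal_mult[symmetric]) (auto simp: mult_ac)
        finally show ?case .
      qed
    qed
    also have "\<dots> = ennreal (3 * C * \<tau> powr (- (1 / 2))) * ennreal K" using K(2) by (subst nn_integral_cmult) auto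
    also have "\<dots> = ennreal (3 * C * K * t powr (- (1 / (2 * \<alpha>))))"
      using C K by (subst ennreal_mult[symmetric]) (auto simp: \<tau>_def powr_powr mult_ac)
    finally show "(\<integral>\<^sup>+x. ennreal \<bar>oseen_kernel \<alpha> t j h k x\<bar> \<partial>lborel) \<le> ennreal (3 * C * K * t powr (- (1 / (2 * \<alpha>))))" .
  qed
qed

end

lemma kernel_measurable:
  assumes [measurable]: "(\<lambda>(t, \<xi>). m t \<xi>) \<in> borel_measurable (borel \<Otimes>\<^sub>M borel)"
  shows "(\<lambda>(t, x). kernel (m t) x) \<in> borel_measurable (borel \<Otimes>\<^sub>M borel)"
proof -
  have "kernel (m t) x = Re ((LINT \<xi>|lborel. cis (x \<bullet> \<xi>) * m t \<xi>) / (2 * pi) ^ 3)" for t x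
    unfolding kernel_def by (subst integral_completion) auto
  then show ?thesis by simp
qed

lemma heat_kernel_measurable [measurable (raw)]:
  assumes [measurable]: "t \<in> borel_measurable M" "x \<in> borel_measurable M"
  shows "(\<lambda>z. heat_kernel \<alpha> (t z) (x z)) \<in> borel_measurable M"
proof -
  have "borel_measurable2 (heat_kernel \<alpha>)"
    unfolding heat_kernel_def by (rule kernel_measurable) measurable
  from measurable_compose[OF _ this, of "\<lambda>z. (t z, x z)"] show ?thesis by simp
qed

lemma oseen_kernel_measurable [measurable (raw)]:
  assumes [measurable]: "t \<in> borel_measurable M" "x \<in> borel_measurable M"
  shows "(\<lambda>z. oseen_kernel \<alpha> (t z) j h k (x z)) \<in> borel_measurable M"
proof -
  have "(\<lambda>(t, x). oseen_kernel \<alpha> t j h k x) \<in> borel_measurable (borel \<Otimes>\<^sub>M borel)"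
    unfolding oseen_kernel_def by (rule kernel_measurable) measurable
  from measurable_compose[OF _ this, of "\<lambda>z. (t z, x z)"] show ?thesis by simp
qed

subsection \<open>Estimates for the heat and Oseen operators\<close>

text \<open>One scalar kernel dominating all 27 components, so that the vector-valued estimates
  reduce to a single convolution.\<close>

definition oseen_abs :: "real \<Rightarrow> real \<Rightarrow> real^3 \<Rightarrow> ennreal" where
  "oseen_abs \<alpha> t z = (\<Sum>j\<in>UNIV. \<Sum>h\<in>UNIV. \<Sum>k\<in>UNIV. ennreal \<bar>oseen_kernel \<alpha> t j h k z\<bar>)"

lemma oseen_abs_measurable [measurable (raw)]:
  assumes [measurable]: "t \<in> borel_measurable M" "x \<in> borel_measurable M"
  shows "(\<lambda>z. oseen_abs \<alpha> (t z) (x z)) \<in> borel_measurable M"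
  unfolding oseen_abs_def by measurable

definition heat_conv_abs :: "real \<Rightarrow> real \<Rightarrow> (real^3 \<Rightarrow> ennreal) \<Rightarrow> real^3 \<Rightarrow> ennreal" where
  "heat_conv_abs \<alpha> t w x = (\<integral>\<^sup>+y. ennreal \<bar>heat_kernel \<alpha> t (x - y)\<bar> * w y \<partial>lborel)"

definition oseen_conv_abs :: "real \<Rightarrow> real \<Rightarrow> (real^3 \<Rightarrow> ennreal) \<Rightarrow> real^3 \<Rightarrow> ennreal" where
  "oseen_conv_abs \<alpha> t w x = (\<integral>\<^sup>+y. oseen_abs \<alpha> t (x - y) * w y \<partial>lborel)"

lemma heat_conv_abs_measurable [measurable (raw)]:
  assumes [measurable]: "t \<in> borel_measurable M" "f \<in> borel_measurable M"
    "(\<lambda>(z, y). w z y) \<in> borel_measurable (M \<Otimes>\<^sub>M borel)"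
  shows "(\<lambda>z. heat_conv_abs \<alpha> (t z) (w z) (f z)) \<in> borel_measurable M"
  unfolding heat_conv_abs_def by measurable

lemma oseen_conv_abs_measurable [measurable (raw)]:
  assumes [measurable]: "t \<in> borel_measurable M" "f \<in> borel_measurable M"
    "(\<lambda>(z, y). w z y) \<in> borel_measurable (M \<Otimes>\<^sub>M borel)"
  shows "(\<lambda>z. oseen_conv_abs \<alpha> (t z) (w z) (f z)) \<in> borel_measurable M"
  unfolding oseen_conv_abs_def by measurable

section \<open>The Duhamel operator with absolute values\<close>

context stable_subordinator
begin

text \<open>With values in [0,\<infinity>] the operator is defined and monotone at every point. The
  source \<open>H\<close> stands for a bound of the products of velocity components.\<close>

definition duhamel_abs :: "(real \<Rightarrow> real^3 \<Rightarrow> ennreal) \<Rightarrow> real \<Rightarrow> real^3 \<Rightarrow> ennreal" where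
  "duhamel_abs H t x = (\<integral>\<^sup>+s. indicator {0<..<t} s * oseen_conv_abs \<alpha> (t - s) (H s) x \<partial>lborel)"

lemma duhamel_abs_measurable [measurable (raw)]:
  assumes [measurable]: "borel_measurable2 H"
    "t \<in> borel_measurable M" "f \<in> borel_measurable M"
  shows "(\<lambda>z. duhamel_abs H (t z) (f z)) \<in> borel_measurable M"
proof -
  have "duhamel_abs H t x = (\<integral>\<^sup>+s. (if 0 < s \<and> s < t then oseen_conv_abs \<alpha> (t - s) (H s) x else 0) \<partial>lborel)" for t x
    unfolding duhamel_abs_def by (intro nn_integral_cong) (auto split: split_indicator)
  then show ?thesis by simp
qed

lemma duhamel_abs_mono:
  assumes "\<And>s y. 0 < s \<Longrightarrow> s < t \<Longrightarrow> H s y \<le> K s y"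
  shows "duhamel_abs H t x \<le> duhamel_abs K t x"
  unfolding duhamel_abs_def oseen_conv_abs_def
  by (intro nn_integral_mono) (auto intro!: nn_integral_mono mult_left_mono assms split: split_indicator)

lemma duhamel_abs_mono_AE:
  assumes "AE s in lborel. 0 < s \<longrightarrow> s < t \<longrightarrow> (AE y in lborel. H s y \<le> K s y)"
  shows "duhamel_abs H t x \<le> duhamel_abs K t x"
  unfolding duhamel_abs_def
proof (rule nn_integral_mono_AE)
  show "AE s in lborel. indicator {0<..<t} s * oseen_conv_abs \<alpha> (t - s) (H s) x
      \<le> indicator {0<..<t} s * oseen_conv_abs \<alpha> (t - s) (K s) x"
    using assms
  proof eventually_elim
    case (elim s)
    show ?case
    proof (cases "0 < s \<and> s < t")
      case True
      then have "AE y in lborel. H s y \<le> K s y" using elim by simp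
      then have "AE y in lborel. oseen_abs \<alpha> (t - s) (x - y) * H s y \<le> oseen_abs \<alpha> (t - s) (x - y) * K s y"
        by eventually_elim (rule mult_left_mono, auto)
      then show ?thesis using True by (simp add: oseen_conv_abs_def nn_integral_mono_AE)
    qed (auto split: split_indicator)
  qed
qed

lemma duhamel_abs_add:
  assumes [measurable]: "borel_measurable2 H"
    "borel_measurable2 K"
  shows "duhamel_abs (\<lambda>s y. H s y + K s y) t x = duhamel_abs H t x + duhamel_abs K t x"
  unfolding duhamel_abs_def oseen_conv_abs_def
  by (simp add: distrib_left nn_integral_add)

end

locale navier_stokes_exponents = log_Hoelder_exponent q a b c + stable_subordinator \<alpha> \<eta>
  for q :: "real^3 \<Rightarrow> real" and a b c \<alpha> :: real and \<eta> :: "real measure" +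
  fixes P :: real
  assumes P_gt_2: "2 < P" and subcritical: "2 * \<alpha> / P + 3 * (2 * a - b) / 2 < \<alpha> - 1 / 2"
begin

definition \<gamma> :: real where "\<gamma> = (1 + 3 * (2 * a - b)) / (2 * \<alpha>)"

lemma \<gamma>_pos: "0 < \<gamma>" and \<gamma>_lt: "\<gamma> < 1 - 2 / P" and \<gamma>_lt_1: "\<gamma> < 1"
proof -
  have \<alpha>0: "0 < \<alpha>" using \<alpha> by simp
  show "0 < \<gamma>" using ab \<alpha>0 by (auto simp: \<gamma>_def intro!: divide_pos_pos add_pos_nonneg)
  have "(1 + 3 * (2 * a - b)) < (1 - 2 / P) * (2 * \<alpha>)"
  proof -
    have "(1 - 2 / P) * (2 * \<alpha>) = 2 * \<alpha> - 2 * (2 * \<alpha> / P)" by (simp add: left_diff_distrib)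
    then show ?thesis using subcritical by linarith
  qed
  then show "\<gamma> < 1 - 2 / P" using \<alpha>0 by (simp add: \<gamma>_def pos_divide_less_eq)
  then show "\<gamma> < 1" using P_gt_2 by (auto intro: order.strict_trans2)
qed

text \<open>Subordination writes the kernel as an average of Gaussians, each bounded on
  \<open>L^q(.)\<close> uniformly in its parameter; hence \<open>C\<close> does not depend on
  \<open>t\<close>. The factor \<open>1 + C1\<close> instead of \<open>C1\<close> only makes the
  constant at least 1.\<close>

lemma Lux_le_heat:
  "\<exists>C\<ge>1. \<forall>t w d. 0 < t \<longrightarrow> Lux_le q w d \<longrightarrow> Lux_le q (heat_conv_abs \<alpha> t w) (C * d)"
proof -
  obtain C1 where C1: "0 < C1" "\<And>t x. 0 < t \<Longrightarrow> ennreal \<bar>heat_kernel \<alpha> t x\<bar>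
     \<le> (\<integral>\<^sup>+s. ennreal C1 * ennreal (gauss (2 * (t powr (1 / \<alpha>) * s)) x) \<partial>\<eta>)"
    using heat_kernel_bound by blast
  obtain C2 where C2: "1 \<le> C2" "\<And>s w d. 0 < s \<Longrightarrow> Lux_le q w d \<Longrightarrow> Lux_le q (gauss_conv s w) (C2 * d)"
    using Lux_le_gauss_conv by blast
  have main: "Lux_le q (heat_conv_abs \<alpha> t w) ((1 + C1) * C2 * d)" if t: "0 < t" and w: "Lux_le q w d" for t w d
  proof -
    have [measurable]: "w \<in> borel_measurable borel" and d: "0 < d" using w by (auto dest: Lux_leD)
    define \<tau> where "\<tau> = t powr (1 / \<alpha>)"
    have \<tau>: "0 < \<tau>" using t by (simp add: \<tau>_def)
    interpret P: pair_sigma_finite \<eta> "lborel :: (real^3) measure" ..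
    have le: "heat_conv_abs \<alpha> t w x \<le> (\<integral>\<^sup>+s. ennreal C1 * gauss_conv (2 * (\<tau> * s)) w x \<partial>\<eta>)" for x
    proof -
      have "heat_conv_abs \<alpha> t w x \<le> (\<integral>\<^sup>+y. (\<integral>\<^sup>+s. ennreal C1 * ennreal (gauss (2 * (\<tau> * s)) (x - y)) \<partial>\<eta>) * w y \<partial>lborel)"
        unfolding heat_conv_abs_def \<tau>_def by (intro nn_integral_mono mult_right_mono C1 t) auto
      also have "\<dots> = (\<integral>\<^sup>+y. (\<integral>\<^sup>+s. ennreal C1 * (w y * ennreal (gauss (2 * (\<tau> * s)) (x - y))) \<partial>\<eta>) \<partial>lborel)"
        by (intro nn_integral_cong, subst nn_integral_multc[symmetric]) (auto simp: mult_ac)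
      also have "\<dots> = (\<integral>\<^sup>+s. (\<integral>\<^sup>+y. ennreal C1 * (w y * ennreal (gauss (2 * (\<tau> * s)) (x - y))) \<partial>lborel) \<partial>\<eta>)"
        by (rule P.Fubini') measurable
      finally show ?thesis by (simp add: nn_integral_cmult gauss_conv_def)
    qed
    have "Lux_le q (\<lambda>x. \<integral>\<^sup>+s. ennreal C1 * gauss_conv (2 * (\<tau> * s)) w x \<partial>\<eta>) (C1 * (C2 * d))"
    proof (rule Lux_le_nn_integral[where c = "\<lambda>_. C1 * (C2 * d)"])
      show "AE s in \<eta>. Lux_le q (\<lambda>x. ennreal C1 * gauss_conv (2 * (\<tau> * s)) w x) (C1 * (C2 * d))"
        using \<eta>_pos by eventually_elim (intro Lux_le_scale C2 w C1, use \<tau> in simp)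
      show "(\<lambda>(s, x). ennreal C1 * gauss_conv (2 * (\<tau> * s)) w x) \<in> borel_measurable (\<eta> \<Otimes>\<^sub>M lborel)"
        by measurable
    qed (use C1 C2 d q_gt_1 in \<open>auto simp: emeasure_space_1 intro: sigma_finite_measure_axioms\<close>)
    then show ?thesis
      by (rule Lux_le_mono) (use le C1 C2 d q_nonneg in \<open>auto simp: distrib_right mult.assoc\<close>)
  qed
  have "1 * 1 \<le> (1 + C1) * C2" using C1 C2 by (intro mult_mono) auto
  then show ?thesis using main by (intro exI[of _ "(1 + C1) * C2"]) auto
qed

text \<open>Hoelder puts the product into \<open>L^(1/M)\<close> with \<open>M = A + B\<close>, and
  Young with kernel exponent \<open>r = 1 / (1 + b - M)\<close> maps it to \<open>L^(1/b)\<close>.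
  Interpolation weights the sup bound by \<open>M - b\<close> and the \<open>L^1\<close> bound by
  \<open>1 - (M - b)\<close>, which gives the power
  \<open>- (1 + 3 * (M - b)) / (2 * \<alpha>)\<close> of \<open>t\<close>. For
  \<open>t \<le> 1\<close> the case \<open>M = 2 * a\<close>, which defines \<gamma>, is the
  worst.\<close>

lemma Lux_le_oseen:
  "\<exists>C>0. \<forall>t A B F G d e. 0 < t \<longrightarrow> t \<le> 1 \<longrightarrow> b \<le> A \<longrightarrow> A \<le> a \<longrightarrow> b \<le> B \<longrightarrow> B \<le> a \<longrightarrow>
     Lux_le (\<lambda>_. 1 / A) F d \<longrightarrow> Lux_le (\<lambda>_. 1 / B) G e \<longrightarrow>
     Lux_le (\<lambda>_. 1 / b) (oseen_conv_abs \<alpha> t (\<lambda>y. F y * G y)) (C * t powr (- \<gamma>) * (d * e))"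
proof -
  obtain C where C: "0 < C"
    "\<And>t j h k x. 0 < t \<Longrightarrow> ennreal \<bar>oseen_kernel \<alpha> t j h k x\<bar> \<le> ennreal (C * t powr (- (2 / \<alpha>)))"
    "\<And>t j h k. 0 < t \<Longrightarrow> (\<integral>\<^sup>+x. ennreal \<bar>oseen_kernel \<alpha> t j h k x\<bar> \<partial>lborel) \<le> ennreal (C * t powr (- (1 / (2 * \<alpha>))))"
    by (rule oseen_kernel_bounds, rule that)
  have "Lux_le (\<lambda>_. 1 / b) (oseen_conv_abs \<alpha> t (\<lambda>y. F y * G y)) (27 * C * t powr (- \<gamma>) * (d * e))"
    if t: "0 < t" "t \<le> 1" and AB: "b \<le> A" "A \<le> a" "b \<le> B" "B \<le> a"
      and F: "Lux_le (\<lambda>_. 1 / A) F d" and G: "Lux_le (\<lambda>_. 1 / B) G e" for t A B F G d e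
  proof -
    define S where "S = 27 * C * t powr (- (2 / \<alpha>))"
    define L where "L = 27 * C * t powr (- (1 / (2 * \<alpha>)))"
    define M where "M = A + B"
    have M: "b < M" "M < 1" "0 < A" "0 < B" "M \<le> 2 * a" using AB ab by (auto simp: M_def)
    have SL: "0 < S" "0 < L" using C t by (auto simp: S_def L_def)
    have \<alpha>0: "0 < \<alpha>" using \<alpha> by simp
    have sup: "oseen_abs \<alpha> t z \<le> ennreal S" for z
    proof -
      have "oseen_abs \<alpha> t z \<le> (\<Sum>j\<in>(UNIV::3 set). \<Sum>h\<in>(UNIV::3 set). \<Sum>k\<in>(UNIV::3 set). ennreal (C * t powr (- (2 / \<alpha>))))"
        unfolding oseen_abs_def by (intro sum_mono C t)
      also have "\<dots> = ennreal 27 * ennreal (C * t powr (- (2 / \<alpha>)))" by simp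
      also have "\<dots> = ennreal S" using C by (subst ennreal_mult[symmetric]) (auto simp: S_def mult.assoc)
      finally show ?thesis .
    qed
    have "(\<integral>\<^sup>+z. oseen_abs \<alpha> t z \<partial>lborel)
        = (\<Sum>j\<in>UNIV. \<Sum>h\<in>UNIV. \<Sum>k\<in>UNIV. (\<integral>\<^sup>+z. ennreal \<bar>oseen_kernel \<alpha> t j h k z\<bar> \<partial>lborel))"
      unfolding oseen_abs_def by (simp add: nn_integral_sum del: sum_ennreal)
    also have "\<dots> \<le> (\<Sum>j\<in>(UNIV::3 set). \<Sum>h\<in>(UNIV::3 set). \<Sum>k\<in>(UNIV::3 set). ennreal (C * t powr (- (1 / (2 * \<alpha>)))))"
      by (intro sum_mono C t)
    also have "\<dots> = ennreal 27 * ennreal (C * t powr (- (1 / (2 * \<alpha>))))" by simp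
    also have "\<dots> = ennreal L" using C by (subst ennreal_mult[symmetric]) (auto simp: L_def mult.assoc)
    finally have int: "(\<integral>\<^sup>+z. oseen_abs \<alpha> t z \<partial>lborel) \<le> ennreal L" .
    define r where "r = 1 / (1 + b - M)"
    have r: "1 < r" "1 / r = 1 - (M - b)" using M ab by (auto simp: r_def field_simps)
    have "Lux_le (\<lambda>_. r) (oseen_abs \<alpha> t) (S powr (1 - 1 / r) * L powr (1 / r))"
      by (rule Lux_le_interpolation) (use r SL sup int in auto)
    then have "Lux_le (\<lambda>_. 1 / b) (\<lambda>x. \<integral>\<^sup>+y. oseen_abs \<alpha> t (x - y) * (F y * G y) \<partial>lborel)
        (S powr (1 - 1 / r) * L powr (1 / r) * (d * e))"
      unfolding r_def using M ab Lux_le_mult[OF M(3,4) F G] by (intro Young_convolution[where M = M]) (auto simp: M_def)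
    moreover have "S powr (1 - 1 / r) * L powr (1 / r) \<le> 27 * C * t powr (- \<gamma>)"
    proof -
      have "S powr (1 - 1 / r) * L powr (1 / r) = (27 * C) powr (M - b) * (27 * C) powr (1 - (M - b)) *
          (t powr (- (2 / \<alpha>) * (M - b)) * t powr (- (1 / (2 * \<alpha>)) * (1 - (M - b))))"
        using C t by (simp add: r S_def L_def powr_mult powr_powr)
      also have "\<dots> = 27 * C * t powr (- (1 + 3 * (M - b)) / (2 * \<alpha>))"
      proof -
        have "- (2 / \<alpha>) * (M - b) + - (1 / (2 * \<alpha>)) * (1 - (M - b)) = - (1 + 3 * (M - b)) / (2 * \<alpha>)"
          using \<alpha>0 by (simp add: field_simps)
        then show ?thesis using C by (simp only: powr_add[symmetric]) simp
      qed
      also have "\<dots> \<le> 27 * C * t powr (- \<gamma>)"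
      proof (intro mult_left_mono powr_mono')
        have "(1 + 3 * (M - b)) / (2 * \<alpha>) \<le> \<gamma>"
          unfolding \<gamma>_def using M \<alpha>0 by (intro divide_right_mono) auto
        then show "- \<gamma> \<le> - (1 + 3 * (M - b)) / (2 * \<alpha>)"
          by (simp only: minus_divide_left[symmetric] neg_le_iff_le)
      qed (use C t in auto)
      finally show ?thesis .
    qed
    moreover have "0 < d" "0 < e" using F G by (auto dest: Lux_leD)
    moreover have [measurable]: "F \<in> borel_measurable borel" "G \<in> borel_measurable borel"
      using F G by (auto dest: Lux_leD)
    ultimately show ?thesis
      unfolding oseen_conv_abs_def[abs_def] using ab
      by (elim Lux_le_mono) (auto intro: mult_right_mono)
  qed
  then show ?thesis using C(1) by (intro exI[of _ "27 * C"]) auto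
qed

text \<open>Minkowski's inequality in time. The time integral of the norms is left as a hypothesis
  with bound \<open>Z\<close>, since constant, exponentially weighted and merely
  \<open>P\<close>-integrable norms all have to be inserted later.\<close>

lemma Lux_le_duhamel:
  "\<exists>C>0. \<forall>t A B F G d e Z. 0 < t \<longrightarrow> t \<le> 1 \<longrightarrow> b \<le> A \<longrightarrow> A \<le> a \<longrightarrow> b \<le> B \<longrightarrow> B \<le> a \<longrightarrow>
     borel_measurable2 F \<longrightarrow>
     borel_measurable2 G \<longrightarrow>
     d \<in> borel_measurable borel \<longrightarrow> e \<in> borel_measurable borel \<longrightarrow>
     (AE s in lborel. 0 < s \<longrightarrow> s < t \<longrightarrow> Lux_le (\<lambda>_. 1 / A) (F s) (d s) \<and> Lux_le (\<lambda>_. 1 / B) (G s) (e s)) \<longrightarrow>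
     0 < Z \<longrightarrow> (\<integral>\<^sup>+s. ennreal ((t - s) powr (- \<gamma>) * (d s * e s)) * indicator {0<..<t} s \<partial>lborel) \<le> ennreal Z \<longrightarrow>
     Lux_le (\<lambda>_. 1 / b) (duhamel_abs (\<lambda>s y. F s y * G s y) t) (C * Z)"
proof -
  obtain C where C: "0 < C" "\<And>t A B F G d e. 0 < t \<Longrightarrow> t \<le> 1 \<Longrightarrow> b \<le> A \<Longrightarrow> A \<le> a \<Longrightarrow> b \<le> B \<Longrightarrow> B \<le> a \<Longrightarrow>
     Lux_le (\<lambda>_. 1 / A) F d \<Longrightarrow> Lux_le (\<lambda>_. 1 / B) G e \<Longrightarrow>
     Lux_le (\<lambda>_. 1 / b) (oseen_conv_abs \<alpha> t (\<lambda>y. F y * G y)) (C * t powr (- \<gamma>) * (d * e))"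
    using Lux_le_oseen by blast
  have "Lux_le (\<lambda>_. 1 / b) (duhamel_abs (\<lambda>s y. F s y * G s y) t) (C * Z)"
    if t: "0 < t" "t \<le> 1" and AB: "b \<le> A" "A \<le> a" "b \<le> B" "B \<le> a"
      and [measurable]: "borel_measurable2 F"
        "borel_measurable2 G"
        "d \<in> borel_measurable borel" "e \<in> borel_measurable borel"
      and FG: "AE s in lborel. 0 < s \<longrightarrow> s < t \<longrightarrow> Lux_le (\<lambda>_. 1 / A) (F s) (d s) \<and> Lux_le (\<lambda>_. 1 / B) (G s) (e s)"
      and Z: "0 < Z" "(\<integral>\<^sup>+s. ennreal ((t - s) powr (- \<gamma>) * (d s * e s)) * indicator {0<..<t} s \<partial>lborel) \<le> ennreal Z"
    for t A B F G d e Z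
  proof -
    let ?\<mu> = "density lborel (indicator {0<..<t}) :: real measure"
    let ?h = "\<lambda>s. oseen_conv_abs \<alpha> (t - s) (\<lambda>y. F s y * G s y)"
    let ?c = "\<lambda>s. C * (t - s) powr (- \<gamma>) * (d s * e s)"
    have [measurable]: "case_prod ?h \<in> borel_measurable (borel \<Otimes>\<^sub>M borel)" by measurable
    have "Lux_le (\<lambda>_. 1 / b) (\<lambda>x. \<integral>\<^sup>+s. ?h s x \<partial>?\<mu>) (C * Z)"
    proof (rule Lux_le_nn_integral[where c = ?c])
      show "sigma_finite_measure ?\<mu>"
        by (subst sigma_finite_measure.sigma_finite_iff_density_finite[OF sigma_finite_lborel])
          (auto split: split_indicator)
      show "AE s in ?\<mu>. Lux_le (\<lambda>_. 1 / b) (?h s) (?c s)"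
      proof (subst AE_density)
        show "AE s in lborel. 0 < (indicator {0<..<t} s :: ennreal) \<longrightarrow> Lux_le (\<lambda>_. 1 / b) (?h s) (?c s)"
          using FG
        proof eventually_elim
          case (elim s)
          show ?case
          proof
            assume "0 < (indicator {0<..<t} s :: ennreal)"
            then have s: "0 < s" "s < t" by (auto split: split_indicator_asm)
            then show "Lux_le (\<lambda>_. 1 / b) (?h s) (?c s)"
              using elim t AB by (intro C(2)[of "t - s" A B]) auto
          qed
        qed
      qed measurable
      have "(\<integral>\<^sup>+s. ennreal (?c s) \<partial>?\<mu>) = (\<integral>\<^sup>+s. ennreal C * (ennreal ((t - s) powr (- \<gamma>) * (d s * e s)) * indicator {0<..<t} s) \<partial>lborel)"
      proof (subst nn_integral_density)
        have "ennreal (?c s) = ennreal C * ennreal ((t - s) powr (- \<gamma>) * (d s * e s))" for s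
          using C(1) by (simp add: ennreal_mult'[symmetric] mult.assoc)
        then show "(\<integral>\<^sup>+s. indicator {0<..<t} s * ennreal (?c s) \<partial>lborel)
          = (\<integral>\<^sup>+s. ennreal C * (ennreal ((t - s) powr (- \<gamma>) * (d s * e s)) * indicator {0<..<t} s) \<partial>lborel)"
          by (simp only: mult_ac)
      qed measurable
      also have "\<dots> \<le> ennreal (C * Z)"
        using C Z by (simp add: nn_integral_cmult ennreal_mult mult_left_mono)
      finally show "(\<integral>\<^sup>+s. ennreal (?c s) \<partial>?\<mu>) \<le> ennreal (C * Z)" .
    qed (use C Z inverse_gt_2 in \<open>auto simp: case_prod_beta'\<close>)
    moreover have "(\<integral>\<^sup>+s. ?h s x \<partial>?\<mu>) = duhamel_abs (\<lambda>s y. F s y * G s y) t x" for x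
      by (simp add: nn_integral_density duhamel_abs_def)
    ultimately show ?thesis by simp
  qed
  then show ?thesis using C(1) by (intro exI[of _ C]) auto
qed

end

subsection \<open>The Duhamel integrals\<close>

lemma vec_lambda_measurable [measurable (raw)]:
  fixes f :: "'n::finite \<Rightarrow> 'a \<Rightarrow> real"
  assumes "\<And>j. f j \<in> borel_measurable M"
  shows "(\<lambda>z. \<chi> j. f j z) \<in> borel_measurable M"
proof -
  have "(\<lambda>z. (\<chi> j. f j z) \<bullet> i) \<in> borel_measurable M" if i: "i \<in> Basis" for i :: "real^'n"
  proof -
    obtain j where "i = axis j 1" using i by (auto simp: Basis_vec_def)
    then show ?thesis using assms by (simp add: inner_axis)
  qed
  then show ?thesis by (subst borel_measurable_euclidean_space) auto
qed

lemma ennreal_norm_vec_le: "ennreal (norm x) \<le> (\<Sum>j\<in>UNIV. ennreal \<bar>x $ j\<bar>)" for x :: "real^'n::finite"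
  by (simp add: norm_le_l1_cart ennreal_leI)

text \<open>For \<open>g < 1\<close>, the weight \<open>e\<^bsup>ls\<^esup>\<close> makes the constant small when \<open>l\<close> is large.\<close>

lemma nn_integral_time_kernel:
  fixes t :: real
  assumes "g < 1" "0 < l"
  shows "(\<integral>\<^sup>+s. ennreal ((t - s) powr (- g) * exp (l * s)) * indicator {0<..<t} s \<partial>lborel)
    \<le> ennreal (exp (l * t) * (Gamma (1 - g) * l powr (g - 1)))"
proof -
  have "(\<integral>\<^sup>+s. ennreal ((t - s) powr (- g) * exp (l * s)) * indicator {0<..<t} s \<partial>lborel)
    = (\<integral>\<^sup>+r. ennreal ((t - (t - r)) powr (- g) * exp (l * (t - r))) * indicator {0<..<t} (t - r) \<partial>lborel)"
    by (rule nn_integral_shift(2)[symmetric]) measurable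
  also have "\<dots> \<le> (\<integral>\<^sup>+r. ennreal (exp (l * t)) * ennreal (indicator {0..} r * r powr ((1 - g) - 1) * exp (- l * r)) \<partial>lborel)"
    by (intro nn_integral_mono)
      (auto simp: ennreal_mult[symmetric] right_diff_distrib exp_diff exp_minus divide_inverse mult_ac split: split_indicator)
  also have "\<dots> = ennreal (exp (l * t)) * ennreal (Gamma (1 - g) * l powr (- (1 - g)))"
    using assms by (subst nn_integral_cmult, measurable, subst nn_integral_powr_exp) auto
  finally show ?thesis using assms by (simp add: ennreal_mult)
qed

text \<open>The weighted estimate with \<open>l = 1 / T\<close>: on the interval the weight is at
  least 1 and at most \<open>exp 1\<close>, which is where that constant comes from.\<close>

lemma nn_integral_time_kernel':
  fixes t T :: real
  assumes "g < 1" "0 < T" "t \<le> T"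
  shows "(\<integral>\<^sup>+s. ennreal ((t - s) powr (- g)) * indicator {0<..<t} s \<partial>lborel)
    \<le> ennreal (exp 1 * Gamma (1 - g) * T powr (1 - g))"
proof -
  have "(\<integral>\<^sup>+s. ennreal ((t - s) powr (- g)) * indicator {0<..<t} s \<partial>lborel)
    \<le> (\<integral>\<^sup>+s. ennreal ((t - s) powr (- g) * exp (1 / T * s)) * indicator {0<..<t} s \<partial>lborel)"
    using assms by (intro nn_integral_mono) (auto intro!: ennreal_leI simp: mult_le_cancel_left1 split: split_indicator)
  also have "\<dots> \<le> ennreal (exp (1 / T * t) * (Gamma (1 - g) * (1 / T) powr (g - 1)))"
    by (rule nn_integral_time_kernel) (use assms in auto)
  also have "\<dots> \<le> ennreal (exp 1 * Gamma (1 - g) * T powr (1 - g))"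
  proof (rule ennreal_leI)
    have "(1 / T) powr (g - 1) = T powr (1 - g)"
      using assms by (simp add: powr_divide powr_minus_divide[symmetric])
    moreover have "exp (1 / T * t) \<le> exp 1" using assms by simp
    moreover have "0 < Gamma (1 - g)" using assms by (intro Gamma_real_pos) auto
    ultimately show "exp (1 / T * t) * (Gamma (1 - g) * (1 / T) powr (g - 1)) \<le> exp 1 * Gamma (1 - g) * T powr (1 - g)"
      by (simp add: mult.assoc mult_right_mono)
  qed
  finally show ?thesis .
qed

section \<open>The signed Duhamel operator\<close>

context stable_subordinator
begin

text \<open>A function on space-time, to be integrated over the product measure: convergence of each
  component is then one condition, and dominated convergence applies once. The iterated integrals of
  a mild solution are recovered by Fubini.\<close>

definition oseen_integrand :: "3 \<Rightarrow> 3 \<Rightarrow> 3 \<Rightarrow> (real \<Rightarrow> real^3 \<Rightarrow> real) \<Rightarrow> real \<Rightarrow> real^3 \<Rightarrow> real \<times> (real^3) \<Rightarrow> real" where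
  "oseen_integrand j h k H t x z =
     indicator {0<..<t} (fst z) * oseen_kernel \<alpha> (t - fst z) j h k (x - snd z) * H (fst z) (snd z)"

definition oseen_integral :: "(3 \<Rightarrow> 3 \<Rightarrow> real \<Rightarrow> real^3 \<Rightarrow> real) \<Rightarrow> real \<Rightarrow> real^3 \<Rightarrow> real^3" where
  "oseen_integral H t x =
     (\<chi> j. \<Sum>h\<in>UNIV. \<Sum>k\<in>UNIV. (LINT z|(lborel \<Otimes>\<^sub>M lborel). oseen_integrand j h k (H h k) t x z))"

lemma oseen_integrand_measurable [measurable (raw)]:
  assumes [measurable]: "borel_measurable2 H"
    "t \<in> borel_measurable M" "x \<in> borel_measurable M" "z \<in> measurable M (borel \<Otimes>\<^sub>M borel)"
  shows "(\<lambda>v. oseen_integrand j h k H (t v) (x v) (z v)) \<in> borel_measurable M"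
proof -
  have "oseen_integrand j h k H t x z = (if 0 < fst z \<and> fst z < t then
      oseen_kernel \<alpha> (t - fst z) j h k (x - snd z) * H (fst z) (snd z) else 0)" for t x z
    by (auto simp: oseen_integrand_def split: split_indicator)
  then show ?thesis by simp
qed

lemma oseen_integral_measurable [measurable (raw)]:
  assumes [measurable]: "\<And>h k. borel_measurable2 (H h k)"
    "t \<in> borel_measurable M" "x \<in> borel_measurable M"
  shows "(\<lambda>v. oseen_integral H (t v) (x v)) \<in> borel_measurable M"
proof -
  interpret L: sigma_finite_measure "lborel \<Otimes>\<^sub>M (lborel :: (real^3) measure) :: (real \<times> _) measure"
    unfolding lborel_prod by (rule sigma_finite_lborel)
  show ?thesis unfolding oseen_integral_def by measurable
qed

lemma duhamel_abs_eq:
  assumes [measurable]: "borel_measurable2 X"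
  shows "duhamel_abs X t x = (\<Sum>j\<in>UNIV. \<Sum>h\<in>UNIV. \<Sum>k\<in>UNIV.
    (\<integral>\<^sup>+z. ennreal (indicator {0<..<t} (fst z) * \<bar>oseen_kernel \<alpha> (t - fst z) j h k (x - snd z)\<bar>) * X (fst z) (snd z) \<partial>(lborel \<Otimes>\<^sub>M lborel)))"
    (is "_ = (\<Sum>j\<in>UNIV. \<Sum>h\<in>UNIV. \<Sum>k\<in>UNIV. (\<integral>\<^sup>+z. ?f j h k z \<partial>_))")
proof -
  have m: "?f j h k z = (if 0 < fst z \<and> fst z < t then
      ennreal \<bar>oseen_kernel \<alpha> (t - fst z) j h k (x - snd z)\<bar> * X (fst z) (snd z) else 0)" for j h k z
    by (auto split: split_indicator)
  have [measurable]: "?f j h k \<in> borel_measurable (borel \<Otimes>\<^sub>M borel)" for j h k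
    unfolding m by measurable
  have "(\<Sum>j\<in>UNIV. \<Sum>h\<in>UNIV. \<Sum>k\<in>UNIV. (\<integral>\<^sup>+z. ?f j h k z \<partial>(lborel \<Otimes>\<^sub>M lborel)))
    = (\<integral>\<^sup>+z. (\<Sum>j\<in>UNIV. \<Sum>h\<in>UNIV. \<Sum>k\<in>UNIV. ?f j h k z) \<partial>(lborel \<Otimes>\<^sub>M lborel))"
    by (simp add: nn_integral_sum)
  also have "\<dots> = (\<integral>\<^sup>+z. indicator {0<..<t} (fst z) * (oseen_abs \<alpha> (t - fst z) (x - snd z) * X (fst z) (snd z)) \<partial>(lborel \<Otimes>\<^sub>M lborel))"
    by (intro nn_integral_cong) (auto simp: oseen_abs_def sum_distrib_right simp del: sum_ennreal split: split_indicator)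
  also have "\<dots> = (\<integral>\<^sup>+s. \<integral>\<^sup>+y. indicator {0<..<t} s * (oseen_abs \<alpha> (t - s) (x - y) * X s y) \<partial>lborel \<partial>lborel)"
  proof (subst lborel.nn_integral_fst[symmetric])
    have "indicator {0<..<t} (fst z) * (oseen_abs \<alpha> (t - fst z) (x - snd z) * X (fst z) (snd z)) =
       (if 0 < fst z \<and> fst z < t then oseen_abs \<alpha> (t - fst z) (x - snd z) * X (fst z) (snd z) else 0)" for z
      by (auto split: split_indicator)
    then show "(\<lambda>z. indicator {0<..<t} (fst z) * (oseen_abs \<alpha> (t - fst z) (x - snd z) * X (fst z) (snd z)))
        \<in> borel_measurable (lborel \<Otimes>\<^sub>M lborel)" by simp
  qed simp
  also have "\<dots> = duhamel_abs X t x"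
    unfolding duhamel_abs_def oseen_conv_abs_def
    by (intro nn_integral_cong) (simp add: nn_integral_cmult)
  finally show ?thesis by simp
qed

lemma nn_integral_oseen_integrand_le:
  assumes [measurable]: "borel_measurable2 X"
    and H: "\<And>s y. ennreal \<bar>H s y\<bar> \<le> X s y"
  shows "(\<integral>\<^sup>+z. ennreal \<bar>oseen_integrand j h k H t x z\<bar> \<partial>(lborel \<Otimes>\<^sub>M lborel))
    \<le> (\<integral>\<^sup>+z. ennreal (indicator {0<..<t} (fst z) * \<bar>oseen_kernel \<alpha> (t - fst z) j h k (x - snd z)\<bar>) * X (fst z) (snd z) \<partial>(lborel \<Otimes>\<^sub>M lborel))"
proof (rule nn_integral_mono)
  fix z :: "real \<times> (real^3)"
  have "ennreal \<bar>oseen_integrand j h k H t x z\<bar> =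
      ennreal (indicator {0<..<t} (fst z) * \<bar>oseen_kernel \<alpha> (t - fst z) j h k (x - snd z)\<bar>) * ennreal \<bar>H (fst z) (snd z)\<bar>"
    by (simp add: oseen_integrand_def abs_mult ennreal_mult[symmetric])
  also have "\<dots> \<le> ennreal (indicator {0<..<t} (fst z) * \<bar>oseen_kernel \<alpha> (t - fst z) j h k (x - snd z)\<bar>) * X (fst z) (snd z)"
    by (intro mult_left_mono H) auto
  finally show "ennreal \<bar>oseen_integrand j h k H t x z\<bar> \<le>
      ennreal (indicator {0<..<t} (fst z) * \<bar>oseen_kernel \<alpha> (t - fst z) j h k (x - snd z)\<bar>) * X (fst z) (snd z)" .
qed

lemma summand_le_duhamel_abs:
  assumes [measurable]: "borel_measurable2 X"
  shows "(\<integral>\<^sup>+z. ennreal (indicator {0<..<t} (fst z) * \<bar>oseen_kernel \<alpha> (t - fst z) j h k (x - snd z)\<bar>) * X (fst z) (snd z) \<partial>(lborel \<Otimes>\<^sub>M lborel))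
    \<le> duhamel_abs X t x" (is "?f j h k \<le> _")
proof -
  have "?f j h k \<le> (\<Sum>k\<in>UNIV. ?f j h k)" by (rule member_le_sum) auto
  also have "\<dots> \<le> (\<Sum>h\<in>UNIV. \<Sum>k\<in>UNIV. ?f j h k)" by (rule member_le_sum[of h _ "\<lambda>h. \<Sum>k\<in>UNIV. ?f j h k"]) auto
  also have "\<dots> \<le> (\<Sum>j\<in>UNIV. \<Sum>h\<in>UNIV. \<Sum>k\<in>UNIV. ?f j h k)"
    by (rule member_le_sum[of j _ "\<lambda>j. \<Sum>h\<in>UNIV. \<Sum>k\<in>UNIV. ?f j h k"]) auto
  finally show ?thesis by (simp add: duhamel_abs_eq)
qed

lemma integrable_oseen_integrand:
  assumes [measurable]: "borel_measurable2 X"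
    "borel_measurable2 H"
    and H: "\<And>s y. ennreal \<bar>H s y\<bar> \<le> X s y" and fin: "duhamel_abs X t x < \<infinity>"
  shows "integrable (lborel \<Otimes>\<^sub>M lborel) (oseen_integrand j h k H t x)"
proof (rule integrableI_bounded)
  have "(\<integral>\<^sup>+z. ennreal (norm (oseen_integrand j h k H t x z)) \<partial>(lborel \<Otimes>\<^sub>M lborel)) \<le> duhamel_abs X t x"
    using order.trans[OF nn_integral_oseen_integrand_le[OF assms(1) H] summand_le_duhamel_abs[OF assms(1)]] by simp
  then show "(\<integral>\<^sup>+z. ennreal (norm (oseen_integrand j h k H t x z)) \<partial>(lborel \<Otimes>\<^sub>M lborel)) < \<infinity>"
    using fin by (rule order.strict_trans1)
qed measurable

lemma norm_oseen_integral_le: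
  assumes [measurable]: "borel_measurable2 X"
    and H: "\<And>h k s y. ennreal \<bar>H h k s y\<bar> \<le> X s y"
  shows "ennreal (norm (oseen_integral H t x)) \<le> duhamel_abs X t x"
proof -
  let ?I = "\<lambda>j h k. LINT z|(lborel \<Otimes>\<^sub>M lborel). oseen_integrand j h k (H h k) t x z"
  have "ennreal (norm (oseen_integral H t x)) \<le> (\<Sum>j\<in>UNIV. ennreal \<bar>\<Sum>h\<in>UNIV. \<Sum>k\<in>UNIV. ?I j h k\<bar>)"
    using ennreal_norm_vec_le[of "oseen_integral H t x"] by (simp add: oseen_integral_def)
  also have "\<dots> \<le> (\<Sum>j\<in>UNIV. \<Sum>h\<in>UNIV. \<Sum>k\<in>UNIV. ennreal \<bar>?I j h k\<bar>)"
  proof (rule sum_mono)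
    fix j
    have "\<bar>\<Sum>h\<in>UNIV. \<Sum>k\<in>UNIV. ?I j h k\<bar> \<le> (\<Sum>h\<in>UNIV. \<Sum>k\<in>UNIV. \<bar>?I j h k\<bar>)"
      by (intro order.trans[OF sum_abs] sum_mono sum_abs)
    then show "ennreal \<bar>\<Sum>h\<in>UNIV. \<Sum>k\<in>UNIV. ?I j h k\<bar> \<le> (\<Sum>h\<in>UNIV. \<Sum>k\<in>UNIV. ennreal \<bar>?I j h k\<bar>)"
      by (simp add: sum_nonneg ennreal_leI)
  qed
  also have "\<dots> \<le> duhamel_abs X t x"
    unfolding duhamel_abs_eq[OF assms(1)]
  proof (intro sum_mono)
    fix j h k
    have "ennreal \<bar>?I j h k\<bar> \<le> (\<integral>\<^sup>+z. ennreal \<bar>oseen_integrand j h k (H h k) t x z\<bar> \<partial>(lborel \<Otimes>\<^sub>M lborel))"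
    \<comment> \<open>A non-integrable component has integral 0 by convention, so the bound holds
      without any finiteness.\<close>
    proof (cases "integrable (lborel \<Otimes>\<^sub>M lborel) (oseen_integrand j h k (H h k) t x)")
      case True
      from integral_norm_bound_ennreal[OF this] show ?thesis by simp
    qed (simp add: not_integrable_integral_eq)
    also have "\<dots> \<le> (\<integral>\<^sup>+z. ennreal (indicator {0<..<t} (fst z) * \<bar>oseen_kernel \<alpha> (t - fst z) j h k (x - snd z)\<bar>) * X (fst z) (snd z) \<partial>(lborel \<Otimes>\<^sub>M lborel))"
      by (rule nn_integral_oseen_integrand_le) (use H in auto)
    finally show "ennreal \<bar>?I j h k\<bar> \<le> \<dots>" .
  qed
  finally show ?thesis .
qed

definition duhamel :: "(real \<Rightarrow> real^3 \<Rightarrow> real^3) \<Rightarrow> real \<Rightarrow> real^3 \<Rightarrow> real^3" where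
  "duhamel u = oseen_integral (\<lambda>h k s y. u s y $ h * u s y $ k)"

definition square :: "(real \<Rightarrow> real^3 \<Rightarrow> real^3) \<Rightarrow> real \<Rightarrow> real^3 \<Rightarrow> ennreal" where
  "square u s y = ennreal (norm (u s y)) * ennreal (norm (u s y))"

lemma square_measurable [measurable]:
  assumes [measurable]: "borel_measurable2 u"
  shows "borel_measurable2 (square u)"
  unfolding square_def by measurable

lemma abs_component_mult_le: "ennreal \<bar>u $ h * u $ k\<bar> \<le> ennreal (norm u) * ennreal (norm u)" for u :: "real^3"
  by (auto simp: ennreal_mult[symmetric] abs_mult intro!: ennreal_leI mult_mono abs_vec_nth_le)

lemma integrable_duhamel:
  assumes [measurable]: "borel_measurable2 u"
    and "duhamel_abs (square u) t x < \<infinity>"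
  shows "integrable (lborel \<Otimes>\<^sub>M lborel) (oseen_integrand j h k (\<lambda>s y. u s y $ h * u s y $ k) t x)"
  by (rule integrable_oseen_integrand[where X = "square u"])
    (use assms(2) in \<open>auto simp: square_def abs_component_mult_le\<close>)

lemma norm_duhamel_le:
  assumes [measurable]: "borel_measurable2 u"
  shows "ennreal (norm (duhamel u t x)) \<le> duhamel_abs (square u) t x"
  unfolding duhamel_def by (rule norm_oseen_integral_le) (auto simp: square_def abs_component_mult_le)

text \<open>The identity \<open>u_h u_k - v_h v_k = (u - v)_h u_k + v_h (u - v)_k\<close> inside one
  integral. Finiteness at the point is what allows the two signed integrals to be
  subtracted.\<close>

lemma norm_duhamel_diff_le:
  assumes [measurable]: "borel_measurable2 u"
    "borel_measurable2 v"
    and fin: "duhamel_abs (square u) t x < \<infinity>" "duhamel_abs (square v) t x < \<infinity>"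
  shows "ennreal (norm (duhamel u t x - duhamel v t x))
    \<le> duhamel_abs (\<lambda>s y. ennreal (norm (u s y - v s y)) * (ennreal (norm (u s y)) + ennreal (norm (v s y)))) t x"
proof -
  have eq: "duhamel u t x - duhamel v t x = oseen_integral (\<lambda>h k s y. u s y $ h * u s y $ k - v s y $ h * v s y $ k) t x"
  proof -
    have "oseen_integrand j h k (\<lambda>s y. u s y $ h * u s y $ k - v s y $ h * v s y $ k) t x z =
       oseen_integrand j h k (\<lambda>s y. u s y $ h * u s y $ k) t x z - oseen_integrand j h k (\<lambda>s y. v s y $ h * v s y $ k) t x z" for j h k z
      by (simp add: oseen_integrand_def right_diff_distrib)
    then show ?thesis
      using integrable_duhamel[OF assms(1) fin(1)] integrable_duhamel[OF assms(2) fin(2)]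
      by (simp add: duhamel_def oseen_integral_def vec_eq_iff sum_subtractf)
  qed
  show ?thesis unfolding eq
  proof (rule norm_oseen_integral_le)
    fix h k s y
    have "u s y $ h * u s y $ k - v s y $ h * v s y $ k = (u s y - v s y) $ h * u s y $ k + v s y $ h * (u s y - v s y) $ k"
      by (simp add: left_diff_distrib right_diff_distrib)
    also have "\<bar>\<dots>\<bar> \<le> norm (u s y - v s y) * norm (u s y) + norm (v s y) * norm (u s y - v s y)"
      by (intro order.trans[OF abs_triangle_ineq] add_mono)
        (auto simp: abs_mult intro!: mult_mono abs_vec_nth_le simp del: vector_minus_component)
    finally show "ennreal \<bar>u s y $ h * u s y $ k - v s y $ h * v s y $ k\<bar>
      \<le> ennreal (norm (u s y - v s y)) * (ennreal (norm (u s y)) + ennreal (norm (v s y)))"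
      by (simp add: ennreal_mult[symmetric] ennreal_plus[symmetric] distrib_left mult.commute ennreal_leI del: ennreal_plus)
  qed measurable
qed

lemma duhamel_tendsto:
  assumes [measurable]: "\<And>n. borel_measurable2 (u n)"
    "borel_measurable2 v"
    "borel_measurable2 F"
    and lim: "\<And>s y. (\<lambda>n. u n s y) \<longlonglongrightarrow> v s y"
    and le: "\<And>n s y. ennreal (norm (u n s y)) \<le> F s y"
    and fin: "duhamel_abs (\<lambda>s y. F s y * F s y) t x < \<infinity>"
  shows "(\<lambda>n. duhamel (u n) t x) \<longlonglongrightarrow> duhamel v t x"
proof -
  have "(\<lambda>n. LINT z|(lborel \<Otimes>\<^sub>M lborel). oseen_integrand j h k (\<lambda>s y. u n s y $ h * u n s y $ k) t x z)
      \<longlonglongrightarrow> (LINT z|(lborel \<Otimes>\<^sub>M lborel). oseen_integrand j h k (\<lambda>s y. v s y $ h * v s y $ k) t x z)" for j h k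
  proof -
    let ?w = "\<lambda>z. ennreal (indicator {0<..<t} (fst z) * \<bar>oseen_kernel \<alpha> (t - fst z) j h k (x - snd z)\<bar>) * (F (fst z) (snd z) * F (fst z) (snd z))"
    have "?w z = (if 0 < fst z \<and> fst z < t then
      ennreal \<bar>oseen_kernel \<alpha> (t - fst z) j h k (x - snd z)\<bar> * (F (fst z) (snd z) * F (fst z) (snd z)) else 0)" for z
      by (auto split: split_indicator)
    then have [measurable]: "?w \<in> borel_measurable (lborel \<Otimes>\<^sub>M lborel)" by simp
    have w: "(\<integral>\<^sup>+z. ?w z \<partial>(lborel \<Otimes>\<^sub>M lborel)) < \<infinity>"
      using order.strict_trans1[OF summand_le_duhamel_abs fin] by simp
    then have wfin: "AE z in lborel \<Otimes>\<^sub>M lborel. ?w z \<noteq> \<infinity>"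
      by (intro nn_integral_PInf_AE) auto
    show ?thesis
    proof (rule integral_dominated_convergence[where w = "\<lambda>z. enn2real (?w z)"])
      show "integrable (lborel \<Otimes>\<^sub>M lborel) (\<lambda>z. enn2real (?w z))"
      proof (rule integrableI_bounded)
        have "(\<integral>\<^sup>+z. ennreal (norm (enn2real (?w z))) \<partial>(lborel \<Otimes>\<^sub>M lborel)) \<le> (\<integral>\<^sup>+z. ?w z \<partial>(lborel \<Otimes>\<^sub>M lborel))"
          by (intro nn_integral_mono) (simp add: ennreal_enn2real_if)
        then show "(\<integral>\<^sup>+z. ennreal (norm (enn2real (?w z))) \<partial>(lborel \<Otimes>\<^sub>M lborel)) < \<infinity>"
          using w by (rule order.strict_trans1)
      qed measurable
      show "AE z in lborel \<Otimes>\<^sub>M lborel. norm (oseen_integrand j h k (\<lambda>s y. u n s y $ h * u n s y $ k) t x z) \<le> enn2real (?w z)" for n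
        using wfin
      proof eventually_elim
        case (elim z)
        have "ennreal \<bar>oseen_integrand j h k (\<lambda>s y. u n s y $ h * u n s y $ k) t x z\<bar> =
            ennreal (indicator {0<..<t} (fst z) * \<bar>oseen_kernel \<alpha> (t - fst z) j h k (x - snd z)\<bar>) * ennreal \<bar>u n (fst z) (snd z) $ h * u n (fst z) (snd z) $ k\<bar>"
          by (simp add: oseen_integrand_def abs_mult ennreal_mult[symmetric])
        also have "\<dots> \<le> ?w z"
          by (intro mult_left_mono order.trans[OF abs_component_mult_le] mult_mono le) auto
        finally have "enn2real (ennreal \<bar>oseen_integrand j h k (\<lambda>s y. u n s y $ h * u n s y $ k) t x z\<bar>) \<le> enn2real (?w z)"
          using elim by (intro enn2real_mono) (auto simp: less_top[symmetric])
        then show ?case by simp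
      qed
      show "AE z in lborel \<Otimes>\<^sub>M lborel. (\<lambda>n. oseen_integrand j h k (\<lambda>s y. u n s y $ h * u n s y $ k) t x z)
          \<longlonglongrightarrow> oseen_integrand j h k (\<lambda>s y. v s y $ h * v s y $ k) t x z"
        unfolding oseen_integrand_def by (intro AE_I2 tendsto_intros lim)
    qed measurable
  qed
  then show ?thesis
    unfolding duhamel_def oseen_integral_def by (intro vec_tendstoI) (simp add: tendsto_sum)
qed

end

subsection \<open>Existence by a monotone majorant\<close>

lemma Lux_le_zero: "0 < c \<Longrightarrow> Lux_le q (\<lambda>_. 0) c"
  by (simp add: Lux_le_def)

lemma AE_zero_of_Lux_le:
  assumes Q: "0 < Q" and w: "\<And>n::nat. Lux_le (\<lambda>_. Q) w (c / 2 ^ n)"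
  shows "AE x in lborel. w x = 0"
proof -
  have [measurable]: "w \<in> borel_measurable borel" and c: "0 < c" using w[of 0] by (auto dest: Lux_leD)
  have le: "(\<integral>\<^sup>+x. epow (w x) Q \<partial>lborel) \<le> ennreal ((c / 2 ^ n) powr Q)" for n :: nat
  proof -
    have "w x = ennreal (c / 2 ^ n) * (ennreal (1 / (c / 2 ^ n)) * w x)" for x
      using c by (simp add: mult.assoc[symmetric] ennreal_mult[symmetric])
    then have "(\<integral>\<^sup>+x. epow (w x) Q \<partial>lborel) = (\<integral>\<^sup>+x. epow (ennreal (c / 2 ^ n)) Q * epow (ennreal (1 / (c / 2 ^ n)) * w x) Q \<partial>lborel)"
      by (simp only: epow_mult[symmetric])
    also have "\<dots> = ennreal ((c / 2 ^ n) powr Q) * (\<integral>\<^sup>+x. epow (ennreal (1 / (c / 2 ^ n)) * w x) Q \<partial>lborel)"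
      using c by (subst nn_integral_cmult) auto
    also have "\<dots> \<le> ennreal ((c / 2 ^ n) powr Q) * 1"
      by (intro mult_left_mono Lux_leD(3)[OF w]) auto
    finally show ?thesis by simp
  qed
  have "(\<lambda>n. c * (1 / 2) ^ n) \<longlonglongrightarrow> c * 0"
    by (intro tendsto_intros LIMSEQ_realpow_zero) auto
  then have "(\<lambda>n. c / 2 ^ n) \<longlonglongrightarrow> 0" by (simp add: power_one_over)
  then have "(\<lambda>n. (c / 2 ^ n) powr Q) \<longlonglongrightarrow> 0 powr Q"
    by (rule tendsto_powr2[OF _ tendsto_const]) (use c Q in auto)
  then have "(\<lambda>n. ennreal ((c / 2 ^ n) powr Q)) \<longlonglongrightarrow> ennreal 0"
    using Q by (intro tendsto_ennrealI) simp
  then have "(\<integral>\<^sup>+x. epow (w x) Q \<partial>lborel) \<le> ennreal 0"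
    by (rule LIMSEQ_le_const) (use le in auto)
  then have "(\<integral>\<^sup>+x. epow (w x) Q \<partial>lborel) = 0" by simp
  then show ?thesis by (subst (asm) nn_integral_0_iff_AE) auto
qed

text \<open>Eliminates the mixed product of the large and the small part, so that the square of a
  sum is estimated by two pure squares, each with a single integrability exponent.\<close>

lemma ennreal_add_square_le: "(x + y) * (x + y) \<le> ennreal 2 * x * x + ennreal 2 * y * y"
proof (cases "x = \<top> \<or> y = \<top>")
  case False
  then obtain r s where rs: "x = ennreal r" "y = ennreal s" "0 \<le> r" "0 \<le> s" by (cases x; cases y) auto
  have "(r + s) * (r + s) \<le> 2 * r * r + 2 * s * s"
    using zero_le_power2[of "r - s"] by (simp add: power2_eq_square algebra_simps)
  then have "ennreal ((r + s) * (r + s)) \<le> ennreal (2 * r * r + 2 * s * s)" by (rule ennreal_leI)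
  then show ?thesis using rs by (simp add: ennreal_mult ennreal_plus mult.assoc)
qed (auto simp: ennreal_mult_top ennreal_top_mult)

context stable_subordinator
begin

primrec majorant :: "(real \<Rightarrow> real^3 \<Rightarrow> ennreal) \<Rightarrow> nat \<Rightarrow> real \<Rightarrow> real^3 \<Rightarrow> ennreal" where
  "majorant Ub 0 = (\<lambda>t x. 0)"
| "majorant Ub (Suc n) = (\<lambda>t x. Ub t x + duhamel_abs (\<lambda>s y. majorant Ub n s y * majorant Ub n s y) t x)"

definition majorant_limit :: "(real \<Rightarrow> real^3 \<Rightarrow> ennreal) \<Rightarrow> real \<Rightarrow> real^3 \<Rightarrow> ennreal" where
  "majorant_limit Ub t x = (SUP n. majorant Ub n t x)"

lemma majorant_measurable [measurable]:
  assumes [measurable]: "borel_measurable2 Ub"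
  shows "borel_measurable2 (majorant Ub n)"
proof (induction n)
  case (Suc n)
  note Suc[measurable]
  show ?case by simp
qed simp

lemma majorant_limit_measurable [measurable]:
  assumes [measurable]: "borel_measurable2 Ub"
  shows "borel_measurable2 (majorant_limit Ub)"
  unfolding majorant_limit_def by measurable

lemma majorant_mono: "majorant Ub n t x \<le> majorant Ub (Suc n) t x"
proof (induction n arbitrary: t x)
  case (Suc n)
  show ?case
    unfolding majorant.simps(2)[of Ub "Suc n"] majorant.simps(2)[of Ub n]
    by (intro add_left_mono duhamel_abs_mono mult_mono) (use Suc in auto)
qed simp

lemma majorant_le_limit: "majorant Ub n t x \<le> majorant_limit Ub t x"
  unfolding majorant_limit_def by (rule SUP_upper) simp

text \<open>Monotone convergence in space and then in time, with squaring continuous along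
  increasing sequences. All values lie in [0,\<infinity>], so the limit equation holds at every
  point and not merely almost everywhere.\<close>

lemma majorant_limit_eq:
  assumes [measurable]: "borel_measurable2 Ub"
  shows "majorant_limit Ub t x =
      Ub t x + duhamel_abs (\<lambda>s y. majorant_limit Ub s y * majorant_limit Ub s y) t x"
    and "duhamel_abs (\<lambda>s y. majorant_limit Ub s y * majorant_limit Ub s y) t x =
      (SUP n. duhamel_abs (\<lambda>s y. majorant Ub n s y * majorant Ub n s y) t x)"
proof -
  let ?F = "majorant Ub" and ?G = "majorant_limit Ub"
  have inc: "?F n s y * ?F n s y \<le> ?F (Suc n) s y * ?F (Suc n) s y" for n s y
    by (intro mult_mono majorant_mono) auto
  have sq: "?G s y * ?G s y = (SUP n. ?F n s y * ?F n s y)" for s y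
    using epow_SUP[of 2 "\<lambda>n. ?F n s y"] by (simp add: majorant_limit_def epow_by_2)
  have conv: "oseen_conv_abs \<alpha> r (\<lambda>y. ?G s y * ?G s y) x = (SUP n. oseen_conv_abs \<alpha> r (\<lambda>y. ?F n s y * ?F n s y) x)" for r s
    unfolding oseen_conv_abs_def sq SUP_mult_left_ennreal
    by (rule nn_integral_monotone_convergence_SUP)
      (auto intro!: incseq_SucI mult_left_mono inc simp: le_fun_def simp del: majorant.simps)
  have conv_inc: "oseen_conv_abs \<alpha> r (\<lambda>y. ?F n s y * ?F n s y) x \<le> oseen_conv_abs \<alpha> r (\<lambda>y. ?F (Suc n) s y * ?F (Suc n) s y) x" for r s n
    unfolding oseen_conv_abs_def by (intro nn_integral_mono mult_left_mono inc) auto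
  show sup: "duhamel_abs (\<lambda>s y. ?G s y * ?G s y) t x = (SUP n. duhamel_abs (\<lambda>s y. ?F n s y * ?F n s y) t x)"
    unfolding duhamel_abs_def conv SUP_mult_left_ennreal
    by (rule nn_integral_monotone_convergence_SUP)
      (auto intro!: incseq_SucI mult_left_mono conv_inc simp: le_fun_def simp del: majorant.simps)
  have "?G t x = (SUP n. ?F (Suc n) t x)"
    unfolding majorant_limit_def
  proof (rule antisym)
    show "(SUP n. ?F n t x) \<le> (SUP n. ?F (Suc n) t x)"
      by (rule SUP_mono) (use majorant_mono in blast)
    show "(SUP n. ?F (Suc n) t x) \<le> (SUP n. ?F n t x)"
      by (rule SUP_mono) blast
  qed
  also have "\<dots> = Ub t x + (SUP n. duhamel_abs (\<lambda>s y. ?F n s y * ?F n s y) t x)"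
    by (simp add: ennreal_SUP_add_right)
  finally show "?G t x = Ub t x + duhamel_abs (\<lambda>s y. ?G s y * ?G s y) t x" by (simp add: sup)
qed

text \<open>The convention \<open>0\<close> where the majorant is infinite keeps the iterates dominated everywhere.\<close>

primrec picard :: "(real \<Rightarrow> real^3 \<Rightarrow> ennreal) \<Rightarrow> (real \<Rightarrow> real^3 \<Rightarrow> real^3) \<Rightarrow> nat \<Rightarrow> real \<Rightarrow> real^3 \<Rightarrow> real^3" where
  "picard Ub U 0 = (\<lambda>t x. 0)"
| "picard Ub U (Suc n) = (\<lambda>t x. if majorant_limit Ub t x < \<infinity> then U t x - duhamel (picard Ub U n) t x else 0)"

lemma duhamel_measurable [measurable]:
  assumes [measurable]: "borel_measurable2 u"
  shows "borel_measurable2 (duhamel u)"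
  unfolding duhamel_def by measurable

lemma picard_measurable [measurable]:
  assumes [measurable]: "borel_measurable2 Ub"
    "borel_measurable2 U"
  shows "borel_measurable2 (picard Ub U n)"
proof (induction n)
  case (Suc n)
  note Suc[measurable]
  show ?case by simp
qed simp

lemma picard_le_majorant:
  assumes [measurable]: "borel_measurable2 Ub"
    "borel_measurable2 U"
    and U: "\<And>t x. ennreal (norm (U t x)) \<le> Ub t x"
  shows "ennreal (norm (picard Ub U n t x)) \<le> majorant Ub n t x"
proof (induction n arbitrary: t x)
  case (Suc n)
  let ?u = "picard Ub U n"
  have "ennreal (norm (U t x - duhamel ?u t x)) \<le> ennreal (norm (U t x)) + ennreal (norm (duhamel ?u t x))"
    by (simp add: ennreal_plus[symmetric] ennreal_leI norm_triangle_ineq4 del: ennreal_plus)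
  also have "\<dots> \<le> Ub t x + duhamel_abs (square ?u) t x" by (intro add_mono U norm_duhamel_le) measurable
  also have "\<dots> \<le> majorant Ub (Suc n) t x"
    by (auto simp: square_def intro!: add_left_mono duhamel_abs_mono mult_mono Suc)
  finally show ?case by (simp del: majorant.simps)
qed simp

lemma duhamel_abs_finite:
  assumes [measurable]: "borel_measurable2 Ub"
    and G: "majorant_limit Ub t x < \<infinity>" and u: "\<And>s y. ennreal (norm (u s y)) \<le> majorant_limit Ub s y"
  shows "duhamel_abs (square u) t x < \<infinity>"
proof -
  have "duhamel_abs (square u) t x \<le> duhamel_abs (\<lambda>s y. majorant_limit Ub s y * majorant_limit Ub s y) t x"
    by (intro duhamel_abs_mono) (auto simp: square_def intro!: mult_mono u)
  also have "\<dots> \<le> majorant_limit Ub t x" by (subst (3) majorant_limit_eq(1)) auto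
  finally show ?thesis using G by (rule order.strict_trans1)
qed

text \<open>A bound of the increments of the iterates by those of the majorant, with both sides moved so that
  no subtraction in \<^typ>\<open>ennreal\<close> occurs.\<close>

lemma picard_increment:
  assumes [measurable]: "borel_measurable2 Ub"
    "borel_measurable2 U"
    and U: "\<And>t x. ennreal (norm (U t x)) \<le> Ub t x"
  shows "ennreal (norm (picard Ub U (Suc n) t x - picard Ub U n t x)) + majorant Ub n t x
    \<le> majorant Ub (Suc n) t x"
proof (induction n arbitrary: t x)
  case 0
  then show ?case using picard_le_majorant[OF assms, of "Suc 0" t x] by simp
next
  case (Suc n)
  let ?u = "picard Ub U" and ?F = "majorant Ub"
  show ?case
  proof (cases "majorant_limit Ub t x < \<infinity>")
    case False
    then show ?thesis using majorant_mono[of Ub "Suc n" t x] by (simp del: majorant.simps)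
  next
    case True
    let ?X = "\<lambda>s y. ennreal (norm (?u (Suc n) s y - ?u n s y)) * (ennreal (norm (?u (Suc n) s y)) + ennreal (norm (?u n s y)))"
    have le: "ennreal (norm (?u m s y)) \<le> majorant_limit Ub s y" for m s y
      using picard_le_majorant[OF assms] majorant_le_limit by (rule order.trans)
    have "?u (Suc (Suc n)) t x - ?u (Suc n) t x = duhamel (?u n) t x - duhamel (?u (Suc n)) t x"
      using True by simp
    then have "ennreal (norm (?u (Suc (Suc n)) t x - ?u (Suc n) t x)) = ennreal (norm (duhamel (?u (Suc n)) t x - duhamel (?u n) t x))"
      by (simp only: norm_minus_commute)
    also have "\<dots> \<le> duhamel_abs ?X t x"
      by (intro norm_duhamel_diff_le duhamel_abs_finite[OF assms(1) True] le picard_measurable assms(1,2))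
    finally have 1: "ennreal (norm (?u (Suc (Suc n)) t x - ?u (Suc n) t x)) \<le> duhamel_abs ?X t x" .
    \<comment> \<open>This is \<open>G^2 - F^2 = (G - F) (G + F)\<close> for consecutive majorants,
      rearranged so that only \<open>d + F \<le> G\<close> is used.\<close>
    have "?X s y + ?F n s y * ?F n s y \<le> ?F (Suc n) s y * ?F (Suc n) s y" for s y
    proof -
      define d where "d = ennreal (norm (?u (Suc n) s y - ?u n s y))"
      have d: "d + ?F n s y \<le> ?F (Suc n) s y" unfolding d_def by (rule Suc)
      have "?X s y + ?F n s y * ?F n s y \<le> d * (?F (Suc n) s y + ?F n s y) + ?F n s y * ?F n s y"
        unfolding d_def by (intro add_right_mono mult_left_mono add_mono picard_le_majorant assms) auto
      also have "\<dots> = d * ?F (Suc n) s y + (d + ?F n s y) * ?F n s y" by (simp only: distrib_left distrib_right ac_simps)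
      also have "\<dots> \<le> d * ?F (Suc n) s y + ?F (Suc n) s y * ?F n s y" by (intro add_left_mono mult_right_mono d) auto
      also have "\<dots> = ?F (Suc n) s y * (d + ?F n s y)" by (simp only: distrib_left mult.commute)
      also have "\<dots> \<le> ?F (Suc n) s y * ?F (Suc n) s y" by (intro mult_left_mono d) auto
      finally show ?thesis .
    qed
    then have "duhamel_abs (\<lambda>s y. ?X s y + ?F n s y * ?F n s y) t x \<le> duhamel_abs (\<lambda>s y. ?F (Suc n) s y * ?F (Suc n) s y) t x"
      by (intro duhamel_abs_mono)
    moreover have "duhamel_abs (\<lambda>s y. ?X s y + ?F n s y * ?F n s y) t x = duhamel_abs ?X t x + duhamel_abs (\<lambda>s y. ?F n s y * ?F n s y) t x"
    proof (rule duhamel_abs_add)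
      note picard_measurable[OF assms(1,2), measurable]
      show "borel_measurable2 ?X" by measurable
    qed measurable
    ultimately have "duhamel_abs ?X t x + duhamel_abs (\<lambda>s y. ?F n s y * ?F n s y) t x \<le> duhamel_abs (\<lambda>s y. ?F (Suc n) s y * ?F (Suc n) s y) t x"
      by simp
    then have 2: "Ub t x + (duhamel_abs ?X t x + duhamel_abs (\<lambda>s y. ?F n s y * ?F n s y) t x) \<le> ?F (Suc (Suc n)) t x"
      unfolding majorant.simps(2)[of Ub "Suc n"] by (rule add_left_mono)
    have "ennreal (norm (?u (Suc (Suc n)) t x - ?u (Suc n) t x)) + ?F (Suc n) t x \<le> duhamel_abs ?X t x + ?F (Suc n) t x"
      by (rule add_right_mono[OF 1])
    also have "\<dots> = Ub t x + (duhamel_abs ?X t x + duhamel_abs (\<lambda>s y. ?F n s y * ?F n s y) t x)"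
      unfolding majorant.simps(2)[of Ub n] by (rule add.left_commute)
    also have "\<dots> \<le> ?F (Suc (Suc n)) t x" by (rule 2)
    finally show ?thesis .
  qed
qed

text \<open>The increment bounds telescope: the norms of the first \<open>n\<close> increments add
  up to at most the majorant of order \<open>n\<close>. So the series converges absolutely where the
  limit of the majorants is finite; elsewhere all iterates are 0.\<close>

lemma picard_convergent:
  assumes [measurable]: "borel_measurable2 Ub"
    "borel_measurable2 U"
    and U: "\<And>t x. ennreal (norm (U t x)) \<le> Ub t x"
  shows "convergent (\<lambda>n. picard Ub U n t x)"
proof (cases "majorant_limit Ub t x < \<infinity>")
  case False
  have "picard Ub U n t x = 0" for n using False by (cases n) auto
  then show ?thesis by (simp add: convergent_const)
next
  case True
  let ?d = "\<lambda>n. picard Ub U (Suc n) t x - picard Ub U n t x"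
  have "(\<Sum>i<n. ennreal (norm (?d i))) \<le> majorant Ub n t x" for n
  proof (induction n)
    case (Suc n)
    have "(\<Sum>i<Suc n. ennreal (norm (?d i))) = ennreal (norm (?d n)) + (\<Sum>i<n. ennreal (norm (?d i)))"
      by (simp add: add.commute)
    also have "\<dots> \<le> ennreal (norm (?d n)) + majorant Ub n t x" by (intro add_left_mono Suc)
    also have "\<dots> \<le> majorant Ub (Suc n) t x" by (rule picard_increment[OF assms])
    finally show ?case .
  qed simp
  then have "(\<Sum>i<n. ennreal (norm (?d i))) \<le> majorant_limit Ub t x" for n
    using majorant_le_limit by (rule order.trans)
  then have "ennreal (\<Sum>i<n. norm (?d i)) \<le> majorant_limit Ub t x" for n by (simp add: sum_ennreal)
  then have "(\<Sum>i<n. norm (?d i)) \<le> enn2real (majorant_limit Ub t x)" for n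
    using True enn2real_mono[of "ennreal (\<Sum>i<n. norm (?d i))" "majorant_limit Ub t x"]
    by (simp add: sum_nonneg)
  then have "summable (\<lambda>i. norm (?d i))" by (intro summableI_nonneg_bounded) auto
  then have "summable ?d" by (rule summable_norm_cancel)
  then have "convergent (\<lambda>n. \<Sum>i<n. ?d i)" by (simp add: summable_iff_convergent)
  moreover have "(\<Sum>i<n. ?d i) = picard Ub U n t x" for n
    by (subst sum_lessThan_telescope) (simp del: picard.simps(2))
  ultimately show ?thesis by simp
qed

text \<open>The square of the limiting majorant dominates the quadratic terms, and its Duhamel
  integral is finite wherever the majorant is, by the majorant equation. The exceptional set is thus
  explicit and the same for the bounds and for the equation.\<close>

lemma picard_solution:
  assumes [measurable]: "borel_measurable2 Ub"
    "borel_measurable2 U"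
    and U: "\<And>t x. ennreal (norm (U t x)) \<le> Ub t x"
  obtains u where "borel_measurable2 u"
    "\<And>t x. ennreal (norm (u t x)) \<le> majorant_limit Ub t x"
    "\<And>t x. majorant_limit Ub t x < \<infinity> \<Longrightarrow> duhamel_abs (square u) t x < \<infinity>"
    "\<And>t x. majorant_limit Ub t x < \<infinity> \<Longrightarrow> u t x = U t x - duhamel u t x"
proof -
  define u where "u t x = lim (\<lambda>n. picard Ub U n t x)" for t x
  have lim: "(\<lambda>n. picard Ub U n t x) \<longlonglongrightarrow> u t x" for t x
    unfolding u_def using picard_convergent[OF assms] by (simp add: convergent_LIMSEQ_iff)
  note picard_measurable[OF assms(1,2), measurable]
  have meas[measurable]: "borel_measurable2 u"
    by (rule borel_measurable_LIMSEQ_metric[where f = "\<lambda>n (t, x). picard Ub U n t x"])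
      (use lim in \<open>auto simp del: picard.simps\<close>)
  have le: "ennreal (norm (picard Ub U n t x)) \<le> majorant_limit Ub t x" for n t x
    using picard_le_majorant[OF assms] majorant_le_limit by (rule order.trans)
  have ule: "ennreal (norm (u t x)) \<le> majorant_limit Ub t x" for t x
    using tendsto_ennrealI[OF tendsto_norm[OF lim]] by (rule LIMSEQ_le_const2) (use le in auto)
  have "u t x = U t x - duhamel u t x" if G: "majorant_limit Ub t x < \<infinity>" for t x
  proof -
    have "duhamel_abs (\<lambda>s y. majorant_limit Ub s y * majorant_limit Ub s y) t x \<le> majorant_limit Ub t x"
      by (subst (3) majorant_limit_eq(1)) auto
    then have "duhamel_abs (\<lambda>s y. majorant_limit Ub s y * majorant_limit Ub s y) t x < \<infinity>"
      using G by (rule order.strict_trans1)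
    then have "(\<lambda>n. duhamel (picard Ub U n) t x) \<longlonglongrightarrow> duhamel u t x"
      by (intro duhamel_tendsto[where F = "majorant_limit Ub"] lim le) measurable
    then have "(\<lambda>n. U t x - duhamel (picard Ub U n) t x) \<longlonglongrightarrow> U t x - duhamel u t x"
      by (intro tendsto_intros)
    then have "(\<lambda>n. picard Ub U (Suc n) t x) \<longlonglongrightarrow> U t x - duhamel u t x" using G by simp
    moreover have "(\<lambda>n. picard Ub U (Suc n) t x) \<longlonglongrightarrow> u t x" using lim by (rule LIMSEQ_Suc)
    ultimately show ?thesis by (rule LIMSEQ_unique[symmetric])
  qed
  then show thesis
    using that[OF meas ule duhamel_abs_finite[OF assms(1) _ ule]] by blast
qed

end

section \<open>Norm bounds for the majorant\<close>

context navier_stokes_exponents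
begin

lemma Lux_le_duhamel_square:
  "\<exists>C>0. \<forall>t F G d Z. 0 < t \<longrightarrow> t \<le> 1 \<longrightarrow>
     borel_measurable2 F \<longrightarrow>
     borel_measurable2 G \<longrightarrow>
     d \<in> borel_measurable borel \<longrightarrow>
     (AE s in lborel. 0 < s \<longrightarrow> s < t \<longrightarrow> Lux_le (\<lambda>_. 1 / a) (F s) (d s) \<and> Lux_le (\<lambda>_. 1 / b) (G s) (d s)) \<longrightarrow>
     0 < Z \<longrightarrow> (\<integral>\<^sup>+s. ennreal ((t - s) powr (- \<gamma>) * (d s * d s)) * indicator {0<..<t} s \<partial>lborel) \<le> ennreal Z \<longrightarrow>
     Lux_le (\<lambda>_. 1 / b) (duhamel_abs (\<lambda>s y. (F s y + G s y) * (F s y + G s y)) t) (C * Z)"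
proof -
  obtain C where C: "0 < C" "\<And>t A B F G d e Z. 0 < t \<Longrightarrow> t \<le> 1 \<Longrightarrow> b \<le> A \<Longrightarrow> A \<le> a \<Longrightarrow> b \<le> B \<Longrightarrow> B \<le> a \<Longrightarrow>
     borel_measurable2 F \<Longrightarrow>
     borel_measurable2 G \<Longrightarrow>
     d \<in> borel_measurable borel \<Longrightarrow> e \<in> borel_measurable borel \<Longrightarrow>
     (AE s in lborel. 0 < s \<longrightarrow> s < t \<longrightarrow> Lux_le (\<lambda>_. 1 / A) (F s) (d s) \<and> Lux_le (\<lambda>_. 1 / B) (G s) (e s)) \<Longrightarrow>
     0 < Z \<Longrightarrow> (\<integral>\<^sup>+s. ennreal ((t - s) powr (- \<gamma>) * (d s * e s)) * indicator {0<..<t} s \<partial>lborel) \<le> ennreal Z \<Longrightarrow>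
     Lux_le (\<lambda>_. 1 / b) (duhamel_abs (\<lambda>s y. F s y * G s y) t) (C * Z)"
    using Lux_le_duhamel by blast
  have "Lux_le (\<lambda>_. 1 / b) (duhamel_abs (\<lambda>s y. (F s y + G s y) * (F s y + G s y)) t) (4 * C * Z)"
    if t: "0 < t" "t \<le> 1" and [measurable]: "borel_measurable2 F"
      "borel_measurable2 G" "d \<in> borel_measurable borel"
      and FG: "AE s in lborel. 0 < s \<longrightarrow> s < t \<longrightarrow> Lux_le (\<lambda>_. 1 / a) (F s) (d s) \<and> Lux_le (\<lambda>_. 1 / b) (G s) (d s)"
      and Z: "0 < Z" "(\<integral>\<^sup>+s. ennreal ((t - s) powr (- \<gamma>) * (d s * d s)) * indicator {0<..<t} s \<partial>lborel) \<le> ennreal Z"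
    for t F G d Z
  proof -
    have Z2: "(\<integral>\<^sup>+s. ennreal ((t - s) powr (- \<gamma>) * (2 * d s * d s)) * indicator {0<..<t} s \<partial>lborel) \<le> ennreal (2 * Z)"
    proof -
      have "ennreal ((t - s) powr (- \<gamma>) * (2 * d s * d s)) * indicator {0<..<t} s
        = ennreal 2 * (ennreal ((t - s) powr (- \<gamma>) * (d s * d s)) * indicator {0<..<t} s)" for s
      proof -
        have "ennreal ((t - s) powr (- \<gamma>) * (2 * d s * d s)) = ennreal 2 * ennreal ((t - s) powr (- \<gamma>) * (d s * d s))"
          by (subst ennreal_mult'[symmetric]) (auto simp: mult_ac)
        then show ?thesis by (simp only: mult.assoc)
      qed
      then have "(\<integral>\<^sup>+s. ennreal ((t - s) powr (- \<gamma>) * (2 * d s * d s)) * indicator {0<..<t} s \<partial>lborel)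
        = ennreal 2 * (\<integral>\<^sup>+s. ennreal ((t - s) powr (- \<gamma>) * (d s * d s)) * indicator {0<..<t} s \<partial>lborel)"
        by (simp only:) (rule nn_integral_cmult, measurable)
      also have "\<dots> \<le> ennreal 2 * ennreal Z" by (intro mult_left_mono Z) auto
      finally show ?thesis using Z by (simp add: ennreal_mult)
    qed
    have 1: "Lux_le (\<lambda>_. 1 / b) (duhamel_abs (\<lambda>s y. ennreal 2 * F s y * F s y) t) (C * (2 * Z))"
    proof (rule C(2)[of t a a "\<lambda>s y. ennreal 2 * F s y" F "\<lambda>s. 2 * d s" d])
      show "AE s in lborel. 0 < s \<longrightarrow> s < t \<longrightarrow> Lux_le (\<lambda>_. 1 / a) (\<lambda>y. ennreal 2 * F s y) (2 * d s) \<and> Lux_le (\<lambda>_. 1 / a) (F s) (d s)"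
        using FG by eventually_elim (auto intro: Lux_le_scale simp del: ennreal_numeral)
    qed (use t ab Z Z2 in auto)
    have 2: "Lux_le (\<lambda>_. 1 / b) (duhamel_abs (\<lambda>s y. ennreal 2 * G s y * G s y) t) (C * (2 * Z))"
    proof (rule C(2)[of t b b "\<lambda>s y. ennreal 2 * G s y" G "\<lambda>s. 2 * d s" d])
      show "AE s in lborel. 0 < s \<longrightarrow> s < t \<longrightarrow> Lux_le (\<lambda>_. 1 / b) (\<lambda>y. ennreal 2 * G s y) (2 * d s) \<and> Lux_le (\<lambda>_. 1 / b) (G s) (d s)"
        using FG by eventually_elim (auto intro: Lux_le_scale simp del: ennreal_numeral)
    qed (use t ab Z Z2 in auto)
    have "Lux_le (\<lambda>_. 1 / b) (\<lambda>x. duhamel_abs (\<lambda>s y. ennreal 2 * F s y * F s y) t x + duhamel_abs (\<lambda>s y. ennreal 2 * G s y * G s y) t x) (C * (2 * Z) + C * (2 * Z))"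
      by (rule Lux_le_add[OF _ _ 1 2]) (use inverse_gt_2 in auto)
    moreover have "duhamel_abs (\<lambda>s y. (F s y + G s y) * (F s y + G s y)) t x
      \<le> duhamel_abs (\<lambda>s y. ennreal 2 * F s y * F s y) t x + duhamel_abs (\<lambda>s y. ennreal 2 * G s y * G s y) t x" for x
      by (subst duhamel_abs_add[symmetric]) (auto intro!: duhamel_abs_mono ennreal_add_square_le simp del: ennreal_numeral)
    ultimately show ?thesis
      by (elim Lux_le_mono) (use ab in auto)
  qed
  then show ?thesis using C(1) by (intro exI[of _ "4 * C"]) auto
qed

lemma Gamma_pos: "0 < Gamma (1 - \<gamma>)"
  using \<gamma>_lt_1 by (intro Gamma_real_pos) simp

text \<open>The induction closes because the Duhamel term lies in \<open>L^(1/b)\<close> with norm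
  at most \<open>M\<close> and can be added to the small values of \<open>Ub\<close>. Both parts
  then have norm at most \<open>2 * M\<close>, and a short time restores the bound \<open>M\<close>.
  That time depends on \<open>M\<close> but not on \<open>Ub\<close> or \<open>n\<close>.\<close>

lemma majorant_bound:
  assumes M: "0 < M"
  obtains T where "0 < T" "T \<le> 1"
    "\<And>Ub n t. borel_measurable2 Ub \<Longrightarrow>
       (\<And>t. 0 < t \<Longrightarrow> t < T \<Longrightarrow> Lux_le q (Ub t) M) \<Longrightarrow> 0 < t \<Longrightarrow> t < T \<Longrightarrow>
       Lux_le (\<lambda>_. 1 / b) (duhamel_abs (\<lambda>s y. majorant Ub n s y * majorant Ub n s y) t) M"
proof -
  obtain C where C: "0 < C" "\<And>t F G d Z. 0 < t \<Longrightarrow> t \<le> 1 \<Longrightarrow>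
     borel_measurable2 F \<Longrightarrow>
     borel_measurable2 G \<Longrightarrow>
     d \<in> borel_measurable borel \<Longrightarrow>
     (AE s in lborel. 0 < s \<longrightarrow> s < t \<longrightarrow> Lux_le (\<lambda>_. 1 / a) (F s) (d s) \<and> Lux_le (\<lambda>_. 1 / b) (G s) (d s)) \<Longrightarrow>
     0 < Z \<Longrightarrow> (\<integral>\<^sup>+s. ennreal ((t - s) powr (- \<gamma>) * (d s * d s)) * indicator {0<..<t} s \<partial>lborel) \<le> ennreal Z \<Longrightarrow>
     Lux_le (\<lambda>_. 1 / b) (duhamel_abs (\<lambda>s y. (F s y + G s y) * (F s y + G s y)) t) (C * Z)"
    using Lux_le_duhamel_square by blast
  \<comment> \<open>Chosen so that the bound after one step is
    \<open>M * (K * T powr (1 - \<gamma>))\<close>; the factor 4 is the square of the 2 in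
    \<open>2 * M\<close>. Then \<open>T\<close> is taken with
    \<open>K * T powr (1 - \<gamma>) \<le> 1\<close>.\<close>
  define K where "K = C * (4 * M * (exp 1 * Gamma (1 - \<gamma>)))"
  have K: "0 < K" using C M Gamma_pos by (simp add: K_def)
  define T where "T = min 1 ((1 / K) powr (1 / (1 - \<gamma>)))"
  have T: "0 < T" "T \<le> 1" using K by (auto simp: T_def)
  have TK: "K * T powr (1 - \<gamma>) \<le> 1"
  proof -
    have "T powr (1 - \<gamma>) \<le> ((1 / K) powr (1 / (1 - \<gamma>))) powr (1 - \<gamma>)"
      using T \<gamma>_lt_1 by (intro powr_mono2) (auto simp: T_def)
    also have "\<dots> = 1 / K" using K \<gamma>_lt_1 by (simp add: powr_powr)
    finally show ?thesis using K by (simp add: field_simps)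
  qed
  show thesis
  proof (rule that[OF T])
    fix Ub n t
    assume [measurable]: "borel_measurable2 Ub"
      and Ub: "\<And>t. 0 < t \<Longrightarrow> t < T \<Longrightarrow> Lux_le q (Ub t) M" and t: "0 < t" "t < T"
    show "Lux_le (\<lambda>_. 1 / b) (duhamel_abs (\<lambda>s y. majorant Ub n s y * majorant Ub n s y) t) M"
      using t
    proof (induction n arbitrary: t)
      case 0
      then show ?case using M by (simp add: duhamel_abs_def oseen_conv_abs_def Lux_le_zero)
    next
      case (Suc n)
      let ?D = "duhamel_abs (\<lambda>s y. majorant Ub n s y * majorant Ub n s y)"
      define F where "F s y = (if ennreal M < Ub s y then Ub s y else 0)" for s y
      define G where "G s y = (if ennreal M < Ub s y then 0 else Ub s y) + ?D s y" for s y
      have [measurable]: "borel_measurable2 F"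
        "borel_measurable2 G"
        unfolding F_def G_def by measurable
      have FG: "Lux_le (\<lambda>_. 1 / a) (F s) (2 * M) \<and> Lux_le (\<lambda>_. 1 / b) (G s) (2 * M)" if s: "0 < s" "s < t" for s
      proof -
        have s': "0 < s" "s < T" using s Suc by auto
        have 1: "Lux_le (\<lambda>_. 1 / a) (F s) M" and 2: "Lux_le (\<lambda>_. 1 / b) (\<lambda>y. if ennreal M < Ub s y then 0 else Ub s y) M"
          using Lux_le_split[OF Ub[OF s'], of "1 / a" "1 / b"] q_ge q_le a_pos by (auto simp: F_def[abs_def])
        have "Lux_le (\<lambda>_. 1 / b) (G s) (M + M)"
          unfolding G_def by (rule Lux_le_add[OF _ _ 2 Suc.IH[OF s']]) (use inverse_gt_2 in auto)
        then show ?thesis using Lux_le_mono[OF 1, of "F s" "2 * M"] M a_pos by auto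
      qed
      have tT: "t \<le> T" using Suc by simp
      have "Lux_le (\<lambda>_. 1 / b) (duhamel_abs (\<lambda>s y. (F s y + G s y) * (F s y + G s y)) t)
          (C * (4 * M * M * (exp 1 * Gamma (1 - \<gamma>) * T powr (1 - \<gamma>))))"
      proof (rule C(2)[of t F G "\<lambda>_. 2 * M"])
        have "(\<integral>\<^sup>+s. ennreal ((t - s) powr (- \<gamma>) * ((2 * M) * (2 * M))) * indicator {0<..<t} s \<partial>lborel)
          = (\<integral>\<^sup>+s. ennreal (4 * M * M) * (ennreal ((t - s) powr (- \<gamma>)) * indicator {0<..<t} s) \<partial>lborel)"
          using M by (intro nn_integral_cong) (auto simp: ennreal_mult[symmetric] mult_ac split: split_indicator)
        also have "\<dots> = ennreal (4 * M * M) * (\<integral>\<^sup>+s. ennreal ((t - s) powr (- \<gamma>)) * indicator {0<..<t} s \<partial>lborel)"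
          by (rule nn_integral_cmult) measurable
        also have "\<dots> \<le> ennreal (4 * M * M) * ennreal (exp 1 * Gamma (1 - \<gamma>) * T powr (1 - \<gamma>))"
          by (intro mult_left_mono nn_integral_time_kernel' \<gamma>_lt_1 T tT) auto
        also have "\<dots> = ennreal (4 * M * M * (exp 1 * Gamma (1 - \<gamma>) * T powr (1 - \<gamma>)))"
          using M Gamma_pos by (subst ennreal_mult[symmetric]) auto
        finally show "(\<integral>\<^sup>+s. ennreal ((t - s) powr (- \<gamma>) * ((2 * M) * (2 * M))) * indicator {0<..<t} s \<partial>lborel)
          \<le> ennreal (4 * M * M * (exp 1 * Gamma (1 - \<gamma>) * T powr (1 - \<gamma>)))" .
      qed (use Suc T M FG Gamma_pos in auto)
      moreover have "F s y + G s y = majorant Ub (Suc n) s y" for s y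
        by (auto simp: F_def G_def)
      moreover have "C * (4 * M * M * (exp 1 * Gamma (1 - \<gamma>) * T powr (1 - \<gamma>))) \<le> M"
      proof -
        have "C * (4 * M * M * (exp 1 * Gamma (1 - \<gamma>) * T powr (1 - \<gamma>))) = M * (K * T powr (1 - \<gamma>))"
          by (simp add: K_def mult_ac)
        also have "\<dots> \<le> M * 1" using M TK by (intro mult_left_mono) auto
        finally show ?thesis by simp
      qed
      ultimately show ?case
        using ab by (intro Lux_le_mono[of "\<lambda>_. 1 / b" _ _ _ M]) (auto simp del: majorant.simps)
    qed
  qed
qed

text \<open>The bounds on the Duhamel iterates survive the monotone limit in \<open>L^(1/b)\<close>
  and are carried to \<open>L^q(.)\<close> by the embedding with constant \<open>E\<close>, whence
  \<open>M' = M + E * M\<close>. Finite norm makes the limiting majorant finite almost everywhere on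
  each time slice, and there the equation holds.\<close>

lemma existence:
  assumes M: "0 < M"
    and m[measurable]: "borel_measurable2 Ub"
      "borel_measurable2 U"
    and U: "\<And>t x. ennreal (norm (U t x)) \<le> Ub t x"
    and UbM: "\<And>t. 0 < t \<Longrightarrow> t \<le> 1 \<Longrightarrow> Lux_le q (Ub t) M"
  obtains T M' u where "0 < T" "T \<le> 1" "borel_measurable2 u"
    "\<And>t. 0 < t \<Longrightarrow> t < T \<Longrightarrow> Lux_le q (\<lambda>x. ennreal (norm (u t x))) M'"
    "\<And>t. 0 < t \<Longrightarrow> t < T \<Longrightarrow>
       AE x in lborel. Ub t x < \<infinity> \<and> duhamel_abs (square u) t x < \<infinity> \<and> u t x = U t x - duhamel u t x"
proof (rule majorant_bound[OF M])
  fix T assume T: "0 < T" "T \<le> 1" and bound: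
    "\<And>Ub n t. borel_measurable2 Ub \<Longrightarrow>
       (\<And>t. 0 < t \<Longrightarrow> t < T \<Longrightarrow> Lux_le q (Ub t) M) \<Longrightarrow> 0 < t \<Longrightarrow> t < T \<Longrightarrow>
       Lux_le (\<lambda>_. 1 / b) (duhamel_abs (\<lambda>s y. majorant Ub n s y * majorant Ub n s y) t) M"
  have Ub: "Lux_le q (Ub t) M" if "0 < t" "t < T" for t using UbM that T by simp
  obtain E where E: "1 \<le> E" "\<And>w d. Lux_le (\<lambda>_. 1 / b) w d \<Longrightarrow> Lux_le q w (E * d)"
    using Lux_le_embedding by blast
  obtain u where u[measurable]: "borel_measurable2 u"
    and ule: "\<And>t x. ennreal (norm (u t x)) \<le> majorant_limit Ub t x"
    and ufin: "\<And>t x. majorant_limit Ub t x < \<infinity> \<Longrightarrow> duhamel_abs (square u) t x < \<infinity>"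
    and ueq: "\<And>t x. majorant_limit Ub t x < \<infinity> \<Longrightarrow> u t x = U t x - duhamel u t x"
    by (rule picard_solution[OF m U], rule that)
  have "Lux_le q (\<lambda>x. ennreal (norm (u t x))) (M + E * M) \<and>
    (AE x in lborel. Ub t x < \<infinity> \<and> duhamel_abs (square u) t x < \<infinity> \<and> u t x = U t x - duhamel u t x)"
    if t: "0 < t" "t < T" for t
  proof -
    have "Lux_le (\<lambda>_. 1 / b) (\<lambda>x. SUP n. duhamel_abs (\<lambda>s y. majorant Ub n s y * majorant Ub n s y) t x) M"
    proof (rule Lux_le_SUP)
      show "incseq (\<lambda>n. duhamel_abs (\<lambda>s y. majorant Ub n s y * majorant Ub n s y) t)"
        by (rule incseq_SucI) (auto simp: le_fun_def intro!: duhamel_abs_mono mult_mono majorant_mono simp del: majorant.simps)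
    qed (use ab bound[OF _ Ub] t in auto)
    then have "Lux_le q (\<lambda>x. SUP n. duhamel_abs (\<lambda>s y. majorant Ub n s y * majorant Ub n s y) t x) (E * M)" by (rule E)
    then have "Lux_le q (\<lambda>x. Ub t x + (SUP n. duhamel_abs (\<lambda>s y. majorant Ub n s y * majorant Ub n s y) t x)) (M + E * M)"
      by (intro Lux_le_add Ub t) (auto simp: q_gt_1)
    then have L: "Lux_le q (majorant_limit Ub t) (M + E * M)"
      by (simp add: majorant_limit_eq[symmetric])
    then have "AE x in lborel. majorant_limit Ub t x < \<infinity>" by (rule Lux_le_AE_finite[OF q_measurable])
    then have "AE x in lborel. Ub t x < \<infinity> \<and> duhamel_abs (square u) t x < \<infinity> \<and> u t x = U t x - duhamel u t x"
    proof eventually_elim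
      case (elim x)
      have "Ub t x \<le> majorant_limit Ub t x" by (subst majorant_limit_eq(1)) auto
      then show ?case using elim ufin[OF elim] ueq[OF elim] by (auto intro: order.strict_trans1)
    qed
    moreover have "Lux_le q (\<lambda>x. ennreal (norm (u t x))) (M + E * M)"
      by (rule Lux_le_mono[OF L]) (auto simp: ule q_nonneg)
    ultimately show ?thesis by simp
  qed
  then show thesis by (intro that[OF T u]) auto
qed

subsection \<open>Uniqueness\<close>

text \<open>Young's inequality separates the singularity from the norms:
  \<open>(t - s)^(-\<gamma>) n^2 \<le> (t - s)^(-\<gamma> r) + n^P\<close> with
  \<open>r = P / (P - 2)\<close>. The condition \<open>\<gamma> < 1 - 2 / P\<close> says that
  \<open>\<gamma> * r < 1\<close>. So norms that are merely \<open>P\<close>-integrable in time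
  yield a Duhamel term bounded uniformly in time.\<close>

lemma Lux_le_duhamel_abs_square:
  fixes n :: "real \<Rightarrow> real"
  assumes T: "0 < T" "T \<le> 1"
    and [measurable]: "borel_measurable2 u" "n \<in> borel_measurable borel"
    and n: "AE s in lborel. 0 < s \<longrightarrow> s < T \<longrightarrow> Lux_le q (\<lambda>x. ennreal (norm (u s x))) (n s)"
    and N: "(\<integral>\<^sup>+s. ennreal (n s powr P) * indicator {0<..<T} s \<partial>lborel) < \<infinity>"
  obtains Z where "0 < Z" "\<And>t. 0 < t \<Longrightarrow> t < T \<Longrightarrow> Lux_le (\<lambda>_. 1 / b) (duhamel_abs (square u) t) Z"
proof -
  obtain C where C: "0 < C" "\<And>t F G d Z. 0 < t \<Longrightarrow> t \<le> 1 \<Longrightarrow>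
     borel_measurable2 F \<Longrightarrow>
     borel_measurable2 G \<Longrightarrow>
     d \<in> borel_measurable borel \<Longrightarrow>
     (AE s in lborel. 0 < s \<longrightarrow> s < t \<longrightarrow> Lux_le (\<lambda>_. 1 / a) (F s) (d s) \<and> Lux_le (\<lambda>_. 1 / b) (G s) (d s)) \<Longrightarrow>
     0 < Z \<Longrightarrow> (\<integral>\<^sup>+s. ennreal ((t - s) powr (- \<gamma>) * (d s * d s)) * indicator {0<..<t} s \<partial>lborel) \<le> ennreal Z \<Longrightarrow>
     Lux_le (\<lambda>_. 1 / b) (duhamel_abs (\<lambda>s y. (F s y + G s y) * (F s y + G s y)) t) (C * Z)"
    using Lux_le_duhamel_square by blast
  define F where "F s y = (if ennreal (n s) < ennreal (norm (u s y)) then ennreal (norm (u s y)) else 0)" for s y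
  define G where "G s y = (if ennreal (n s) < ennreal (norm (u s y)) then 0 else ennreal (norm (u s y)))" for s y
  have [measurable]: "borel_measurable2 F"
    "borel_measurable2 G"
    unfolding F_def G_def by measurable
  have FG: "F s y + G s y = ennreal (norm (u s y))" for s y by (simp add: F_def G_def)
  define N0 where "N0 = enn2real (\<integral>\<^sup>+s. ennreal (n s powr P) * indicator {0<..<T} s \<partial>lborel)"
  have N0: "(\<integral>\<^sup>+s. ennreal (n s powr P) * indicator {0<..<T} s \<partial>lborel) = ennreal N0" "0 \<le> N0"
    using N by (auto simp: N0_def less_top)
  define r where "r = P / (P - 2)"
  have r: "1 < r" "1 / r + 1 / (P / 2) = 1" "\<gamma> * r < 1"
  proof -
    show "1 < r" using P_gt_2 by (simp add: r_def)
    show "1 / r + 1 / (P / 2) = 1" using P_gt_2 by (simp add: r_def field_simps)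
    have "\<gamma> * r < (1 - 2 / P) * r" using \<gamma>_lt \<open>1 < r\<close> by (intro mult_strict_right_mono) auto
    also have "\<dots> = 1" using P_gt_2 by (simp add: r_def field_simps)
    finally show "\<gamma> * r < 1" .
  qed
  define Z where "Z = exp 1 * Gamma (1 - \<gamma> * r) * 1 powr (1 - \<gamma> * r) + N0"
  have G0: "0 < Gamma (1 - \<gamma> * r)" using r by (intro Gamma_real_pos) simp
  have Z: "0 < Z" using N0 G0 by (simp add: Z_def add_pos_nonneg)
  have "Lux_le (\<lambda>_. 1 / b) (duhamel_abs (\<lambda>s y. (F s y + G s y) * (F s y + G s y)) t) (C * Z)"
    if t: "0 < t" "t < T" for t
  proof (rule C(2)[of t F G n])
    show "AE s in lborel. 0 < s \<longrightarrow> s < t \<longrightarrow> Lux_le (\<lambda>_. 1 / a) (F s) (n s) \<and> Lux_le (\<lambda>_. 1 / b) (G s) (n s)"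
      using n
    proof eventually_elim
      case (elim s)
      show ?case
      proof (intro impI)
        assume "0 < s" "s < t"
        then have "Lux_le q (\<lambda>x. ennreal (norm (u s x))) (n s)" using elim t by auto
        from Lux_le_split[OF this, of "1 / a" "1 / b"] show "Lux_le (\<lambda>_. 1 / a) (F s) (n s) \<and> Lux_le (\<lambda>_. 1 / b) (G s) (n s)"
          using q_ge q_le a_pos by (auto simp: F_def[abs_def] G_def[abs_def])
      qed
    qed
    have "(\<integral>\<^sup>+s. ennreal ((t - s) powr (- \<gamma>) * (n s * n s)) * indicator {0<..<t} s \<partial>lborel)
      \<le> (\<integral>\<^sup>+s. ennreal ((t - s) powr (- (\<gamma> * r))) * indicator {0<..<t} s + ennreal (n s powr P) * indicator {0<..<T} s \<partial>lborel)"
    proof (rule nn_integral_mono_AE)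
      show "AE s in lborel. ennreal ((t - s) powr (- \<gamma>) * (n s * n s)) * indicator {0<..<t} s
        \<le> ennreal ((t - s) powr (- (\<gamma> * r))) * indicator {0<..<t} s + ennreal (n s powr P) * indicator {0<..<T} s"
        using n
      proof eventually_elim
        case (elim s)
        show ?case
        proof (cases "0 < s \<and> s < t")
          case True
          then have "0 < n s" using elim t Lux_leD(1) by auto
          have "(t - s) powr (- \<gamma>) * (n s * n s) \<le> ((t - s) powr (- \<gamma>)) powr r / r + (n s * n s) powr (P / 2) / (P / 2)"
            by (rule Youngs_inequality) (use r P_gt_2 in auto)
          also have "\<dots> \<le> ((t - s) powr (- \<gamma>)) powr r / 1 + (n s * n s) powr (P / 2) / 1"
            using r P_gt_2 by (intro add_mono divide_left_mono) auto
          also have "(n s * n s) powr (P / 2) = n s powr P"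
            using \<open>0 < n s\<close> by (simp add: powr_mult powr_add[symmetric])
          finally have "(t - s) powr (- \<gamma>) * (n s * n s) \<le> (t - s) powr (- (\<gamma> * r)) + n s powr P"
            by (simp add: powr_powr)
          then show ?thesis using True t by (simp add: ennreal_plus[symmetric] ennreal_leI del: ennreal_plus)
        qed (auto split: split_indicator)
      qed
    qed
    also have "\<dots> = (\<integral>\<^sup>+s. ennreal ((t - s) powr (- (\<gamma> * r))) * indicator {0<..<t} s \<partial>lborel) + ennreal N0"
      by (subst nn_integral_add) (auto simp: N0)
    also have "\<dots> \<le> ennreal (exp 1 * Gamma (1 - \<gamma> * r) * 1 powr (1 - \<gamma> * r)) + ennreal N0"
      using r t T by (intro add_right_mono nn_integral_time_kernel') auto
    also have "\<dots> = ennreal Z" using N0 G0 by (simp add: Z_def)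
    finally show "(\<integral>\<^sup>+s. ennreal ((t - s) powr (- \<gamma>) * (n s * n s)) * indicator {0<..<t} s \<partial>lborel) \<le> ennreal Z" .
  qed (use t T Z in auto)
  then have "Lux_le (\<lambda>_. 1 / b) (duhamel_abs (square u) t) (C * Z)" if "0 < t" "t < T" for t
    using that by (simp add: FG square_def[abs_def])
  then show thesis using C Z by (intro that[of "C * Z"]) auto
qed

end

context navier_stokes_exponents
begin

lemma uniqueness:
  fixes n :: "real \<Rightarrow> real" and u v :: "real \<Rightarrow> real^3 \<Rightarrow> real^3"
  assumes T: "0 < T" "T \<le> 1" and M: "0 < M"
    and [measurable]: "borel_measurable2 Ub"
      "borel_measurable2 u"
      "borel_measurable2 v"
      "n \<in> borel_measurable borel"
    and U: "\<And>t x. ennreal (norm (U t x)) \<le> Ub t x"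
    and Ub: "\<And>t. 0 < t \<Longrightarrow> t < T \<Longrightarrow> Lux_le q (Ub t) M"
    and n: "AE s in lborel. 0 < s \<longrightarrow> s < T \<longrightarrow> Lux_le q (\<lambda>x. ennreal (norm (u s x))) (n s)"
      "AE s in lborel. 0 < s \<longrightarrow> s < T \<longrightarrow> Lux_le q (\<lambda>x. ennreal (norm (v s x))) (n s)"
    and N: "(\<integral>\<^sup>+s. ennreal (n s powr P) * indicator {0<..<T} s \<partial>lborel) < \<infinity>"
    and eq: "AE t in lborel. 0 < t \<longrightarrow> t < T \<longrightarrow> (AE x in lborel. u t x = U t x - duhamel u t x)"
      "AE t in lborel. 0 < t \<longrightarrow> t < T \<longrightarrow> (AE x in lborel. v t x = U t x - duhamel v t x)"
  shows "AE t in lborel. 0 < t \<longrightarrow> t < T \<longrightarrow> (AE x in lborel. u t x = v t x)"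
proof -
  obtain C where C: "0 < C" "\<And>t A B F G d e Z. 0 < t \<Longrightarrow> t \<le> 1 \<Longrightarrow> b \<le> A \<Longrightarrow> A \<le> a \<Longrightarrow> b \<le> B \<Longrightarrow> B \<le> a \<Longrightarrow>
     borel_measurable2 F \<Longrightarrow>
     borel_measurable2 G \<Longrightarrow>
     d \<in> borel_measurable borel \<Longrightarrow> e \<in> borel_measurable borel \<Longrightarrow>
     (AE s in lborel. 0 < s \<longrightarrow> s < t \<longrightarrow> Lux_le (\<lambda>_. 1 / A) (F s) (d s) \<and> Lux_le (\<lambda>_. 1 / B) (G s) (e s)) \<Longrightarrow>
     0 < Z \<Longrightarrow> (\<integral>\<^sup>+s. ennreal ((t - s) powr (- \<gamma>) * (d s * e s)) * indicator {0<..<t} s \<partial>lborel) \<le> ennreal Z \<Longrightarrow>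
     Lux_le (\<lambda>_. 1 / b) (duhamel_abs (\<lambda>s y. F s y * G s y) t) (C * Z)"
    using Lux_le_duhamel by blast
  obtain Zu where Zu: "0 < Zu" "\<And>t. 0 < t \<Longrightarrow> t < T \<Longrightarrow> Lux_le (\<lambda>_. 1 / b) (duhamel_abs (square u) t) Zu"
    by (rule Lux_le_duhamel_abs_square[OF T assms(5,7) n(1) N], rule that)
  obtain Zv where Zv: "0 < Zv" "\<And>t. 0 < t \<Longrightarrow> t < T \<Longrightarrow> Lux_le (\<lambda>_. 1 / b) (duhamel_abs (square v) t) Zv"
    by (rule Lux_le_duhamel_abs_square[OF T assms(6,7) n(2) N], rule that)
  note bq = inverse_gt_2
  have qb: "(\<lambda>_. 1 / b) \<in> borel_measurable borel" "1 < 1 / b" using bq by auto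
  define D where "D s y = ennreal (norm (u s y - v s y))" for s y
  \<comment> \<open>By the equation \<open>|u| + |v|\<close> is at most \<open>2 Ub\<close> plus two
    Duhamel terms. The large values of \<open>Ub\<close> go to \<open>H1\<close>, everything else to
    \<open>H2\<close>. Unlike \<open>n\<close>, these bounds are uniform in time, which the
    contraction argument requires.\<close>
  define H1 where "H1 s y = ennreal 2 * (if ennreal M < Ub s y then Ub s y else 0)" for s y
  define H2 where "H2 s y = ennreal 2 * (if ennreal M < Ub s y then 0 else Ub s y) +
      (duhamel_abs (square u) s y + duhamel_abs (square v) s y)" for s y
  have [measurable]: "borel_measurable2 D"
    "borel_measurable2 H1"
    "borel_measurable2 H2"
    unfolding D_def H1_def H2_def by measurable
  define K where "K = 2 * M + (Zu + Zv)"
  have K: "0 < K" using M Zu Zv by (simp add: K_def)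
  have H: "Lux_le (\<lambda>_. 1 / a) (H1 s) K" "Lux_le (\<lambda>_. 1 / b) (H2 s) K" if s: "0 < s" "s < T" for s
  proof -
    have 1: "Lux_le (\<lambda>_. 1 / a) (\<lambda>y. if ennreal M < Ub s y then Ub s y else 0) M"
      and 2: "Lux_le (\<lambda>_. 1 / b) (\<lambda>y. if ennreal M < Ub s y then 0 else Ub s y) M"
      using Lux_le_split[OF Ub[OF s], of "1 / a" "1 / b"] q_ge q_le a_pos by auto
    have "Lux_le (\<lambda>_. 1 / a) (H1 s) (2 * M)" unfolding H1_def by (rule Lux_le_scale[OF 1]) simp
    from Lux_le_mono[OF this, of "H1 s" K] show "Lux_le (\<lambda>_. 1 / a) (H1 s) K"
      using Zu Zv a_pos by (auto simp: K_def)
    show "Lux_le (\<lambda>_. 1 / b) (H2 s) K"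
      unfolding H2_def K_def
      by (intro Lux_le_add[OF qb(1)] Lux_le_scale[OF 2] Zu Zv s) (use bq in auto)
  qed
  have fin: "AE x in lborel. duhamel_abs (square u) t x < \<infinity> \<and> duhamel_abs (square v) t x < \<infinity>"
    if "0 < t" "t < T" for t
    using Lux_le_AE_finite[OF qb(1) Zu(2)[OF that]] Lux_le_AE_finite[OF qb(1) Zv(2)[OF that]]
    by eventually_elim simp
  \<comment> \<open>The linear parts cancel in the difference of the two equations, and only Duhamel
    terms, bounded in \<open>L^(1/b)\<close>, remain.\<close>
  have base: "AE t in lborel. 0 < t \<longrightarrow> t < T \<longrightarrow> Lux_le (\<lambda>_. 1 / b) (D t) (Zu + Zv)"
    using eq
  proof eventually_elim
    case (elim t)
    show ?case
    proof (intro impI)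
      assume t: "0 < t" "t < T"
      then have e: "AE x in lborel. u t x = U t x - duhamel u t x" "AE x in lborel. v t x = U t x - duhamel v t x"
        using elim by auto
      have "AE x in lborel. D t x \<le> duhamel_abs (square u) t x + duhamel_abs (square v) t x"
        using e
      proof eventually_elim
        case (elim x)
        have "u t x - v t x = duhamel v t x - duhamel u t x" by (subst elim(1), subst elim(2)) simp
        then have "D t x \<le> ennreal (norm (duhamel u t x)) + ennreal (norm (duhamel v t x))"
          unfolding D_def using norm_triangle_ineq4[of "duhamel v t x" "duhamel u t x"]
          by (simp add: ennreal_plus[symmetric] ennreal_leI add.commute del: ennreal_plus)
        also have "\<dots> \<le> duhamel_abs (square u) t x + duhamel_abs (square v) t x"
          by (intro add_mono norm_duhamel_le assms(5,6))
        finally show ?case .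
      qed
      then show "Lux_le (\<lambda>_. 1 / b) (D t) (Zu + Zv)"
        using Lux_le_mono[OF Lux_le_add[OF qb(1) _ Zu(2)[OF t] Zv(2)[OF t]], of "D t" "Zu + Zv"] ab bq by auto
    qed
  qed
  have sum_le: "AE t in lborel. 0 < t \<longrightarrow> t < T \<longrightarrow>
      (AE x in lborel. ennreal (norm (u t x)) + ennreal (norm (v t x)) \<le> H1 t x + H2 t x)"
    using eq
  proof eventually_elim
    case (elim t)
    show ?case
    proof (intro impI)
      assume t: "0 < t" "t < T"
      then have e: "AE x in lborel. u t x = U t x - duhamel u t x" "AE x in lborel. v t x = U t x - duhamel v t x"
        using elim by auto
      have le: "ennreal (norm (U t x - duhamel w t x)) \<le> Ub t x + duhamel_abs (square w) t x"
        if [measurable]: "borel_measurable2 w" for w x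
      proof -
        have "ennreal (norm (U t x - duhamel w t x)) \<le> ennreal (norm (U t x)) + ennreal (norm (duhamel w t x))"
          using norm_triangle_ineq4[of "U t x" "duhamel w t x"]
          by (simp add: ennreal_plus[symmetric] ennreal_leI del: ennreal_plus)
        also have "\<dots> \<le> Ub t x + duhamel_abs (square w) t x" by (intro add_mono U norm_duhamel_le that)
        finally show ?thesis .
      qed
      show "AE x in lborel. ennreal (norm (u t x)) + ennreal (norm (v t x)) \<le> H1 t x + H2 t x"
        using e
      proof eventually_elim
        case (elim x)
        have two: "X + X = ennreal 2 * X" for X :: ennreal
          by (metis ennreal_numeral mult_2 zero_le_numeral)
        have "ennreal (norm (u t x)) + ennreal (norm (v t x)) \<le>
            (Ub t x + duhamel_abs (square u) t x) + (Ub t x + duhamel_abs (square v) t x)"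
          by (subst elim(1), subst elim(2), intro add_mono le assms(5,6))
        also have "\<dots> = (Ub t x + Ub t x) + (duhamel_abs (square u) t x + duhamel_abs (square v) t x)"
          by (simp only: ac_simps)
        also have "\<dots> = H1 t x + H2 t x" unfolding two by (simp add: H1_def H2_def del: ennreal_numeral)
        finally show ?case .
      qed
    qed
  qed
  have D_le: "AE t in lborel. 0 < t \<longrightarrow> t < T \<longrightarrow>
      (AE x in lborel. D t x \<le> duhamel_abs (\<lambda>s y. D s y * H1 s y) t x + duhamel_abs (\<lambda>s y. D s y * H2 s y) t x)"
    using eq
  proof eventually_elim
    case (elim t)
    show ?case
    proof (intro impI)
      assume t: "0 < t" "t < T"
      then have e: "AE x in lborel. u t x = U t x - duhamel u t x" "AE x in lborel. v t x = U t x - duhamel v t x"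
        using elim by auto
      show "AE x in lborel. D t x \<le> duhamel_abs (\<lambda>s y. D s y * H1 s y) t x + duhamel_abs (\<lambda>s y. D s y * H2 s y) t x"
        using e fin[OF t]
      proof eventually_elim
        case (elim x)
        have "u t x - v t x = duhamel v t x - duhamel u t x" by (subst elim(1), subst elim(2)) simp
        then have "D t x = ennreal (norm (duhamel u t x - duhamel v t x))"
          unfolding D_def by (simp only: norm_minus_commute)
        also have "\<dots> \<le> duhamel_abs (\<lambda>s y. ennreal (norm (u s y - v s y)) * (ennreal (norm (u s y)) + ennreal (norm (v s y)))) t x"
          by (rule norm_duhamel_diff_le) (use elim assms(5,6) in auto)
        also have "\<dots> \<le> duhamel_abs (\<lambda>s y. D s y * H1 s y + D s y * H2 s y) t x"
        proof (rule duhamel_abs_mono_AE)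
          show "AE s in lborel. 0 < s \<longrightarrow> s < t \<longrightarrow> (AE y in lborel.
            ennreal (norm (u s y - v s y)) * (ennreal (norm (u s y)) + ennreal (norm (v s y))) \<le> D s y * H1 s y + D s y * H2 s y)"
            using sum_le
          proof eventually_elim
            case (elim s)
            show ?case
            proof (intro impI)
              assume "0 < s" "s < t"
              then have "AE y in lborel. ennreal (norm (u s y)) + ennreal (norm (v s y)) \<le> H1 s y + H2 s y"
                using elim t by auto
              then show "AE y in lborel. ennreal (norm (u s y - v s y)) * (ennreal (norm (u s y)) + ennreal (norm (v s y))) \<le> D s y * H1 s y + D s y * H2 s y"
                unfolding D_def distrib_left[symmetric] by eventually_elim (rule mult_left_mono, auto)
            qed
          qed
        qed
        also have "\<dots> = duhamel_abs (\<lambda>s y. D s y * H1 s y) t x + duhamel_abs (\<lambda>s y. D s y * H2 s y) t x"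
          by (rule duhamel_abs_add) measurable
        finally show ?case .
      qed
    qed
  qed
  \<comment> \<open>Solves
    \<open>4 * C * K * Gamma (1 - \<gamma>) * l powr (\<gamma> - 1) = 1\<close>. The two Duhamel
    terms together contribute \<open>2 * C * K * ...\<close>, so one step halves \<epsilon>.\<close>
  define l where "l = (4 * C * K * Gamma (1 - \<gamma>)) powr (1 / (1 - \<gamma>))"
  have l0: "0 < l" using C K Gamma_pos by (simp add: l_def)
  have l: "4 * C * K * Gamma (1 - \<gamma>) * l powr (\<gamma> - 1) = 1"
  proof -
    define X where "X = 4 * C * K * Gamma (1 - \<gamma>)"
    have X: "0 < X" using C K Gamma_pos by (simp add: X_def)
    have "1 / (1 - \<gamma>) * (\<gamma> - 1) = -1" using \<gamma>_lt_1 by (simp add: field_simps)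
    then have "l powr (\<gamma> - 1) = X powr -1" unfolding l_def X_def[symmetric] powr_powr by simp
    then show ?thesis unfolding X_def[symmetric] using X by (simp add: powr_minus)
  qed
  have step: "AE t in lborel. 0 < t \<longrightarrow> t < T \<longrightarrow> Lux_le (\<lambda>_. 1 / b) (D t) (\<epsilon> / 2 * exp (l * t))"
    if \<epsilon>: "0 < \<epsilon>" and IH: "AE t in lborel. 0 < t \<longrightarrow> t < T \<longrightarrow> Lux_le (\<lambda>_. 1 / b) (D t) (\<epsilon> * exp (l * t))" for \<epsilon>
    using D_le
  proof eventually_elim
    case (elim t)
    show ?case
    proof (intro impI)
      assume t: "0 < t" "t < T"
      define Z where "Z = \<epsilon> * K * (exp (l * t) * (Gamma (1 - \<gamma>) * l powr (\<gamma> - 1)))"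
      have Z: "0 < Z" using \<epsilon> K Gamma_pos l0 by (simp add: Z_def)
      have int: "(\<integral>\<^sup>+s. ennreal ((t - s) powr (- \<gamma>) * (\<epsilon> * exp (l * s) * K)) * indicator {0<..<t} s \<partial>lborel) \<le> ennreal Z"
      proof -
        have "(\<integral>\<^sup>+s. ennreal ((t - s) powr (- \<gamma>) * (\<epsilon> * exp (l * s) * K)) * indicator {0<..<t} s \<partial>lborel)
          = (\<integral>\<^sup>+s. ennreal (\<epsilon> * K) * (ennreal ((t - s) powr (- \<gamma>) * exp (l * s)) * indicator {0<..<t} s) \<partial>lborel)"
          using \<epsilon> K by (intro nn_integral_cong) (auto simp: ennreal_mult[symmetric] mult_ac split: split_indicator)
        also have "\<dots> = ennreal (\<epsilon> * K) * (\<integral>\<^sup>+s. ennreal ((t - s) powr (- \<gamma>) * exp (l * s)) * indicator {0<..<t} s \<partial>lborel)"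
          by (rule nn_integral_cmult) measurable
        also have "\<dots> \<le> ennreal (\<epsilon> * K) * ennreal (exp (l * t) * (Gamma (1 - \<gamma>) * l powr (\<gamma> - 1)))"
          by (intro mult_left_mono nn_integral_time_kernel \<gamma>_lt_1 l0) auto
        also have "\<dots> = ennreal Z"
          using \<epsilon> K Gamma_pos by (subst ennreal_mult[symmetric]) (auto simp: Z_def)
        finally show ?thesis .
      qed
      have 1: "Lux_le (\<lambda>_. 1 / b) (duhamel_abs (\<lambda>s y. D s y * H1 s y) t) (C * Z)"
      proof (rule C(2)[of t b a D H1 "\<lambda>s. \<epsilon> * exp (l * s)" "\<lambda>_. K"])
        show "AE s in lborel. 0 < s \<longrightarrow> s < t \<longrightarrow> Lux_le (\<lambda>_. 1 / b) (D s) (\<epsilon> * exp (l * s)) \<and> Lux_le (\<lambda>_. 1 / a) (H1 s) K"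
          using IH by eventually_elim (use t H in auto)
      qed (use t T ab Z int in auto)
      have 2: "Lux_le (\<lambda>_. 1 / b) (duhamel_abs (\<lambda>s y. D s y * H2 s y) t) (C * Z)"
      proof (rule C(2)[of t b b D H2 "\<lambda>s. \<epsilon> * exp (l * s)" "\<lambda>_. K"])
        show "AE s in lborel. 0 < s \<longrightarrow> s < t \<longrightarrow> Lux_le (\<lambda>_. 1 / b) (D s) (\<epsilon> * exp (l * s)) \<and> Lux_le (\<lambda>_. 1 / b) (H2 s) K"
          using IH by eventually_elim (use t H in auto)
      qed (use t T ab Z int in auto)
      have "C * Z + C * Z = \<epsilon> / 2 * exp (l * t) * (4 * C * K * Gamma (1 - \<gamma>) * l powr (\<gamma> - 1))"
        by (simp add: Z_def mult_ac)
      then have CZ: "C * Z + C * Z = \<epsilon> / 2 * exp (l * t)" by (simp only: l mult_1_right)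
      have "Lux_le (\<lambda>_. 1 / b) (\<lambda>x. duhamel_abs (\<lambda>s y. D s y * H1 s y) t x + duhamel_abs (\<lambda>s y. D s y * H2 s y) t x) (\<epsilon> / 2 * exp (l * t))"
        unfolding CZ[symmetric] by (rule Lux_le_add[OF qb(1) _ 1 2]) (use qb in auto)
      then show "Lux_le (\<lambda>_. 1 / b) (D t) (\<epsilon> / 2 * exp (l * t))"
        by (rule Lux_le_mono) (use elim t ab in auto)
    qed
  qed
  have "AE t in lborel. 0 < t \<longrightarrow> t < T \<longrightarrow> Lux_le (\<lambda>_. 1 / b) (D t) ((Zu + Zv) / 2 ^ m * exp (l * t))" for m :: nat
  proof (induction m)
    case 0
    show ?case using base
    proof eventually_elim
      case (elim t)
      show ?case
      proof (intro impI)
        assume t: "0 < t" "t < T"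
        have "(Zu + Zv) * 1 \<le> (Zu + Zv) * exp (l * t)" using Zu Zv l0 t by (intro mult_left_mono) auto
        then show "Lux_le (\<lambda>_. 1 / b) (D t) ((Zu + Zv) / 2 ^ 0 * exp (l * t))"
          using Lux_le_mono[of "\<lambda>_. 1 / b" "D t" "Zu + Zv" "D t"] elim t ab by auto
      qed
    qed
  next
    case (Suc m)
    have "0 < (Zu + Zv) / 2 ^ m" using Zu Zv by (simp add: add_pos_pos)
    from step[OF this Suc] show ?case by (simp add: mult.commute)
  qed
  \<comment> \<open>Each halving has its own null set of times; their countable union is discarded
    before \<open>m\<close> tends to infinity.\<close>
  then have "AE t in lborel. \<forall>m::nat. 0 < t \<longrightarrow> t < T \<longrightarrow> Lux_le (\<lambda>_. 1 / b) (D t) ((Zu + Zv) / 2 ^ m * exp (l * t))"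
    unfolding AE_all_countable by blast
  then show ?thesis
  proof eventually_elim
    case (elim t)
    show ?case
    proof (intro impI)
      assume "0 < t" "t < T"
      then have "Lux_le (\<lambda>_. 1 / b) (D t) ((Zu + Zv) * exp (l * t) / 2 ^ m)" for m :: nat
        using elim by simp
      then have "AE y in lborel. D t y = 0" by (rule AE_zero_of_Lux_le[rotated]) (use ab in simp)
      then show "AE x in lborel. u t x = v t x" by eventually_elim (simp add: D_def)
    qed
  qed
qed

subsection \<open>The linear part\<close>

lemma linear_part_bound:
  fixes u0 :: "real^3 \<Rightarrow> real^3" and f :: "real \<Rightarrow> real^3 \<Rightarrow> real^3" and e :: "real \<Rightarrow> real"
  assumes [measurable]: "borel_measurable2 f"
      "e \<in> borel_measurable borel"
    and u0: "Lux_le q (\<lambda>x. ennreal (norm (u0 x))) d"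
    and f: "AE s in lborel. 0 < s \<longrightarrow> s < 1 \<longrightarrow> Lux_le q (\<lambda>x. ennreal (norm (f s x))) (e s)"
    and E: "(\<integral>\<^sup>+s. ennreal (e s) * indicator {0<..<1} s \<partial>lborel) < \<infinity>"
  obtains M where "0 < M" "\<And>t. 0 < t \<Longrightarrow> t \<le> 1 \<Longrightarrow>
     Lux_le q (\<lambda>x. heat_conv_abs \<alpha> t (\<lambda>y. ennreal (norm (u0 y))) x +
       (\<integral>\<^sup>+s. indicator {0<..<t} s * heat_conv_abs \<alpha> (t - s) (\<lambda>y. ennreal (norm (f s y))) x \<partial>lborel)) M"
proof -
  obtain C where C: "1 \<le> C" "\<And>t w d. 0 < t \<Longrightarrow> Lux_le q w d \<Longrightarrow> Lux_le q (heat_conv_abs \<alpha> t w) (C * d)"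
    using Lux_le_heat by blast
  \<comment> \<open>The summand 1 keeps \<open>N\<close> positive, as a bound in
    \<open>Lux_le\<close> has to be.\<close>
  define N where "N = enn2real (\<integral>\<^sup>+s. ennreal (e s) * indicator {0<..<1} s \<partial>lborel) + 1"
  have N: "(\<integral>\<^sup>+s. ennreal (e s) * indicator {0<..<1} s \<partial>lborel) \<le> ennreal N" "0 < N"
    using E by (auto simp: N_def less_top[symmetric] ennreal_plus add_nonneg_pos)
  have d: "0 < d" using u0 by (rule Lux_leD)
  have "Lux_le q (\<lambda>x. heat_conv_abs \<alpha> t (\<lambda>y. ennreal (norm (u0 y))) x +
       (\<integral>\<^sup>+s. indicator {0<..<t} s * heat_conv_abs \<alpha> (t - s) (\<lambda>y. ennreal (norm (f s y))) x \<partial>lborel)) (C * d + C * N)"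
    if t: "0 < t" "t \<le> 1" for t
  proof (rule Lux_le_add)
    show "Lux_le q (\<lambda>x. heat_conv_abs \<alpha> t (\<lambda>y. ennreal (norm (u0 y))) x) (C * d)"
      by (rule C(2)[OF t(1) u0])
    let ?\<mu> = "density lborel (indicator {0<..<t}) :: real measure"
    let ?h = "\<lambda>s. heat_conv_abs \<alpha> (t - s) (\<lambda>y. ennreal (norm (f s y)))"
    have [measurable]: "case_prod ?h \<in> borel_measurable (borel \<Otimes>\<^sub>M borel)" by measurable
    have "Lux_le q (\<lambda>x. \<integral>\<^sup>+s. ?h s x \<partial>?\<mu>) (C * N)"
    proof (rule Lux_le_nn_integral[where c = "\<lambda>s. C * e s"])
      show "sigma_finite_measure ?\<mu>"
        by (subst sigma_finite_measure.sigma_finite_iff_density_finite[OF sigma_finite_lborel])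
          (auto split: split_indicator)
      show "AE s in ?\<mu>. Lux_le q (?h s) (C * e s)"
      proof (subst AE_density)
        show "AE s in lborel. 0 < (indicator {0<..<t} s :: ennreal) \<longrightarrow> Lux_le q (?h s) (C * e s)"
          using f
        proof eventually_elim
          case (elim s)
          show ?case
          proof
            assume "0 < (indicator {0<..<t} s :: ennreal)"
            then have s: "0 < s" "s < t" by (auto split: split_indicator_asm)
            then show "Lux_le q (?h s) (C * e s)" using elim t by (intro C) auto
          qed
        qed
      qed measurable
      have "(\<integral>\<^sup>+s. ennreal (C * e s) \<partial>?\<mu>) = (\<integral>\<^sup>+s. indicator {0<..<t} s * ennreal (C * e s) \<partial>lborel)"
        by (subst nn_integral_density) auto
      also have "\<dots> \<le> (\<integral>\<^sup>+s. ennreal C * (ennreal (e s) * indicator {0<..<1} s) \<partial>lborel)"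
        using C(1) t by (intro nn_integral_mono) (auto simp: ennreal_mult' split: split_indicator)
      also have "\<dots> \<le> ennreal C * ennreal N"
        using N by (subst nn_integral_cmult) (auto intro: mult_left_mono)
      finally show "(\<integral>\<^sup>+s. ennreal (C * e s) \<partial>?\<mu>) \<le> ennreal (C * N)"
        using C(1) N by (simp add: ennreal_mult)
    qed (use C N q_gt_1 in \<open>auto simp: case_prod_beta'\<close>)
    moreover have "(\<integral>\<^sup>+s. ?h s x \<partial>?\<mu>) = (\<integral>\<^sup>+s. indicator {0<..<t} s * ?h s x \<partial>lborel)" for x
      by (subst nn_integral_density) auto
    ultimately show "Lux_le q (\<lambda>x. \<integral>\<^sup>+s. indicator {0<..<t} s * ?h s x \<partial>lborel) (C * N)" by simp
  qed (auto simp: q_gt_1)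
  then show thesis using C d N by (intro that[of "C * d + C * N"]) (auto simp: add_pos_pos)
qed

end

subsection \<open>Borel representatives\<close>

lemma Lebesgue_measurable_cong_AE:
  assumes ae: "AE x in lebesgue. f x = g x" and f: "f \<in> lebesgue \<rightarrow>\<^sub>M N"
    and g: "\<And>x. g x \<in> space N"
  shows "g \<in> lebesgue \<rightarrow>\<^sub>M N"
proof (rule measurableI)
  fix A assume "A \<in> sets N"
  then have "f -` A \<inter> space lebesgue \<in> sets lebesgue" by (rule measurable_sets[OF f])
  then show "g -` A \<inter> space lebesgue \<in> sets lebesgue"
    by (rule completion.in_sets_AE[rotated]) (use ae in \<open>auto elim!: eventually_mono\<close>)
qed (use g in auto)

text \<open>Completeness of Lebesgue measure carries measurability from one function to the other.
  The claim therefore includes non-measurable functions, whose integrals are 0 by convention;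
  arbitrary representatives can be exchanged inside the definition of a mild solution.\<close>

lemma Lebesgue_integral_cong_AE:
  fixes f g :: "'a::euclidean_space \<Rightarrow> 'b::{banach, second_countable_topology}"
  assumes ae: "AE x in lebesgue. f x = g x"
  shows "integrable lebesgue f \<longleftrightarrow> integrable lebesgue g" "integral\<^sup>L lebesgue f = integral\<^sup>L lebesgue g"
proof -
  have ae': "AE x in lebesgue. g x = f x" using ae by eventually_elim simp
  have *: "f \<in> borel_measurable lebesgue \<longleftrightarrow> g \<in> borel_measurable lebesgue"
    by (intro iffI) (rule Lebesgue_measurable_cong_AE[OF ae] Lebesgue_measurable_cong_AE[OF ae'], assumption, simp)+
  show 1: "integrable lebesgue f \<longleftrightarrow> integrable lebesgue g"
  proof (cases "f \<in> borel_measurable lebesgue")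
    case True
    then show ?thesis using * by (intro integrable_cong_AE ae) auto
  next
    case False
    then show ?thesis using * borel_measurable_integrable by blast
  qed
  show "integral\<^sup>L lebesgue f = integral\<^sup>L lebesgue g"
  proof (cases "integrable lebesgue f")
    case True
    then show ?thesis using 1 ae by (intro integral_cong_AE) auto
  qed (use 1 in \<open>simp add: not_integrable_integral_eq\<close>)
qed

lemma integrable_lebesgue_on_iff:
  fixes f :: "'a::euclidean_space \<Rightarrow> 'b::{banach, second_countable_topology}"
  assumes "S \<in> sets borel"
  shows "integrable (lebesgue_on S) f \<longleftrightarrow> integrable lebesgue (\<lambda>x. indicator S x *\<^sub>R f x)"
    "integral\<^sup>L (lebesgue_on S) f = integral\<^sup>L lebesgue (\<lambda>x. indicator S x *\<^sub>R f x)"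
  using assms by (simp_all add: integrable_restrict_space integral_restrict_space)

lemma AE_lebesgue_on_iff:
  assumes "S \<in> sets borel"
  shows "(AE x in lebesgue_on S. Q x) \<longleftrightarrow> (AE x in lborel. x \<in> S \<longrightarrow> Q x)"
  using assms by (simp add: AE_restrict_space_iff AE_completion_iff)

lemma lebesgue_on_integral_cong_AE:
  fixes f g :: "'a::euclidean_space \<Rightarrow> 'b::{banach, second_countable_topology}"
  assumes S: "S \<in> sets borel" and ae: "AE x in lborel. x \<in> S \<longrightarrow> f x = g x"
  shows "integrable (lebesgue_on S) f \<longleftrightarrow> integrable (lebesgue_on S) g"
    "integral\<^sup>L (lebesgue_on S) f = integral\<^sup>L (lebesgue_on S) g"
proof -
  have "AE x in lebesgue. indicator S x *\<^sub>R f x = indicator S x *\<^sub>R g x"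
    using AE_completion[OF ae] by eventually_elim (auto split: split_indicator)
  from Lebesgue_integral_cong_AE[OF this]
  show "integrable (lebesgue_on S) f \<longleftrightarrow> integrable (lebesgue_on S) g"
    "integral\<^sup>L (lebesgue_on S) f = integral\<^sup>L (lebesgue_on S) g"
    by (simp_all add: integrable_lebesgue_on_iff[OF S])
qed

text \<open>The function is extended by 0 outside \<open>S\<close> and treated coordinate by
  coordinate, where the real-valued statement for completed measures applies.\<close>

lemma Borel_representative:
  fixes f :: "'a::euclidean_space \<Rightarrow> 'b::euclidean_space"
  assumes f: "f \<in> borel_measurable (lebesgue_on S)" and S: "S \<in> sets borel"
  obtains g where "g \<in> borel_measurable borel" "AE x in lborel. x \<in> S \<longrightarrow> f x = g x"
proof -
  have "(\<lambda>x. indicator S x *\<^sub>R f x) \<in> borel_measurable lebesgue"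
    using f S by (subst (asm) borel_measurable_restrict_space_iff) auto
  then have "(\<lambda>x. (indicator S x *\<^sub>R f x) \<bullet> i) \<in> borel_measurable lebesgue" for i
    by (rule borel_measurable_inner) simp
  then have "\<exists>g\<in>borel_measurable lborel. AE x in lborel. (indicator S x *\<^sub>R f x) \<bullet> i = g x" for i
    by (rule completion_ex_borel_measurable_real)
  then obtain g where g: "\<And>i. g i \<in> borel_measurable lborel" "\<And>i. AE x in lborel. (indicator S x *\<^sub>R f x) \<bullet> i = g i x"
    by metis
  note g(1)[simplified, measurable]
  show thesis
  proof (rule that)
    show "(\<lambda>x. \<Sum>i\<in>Basis. g i x *\<^sub>R i) \<in> borel_measurable borel" by measurable
    have "AE x in lborel. \<forall>i\<in>Basis. (indicator S x *\<^sub>R f x) \<bullet> i = g i x"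
      by (subst AE_ball_countable) (use g(2) in \<open>auto intro: countable_finite\<close>)
    then show "AE x in lborel. x \<in> S \<longrightarrow> f x = (\<Sum>i\<in>Basis. g i x *\<^sub>R i)"
    proof eventually_elim
      case (elim x)
      show ?case
      proof
        assume "x \<in> S"
        then have "(\<Sum>i\<in>Basis. g i x *\<^sub>R i) = (\<Sum>i\<in>Basis. (f x \<bullet> i) *\<^sub>R i)"
          using elim by (intro sum.cong) auto
        then show "f x = (\<Sum>i\<in>Basis. g i x *\<^sub>R i)" by (simp add: euclidean_representation)
      qed
    qed
  qed
qed

subsection \<open>Iterated Lebesgue integrals\<close>

text \<open>Links the iterated integrals over completed measures, in which mild solutions are
  formulated, to one integral over the Borel product, in which all estimates are made.\<close>

lemma iterated_integral_lebesgue: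
  fixes \<phi> :: "real \<Rightarrow> real^3 \<Rightarrow> 'b::{banach, second_countable_topology}"
  assumes [measurable]: "borel_measurable2 \<phi>"
    and int: "integrable (lborel \<Otimes>\<^sub>M lborel) (\<lambda>z. indicator {0<..<t} (fst z) *\<^sub>R \<phi> (fst z) (snd z))"
  shows "AE s in lebesgue_on {0<..<t}. integrable lebesgue (\<phi> s)"
    and "integrable (lebesgue_on {0<..<t}) (\<lambda>s. LINT y|lebesgue. \<phi> s y)"
    and "(LINT s|lebesgue_on {0<..<t}. LINT y|lebesgue. \<phi> s y)
      = (LINT z|(lborel \<Otimes>\<^sub>M lborel). indicator {0<..<t} (fst z) *\<^sub>R \<phi> (fst z) (snd z))"
proof -
  have \<phi>: "\<phi> s \<in> borel_measurable borel" for s by measurable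
  have L: "(LINT y|lebesgue. \<phi> s y) = (LINT y|lborel. \<phi> s y)" for s
    by (rule integral_completion) (use \<phi> in simp)
  have "AE s in lborel. integrable lborel (\<lambda>y. indicator {0<..<t} s *\<^sub>R \<phi> s y)"
    using lborel_pair.AE_integrable_fst'[OF int] by simp
  then have "AE s in lborel. s \<in> {0<..<t} \<longrightarrow> integrable lebesgue (\<phi> s)"
    by eventually_elim (auto simp: integrable_completion \<phi> split: split_indicator_asm)
  then show "AE s in lebesgue_on {0<..<t}. integrable lebesgue (\<phi> s)"
    by (subst AE_lebesgue_on_iff) auto
  have eq: "indicator {0<..<t} s *\<^sub>R (LINT y|lebesgue. \<phi> s y) = (LINT y|lborel. indicator {0<..<t} s *\<^sub>R \<phi> s y)" for s
    unfolding L by (auto split: split_indicator)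
  have m: "(\<lambda>s. LINT y|lborel. indicator {0<..<t} s *\<^sub>R \<phi> s y) \<in> borel_measurable lborel"
    unfolding eq[symmetric] L by measurable
  show "integrable (lebesgue_on {0<..<t}) (\<lambda>s. LINT y|lebesgue. \<phi> s y)"
    using lborel_pair.integrable_fst'[OF int] m
    by (subst integrable_lebesgue_on_iff) (auto simp: eq integrable_completion)
  show "(LINT s|lebesgue_on {0<..<t}. LINT y|lebesgue. \<phi> s y)
      = (LINT z|(lborel \<Otimes>\<^sub>M lborel). indicator {0<..<t} (fst z) *\<^sub>R \<phi> (fst z) (snd z))"
    using lborel_pair.integral_fst'[OF int] m
    by (subst integrable_lebesgue_on_iff(2)) (auto simp: eq integral_completion)
qed

subsection \<open>Mild solutions and their representatives\<close>

lemma conv_cong_AE: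
  assumes "AE y in lborel. v y = w y"
  shows "conv_exists k v x \<longleftrightarrow> conv_exists k w x" "conv k v x = conv k w x"
proof -
  have "AE y in lebesgue. k (x - y) *\<^sub>R v y = k (x - y) *\<^sub>R w y"
    using AE_completion[OF assms] by eventually_elim simp
  from Lebesgue_integral_cong_AE[OF this]
  show "conv_exists k v x \<longleftrightarrow> conv_exists k w x" "conv k v x = conv k w x"
    by (simp_all add: conv_exists_def conv_def)
qed

lemma oseen_conv_cong_AE:
  assumes "AE y in lborel. v y = w y"
  shows "oseen_conv_exists \<alpha> t v x \<longleftrightarrow> oseen_conv_exists \<alpha> t w x" "oseen_conv \<alpha> t v x = oseen_conv \<alpha> t w x"
proof -
  have "AE y in lborel. v y $ h * v y $ k = w y $ h * w y $ k" for h k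
    using assms by eventually_elim simp
  from conv_cong_AE[OF this]
  show "oseen_conv_exists \<alpha> t v x \<longleftrightarrow> oseen_conv_exists \<alpha> t w x" "oseen_conv \<alpha> t v x = oseen_conv \<alpha> t w x"
    by (simp_all add: oseen_conv_exists_def oseen_conv_def)
qed

definition mild_rhs :: "real \<Rightarrow> (real^3 \<Rightarrow> real^3) \<Rightarrow> (real \<Rightarrow> real^3 \<Rightarrow> real^3) \<Rightarrow>
    (real \<Rightarrow> real^3 \<Rightarrow> real^3) \<Rightarrow> real \<Rightarrow> real^3 \<Rightarrow> real^3" where
  "mild_rhs \<alpha> u0 f u t x = conv (heat_kernel \<alpha> t) u0 x
     + (LINT s|lebesgue_on {0<..<t}. conv (heat_kernel \<alpha> (t - s)) (f s) x)
     - (LINT s|lebesgue_on {0<..<t}. oseen_conv \<alpha> (t - s) (u s) x)"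

text \<open>At a given point \<open>t, x\<close> the terms depend on the data and on
  \<open>u\<close> only through integrals over slices. So the exchange of representatives is exact
  at every \<open>x\<close>; only the left side of the equation needs a null set in space.\<close>

lemma mild_cong_AE:
  assumes u0: "AE y in lborel. u0 y = u0' y"
    and f: "AE s in lborel. s \<in> {0<..<t} \<longrightarrow> (AE y in lborel. f s y = f' s y)"
    and u: "AE s in lborel. s \<in> {0<..<t} \<longrightarrow> (AE y in lborel. u s y = u' s y)"
  shows "mild_terms_exist \<alpha> u0 f u t x \<longleftrightarrow> mild_terms_exist \<alpha> u0' f' u' t x"
    "mild_rhs \<alpha> u0 f u t x = mild_rhs \<alpha> u0' f' u' t x"
proof -
  have S: "{0<..<t} \<in> sets borel" by simp
  have f1: "AE s in lborel. s \<in> {0<..<t} \<longrightarrow> conv_exists (heat_kernel \<alpha> (t - s)) (f s) x = conv_exists (heat_kernel \<alpha> (t - s)) (f' s) x"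
    and f2: "AE s in lborel. s \<in> {0<..<t} \<longrightarrow> conv (heat_kernel \<alpha> (t - s)) (f s) x = conv (heat_kernel \<alpha> (t - s)) (f' s) x"
    using f by (eventually_elim, auto simp: conv_cong_AE)+
  have u1: "AE s in lborel. s \<in> {0<..<t} \<longrightarrow> oseen_conv_exists \<alpha> (t - s) (u s) x = oseen_conv_exists \<alpha> (t - s) (u' s) x"
    and u2: "AE s in lborel. s \<in> {0<..<t} \<longrightarrow> oseen_conv \<alpha> (t - s) (u s) x = oseen_conv \<alpha> (t - s) (u' s) x"
    using u by (eventually_elim, auto simp: oseen_conv_cong_AE)+
  have "(AE s in lebesgue_on {0<..<t}. conv_exists (heat_kernel \<alpha> (t - s)) (f s) x) \<longleftrightarrow>
      (AE s in lebesgue_on {0<..<t}. conv_exists (heat_kernel \<alpha> (t - s)) (f' s) x)"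
    unfolding AE_lebesgue_on_iff[OF S] by (rule eventually_subst) (use f1 in \<open>eventually_elim, auto\<close>)
  moreover have "(AE s in lebesgue_on {0<..<t}. oseen_conv_exists \<alpha> (t - s) (u s) x) \<longleftrightarrow>
      (AE s in lebesgue_on {0<..<t}. oseen_conv_exists \<alpha> (t - s) (u' s) x)"
    unfolding AE_lebesgue_on_iff[OF S] by (rule eventually_subst) (use u1 in \<open>eventually_elim, auto\<close>)
  ultimately show "mild_terms_exist \<alpha> u0 f u t x \<longleftrightarrow> mild_terms_exist \<alpha> u0' f' u' t x"
    using conv_cong_AE(1)[OF u0] lebesgue_on_integral_cong_AE(1)[OF S f2] lebesgue_on_integral_cong_AE(1)[OF S u2]
    by (simp add: mild_terms_exist_def)
  show "mild_rhs \<alpha> u0 f u t x = mild_rhs \<alpha> u0' f' u' t x"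
    using conv_cong_AE(2)[OF u0] lebesgue_on_integral_cong_AE(2)[OF S f2] lebesgue_on_integral_cong_AE(2)[OF S u2]
    by (simp add: mild_rhs_def)
qed

definition heat_integral :: "real \<Rightarrow> (real \<Rightarrow> real^3 \<Rightarrow> real^3) \<Rightarrow> real \<Rightarrow> real^3 \<Rightarrow> real^3" where
  "heat_integral \<alpha> f t x = (LINT z|(lborel \<Otimes>\<^sub>M lborel). indicator {0<..<t} (fst z) *\<^sub>R
     (heat_kernel \<alpha> (t - fst z) (x - snd z) *\<^sub>R f (fst z) (snd z)))"

definition linear_part :: "real \<Rightarrow> (real^3 \<Rightarrow> real^3) \<Rightarrow> (real \<Rightarrow> real^3 \<Rightarrow> real^3) \<Rightarrow> real \<Rightarrow> real^3 \<Rightarrow> real^3" where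
  "linear_part \<alpha> u0 f t x = (LINT y|lborel. heat_kernel \<alpha> t (x - y) *\<^sub>R u0 y) + heat_integral \<alpha> f t x"

definition linear_part_abs :: "real \<Rightarrow> (real^3 \<Rightarrow> real^3) \<Rightarrow> (real \<Rightarrow> real^3 \<Rightarrow> real^3) \<Rightarrow> real \<Rightarrow> real^3 \<Rightarrow> ennreal" where
  "linear_part_abs \<alpha> u0 f t x = heat_conv_abs \<alpha> t (\<lambda>y. ennreal (norm (u0 y))) x +
       (\<integral>\<^sup>+s. indicator {0<..<t} s * heat_conv_abs \<alpha> (t - s) (\<lambda>y. ennreal (norm (f s y))) x \<partial>lborel)"

lemma heat_integrand_measurable [measurable (raw)]:
  assumes [measurable]: "borel_measurable2 f"
    "t \<in> borel_measurable M" "x \<in> borel_measurable M" "z \<in> measurable M (borel \<Otimes>\<^sub>M borel)"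
  shows "(\<lambda>v. indicator {0<..<t v} (fst (z v)) *\<^sub>R (heat_kernel \<alpha> (t v - fst (z v)) (x v - snd (z v)) *\<^sub>R f (fst (z v)) (snd (z v)) :: real^3)) \<in> borel_measurable M"
proof -
  have "indicator {0<..<t v} (fst (z v)) *\<^sub>R (heat_kernel \<alpha> (t v - fst (z v)) (x v - snd (z v)) *\<^sub>R f (fst (z v)) (snd (z v)) :: real^3)
     = (if 0 < fst (z v) \<and> fst (z v) < t v then heat_kernel \<alpha> (t v - fst (z v)) (x v - snd (z v)) *\<^sub>R f (fst (z v)) (snd (z v)) else 0)" for v
    by (auto split: split_indicator)
  note * = this
  show ?thesis unfolding * by measurable
qed

lemma nn_integral_heat_integrand:
  fixes f :: "real \<Rightarrow> real^3 \<Rightarrow> real^3"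
  assumes [measurable]: "borel_measurable2 f"
  shows "(\<integral>\<^sup>+z. ennreal (norm (indicator {0<..<t} (fst z) *\<^sub>R (heat_kernel \<alpha> (t - fst z) (x - snd z) *\<^sub>R f (fst z) (snd z)))) \<partial>(lborel \<Otimes>\<^sub>M lborel))
    = (\<integral>\<^sup>+s. indicator {0<..<t} s * heat_conv_abs \<alpha> (t - s) (\<lambda>y. ennreal (norm (f s y))) x \<partial>lborel)"
    (is "(\<integral>\<^sup>+z. ennreal (norm (?g z)) \<partial>_) = _")
proof -
  have [measurable]: "?g \<in> borel_measurable (borel \<Otimes>\<^sub>M borel)"
    by (rule heat_integrand_measurable[where t = "\<lambda>_. t" and x = "\<lambda>_. x" and z = "\<lambda>z. z"]) measurable
  have "(\<integral>\<^sup>+z. ennreal (norm (?g z)) \<partial>(lborel \<Otimes>\<^sub>M lborel)) = (\<integral>\<^sup>+s. \<integral>\<^sup>+y. ennreal (norm (?g (s, y))) \<partial>lborel \<partial>lborel)"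
    by (rule lborel.nn_integral_fst[symmetric]) measurable
  also have "\<dots> = (\<integral>\<^sup>+s. indicator {0<..<t} s * heat_conv_abs \<alpha> (t - s) (\<lambda>y. ennreal (norm (f s y))) x \<partial>lborel)"
    by (intro nn_integral_cong) (auto simp: heat_conv_abs_def ennreal_mult split: split_indicator)
  finally show ?thesis .
qed

lemma linear_part_measurable [measurable]:
  assumes [measurable]: "u0 \<in> borel_measurable borel" "borel_measurable2 f"
  shows "borel_measurable2 (linear_part \<alpha> u0 f)"
proof -
  have sig: "sigma_finite_measure (lborel \<Otimes>\<^sub>M (lborel :: (real^3) measure) :: (real \<times> _) measure)"
    unfolding lborel_prod by (rule sigma_finite_lborel)
  have "(\<lambda>(v, z). indicator {0<..<fst v} (fst z) *\<^sub>R (heat_kernel \<alpha> (fst v - fst z) (snd v - snd z) *\<^sub>R f (fst z) (snd z)))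
      \<in> borel_measurable ((borel \<Otimes>\<^sub>M borel) \<Otimes>\<^sub>M (lborel \<Otimes>\<^sub>M lborel))"
    unfolding case_prod_beta'
    by (rule heat_integrand_measurable[where t = "\<lambda>v. fst (fst v)" and x = "\<lambda>v. snd (fst v)" and z = snd]) measurable
  then have "(\<lambda>v. heat_integral \<alpha> f (fst v) (snd v)) \<in> borel_measurable (borel \<Otimes>\<^sub>M borel)"
    unfolding heat_integral_def by (rule sigma_finite_measure.borel_measurable_lebesgue_integral[OF sig])
  then show ?thesis unfolding linear_part_def case_prod_beta' by measurable
qed

lemma linear_part_abs_measurable [measurable]:
  assumes [measurable]: "u0 \<in> borel_measurable borel" "borel_measurable2 f"
  shows "borel_measurable2 (linear_part_abs \<alpha> u0 f)"
proof -
  have "(\<integral>\<^sup>+s. indicator {0<..<t} s * heat_conv_abs \<alpha> (t - s) (\<lambda>y. ennreal (norm (f s y))) x \<partial>lborel)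
    = (\<integral>\<^sup>+s. (if 0 < s \<and> s < t then heat_conv_abs \<alpha> (t - s) (\<lambda>y. ennreal (norm (f s y))) x else 0) \<partial>lborel)" for t x
    by (intro nn_integral_cong) (auto split: split_indicator)
  then show ?thesis unfolding linear_part_abs_def by simp
qed

lemma norm_integral_le_nn_integral:
  fixes f :: "'a \<Rightarrow> 'b::{banach, second_countable_topology}"
  shows "ennreal (norm (integral\<^sup>L M f)) \<le> (\<integral>\<^sup>+x. ennreal (norm (f x)) \<partial>M)"
  by (cases "integrable M f") (auto intro: integral_norm_bound_ennreal simp: not_integrable_integral_eq)

lemma norm_linear_part_le:
  assumes [measurable]: "borel_measurable2 f"
  shows "ennreal (norm (linear_part \<alpha> u0 f t x)) \<le> linear_part_abs \<alpha> u0 f t x"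
proof -
  have "ennreal (norm (linear_part \<alpha> u0 f t x)) \<le>
      ennreal (norm (LINT y|lborel. heat_kernel \<alpha> t (x - y) *\<^sub>R u0 y)) + ennreal (norm (heat_integral \<alpha> f t x))"
    unfolding linear_part_def
    by (simp add: ennreal_plus[symmetric] ennreal_leI norm_triangle_ineq del: ennreal_plus)
  also have "\<dots> \<le> linear_part_abs \<alpha> u0 f t x"
    unfolding linear_part_abs_def
  proof (rule add_mono)
    show "ennreal (norm (LINT y|lborel. heat_kernel \<alpha> t (x - y) *\<^sub>R u0 y)) \<le> heat_conv_abs \<alpha> t (\<lambda>y. ennreal (norm (u0 y))) x"
      unfolding heat_conv_abs_def
      by (rule order.trans[OF norm_integral_le_nn_integral]) (simp add: ennreal_mult)
    show "ennreal (norm (heat_integral \<alpha> f t x)) \<le> (\<integral>\<^sup>+s. indicator {0<..<t} s * heat_conv_abs \<alpha> (t - s) (\<lambda>y. ennreal (norm (f s y))) x \<partial>lborel)"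
      unfolding heat_integral_def nn_integral_heat_integrand[OF assms, symmetric]
      by (rule norm_integral_le_nn_integral)
  qed
  finally show ?thesis .
qed

lemma vec_lambda_eq_sum: "(\<chi> j. g j) = (\<Sum>j\<in>UNIV. g j *\<^sub>R axis j (1::real))"
  unfolding vec_eq_iff by (simp add: axis_def if_distrib[of "\<lambda>z. _ * z"] cong: if_cong)

text \<open>Finiteness of the two absolute integrals at one point gives absolute convergence of
  every term there. Fubini then yields both the existence clauses and the values, without an
  exceptional set.\<close>

lemma (in stable_subordinator) mild_at_finite_point:
  assumes [measurable]: "u0 \<in> borel_measurable borel" "borel_measurable2 f"
    "borel_measurable2 u"
    and fin: "linear_part_abs \<alpha> u0 f t x < \<infinity>" "duhamel_abs (square u) t x < \<infinity>"
  shows "mild_terms_exist \<alpha> u0 f u t x" "mild_rhs \<alpha> u0 f u t x = linear_part \<alpha> u0 f t x - duhamel u t x"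
proof -
  have fin1: "heat_conv_abs \<alpha> t (\<lambda>y. ennreal (norm (u0 y))) x < \<infinity>"
    and fin2: "(\<integral>\<^sup>+s. indicator {0<..<t} s * heat_conv_abs \<alpha> (t - s) (\<lambda>y. ennreal (norm (f s y))) x \<partial>lborel) < \<infinity>"
    using fin(1) by (auto simp: linear_part_abs_def)
  have int0: "integrable lborel (\<lambda>y. heat_kernel \<alpha> t (x - y) *\<^sub>R u0 y)"
    by (rule integrableI_bounded) (use fin1 in \<open>auto simp: heat_conv_abs_def ennreal_mult\<close>)
  have c0: "conv_exists (heat_kernel \<alpha> t) u0 x" "conv (heat_kernel \<alpha> t) u0 x = (LINT y|lborel. heat_kernel \<alpha> t (x - y) *\<^sub>R u0 y)"
    using int0 by (simp_all add: conv_exists_def conv_def integrable_completion integral_completion)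
  have m1: "(\<lambda>(s, y). heat_kernel \<alpha> (t - s) (x - y) *\<^sub>R f s y) \<in> borel_measurable (borel \<Otimes>\<^sub>M borel)"
    by measurable
  have int1: "integrable (lborel \<Otimes>\<^sub>M lborel) (\<lambda>z. indicator {0<..<t} (fst z) *\<^sub>R
      (heat_kernel \<alpha> (t - fst z) (x - snd z) *\<^sub>R f (fst z) (snd z)))"
  proof (rule integrableI_bounded)
    show "(\<integral>\<^sup>+z. ennreal (norm (indicator {0<..<t} (fst z) *\<^sub>R (heat_kernel \<alpha> (t - fst z) (x - snd z) *\<^sub>R f (fst z) (snd z)))) \<partial>(lborel \<Otimes>\<^sub>M lborel)) < \<infinity>"
      unfolding nn_integral_heat_integrand[OF assms(2)] by (rule fin2)
    show "(\<lambda>z. indicator {0<..<t} (fst z) *\<^sub>R (heat_kernel \<alpha> (t - fst z) (x - snd z) *\<^sub>R f (fst z) (snd z)))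
        \<in> borel_measurable (lborel \<Otimes>\<^sub>M lborel)"
      by (rule heat_integrand_measurable[where t = "\<lambda>_. t" and x = "\<lambda>_. x" and z = "\<lambda>z. z"]) measurable
  qed
  note h = iterated_integral_lebesgue[OF m1 int1]
  have int2: "integrable (lborel \<Otimes>\<^sub>M lborel) (\<lambda>z. indicator {0<..<t} (fst z) *\<^sub>R
      (oseen_kernel \<alpha> (t - fst z) j h k (x - snd z) *\<^sub>R (u (fst z) (snd z) $ h * u (fst z) (snd z) $ k)))" for j h k
    using integrable_duhamel[OF assms(3) fin(2)] by (simp add: oseen_integrand_def[abs_def] mult.assoc)
  have m2: "(\<lambda>(s, y). oseen_kernel \<alpha> (t - s) j h k (x - y) *\<^sub>R (u s y $ h * u s y $ k)) \<in> borel_measurable (borel \<Otimes>\<^sub>M borel)" for j h k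
    by measurable
  note o = iterated_integral_lebesgue[OF m2 int2]
  let ?c = "\<lambda>j h k s. conv (oseen_kernel \<alpha> (t - s) j h k) (\<lambda>y. u s y $ h * u s y $ k) x"
  have ic: "integrable (lebesgue_on {0<..<t}) (?c j h k)" for j h k
    unfolding conv_def by (rule o(2))
  have lc: "(LINT s|lebesgue_on {0<..<t}. ?c j h k s) = (LINT z|(lborel \<Otimes>\<^sub>M lborel). oseen_integrand j h k (\<lambda>s y. u s y $ h * u s y $ k) t x z)" for j h k
    unfolding conv_def o(3) by (simp add: oseen_integrand_def mult.assoc)
  have vec: "oseen_conv \<alpha> (t - s) (u s) x = (\<Sum>j\<in>UNIV. (\<Sum>h\<in>UNIV. \<Sum>k\<in>UNIV. ?c j h k s) *\<^sub>R axis j 1)" for s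
    unfolding oseen_conv_def by (rule vec_lambda_eq_sum)
  have oi: "integrable (lebesgue_on {0<..<t}) (\<lambda>s. oseen_conv \<alpha> (t - s) (u s) x)"
    unfolding vec by (intro Bochner_Integration.integrable_sum integrable_scaleR_left ic)
  have "(LINT s|lebesgue_on {0<..<t}. oseen_conv \<alpha> (t - s) (u s) x)
    = (\<Sum>j\<in>UNIV. (\<Sum>h\<in>UNIV. \<Sum>k\<in>UNIV. (LINT s|lebesgue_on {0<..<t}. ?c j h k s)) *\<^sub>R axis j 1)"
    unfolding vec
    by (simp only: Bochner_Integration.integral_sum Bochner_Integration.integrable_sum integrable_scaleR_left
        integral_scaleR_left ic)
  then have ol: "(LINT s|lebesgue_on {0<..<t}. oseen_conv \<alpha> (t - s) (u s) x) = duhamel u t x"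
    unfolding lc vec_lambda_eq_sum[symmetric] by (simp only: duhamel_def oseen_integral_def)
  show "mild_terms_exist \<alpha> u0 f u t x"
  proof -
    have "AE s in lebesgue_on {0<..<t}. oseen_conv_exists \<alpha> (t - s) (u s) x"
    proof -
      have "AE s in lebesgue_on {0<..<t}. \<forall>j h k. conv_exists (oseen_kernel \<alpha> (t - s) j h k) (\<lambda>y. u s y $ h * u s y $ k) x"
        using o(1) by (simp add: conv_exists_def AE_all_countable)
      then show ?thesis by (simp add: oseen_conv_exists_def)
    qed
    then show ?thesis
      using c0(1) h(1,2) oi by (simp add: mild_terms_exist_def conv_exists_def conv_def)
  qed
  show "mild_rhs \<alpha> u0 f u t x = linear_part \<alpha> u0 f t x - duhamel u t x"
    using h(3) by (simp add: mild_rhs_def linear_part_def heat_integral_def c0(2) ol conv_def[of "heat_kernel \<alpha> (t - _)"])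
qed

subsection \<open>Regular representatives of the exponents\<close>

lemma Hoelder_modulus_tendsto_0:
  "((\<lambda>y. c / ln (exp 1 + 1 / norm (y - x :: 'a::real_normed_vector))) \<longlongrightarrow> 0) (at x)"
proof -
  have "filterlim (\<lambda>y. norm (y - x)) (at_right 0) (at x)"
    by (auto simp: filterlim_at tendsto_norm_zero LIM_zero eventually_at_filter intro!: tendsto_norm_zero LIM_zero)
  then have "filterlim (\<lambda>y. inverse (norm (y - x))) at_top (at x)"
    by (rule filterlim_compose[OF filterlim_inverse_at_top_right])
  then have "filterlim (\<lambda>y. exp 1 + 1 / norm (y - x)) at_top (at x)"
    by (intro filterlim_tendsto_add_at_top[OF tendsto_const]) (simp add: inverse_eq_divide)
  then have "filterlim (\<lambda>y. ln (exp 1 + 1 / norm (y - x))) at_top (at x)"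
    by (rule filterlim_compose[OF ln_at_top])
  then show ?thesis
    by (intro tendsto_divide_0[OF tendsto_const]) (rule filterlim_at_top_imp_at_infinity)
qed

lemma decay_modulus_tendsto_0:
  "((\<lambda>x :: 'a::real_normed_vector. c / ln (exp 1 + norm x)) \<longlongrightarrow> 0) at_infinity"
proof -
  have "filterlim (\<lambda>x :: 'a. exp 1 + norm x) at_top at_infinity"
    by (intro filterlim_tendsto_add_at_top[OF tendsto_const]) (rule filterlim_norm_at_top)
  then have "filterlim (\<lambda>x :: 'a. ln (exp 1 + norm x)) at_top at_infinity"
    by (rule filterlim_compose[OF ln_at_top])
  then show ?thesis
    by (intro tendsto_divide_0[OF tendsto_const]) (rule filterlim_at_top_imp_at_infinity)
qed

text \<open>The fraction equals \<open>1 + b / (b + 1 - 2 * a)\<close> and the subtracted term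
  equals \<open>b / (1 - b)\<close>. The former quotient is the larger one since
  \<open>b \<le> a\<close> gives \<open>b + 1 - 2 * a \<le> 1 - b\<close>.\<close>

lemma theta1_factor_ge_1:
  fixes a b :: real
  assumes ab: "0 < b" "b \<le> a" "a < 1 / 2"
  shows "1 \<le> (2 + (1 / b) * (1 - 2 * a)) / (1 + (1 / b) * (1 - 2 * a)) - 1 / (1 / b - 1)"
proof -
  define A where "A = (1 / b) * (1 - 2 * a)"
  have A: "0 < A" using ab by (simp add: A_def)
  have "(2 + A) / (1 + A) = 1 + 1 / (1 + A)" using A by (simp add: divide_simps)
  moreover have "1 / (1 / b - 1) = b / (1 - b)" using ab by (simp add: divide_simps)
  moreover have "1 / (1 + A) = b / (b + 1 - 2 * a)" using ab A by (simp add: A_def divide_simps) 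
  moreover have "b / (1 - b) \<le> b / (b + 1 - 2 * a)" using ab by (intro divide_left_mono) auto
  ultimately show ?thesis by (simp add: A_def)
qed

lemma recip_bounds:
  assumes "1 \<le> r"
  shows "0 \<le> recip r" "r \<noteq> \<infinity> \<Longrightarrow> 0 < recip r \<and> r = ereal (1 / recip r)"
  using assms by (cases r; auto simp: recip_def one_ereal_def)+

text \<open>The local condition makes \<open>1 / q\<close> continuous, and the preimage of a closed
  interval under a continuous function is closed. A closed set containing almost every point is
  everything, so the essential bounds hold at every point and \<open>q\<close> is
  real-valued.\<close>

lemma log_exponents_regular:
  assumes q: "q \<in> log_exponents" and inf: "2 < exp_inf UNIV q" and le: "exp_inf UNIV q \<le> exp_sup UNIV q"
    and sup: "exp_sup UNIV q < \<infinity>" "exp_sup UNIV q = exp_at_infinity q"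
  obtains Q a b c where "log_Hoelder_exponent Q a b c" "q = (\<lambda>x. ereal (Q x))" "2 * a - b \<le> theta1 q"
proof -
  define g where "g x = recip (q x)" for x
  obtain c l where c: "0 < c" and loc: "\<And>x y. \<bar>g x - g y\<bar> \<le> c / ln (exp 1 + 1 / norm (x - y))"
    and dec: "\<And>x. \<bar>g x - l\<bar> \<le> c / ln (exp 1 + norm x)"
    using q unfolding log_exponents_def g_def by auto
  have q1: "1 \<le> q x" for x using q by (simp add: log_exponents_def exponents_def)
  have qm[measurable]: "q \<in> borel_measurable lebesgue"
    using q by (simp add: log_exponents_def exponents_def lebesgue_on_UNIV_eq)
  have cont: "continuous_on UNIV g"
  proof -
    have "(g \<longlongrightarrow> g x) (at x)" for x
      by (rule Lim_null_comparison[THEN LIM_zero_cancel, OF _ Hoelder_modulus_tendsto_0[of c x]])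
        (use loc in \<open>simp add: always_eventually\<close>)
    then show ?thesis by (simp add: continuous_on_def)
  qed
  have "(g \<longlongrightarrow> l) at_infinity"
    by (rule Lim_null_comparison[THEN LIM_zero_cancel, OF _ decay_modulus_tendsto_0[of c]])
      (use dec in \<open>simp add: always_eventually\<close>)
  moreover have "at_infinity \<noteq> (bot :: (real^3) filter)"
  proof
    assume "at_infinity = (bot :: (real^3) filter)"
    then obtain B where B: "\<forall>x :: real^3. norm x < B" by (auto simp: trivial_limit_def eventually_at_infinity not_le)
    obtain x :: "real^3" where "norm x = \<bar>B\<bar>" using vector_choose_size abs_ge_zero by blast
    then show False using B[rule_format, of x] by simp
  qed
  ultimately have "Lim at_infinity g = l" by (intro tendsto_Lim)
  then have qinf: "exp_at_infinity q = 1 / ereal l" by (simp add: exp_at_infinity_def g_def[abs_def])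
  have gt: "2 < 1 / ereal l" and fin: "1 / ereal l < \<infinity>" using inf le sup qinf by auto
  \<comment> \<open>The limit 0 would make the exponent at infinity infinite, against the finite
    supremum; a negative limit would make it less than 2.\<close>
  have l: "0 < l"
  proof (rule ccontr)
    assume "\<not> 0 < l"
    then consider "l = 0" | "l < 0" by linarith
    then show False
    proof cases
      case 2
      then have "1 / l < 2" using divide_pos_neg[of 1 l] by linarith
      then have "1 / ereal l < 2" using 2 by (simp add: one_ereal_def)
      then show False using gt by simp
    qed (use fin in simp)
  qed
  have supl: "exp_sup UNIV q = ereal (1 / l)" using sup(2) qinf l by (simp add: one_ereal_def)
  obtain m where m: "exp_inf UNIV q = ereal m" using inf le supl by (cases "exp_inf UNIV q") auto
  have m2: "2 < m" "m \<le> 1 / l" using inf le supl m by auto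
  have "AE x in lebesgue. q x \<le> ereal (1 / l)"
    using esssup_AE[of q lebesgue] supl by (simp add: exp_sup_def lebesgue_on_UNIV_eq)
  moreover have "AE x in lebesgue. - q x \<le> - ereal m"
    using esssup_AE[of "\<lambda>x. - q x" lebesgue] m
    by (simp add: exp_inf_def lebesgue_on_UNIV_eq ereal_uminus_eq_reorder)
  ultimately have "AE x in lebesgue. g x \<in> {l..1 / m}"
  proof eventually_elim
    case (elim x)
    then obtain r where r: "q x = ereal r" "m \<le> r" "r \<le> 1 / l" by (cases "q x") auto
    then have "l \<le> 1 / r" "1 / r \<le> 1 / m" using l m2 by (auto simp: divide_simps mult.commute)
    then show ?case using r m2 by (simp add: g_def recip_def one_ereal_def)
  qed
  then have "AE x in lebesgue. x \<in> g -` {l..1 / m}" by simp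
  then have gb: "l \<le> g x" "g x \<le> 1 / m" for x
    using mem_closed_if_AE_lebesgue[of "g -` {l..1 / m}" x] continuous_closed_vimage[of "{l..1/m}" g] cont
    by (auto simp: continuous_on_eq_continuous_at)
  define Q where "Q x = 1 / g x" for x
  have gpos: "0 < g x" for x using gb(1)[of x] l by simp
  have qQ: "q x = ereal (Q x)" for x
  proof -
    have "q x \<noteq> \<infinity>" using gpos[of x] by (auto simp: g_def recip_def)
    then show ?thesis using recip_bounds(2)[OF q1] by (simp add: Q_def g_def)
  qed
  have gQ: "1 / Q x = g x" for x by (simp add: Q_def)
  show thesis
  proof (rule that)
    have gm: "g \<in> borel_measurable borel" by (rule borel_measurable_continuous_onI[OF cont])
    have "1 / l \<ge> m" using m2 by simp
    then have lm: "l \<le> 1 / m" using l m2 by (simp add: divide_simps mult.commute)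
    show "log_Hoelder_exponent Q (1 / m) l c"
    proof
      show "Q \<in> borel_measurable borel" unfolding Q_def[abs_def] using gm by measurable
      show "1 / (1 / m) \<le> Q x" "Q x \<le> 1 / l" for x
        using divide_left_mono[OF gb(2)[of x], of 1] divide_left_mono[OF gb(1)[of x], of 1] gpos[of x] l m2
        by (auto simp: Q_def)
    qed (use l m2 c lm loc dec in \<open>auto simp: gQ\<close>)
    show "q = (\<lambda>x. ereal (Q x))" using qQ by auto
    have "2 * (1 / m) - l \<le> (2 * (1 / m) - l) *
        ((2 + (1 / l) * (1 - 2 * (1 / m))) / (1 + (1 / l) * (1 - 2 * (1 / m))) - 1 / (1 / l - 1))"
      using mult_left_mono[OF theta1_factor_ge_1[of l "1 / m"], of "2 * (1 / m) - l"] l m2 lm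
      by simp
    also have "\<dots> = theta1 q"
      using supl sup(2) m by (simp add: theta1_def)
    finally show "2 * (1 / m) - l \<le> theta1 q" .
  qed
qed

text \<open>A finite essential infimum is itself a suitable \<open>P\<close>. If it is infinite, its
  reciprocal is 0 and any large \<open>P\<close> works; \<open>4 * \<alpha> / (e - d)\<close> makes
  the new term at most half of the gap, and the maximum with 3 ensures \<open>P > 2\<close>.\<close>

lemma time_exponent_lower_bound:
  fixes p :: "real \<Rightarrow> ereal"
  assumes p: "p \<in> exponents {0..1}" and inf: "2 < exp_inf {0..1} p"
    and \<alpha>: "0 < \<alpha>" and sub: "2 * \<alpha> * recip (exp_inf {0..1} p) + d < e"
  obtains P where "2 < P" "AE t in lborel. t \<in> {0..1} \<longrightarrow> ereal P \<le> p t" "2 * \<alpha> / P + d < e"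
proof -
  have [measurable]: "p \<in> borel_measurable (lebesgue_on {0..1})" using p by (simp add: exponents_def)
  have ae: "AE t in lborel. t \<in> {0..1} \<longrightarrow> exp_inf {0..1} p \<le> p t"
    using esssup_AE[of "\<lambda>t. - p t" "lebesgue_on {0..1}"]
    by (subst AE_lebesgue_on_iff[symmetric]) (auto simp: exp_inf_def ereal_uminus_le_reorder)
  show thesis
  proof (cases "exp_inf {0..1} p")
    case (real m)
    then show ?thesis using that[of m] inf sub ae by (simp add: recip_def one_ereal_def)
  next
    case PInf
    then have de: "d < e" using sub by (simp add: recip_def)
    define P where "P = max 3 (4 * \<alpha> / (e - d))"
    have "2 * \<alpha> / P \<le> (e - d) / 2"
    proof -
      have "4 * \<alpha> \<le> P * (e - d)" using de by (simp add: P_def pos_divide_le_eq[symmetric])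
      then show ?thesis by (simp add: P_def pos_divide_le_eq field_simps)
    qed
    then have "2 * \<alpha> / P + d < e" using de by argo
    moreover have "AE t in lborel. t \<in> {0..1} \<longrightarrow> ereal P \<le> p t" using ae PInf by auto
    ultimately show ?thesis using that[of P] by (simp add: P_def)
  qed (use inf in simp)
qed

subsection \<open>Luxemburg norms of Borel representatives\<close>

lemma omega_ereal [simp]: "omega (ereal p) s = ennreal (s powr p)"
  by (simp add: omega_def)

context log_Hoelder_exponent
begin

abbreviation "q_ereal \<equiv> \<lambda>x. ereal (q x)"

lemma modular_scaled_eq:
  fixes w w' :: "real^3 \<Rightarrow> 'b::euclidean_space"
  assumes "AE x in lborel. w x = w' x" "0 \<le> r"
  shows "modular UNIV q_ereal (\<lambda>x. r *\<^sub>R w x) = (\<integral>\<^sup>+x. epow (ennreal r * ennreal (norm (w' x))) (q x) \<partial>lborel)"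
  unfolding modular_def lebesgue_on_UNIV_eq nn_integral_completion
  by (rule nn_integral_cong_AE) (use assms in \<open>auto simp: ennreal_mult[symmetric]\<close>)

lemma modular_le_1_iff:
  fixes w w' :: "real^3 \<Rightarrow> 'b::euclidean_space"
  assumes "AE x in lborel. w x = w' x" "w' \<in> borel_measurable borel"
  shows "0 < r \<and> modular UNIV q_ereal (\<lambda>x. w x /\<^sub>R r) \<le> 1 \<longleftrightarrow> Lux_le q (\<lambda>x. ennreal (norm (w' x))) r"
  using modular_scaled_eq[OF assms(1), of "inverse r"] assms(2)
  by (auto simp: Lux_le_def inverse_eq_divide)

lemma var_norm_eq:
  fixes w w' :: "real^3 \<Rightarrow> 'b::euclidean_space"
  assumes "AE x in lborel. w x = w' x" "w' \<in> borel_measurable borel"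
  shows "var_norm UNIV q_ereal w = Inf {r. Lux_le q (\<lambda>x. ennreal (norm (w' x))) r}"
  unfolding var_norm_def modular_le_1_iff[OF assms] ..

lemma var_Lebesgue_iff:
  fixes w w' :: "real^3 \<Rightarrow> 'b::euclidean_space"
  assumes "AE x in lborel. w x = w' x" "w' \<in> borel_measurable borel"
  shows "w \<in> var_Lebesgue UNIV q_ereal \<longleftrightarrow> (\<exists>r. Lux_le q (\<lambda>x. ennreal (norm (w' x))) r)"
proof
  assume "w \<in> var_Lebesgue UNIV q_ereal"
  then obtain r where r: "0 < r" and fin: "modular UNIV q_ereal (\<lambda>x. r *\<^sub>R w x) < \<infinity>"
    by (auto simp: var_Lebesgue_def)
  define C where "C = enn2real (modular UNIV q_ereal (\<lambda>x. r *\<^sub>R w x)) + 1"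
  have "Lux_le q (\<lambda>x. ennreal r * ennreal (norm (w' x))) C"
  proof (rule Lux_le_of_modular)
    show "(\<integral>\<^sup>+x. epow (ennreal r * ennreal (norm (w' x))) (q x) \<partial>lborel) \<le> ennreal C"
      using r fin modular_scaled_eq[OF assms(1), of r]
      by (auto simp: C_def less_top[symmetric] ennreal_plus simp del: ennreal_plus[symmetric])
    show "1 \<le> q x" for x using q_gt_1[of x] by simp
  qed (use assms(2) in \<open>auto simp: C_def\<close>)
  from Lux_le_scale[OF this, of "1 / r"] r
  have "Lux_le q (\<lambda>x. ennreal (norm (w' x))) (1 / r * C)"
    by (simp add: mult.assoc[symmetric] ennreal_mult[symmetric])
  then show "\<exists>r. Lux_le q (\<lambda>x. ennreal (norm (w' x))) r" by blast
next
  assume "\<exists>r. Lux_le q (\<lambda>x. ennreal (norm (w' x))) r"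
  then obtain r where "0 < r" "modular UNIV q_ereal (\<lambda>x. w x /\<^sub>R r) \<le> 1"
    unfolding modular_le_1_iff[OF assms, symmetric] by blast
  moreover have "w \<in> borel_measurable (lebesgue_on UNIV)"
    unfolding lebesgue_on_UNIV_eq
  proof (rule Lebesgue_measurable_cong_AE)
    show "AE x in lebesgue. w' x = w x" using AE_completion[OF assms(1)] by eventually_elim simp
    show "w' \<in> borel_measurable lebesgue" using assms(2) by (intro measurable_completion) simp
  qed auto
  ultimately show "w \<in> var_Lebesgue UNIV q_ereal"
    using le_less_trans[OF _ ennreal_one_less_top] by (auto simp: var_Lebesgue_def intro!: exI[of _ "inverse r"])
qed

text \<open>The norm is an infimum, so a strict inequality provides an admissible
  \<open>s < r\<close>; membership in the space guarantees that the infimum is over a nonempty set.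
  The positive slack \<open>K\<close> added to norms later on comes from this strictness.\<close>

lemma Lux_le_of_var_norm_less:
  fixes w w' :: "real^3 \<Rightarrow> 'b::euclidean_space"
  assumes "AE x in lborel. w x = w' x" "w' \<in> borel_measurable borel"
    and "w \<in> var_Lebesgue UNIV q_ereal" "var_norm UNIV q_ereal w < r"
  shows "Lux_le q (\<lambda>x. ennreal (norm (w' x))) r"
proof -
  have "{r. Lux_le q (\<lambda>x. ennreal (norm (w' x))) r} \<noteq> {}"
    using var_Lebesgue_iff[OF assms(1,2)] assms(3) by blast
  from cInf_lessD[OF this assms(4)[unfolded var_norm_eq[OF assms(1,2)]]]
  obtain s where s: "Lux_le q (\<lambda>x. ennreal (norm (w' x))) s" "s < r" by blast
  show ?thesis by (rule Lux_le_mono[OF s(1)]) (use s assms(2) q_nonneg in auto)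
qed

lemma var_norm_le:
  fixes w w' :: "real^3 \<Rightarrow> 'b::euclidean_space"
  assumes "AE x in lborel. w x = w' x" "w' \<in> borel_measurable borel"
    and "Lux_le q (\<lambda>x. ennreal (norm (w' x))) r"
  shows "var_norm UNIV q_ereal w \<le> r" "0 \<le> var_norm UNIV q_ereal w"
  unfolding var_norm_eq[OF assms(1,2)]
  using assms(3) by (auto intro!: cInf_lower cInf_greatest bdd_belowI[of _ 0] dest: Lux_leD(1))

text \<open>Rational witnesses present the sublevel sets of the norm, as a function of time, as
  countable unions; this gives its measurability.\<close>

lemma var_norm_less_iff:
  fixes w :: "real^3 \<Rightarrow> 'b::euclidean_space"
  assumes "w \<in> borel_measurable borel" "Lux_le q (\<lambda>x. ennreal (norm (w x))) M"
  shows "var_norm UNIV q_ereal w < r \<longleftrightarrow> (\<exists>s\<in>\<rat>. s < r \<and> Lux_le q (\<lambda>x. ennreal (norm (w x))) s)"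
proof
  assume "var_norm UNIV q_ereal w < r"
  then obtain s where s: "s \<in> \<rat>" "var_norm UNIV q_ereal w < s" "s < r" using Rats_dense_in_real by blast
  moreover have "w \<in> var_Lebesgue UNIV q_ereal" using var_Lebesgue_iff[of w w] assms by auto
  ultimately show "\<exists>s\<in>\<rat>. s < r \<and> Lux_le q (\<lambda>x. ennreal (norm (w x))) s"
    using Lux_le_of_var_norm_less[of w w s] assms by auto
next
  assume "\<exists>s\<in>\<rat>. s < r \<and> Lux_le q (\<lambda>x. ennreal (norm (w x))) s"
  then show "var_norm UNIV q_ereal w < r" using var_norm_le(1)[of w w] assms by fastforce
qed

end

section \<open>Mixed norms in time and space\<close>

lemma AE_lebesgue_on_Times_iff:
  "(AE z in lebesgue_on ({0<..<T::real} \<times> (UNIV :: (real^3) set)). R z) \<longleftrightarrow>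
   (AE z in lborel \<Otimes>\<^sub>M lborel. fst z \<in> {0<..<T} \<longrightarrow> R z)"
proof -
  have "{0<..<T} \<times> (UNIV :: (real^3) set) \<in> sets borel"
    by (simp add: borel_prod[symmetric])
  then show ?thesis unfolding lborel_prod by (simp add: AE_lebesgue_on_iff mem_Times_iff)
qed

lemma (in log_Hoelder_exponent) mixed_Lebesgue_representative:
  fixes v :: "real \<Rightarrow> real^3 \<Rightarrow> real^3"
  assumes v: "v \<in> mixed_Lebesgue T p q_ereal"
  obtains v' h where "borel_measurable2 v'" "h \<in> borel_measurable borel"
    "AE z in lborel \<Otimes>\<^sub>M lborel. fst z \<in> {0<..<T} \<longrightarrow> v (fst z) (snd z) = v' (fst z) (snd z)"
    "AE t in lborel. t \<in> {0<..<T} \<longrightarrow> (AE x in lborel. v t x = v' t x)"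
    "AE t in lborel. t \<in> {0<..<T} \<longrightarrow> var_norm UNIV q_ereal (v t) = h t"
    "\<And>K. 0 < K \<Longrightarrow> AE t in lborel. 0 < t \<longrightarrow> t < T \<longrightarrow> Lux_le q (\<lambda>x. ennreal (norm (v' t x))) (\<bar>h t\<bar> + K)"
proof -
  have "{0<..<T} \<times> (UNIV :: (real^3) set) \<in> sets borel" by (simp add: borel_prod[symmetric])
  then obtain g where g: "g \<in> borel_measurable borel"
    "AE z in lborel. z \<in> {0<..<T} \<times> UNIV \<longrightarrow> (case z of (t, x) \<Rightarrow> v t x) = g z"
    using Borel_representative[of "\<lambda>(t, x). v t x" "{0<..<T} \<times> UNIV"] v
    unfolding mixed_Lebesgue_def by blast
  have "(\<lambda>t. var_norm UNIV q_ereal (v t)) \<in> borel_measurable (lebesgue_on {0<..<T})" "{0<..<T} \<in> sets borel"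
    using v by (simp_all add: mixed_Lebesgue_def var_Lebesgue_def)
  from Borel_representative[OF this]
  obtain h where h: "h \<in> borel_measurable borel" "AE t in lborel. t \<in> {0<..<T} \<longrightarrow> var_norm UNIV q_ereal (v t) = h t" .
  define v' where "v' t x = g (t, x)" for t x
  have v'[measurable]: "borel_measurable2 v'"
    using g(1) by (simp add: v'_def borel_prod)
  have "AE z in lborel \<Otimes>\<^sub>M lborel. z \<in> {0<..<T} \<times> UNIV \<longrightarrow> (case z of (t, x) \<Rightarrow> v t x) = g z"
    using g(2) by (simp only: lborel_prod)
  then have zz: "AE z in lborel \<Otimes>\<^sub>M lborel. fst z \<in> {0<..<T} \<longrightarrow> v (fst z) (snd z) = v' (fst z) (snd z)"
    by eventually_elim (auto simp: v'_def)
  from lborel_pair.AE_pair[OF this]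
  have vv': "AE t in lborel. t \<in> {0<..<T} \<longrightarrow> (AE x in lborel. v t x = v' t x)"
    by eventually_elim auto
  have mem: "AE t in lborel. t \<in> {0<..<T} \<longrightarrow> v t \<in> var_Lebesgue UNIV q_ereal"
    using v by (subst AE_lebesgue_on_iff[symmetric]) (auto simp: mixed_Lebesgue_def)
  have "AE t in lborel. 0 < t \<longrightarrow> t < T \<longrightarrow> Lux_le q (\<lambda>x. ennreal (norm (v' t x))) (\<bar>h t\<bar> + K)" if "0 < K" for K
    using vv' mem h(2)
  proof eventually_elim
    case (elim t)
    have "v' t \<in> borel_measurable borel" by measurable
    with elim that show ?case by (auto intro!: Lux_le_of_var_norm_less[of "v t" "v' t"])
  qed
  from that[OF v' h(1) zz vv' h(2) this] show thesis .
qed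

lemma emeasure_Ioo_finite: "emeasure lborel {0<..<T::real} < \<top>"
  by (cases "0 \<le> T") auto

text \<open>Where \<open>r * \<bar>h t\<bar> > 1\<close>, the power \<open>P \<le> p t\<close> is
  dominated by the integrand of the modular, also at \<open>p t = \<infinity>\<close>, where that
  integrand is infinite. Elsewhere the function is bounded on an interval of finite length. The
  constant \<open>D\<close> absorbs both the scaling \<open>1 / r\<close> and the shift
  \<open>K\<close>.\<close>

lemma powr_integral_finite:
  fixes h n :: "real \<Rightarrow> real" and p :: "real \<Rightarrow> ereal"
  assumes n: "n \<in> var_Lebesgue {0<..<T} p" and P: "1 \<le> P"
    and p: "AE t in lborel. t \<in> {0<..<T} \<longrightarrow> ereal P \<le> p t"
    and [measurable]: "h \<in> borel_measurable borel" and h: "AE t in lborel. t \<in> {0<..<T} \<longrightarrow> n t = h t" and K: "0 \<le> K"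
  shows "(\<integral>\<^sup>+t. ennreal ((\<bar>h t\<bar> + K) powr P) * indicator {0<..<T} t \<partial>lborel) < \<infinity>"
proof -
  obtain r where r: "0 < r" and fin: "modular {0<..<T} p (\<lambda>t. r *\<^sub>R n t) < \<infinity>"
    using n by (auto simp: var_Lebesgue_def)
  define D where "D = (1 + K) * (1 + 1 / r)"
  define F where "F t = (if 1 < r * \<bar>h t\<bar> then (r * \<bar>h t\<bar>) powr P else 0)" for t
  have [measurable]: "F \<in> borel_measurable borel" unfolding F_def[abs_def] by measurable
  have "(\<integral>\<^sup>+t. ennreal (F t) * indicator {0<..<T} t \<partial>lborel) \<le> (\<integral>\<^sup>+t. omega (p t) (norm (r *\<^sub>R n t)) * indicator {0<..<T} t \<partial>lborel)"
  proof (rule nn_integral_mono_AE)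
    show "AE t in lborel. ennreal (F t) * indicator {0<..<T} t \<le> omega (p t) (norm (r *\<^sub>R n t)) * indicator {0<..<T} t"
      using p h
    proof eventually_elim
      case (elim t)
      show ?case
      proof (cases "t \<in> {0<..<T} \<and> 1 < r * \<bar>h t\<bar>")
        case True
        then have "n t = h t" "ereal P \<le> p t" using elim by auto
        then show ?thesis using True r
          by (cases "p t") (auto simp: F_def omega_def abs_mult intro!: ennreal_leI powr_mono)
      qed (auto simp: F_def)
    qed
  qed
  also have "\<dots> = modular {0<..<T} p (\<lambda>t. r *\<^sub>R n t)"
    unfolding modular_def by (simp add: nn_integral_restrict_space nn_integral_completion)
  finally have F: "(\<integral>\<^sup>+t. ennreal (F t) * indicator {0<..<T} t \<partial>lborel) < \<infinity>" using fin by (rule order.strict_trans1)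
  have bound: "(\<bar>h t\<bar> + K) powr P \<le> D powr P + D powr P * F t" for t
  proof (cases "1 < r * \<bar>h t\<bar>")
    case True
    have "\<bar>h t\<bar> + K \<le> D * (r * \<bar>h t\<bar>)"
    proof -
      have "\<bar>h t\<bar> = (1 / r) * (r * \<bar>h t\<bar>)" using r by simp
      moreover have "K \<le> K * (r * \<bar>h t\<bar>)" using K True by (intro mult_le_cancel_left1[THEN iffD2]) auto
      moreover have "D * (r * \<bar>h t\<bar>) = (1 / r) * (r * \<bar>h t\<bar>) + K * (r * \<bar>h t\<bar>) + (1 + K / r) * (r * \<bar>h t\<bar>)"
        using r by (simp add: D_def field_simps)
      moreover have "0 \<le> (1 + K / r) * (r * \<bar>h t\<bar>)" using K r by (intro mult_nonneg_nonneg) auto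
      ultimately show ?thesis by linarith
    qed
    then have "(\<bar>h t\<bar> + K) powr P \<le> (D * (r * \<bar>h t\<bar>)) powr P" using K P by (intro powr_mono2) auto
    also have "\<dots> = D powr P * F t" using True K r by (simp add: F_def powr_mult D_def)
    finally show ?thesis by (simp add: add_increasing)
  next
    case False
    then have "\<bar>h t\<bar> \<le> 1 / r" using r by (simp add: field_simps)
    moreover have "D = 1 + 1 / r + K + K / r" using r by (simp add: D_def field_simps)
    moreover have "0 \<le> K / r" using K r by simp
    ultimately have "\<bar>h t\<bar> + K \<le> D" by linarith
    then have "(\<bar>h t\<bar> + K) powr P \<le> D powr P" using K P by (intro powr_mono2) auto
    then show ?thesis by (simp add: F_def False)
  qed
  have "(\<integral>\<^sup>+t. ennreal ((\<bar>h t\<bar> + K) powr P) * indicator {0<..<T} t \<partial>lborel)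
     \<le> (\<integral>\<^sup>+t. ennreal (D powr P) * indicator {0<..<T} t + ennreal (D powr P) * (ennreal (F t) * indicator {0<..<T} t) \<partial>lborel)"
  proof (rule nn_integral_mono)
    fix t
    have "0 \<le> F t" by (simp add: F_def)
    then show "ennreal ((\<bar>h t\<bar> + K) powr P) * indicator {0<..<T} t
        \<le> ennreal (D powr P) * indicator {0<..<T} t + ennreal (D powr P) * (ennreal (F t) * indicator {0<..<T} t)"
      using bound[of t] by (auto simp: ennreal_mult[symmetric] ennreal_plus[symmetric] simp del: ennreal_plus intro!: ennreal_leI split: split_indicator)
  qed
  also have "\<dots> = ennreal (D powr P) * emeasure lborel {0<..<T} + ennreal (D powr P) * (\<integral>\<^sup>+t. ennreal (F t) * indicator {0<..<T} t \<partial>lborel)"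
    by (simp add: nn_integral_add nn_integral_cmult)
  also have "\<dots> < \<infinity>" using F by (auto simp: ennreal_mult_less_top emeasure_Ioo_finite)
  finally show ?thesis .
qed

text \<open>After division by \<open>M\<close> the spatial norm is at most 1, and then
  \<open>omega (p t)\<close> is at most 1 for every exponent. The modular is therefore bounded by
  the length of the time interval, whatever \<open>p\<close> is.\<close>

lemma (in log_Hoelder_exponent) mixed_Lebesgue_memI:
  fixes u :: "real \<Rightarrow> real^3 \<Rightarrow> real^3" and p :: "real \<Rightarrow> ereal"
  assumes [measurable]: "borel_measurable2 u"
    and p: "p \<in> exponents {0..1}" and T: "T \<le> 1" and M: "0 < M"
    and u: "\<And>t. 0 < t \<Longrightarrow> t < T \<Longrightarrow> Lux_le q (\<lambda>x. ennreal (norm (u t x))) M"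
  shows "u \<in> mixed_Lebesgue T p q_ereal"
proof -
  note q_measurable[measurable]
  have ut: "u t \<in> borel_measurable borel" for t by measurable
  have "(\<lambda>(t, x). u t x) \<in> borel_measurable borel"
    using assms(1) by (simp add: borel_prod)
  then have 1: "(\<lambda>(t, x). u t x) \<in> borel_measurable (lebesgue_on ({0<..<T} \<times> UNIV))"
    by (intro measurable_restrict_space1 measurable_completion) simp
  have 2: "AE t in lebesgue_on {0<..<T}. u t \<in> var_Lebesgue UNIV q_ereal"
  proof (rule AE_I2)
    fix t assume "t \<in> space (lebesgue_on {0<..<T})"
    then show "u t \<in> var_Lebesgue UNIV q_ereal" using var_Lebesgue_iff[OF _ ut, of "u t"] u[of t] by auto
  qed
  have 3: "(\<lambda>t. var_norm UNIV q_ereal (u t)) \<in> borel_measurable (lebesgue_on {0<..<T})"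
  proof (rule borel_measurableI_less)
    fix r :: real
    have "{t \<in> space (lebesgue_on {0<..<T}). var_norm UNIV q_ereal (u t) < r}
      = {t. 0 < t \<and> t < T \<and> (\<exists>s\<in>\<rat>. s < r \<and> 0 < s \<and> (\<integral>\<^sup>+x. epow (ennreal (1 / s) * ennreal (norm (u t x))) (q x) \<partial>lborel) \<le> 1)}"
      using var_norm_less_iff[OF ut u] by (auto simp: Lux_le_def ut)
    also have "\<dots> = {0<..<T} \<inter> (\<Union>s\<in>\<rat> \<inter> {0<..<r}. {t. (\<integral>\<^sup>+x. epow (ennreal (1 / s) * ennreal (norm (u t x))) (q x) \<partial>lborel) \<le> 1})"
      by auto
    also have "\<dots> \<in> sets (lebesgue_on {0<..<T})"
    proof -
      have "{t. (\<integral>\<^sup>+x. epow (ennreal (1 / s) * ennreal (norm (u t x))) (q x) \<partial>lborel) \<le> 1} \<in> sets borel" for s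
        by measurable
      then have "(\<Union>s\<in>\<rat> \<inter> {0<..<r}. {t. (\<integral>\<^sup>+x. epow (ennreal (1 / s) * ennreal (norm (u t x))) (q x) \<partial>lborel) \<le> 1}) \<in> sets borel"
        by (intro sets.countable_UN') (auto intro: countable_subset[OF _ countable_rat])
      then show ?thesis by (simp add: sets_restrict_space_iff)
    qed
    finally show "{t \<in> space (lebesgue_on {0<..<T}). var_norm UNIV q_ereal (u t) < r} \<in> sets (lebesgue_on {0<..<T})" .
  qed
  have "modular {0<..<T} p (\<lambda>t. (1 / M) *\<^sub>R var_norm UNIV q_ereal (u t)) \<le> (\<integral>\<^sup>+t. 1 \<partial>lebesgue_on {0<..<T})"
    unfolding modular_def
  proof (rule nn_integral_mono)
    fix t assume "t \<in> space (lebesgue_on {0<..<T})"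
    then have t: "0 < t" "t < T" by auto
    have pt: "1 \<le> p t" using p t T by (auto simp: exponents_def)
    have "\<bar>var_norm UNIV q_ereal (u t)\<bar> / M \<le> 1"
      using var_norm_le[OF _ ut u[OF t], of "u t"] M by simp
    then show "omega (p t) (norm ((1 / M) *\<^sub>R var_norm UNIV q_ereal (u t))) \<le> 1"
      using pt M by (cases "p t") (auto simp: omega_def powr_le1)
  qed
  also have "\<dots> < \<infinity>" by (simp add: emeasure_restrict_space emeasure_Ioo_finite)
  finally have "(\<lambda>t. var_norm UNIV q_ereal (u t)) \<in> var_Lebesgue {0<..<T} p"
    using 3 M unfolding var_Lebesgue_def by (auto intro!: exI[of _ "1 / M"])
  then show ?thesis using 1 2 by (simp add: mixed_Lebesgue_def)
qed

subsection \<open>Well-posedness\<close>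

lemma mild_solution_iff:
  "mild_solution \<alpha> T u0 f w \<longleftrightarrow> (AE z in lborel \<Otimes>\<^sub>M lborel. fst z \<in> {0<..<T} \<longrightarrow>
     mild_terms_exist \<alpha> u0 f w (fst z) (snd z) \<and> w (fst z) (snd z) = mild_rhs \<alpha> u0 f w (fst z) (snd z))"
  unfolding mild_solution_def case_prod_beta mild_rhs_def[symmetric] AE_lebesgue_on_Times_iff ..

text \<open>The estimates apply to Borel representatives of \<open>u0\<close>, \<open>f\<close> and
  of a competitor \<open>v\<close>. Equality on almost every slice and equality almost everywhere in
  space-time are exchanged by Fubini, using joint measurability of the representatives.\<close>

theorem (in navier_stokes_exponents) well_posedness:
  fixes p :: "real \<Rightarrow> ereal" and f :: "real \<Rightarrow> real^3 \<Rightarrow> real^3" and u0 :: "real^3 \<Rightarrow> real^3"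
  assumes p: "p \<in> exponents {0..1}" and pP: "AE t in lborel. t \<in> {0..1} \<longrightarrow> ereal P \<le> p t"
    and f: "f \<in> mixed_Lebesgue 1 (\<lambda>_. 1) q_ereal" and u0: "u0 \<in> var_Lebesgue UNIV q_ereal"
  shows "\<exists>T. 0 < T \<and> T \<le> 1 \<and>
    (\<exists>u \<in> mixed_Lebesgue T p q_ereal. mild_solution \<alpha> T u0 f u \<and>
      (\<forall>v \<in> mixed_Lebesgue T p q_ereal. mild_solution \<alpha> T u0 f v \<longrightarrow>
        (AE (t, x) in lebesgue_on ({0<..<T} \<times> UNIV). v t x = u t x)))"
proof -
  obtain u0' where u0': "u0' \<in> borel_measurable borel" "AE x in lborel. u0 x = u0' x"
    using Borel_representative[of u0 UNIV] u0 unfolding var_Lebesgue_def by auto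
  obtain d where d: "Lux_le q (\<lambda>x. ennreal (norm (u0' x))) d"
    using var_Lebesgue_iff[OF u0'(2,1)] u0 by blast
  obtain f' hf where f': "borel_measurable2 f'" "hf \<in> borel_measurable borel"
    "AE z in lborel \<Otimes>\<^sub>M lborel. fst z \<in> {0<..<1} \<longrightarrow> f (fst z) (snd z) = f' (fst z) (snd z)"
    "AE t in lborel. t \<in> {0<..<1} \<longrightarrow> (AE x in lborel. f t x = f' t x)"
    and hf: "AE t in lborel. t \<in> {0<..<1} \<longrightarrow> var_norm UNIV q_ereal (f t) = hf t"
    "\<And>K. 0 < K \<Longrightarrow> AE t in lborel. 0 < t \<longrightarrow> t < 1 \<longrightarrow> Lux_le q (\<lambda>x. ennreal (norm (f' t x))) (\<bar>hf t\<bar> + K)"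
    by (rule mixed_Lebesgue_representative[OF f], rule that)
  note meas = u0'(1) f'(1)
  note [measurable] = meas f'(2)
  have "(\<integral>\<^sup>+t. ennreal ((\<bar>hf t\<bar> + 1) powr 1) * indicator {0<..<1} t \<partial>lborel) < \<infinity>"
    by (rule powr_integral_finite[OF _ _ _ f'(2) hf(1), of "\<lambda>_. 1"])
      (use f in \<open>auto simp: mixed_Lebesgue_def one_ereal_def\<close>)
  then have E: "(\<integral>\<^sup>+t. ennreal (\<bar>hf t\<bar> + 1) * indicator {0<..<1} t \<partial>lborel) < \<infinity>"
    by (simp add: powr_one)
  have "(\<lambda>t. \<bar>hf t\<bar> + 1) \<in> borel_measurable borel" by measurable
  from linear_part_bound[OF f'(1) this d hf(2)[of 1] E]
  obtain M where M: "0 < M" "\<And>t. 0 < t \<Longrightarrow> t \<le> 1 \<Longrightarrow> Lux_le q (linear_part_abs \<alpha> u0' f' t) M"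
    unfolding linear_part_abs_def[abs_def] by auto
  define U where "U = linear_part \<alpha> u0' f'"
  define Ub where "Ub = linear_part_abs \<alpha> u0' f'"
  have UbUm[measurable]: "borel_measurable2 Ub"
    "borel_measurable2 U"
    unfolding U_def Ub_def by measurable
  have U: "ennreal (norm (U t x)) \<le> Ub t x" for t x
    unfolding U_def Ub_def by (rule norm_linear_part_le) measurable
  obtain T M' u where T: "0 < T" "T \<le> 1" and um[measurable]: "borel_measurable2 u"
    and uM: "\<And>t. 0 < t \<Longrightarrow> t < T \<Longrightarrow> Lux_le q (\<lambda>x. ennreal (norm (u t x))) M'"
    and ueq: "\<And>t. 0 < t \<Longrightarrow> t < T \<Longrightarrow> AE x in lborel. Ub t x < \<infinity> \<and> duhamel_abs (square u) t x < \<infinity> \<and> u t x = U t x - duhamel u t x"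
    by (rule existence[OF M(1) UbUm U M(2)[folded Ub_def]], assumption, assumption) (rule that)
  have UbM: "Lux_le q (Ub t) M" if "0 < t" "t < T" for t using M(2)[of t] that T by (simp add: Ub_def)
  \<comment> \<open>Any time in the interval would serve; a norm bound at one time already contains
    positivity.\<close>
  have M': "0 < M'" using uM[of "T / 2"] T by (auto dest: Lux_leD(1))
  have transfer: "mild_terms_exist \<alpha> u0 f w t x \<longleftrightarrow> mild_terms_exist \<alpha> u0' f' w' t x"
      "mild_rhs \<alpha> u0 f w t x = mild_rhs \<alpha> u0' f' w' t x"
    if w: "AE s in lborel. s \<in> {0<..<T} \<longrightarrow> (AE y in lborel. w s y = w' s y)" and t: "t < T" for w w' t x
  proof -
    have 1: "AE s in lborel. s \<in> {0<..<t} \<longrightarrow> (AE y in lborel. f s y = f' s y)"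
      using f'(4) by eventually_elim (use t T in auto)
    have 2: "AE s in lborel. s \<in> {0<..<t} \<longrightarrow> (AE y in lborel. w s y = w' s y)"
      using w by eventually_elim (use t in auto)
    show "mild_terms_exist \<alpha> u0 f w t x \<longleftrightarrow> mild_terms_exist \<alpha> u0' f' w' t x"
      "mild_rhs \<alpha> u0 f w t x = mild_rhs \<alpha> u0' f' w' t x"
      by (rule mild_cong_AE[OF u0'(2) 1 2])+
  qed
  have u_mild: "mild_solution \<alpha> T u0 f u"
  proof -
    have "AE z in lborel \<Otimes>\<^sub>M lborel. 0 < fst z \<and> fst z < T \<longrightarrow> Ub (fst z) (snd z) < \<infinity> \<and>
        duhamel_abs (square u) (fst z) (snd z) < \<infinity> \<and> u (fst z) (snd z) = U (fst z) (snd z) - duhamel u (fst z) (snd z)"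
    proof (rule lborel_pair.AE_pair_measure)
      show "AE t in lborel. AE x in lborel. 0 < fst (t, x) \<and> fst (t, x) < T \<longrightarrow> Ub (fst (t, x)) (snd (t, x)) < \<infinity> \<and>
        duhamel_abs (square u) (fst (t, x)) (snd (t, x)) < \<infinity> \<and> u (fst (t, x)) (snd (t, x)) = U (fst (t, x)) (snd (t, x)) - duhamel u (fst (t, x)) (snd (t, x))"
      proof (rule AE_I2)
        fix t :: real
        show "AE x in lborel. 0 < fst (t, x) \<and> fst (t, x) < T \<longrightarrow> Ub (fst (t, x)) (snd (t, x)) < \<infinity> \<and>
          duhamel_abs (square u) (fst (t, x)) (snd (t, x)) < \<infinity> \<and> u (fst (t, x)) (snd (t, x)) = U (fst (t, x)) (snd (t, x)) - duhamel u (fst (t, x)) (snd (t, x))"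
          using ueq[of t] by (cases "0 < t \<and> t < T") auto
      qed
    qed measurable
    then show ?thesis
      unfolding mild_solution_iff
    proof eventually_elim
      case (elim z)
      show ?case
      proof
        assume z: "fst z \<in> {0<..<T}"
        then have fin: "linear_part_abs \<alpha> u0' f' (fst z) (snd z) < \<infinity>" "duhamel_abs (square u) (fst z) (snd z) < \<infinity>"
          and e: "u (fst z) (snd z) = U (fst z) (snd z) - duhamel u (fst z) (snd z)"
          using elim by (auto simp: Ub_def)
        have *: "AE s in lborel. s \<in> {0<..<T} \<longrightarrow> (AE y in lborel. u s y = u s y)" by simp
        show "mild_terms_exist \<alpha> u0 f u (fst z) (snd z) \<and> u (fst z) (snd z) = mild_rhs \<alpha> u0 f u (fst z) (snd z)"
          using mild_at_finite_point[OF meas um fin] transfer[OF *, of "fst z"] z e by (simp add: U_def)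
      qed
    qed
  qed
  have unique: "AE (t, x) in lebesgue_on ({0<..<T} \<times> UNIV). v t x = u t x"
    if v: "v \<in> mixed_Lebesgue T p q_ereal" and v_mild: "mild_solution \<alpha> T u0 f v" for v
  proof -
    obtain v' hv where v'[measurable]: "borel_measurable2 v'"
      and hv[measurable]: "hv \<in> borel_measurable borel"
      and vz: "AE z in lborel \<Otimes>\<^sub>M lborel. fst z \<in> {0<..<T} \<longrightarrow> v (fst z) (snd z) = v' (fst z) (snd z)"
      and vt: "AE t in lborel. t \<in> {0<..<T} \<longrightarrow> (AE x in lborel. v t x = v' t x)"
      and hvn: "AE t in lborel. t \<in> {0<..<T} \<longrightarrow> var_norm UNIV q_ereal (v t) = hv t"
      and vL: "\<And>K. 0 < K \<Longrightarrow> AE t in lborel. 0 < t \<longrightarrow> t < T \<longrightarrow> Lux_le q (\<lambda>x. ennreal (norm (v' t x))) (\<bar>hv t\<bar> + K)"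
      by (rule mixed_Lebesgue_representative[OF v], rule that)
    \<comment> \<open>A common bound for both norms: \<open>M'\<close> bounds the norm of
      \<open>u\<close> and at the same time is the positive slack needed for
      \<open>v'\<close>.\<close>
    define n where "n t = \<bar>hv t\<bar> + M'" for t
    have nm[measurable]: "n \<in> borel_measurable borel" unfolding n_def by measurable
    have N: "(\<integral>\<^sup>+t. ennreal (n t powr P) * indicator {0<..<T} t \<partial>lborel) < \<infinity>"
      unfolding n_def
    proof (rule powr_integral_finite[OF _ _ _ hv hvn])
      show "AE t in lborel. t \<in> {0<..<T} \<longrightarrow> ereal P \<le> p t"
        using pP by eventually_elim (use T in auto)
    qed (use v P_gt_2 M' in \<open>auto simp: mixed_Lebesgue_def\<close>)
    have vn: "AE t in lborel. 0 < t \<longrightarrow> t < T \<longrightarrow> Lux_le q (\<lambda>x. ennreal (norm (v' t x))) (n t)"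
      unfolding n_def by (rule vL[OF M'])
    have un: "AE t in lborel. 0 < t \<longrightarrow> t < T \<longrightarrow> Lux_le q (\<lambda>x. ennreal (norm (u t x))) (n t)"
    proof (intro AE_I2 impI)
      fix t assume t: "0 < t" "t < T"
      show "Lux_le q (\<lambda>x. ennreal (norm (u t x))) (n t)"
        by (rule Lux_le_mono[OF uM[OF t]]) (auto simp: n_def q_nonneg)
    qed
    obtain Z where Z: "\<And>t. 0 < t \<Longrightarrow> t < T \<Longrightarrow> Lux_le (\<lambda>_. 1 / b) (duhamel_abs (square v') t) Z"
      by (rule Lux_le_duhamel_abs_square[OF T v' nm vn N], rule that)
    have veq: "AE t in lborel. 0 < t \<longrightarrow> t < T \<longrightarrow> (AE x in lborel. v' t x = U t x - duhamel v' t x)"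
      using lborel_pair.AE_pair[OF v_mild[unfolded mild_solution_iff]] vt
    proof eventually_elim
      case (elim t)
      show ?case
      proof (intro impI)
        assume t: "0 < t" "t < T"
        have "AE x in lborel. linear_part_abs \<alpha> u0' f' t x < \<infinity>"
          using Lux_le_AE_finite[OF q_measurable UbM[OF t]] by (simp add: Ub_def)
        moreover have "AE x in lborel. duhamel_abs (square v') t x < \<infinity>"
          by (rule Lux_le_AE_finite[OF _ Z[OF t]]) simp
        moreover have "AE x in lborel. v t x = v' t x" using elim t by auto
        ultimately show "AE x in lborel. v' t x = U t x - duhamel v' t x"
          using elim(1)
        proof eventually_elim
          case (elim x)
          show ?case
            using mild_at_finite_point(2)[OF meas v' elim(1,2)] transfer(2)[OF vt t(2), of x] elim(3,4) t
            by (simp add: U_def)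
        qed
      qed
    qed
    have "AE t in lborel. 0 < t \<longrightarrow> t < T \<longrightarrow> (AE x in lborel. u t x = v' t x)"
    proof (rule uniqueness[OF T M(1) UbUm(1) um v' nm U UbM un vn N _ veq])
      show "AE t in lborel. 0 < t \<longrightarrow> t < T \<longrightarrow> (AE x in lborel. u t x = U t x - duhamel u t x)"
      proof (rule AE_I2, intro impI)
        fix t assume "0 < t" "t < T"
        from ueq[OF this] show "AE x in lborel. u t x = U t x - duhamel u t x" by eventually_elim simp
      qed
    qed
    then have "AE t in lborel. AE x in lborel. 0 < fst (t, x) \<and> fst (t, x) < T \<longrightarrow> u (fst (t, x)) (snd (t, x)) = v' (fst (t, x)) (snd (t, x))"
    proof eventually_elim
      case (elim t)
      then show ?case by (cases "0 < t \<and> t < T") auto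
    qed
    then have "AE z in lborel \<Otimes>\<^sub>M lborel. 0 < fst z \<and> fst z < T \<longrightarrow> u (fst z) (snd z) = v' (fst z) (snd z)"
      by (rule lborel_pair.AE_pair_measure[rotated]) measurable
    with vz have "AE z in lborel \<Otimes>\<^sub>M lborel. fst z \<in> {0<..<T} \<longrightarrow> v (fst z) (snd z) = u (fst z) (snd z)"
      by eventually_elim auto
    then show ?thesis unfolding case_prod_beta AE_lebesgue_on_Times_iff .
  qed
  have "u \<in> mixed_Lebesgue T p q_ereal" by (rule mixed_Lebesgue_memI[OF um p T(2) M' uM])
  with T u_mild unique show ?thesis by blast
qed

theorem theorem4p8:
  fixes \<alpha> :: real
    and p :: "real \<Rightarrow> ereal"
    and q :: "real^3 \<Rightarrow> ereal"
    and f :: "real \<Rightarrow> real^3 \<Rightarrow> real^3"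
    and u\<^sub>0 :: "real^3 \<Rightarrow> real^3"
  assumes "1/2 < \<alpha>" "\<alpha> \<le> 1"
    and "p \<in> exponents {0..1}"
    and "q \<in> log_exponents"
    and "2 < exp_inf UNIV q" "exp_inf UNIV q \<le> exp_sup UNIV q" "exp_sup UNIV q < \<infinity>"
    and "exp_sup UNIV q = exp_at_infinity q"
    and "2 < exp_inf {0..1} p"
    and "2 * \<alpha> * recip (exp_inf {0..1} p) + 3 * theta1 q / 2 < \<alpha> - 1/2"
    and "f \<in> mixed_Lebesgue 1 (\<lambda>_. 1) q"
    and "AE t in lebesgue_on {0<..<1}. divergence_free (f t)"
    and "u\<^sub>0 \<in> var_Lebesgue UNIV q"
    and "divergence_free u\<^sub>0"
  shows "\<exists>T. 0 < T \<and> T \<le> 1 \<and>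
    (\<exists>u \<in> mixed_Lebesgue T p q. mild_solution \<alpha> T u\<^sub>0 f u \<and>
      (\<forall>v \<in> mixed_Lebesgue T p q. mild_solution \<alpha> T u\<^sub>0 f v \<longrightarrow>
        (AE (t, x) in lebesgue_on ({0<..<T} \<times> UNIV). v t x = u t x)))"
proof -
  from log_exponents_regular[OF assms(4-8)]
  obtain Q a b c where Q: "log_Hoelder_exponent Q a b c" and q: "q = (\<lambda>x. ereal (Q x))"
    and \<theta>: "2 * a - b \<le> theta1 q" .
  obtain P where P: "2 < P" "AE t in lborel. t \<in> {0..1} \<longrightarrow> ereal P \<le> p t"
    "2 * \<alpha> / P + 3 * theta1 q / 2 < \<alpha> - 1 / 2"
    by (rule time_exponent_lower_bound[OF assms(3,9) _ assms(10)], use assms(1) in simp, rule that)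
  obtain \<eta> :: "real measure" where \<eta>: "prob_space \<eta>" "sets \<eta> = sets borel" "AE s in \<eta>. 0 < s"
    "\<And>l. 0 < l \<Longrightarrow> Laplace \<eta> l = ennreal (exp (- (l powr \<alpha>)))"
    by (rule stable_subordinator_exists[of \<alpha>]) (use assms(1,2) in \<open>auto intro: that\<close>)
  interpret navier_stokes_exponents Q a b c \<alpha> \<eta> P
  proof (intro navier_stokes_exponents.intro Q stable_subordinator.intro navier_stokes_exponents_axioms.intro)
    show "2 * \<alpha> / P + 3 * (2 * a - b) / 2 < \<alpha> - 1 / 2"
    proof -
      have "3 * (2 * a - b) / 2 \<le> 3 * theta1 q / 2" using \<theta> by simp
      then show ?thesis using P(3) by linarith
    qed
  qed (use assms(1,2) \<eta> P(1) in auto)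
  show ?thesis
    using assms(11,13) unfolding q by (rule well_posedness[OF assms(3) P(2)])
qed

end
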